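(* Let $(N,\Pi)$ be a Beurling generalized number system with positive density $N(x)\sim ax$ for some $a>0$. Let $\mathrm{d}G=\exp^{\ast}(g\,\mathrm{d}\Pi)$ be a multiplicative arithmetic measure with $g=g_1+g_2$, where $|g_1(x)|\le1$, $\int_1^x|g_1(u)|\log u\,\mathrm{d}\Pi(u)\ll x$, and $\int_1^\infty x^{-1}|g_2(x)|\,\mathrm{d}\Pi(x)<\infty$. Let $c,\alpha\in\mathbb{R}$ and $L$ a slowly varying function with $|L(u)|=1$. Then $$G(x)=\frac{c\,x^{1+i\alpha}}{1+i\alpha}L(\log x)+o(x)\quad(x\to\infty)$$ holds if and only if $$\widehat{G}(s)=\frac{c}{s-1-i\alpha}L\Big(\frac{1}{\sigma-1}\Big)+o\Big(\frac{1}{\sigma-1}\Big)\quad(\sigma\to1^+)$$ holds uniformly for $t$ in compact intervals, where $s=\sigma+it$.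
   Context: A Beurling generalized number system is a pair of non-decreasing right-continuous functions $N$ and $\Pi$ supported on $[1,\infty)$ with $N(1)=1$, $\Pi(1)=0$, subject to $\mathrm{d}N=\exp^{\ast}(\mathrm{d}\Pi)$, where $\exp^{\ast}(\mu)=\delta_1+\mu+\mu\ast\mu/2!+\cdots$ is the exponential with respect to the multiplicative convolution of measures on $[1,\infty)$. A measure $\mathrm{d}G$ on $[1,\infty)$ is arithmetic if it is absolutely continuous with respect to $\mathrm{d}N$, and multiplicative if $\mathrm{d}G=\exp^{\ast}(g\,\mathrm{d}\Pi)$ for some function $g$. We write $G(x)=\int_{1^-}^x\mathrm{d}G$ and $\widehat{G}(s)=\int_{1^-}^\infty x^{-s}\mathrm{d}G(x)$. A function $L$ is slowly varying if it is measurable and $L(\lambda u)/L(u)\to1$ as $u\to\infty$ for every $\lambda>0$. *)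

theory Defs
  imports "HOL-Analysis.Analysis" "HOL-Library.Landau_Symbols"
begin

text \<open>
  Complex measures on \<open>[1,\<infinity>)\<close> that are finite on bounded sets, but may have infinite total
  variation, are represented by their values on bounded Borel subsets of \<open>[1,\<infinity>)\<close>. Values of such a
  set function at other sets carry no meaning.
\<close>

definition bounded_borel :: "real set set" where
  "bounded_borel = {A \<in> sets borel. A \<subseteq> {1..} \<and> bounded A}"

definition local_measure :: "(real set \<Rightarrow> complex) \<Rightarrow> bool" where
  "local_measure \<mu> \<longleftrightarrow>
     (\<forall>A :: nat \<Rightarrow> real set. range A \<subseteq> bounded_borel \<longrightarrow> disjoint_family A \<longrightarrow>
        (\<Union>n. A n) \<in> bounded_borel \<longrightarrow> (\<lambda>n. \<mu> (A n)) sums \<mu> (\<Union>n. A n))"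

definition same_measure :: "(real set \<Rightarrow> complex) \<Rightarrow> (real set \<Rightarrow> complex) \<Rightarrow> bool" where
  "same_measure \<mu> \<nu> \<longleftrightarrow> (\<forall>A \<in> bounded_borel. \<mu> A = \<nu> A)"

definition weighted :: "(real \<Rightarrow> complex) \<Rightarrow> real measure \<Rightarrow> real set \<Rightarrow> complex" where
  "weighted g M A = (LINT x:A|M. g x)"

text \<open>
  The positive part in the Jordan decomposition of a real set function, as a measure on \<open>[1,\<infinity>)\<close>.
  Negative values are cut off by \<^const>\<open>ennreal\<close>, which is harmless since \<open>B = {}\<close> is admitted.
\<close>

definition upper_variation :: "(real set \<Rightarrow> real) \<Rightarrow> real measure" where
  "upper_variation \<phi> =
     measure_of {1..} (sets (restrict_space borel {1..}))
       (\<lambda>A. SUP B \<in> {B \<in> bounded_borel. B \<subseteq> A}. ennreal (\<phi> B))"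

definition integral_wrt :: "(real set \<Rightarrow> complex) \<Rightarrow> (real \<Rightarrow> complex) \<Rightarrow> complex" where
  "integral_wrt \<mu> f =
     (LINT x|upper_variation (\<lambda>A. Re (\<mu> A)). f x) - (LINT x|upper_variation (\<lambda>A. - Re (\<mu> A)). f x)
     + \<i> * ((LINT x|upper_variation (\<lambda>A. Im (\<mu> A)). f x)
            - (LINT x|upper_variation (\<lambda>A. - Im (\<mu> A)). f x))"

text \<open>
  Multiplicative convolution: \<open>(\<mu> \<star> \<nu>)(A)\<close> is the integral of the indicator of \<open>x y \<in> A\<close> with
  respect to \<open>d\<nu>(y) d\<mu>(x)\<close>.
\<close>

definition mult_conv :: "(real set \<Rightarrow> complex) \<Rightarrow> (real set \<Rightarrow> complex) \<Rightarrow> real set \<Rightarrow> complex" where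
  "mult_conv \<mu> \<nu> A = integral_wrt \<mu> (\<lambda>x. \<nu> {y \<in> {1..}. x * y \<in> A})"

primrec conv_power :: "(real set \<Rightarrow> complex) \<Rightarrow> nat \<Rightarrow> real set \<Rightarrow> complex" where
  "conv_power \<mu> 0 = (\<lambda>A. indicator A 1)"
| "conv_power \<mu> (Suc n) = mult_conv \<mu> (conv_power \<mu> n)"

definition conv_exp :: "(real set \<Rightarrow> complex) \<Rightarrow> real set \<Rightarrow> complex" where
  "conv_exp \<mu> A = (\<Sum>n. conv_power \<mu> n A / fact n)"

definition beurling_system :: "(real \<Rightarrow> real) \<Rightarrow> (real \<Rightarrow> real) \<Rightarrow> bool" where
  "beurling_system N P \<longleftrightarrow>
     mono N \<and> (\<forall>x. continuous (at_right x) N) \<and> (\<forall>x<1. N x = 0) \<and> N 1 = 1 \<and>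
     mono P \<and> (\<forall>x. continuous (at_right x) P) \<and> (\<forall>x<1. P x = 0) \<and> P 1 = 0 \<and>
     same_measure (\<lambda>A. of_real (measure (interval_measure N) A))
       (conv_exp (\<lambda>A. of_real (measure (interval_measure P) A)))"

definition arithmetic :: "(real \<Rightarrow> real) \<Rightarrow> (real set \<Rightarrow> complex) \<Rightarrow> bool" where
  "arithmetic N dG \<longleftrightarrow> local_measure dG \<and>
     (\<forall>A \<in> bounded_borel. A \<in> null_sets (interval_measure N) \<longrightarrow> dG A = 0)"

definition summatory :: "(real set \<Rightarrow> complex) \<Rightarrow> real \<Rightarrow> complex" where
  "summatory dG x = dG {1..x}"

definition mellin_stieltjes :: "(real set \<Rightarrow> complex) \<Rightarrow> complex \<Rightarrow> complex" where
  "mellin_stieltjes dG s = integral_wrt dG (\<lambda>x. of_real x powr (- s))"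

definition slowly_varying :: "(real \<Rightarrow> complex) \<Rightarrow> bool" where
  "slowly_varying L \<longleftrightarrow> set_borel_measurable lebesgue {0<..} L \<and>
     (\<forall>l>0. ((\<lambda>u. L (l * u) / L u) \<longlongrightarrow> 1) at_top)"

end

theory Submission
  imports Defs "HOL-Probability.Giry_Monad"
begin

text \<open>
  By the identity \<open>log \<cdot> exp\<^sup>*(\<mu>) = (log \<cdot> \<mu>) * exp\<^sup>*(\<mu>)\<close>, the function \<open>T(u) = e\<^bsup>-(1+i\<alpha>)u\<^esup> G(e\<^sup>u)\<close> solves a
  renewal equation \<open>U T(U) = \<integral> T(U - log x) g(x) x\<^bsup>-1-i\<alpha>\<^esup> log x d\<Pi>(x) + O(1)\<close>. One implication is an
  Abelian argument: the transform of \<open>T\<close> is \<open>F(s) / s\<close>, where \<open>F\<close> is the Mellin-Stieltjes transform of \<open>G\<close>.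

  The converse is a variant of the method of Halasz. With \<open>w = \<sigma> - 1\<close>, the mean square of
  \<open>T(u) - c' L(1/w)\<close> against \<open>e\<^bsup>-2wu\<^esup>\<close> is estimated by Plancherel's identity with a Fejer weight. One
  writes \<open>|F|\<^sup>2 = |F|\<^bsup>1/2\<^esup> |F|\<^bsup>3/2\<^esup>\<close>; away from the pole the first factor is small by hypothesis, and the
  second one is dominated by the square of the transform of \<open>exp\<^sup>*((3/4) g1 d\<Pi>)\<close>, whose summatory
  function is \<open>O(x (log x)\<^bsup>-1/4\<^esup>)\<close>. Large frequencies need not be controlled, because \<open>N(x) \<sim> a x\<close> makes \<open>T\<close>
  slowly oscillating. Hence \<open>T - c' L\<close> is small in the mean. Finally, the renewal equation bounds the
  increments \<open>T(U + H) - T(U)\<close> with \<open>0 \<le> H \<le> \<eta> U\<close> by mean values of such increments, so that the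
  convergence in the mean is pointwise.
\<close>

section \<open>Integration against set functions with a density\<close>

text \<open>The splitting of the exponent is dictated by scaling. For 1/2 < \<beta> < 1 the measure
  \<open>exp\<^sup>*(\<beta> g1 d\<Pi>)\<close> has a summatory function O(x (log x)^(\<beta>-1)),
  so Plancherel bounds the mean square of its transform by a multiple of w^(1-2\<beta>), while the
  remaining factor |F|^(2-2\<beta>) is at most (\<epsilon>/w)^(2-2\<beta>) away from the pole. The
  product is of order \<epsilon>^(2-2\<beta>)/w, the required gain over the trivial 1/w. For \<beta>
  = 1 no small factor is left, and for \<beta> \<le> 1/2 the mean square no longer follows the scale
  w^(1-2\<beta>); the middle value 3/4 leads to square roots only. Fractional powers make sense
  because F is an exponential, in which g2 is a bounded factor. The main term is frozen: at the
  scale X = 1/w it is the constant c' L(X), so that subtracting it removes exactly one simple pole.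
  The obstacle to pointwise limits is that d\<Pi> is known on average only. The renewal sum cannot
  be compared with an integral point by point, which forces a further average over a short
  window.\<close>

lemma bounded_borelI:
  assumes "A \<in> sets borel" "A \<subseteq> {1..b}"
  shows "A \<in> bounded_borel"
  using assms bounded_subset[OF bounded_closed_interval[of 1 b]]
  by (auto simp: bounded_borel_def)

lemma bounded_borel_sets: "A \<in> bounded_borel \<Longrightarrow> A \<in> sets borel"
  by (simp add: bounded_borel_def)

lemma bounded_borelE:
  assumes "A \<in> bounded_borel"
  obtains b where "b \<ge> 1" "A \<subseteq> {1..b}"
proof -
  obtain C where C: "\<forall>x\<in>A. \<bar>x\<bar> \<le> C"
    using assms by (auto simp: bounded_borel_def bounded_real)
  have "A \<subseteq> {1..max 1 C}"
    using assms C by (force simp: bounded_borel_def)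
  then show thesis by (intro that[of "max 1 C"]) auto
qed

text \<open>A Hahn decomposition by hand: the supremum over bounded \<open>B\<close> is exhausted by
  the sets \<open>A \<inter> {1..n}\<close> cut down to \<open>k \<ge> 0\<close>, and
  \<open>ennreal\<close> discards the negative part of \<open>k\<close>.\<close>

lemma upper_variation_density:
  fixes W :: "real measure" and k :: "real \<Rightarrow> real"
  assumes sets_W[measurable_cong, simp]: "sets W = sets borel"
    and k[measurable]: "k \<in> borel_measurable borel"
    and int: "\<And>A. A \<in> bounded_borel \<Longrightarrow> set_integrable W A k"
    and \<phi>: "\<And>A. A \<in> bounded_borel \<Longrightarrow> \<phi> A = (LINT x:A|W. k x)"
  shows "upper_variation \<phi> = restrict_space (density W (\<lambda>x. ennreal (k x))) {1..}"
proof -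
  let ?D = "density W (\<lambda>x. ennreal (k x))"
  have sp: "space W = UNIV" using sets_eq_imp_space_eq[OF sets_W] by simp
  have eq: "(SUP B \<in> {B \<in> bounded_borel. B \<subseteq> A}. ennreal (\<phi> B)) = emeasure ?D A"
    if A[measurable]: "A \<in> sets borel" and A1: "A \<subseteq> {1..}" for A
  proof (rule antisym)
    show "(SUP B \<in> {B \<in> bounded_borel. B \<subseteq> A}. ennreal (\<phi> B)) \<le> emeasure ?D A"
    proof (rule SUP_least)
      fix B assume B: "B \<in> {B \<in> bounded_borel. B \<subseteq> A}"
      then have [measurable]: "B \<in> sets borel" by (simp add: bounded_borel_def)
      have iB: "integrable W (\<lambda>x. indicator B x * k x)"
        using int[of B] B by (simp add: set_integrable_def)
      have "\<phi> B = (\<integral>x. indicator B x * k x \<partial>W)"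
        using \<phi>[of B] B by (simp add: set_lebesgue_integral_def)
      also have "\<dots> \<le> (\<integral>x. \<bar>indicator B x * max 0 (k x)\<bar> \<partial>W)"
        by (intro integral_mono iB integrable_abs)
           (auto simp: indicator_def intro!: Bochner_Integration.integrable_bound[OF iB])
      finally have "ennreal (\<phi> B) \<le> ennreal (\<integral>x. \<bar>indicator B x * max 0 (k x)\<bar> \<partial>W)"
        by (rule ennreal_leI)
      also have "\<dots> = (\<integral>\<^sup>+x. ennreal \<bar>indicator B x * max 0 (k x)\<bar> \<partial>W)"
        by (intro nn_integral_eq_integral[symmetric] integrable_abs)
           (auto simp: indicator_def intro!: Bochner_Integration.integrable_bound[OF iB])
      also have "\<dots> = emeasure ?D B"
        by (subst emeasure_density) (auto intro!: nn_integral_cong simp: indicator_def max_def ennreal_neg)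
      also have "\<dots> \<le> emeasure ?D A"
        using B by (intro emeasure_mono) auto
      finally show "ennreal (\<phi> B) \<le> emeasure ?D A" .
    qed
  next
    define B where "B n = A \<inter> {1..real n} \<inter> {x. k x \<ge> 0}" for n :: nat
    have Bm[measurable]: "B n \<in> sets borel" for n unfolding B_def by measurable
    have Bb: "B n \<in> bounded_borel" for n
      by (rule bounded_borelI[of _ "real n"]) (auto simp: B_def)
    have inc: "incseq B" by (auto simp: incseq_def B_def)
    have phiB: "ennreal (\<phi> (B n)) = emeasure ?D (B n)" for n
    proof -
      have iB: "integrable W (\<lambda>x. indicator (B n) x * k x)"
        using int[OF Bb[of n]] by (simp add: set_integrable_def)
      have "ennreal (\<phi> (B n)) = ennreal (\<integral>x. indicator (B n) x * k x \<partial>W)"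
        using \<phi>[OF Bb[of n]] by (simp add: set_lebesgue_integral_def)
      also have "\<dots> = (\<integral>\<^sup>+x. ennreal (indicator (B n) x * k x) \<partial>W)"
        by (intro nn_integral_eq_integral[symmetric] iB) (auto simp: indicator_def B_def)
      also have "\<dots> = emeasure ?D (B n)"
        by (subst emeasure_density) (auto intro!: nn_integral_cong simp: indicator_def)
      finally show ?thesis .
    qed
    have "emeasure ?D A = emeasure ?D (\<Union>n. B n)"
    proof -
      have U: "(\<Union>n. B n) = A \<inter> {x. k x \<ge> 0}"
        using A1 by (auto simp: B_def intro: real_arch_simple)
      show ?thesis unfolding U
        by (subst (1 2) emeasure_density)
           (auto intro!: nn_integral_cong simp: indicator_def ennreal_neg)
    qed
    also have "\<dots> = (SUP n. emeasure ?D (B n))"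
      by (rule SUP_emeasure_incseq[symmetric]) (use inc in auto)
    also have "\<dots> \<le> (SUP B \<in> {B \<in> bounded_borel. B \<subseteq> A}. ennreal (\<phi> B))"
    proof (rule SUP_least)
      fix n
      have "B n \<in> {B \<in> bounded_borel. B \<subseteq> A}" using Bb by (auto simp: B_def)
      then show "emeasure ?D (B n) \<le> (SUP B \<in> {B \<in> bounded_borel. B \<subseteq> A}. ennreal (\<phi> B))"
        unfolding phiB[symmetric] by (rule SUP_upper)
    qed
    finally show "emeasure ?D A \<le> (SUP B \<in> {B \<in> bounded_borel. B \<subseteq> A}. ennreal (\<phi> B))" .
  qed
  let ?R = "restrict_space ?D {1..}"
  \<comment> \<open>\<open>measure_of\<close> falls back to the zero measure unless its set function
    is a measure; comparison with the genuine measure \<open>?R\<close> on all sets excludes this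
    default.\<close>
  have R: "measure_of {1..} (sets ?R) (emeasure ?R) = ?R"
    using measure_of_of_measure[of ?R] by (simp add: space_restrict_space sp)
  have sR: "sets ?R = sets (restrict_space borel {1..})"
    by (simp add: sets_restrict_space)
  have "upper_variation \<phi> = measure_of {1..} (sets ?R) (emeasure ?R)"
    unfolding upper_variation_def sR
  proof (rule measure_of_eq)
    show "sets (restrict_space borel {1..}) \<subseteq> Pow {1..}"
      by (auto simp: sets_restrict_space)
    fix A assume "A \<in> sigma_sets {1..} (sets (restrict_space borel {1::real..}))"
    moreover have "sigma_sets {1..} (sets (restrict_space borel {1::real..})) = sets (restrict_space borel {1::real..})"
      using sets.sigma_sets_eq[of "restrict_space borel {1::real..}"] by (simp add: space_restrict_space)
    ultimately have A: "A \<in> sets (restrict_space borel {1::real..})" by simp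
    then obtain A' where "A = {1..} \<inter> A'" "A' \<in> sets borel" by (auto simp: sets_restrict_space)
    then have A2: "A \<in> sets borel" "A \<subseteq> {1..}" by auto
    show "(SUP B \<in> {B \<in> bounded_borel. B \<subseteq> A}. ennreal (\<phi> B)) = emeasure ?R A"
      using eq[OF A2] A2 by (subst emeasure_restrict_space) auto
  qed
  with R show ?thesis by simp
qed

lemma integral_upper_variation:
  fixes W :: "real measure" and k :: "real \<Rightarrow> real" and f f' :: "real \<Rightarrow> complex"
  assumes sets_W[measurable_cong, simp]: "sets W = sets borel"
    and k[measurable]: "k \<in> borel_measurable borel"
    and int: "\<And>A. A \<in> bounded_borel \<Longrightarrow> set_integrable W A k"
    and \<phi>: "\<And>A. A \<in> bounded_borel \<Longrightarrow> \<phi> A = (LINT x:A|W. k x)"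
    and f'[measurable]: "f' \<in> borel_measurable borel" and ff': "\<And>x. x \<ge> 1 \<Longrightarrow> f x = f' x"
  shows "(LINT x|upper_variation \<phi>. f x) = (LINT x:{1..}|W. of_real (max 0 (k x)) * f' x)"
proof -
  have sp: "space W = UNIV" using sets_eq_imp_space_eq[OF sets_W] by simp
  \<comment> \<open>\<open>integral_density\<close> asks for a nonnegative real density, so the
    cut-off of negative values is made explicit.\<close>
  have D: "density W (\<lambda>x. ennreal (k x)) = density W (\<lambda>x. ennreal (max 0 (k x)))"
    by (intro density_cong) (auto simp: max_def ennreal_neg)
  have "(LINT x|upper_variation \<phi>. f x) = (LINT x|upper_variation \<phi>. f' x)"
    unfolding upper_variation_density[OF sets_W k int \<phi>, simplified]
    by (intro Bochner_Integration.integral_cong) (auto simp: space_restrict_space ff')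
  also have "\<dots> = (\<integral>x. indicator {1..} x *\<^sub>R f' x \<partial>density W (\<lambda>x. ennreal (max 0 (k x))))"
    unfolding upper_variation_density[OF sets_W k int \<phi>, simplified] D
    by (subst integral_restrict_space) auto
  also have "\<dots> = (\<integral>x. max 0 (k x) *\<^sub>R (indicator {1..} x *\<^sub>R f' x) \<partial>W)"
    by (subst integral_density) auto
  also have "\<dots> = (LINT x:{1..}|W. of_real (max 0 (k x)) * f' x)"
    unfolding set_lebesgue_integral_def
    by (intro Bochner_Integration.integral_cong) (auto simp: scaleR_conv_of_real indicator_def)
  finally show ?thesis .
qed

text \<open>Two integrands occur because \<open>f\<close> is known on \<open>{1..}\<close> only: in
  \<open>mult_conv\<close> it is the value of a set function on a section, which has no meaning for
  \<open>x < 1\<close>, whereas \<open>f'\<close> is Borel on the whole line. The four variations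
  have the positive and negative parts of \<open>Re k\<close> and \<open>Im k\<close> as densities;
  each part is at most \<open>norm (k x)\<close>, so \<open>fk\<close> makes all four integrals
  converge.\<close>

lemma integral_wrt_density:
  fixes W :: "real measure" and k f f' :: "real \<Rightarrow> complex"
  assumes sets_W[measurable_cong, simp]: "sets W = sets borel"
    and k[measurable]: "k \<in> borel_measurable borel"
    and int: "\<And>A. A \<in> bounded_borel \<Longrightarrow> set_integrable W A k"
    and \<mu>: "\<And>A. A \<in> bounded_borel \<Longrightarrow> \<mu> A = (LINT x:A|W. k x)"
    and f'[measurable]: "f' \<in> borel_measurable borel" and ff': "\<And>x. x \<ge> 1 \<Longrightarrow> f x = f' x"
    and fk: "set_integrable W {1..} (\<lambda>x. f' x * k x)"
  shows "integral_wrt \<mu> f = (LINT x:{1..}|W. f' x * k x)"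
proof -
  have ReI: "set_integrable W A (\<lambda>x. Re (k x))" "set_integrable W A (\<lambda>x. - Re (k x))"
     "set_integrable W A (\<lambda>x. Im (k x))" "set_integrable W A (\<lambda>x. - Im (k x))"
     "Re (\<mu> A) = (LINT x:A|W. Re (k x))" "- Re (\<mu> A) = (LINT x:A|W. - Re (k x))"
     "Im (\<mu> A) = (LINT x:A|W. Im (k x))" "- Im (\<mu> A) = (LINT x:A|W. - Im (k x))"
    if A: "A \<in> bounded_borel" for A
  proof -
    have i: "integrable W (\<lambda>x. indicator A x *\<^sub>R k x)" using int[OF A] by (simp add: set_integrable_def)
    have R: "integrable W (\<lambda>x. Re (indicator A x *\<^sub>R k x))" "integrable W (\<lambda>x. Im (indicator A x *\<^sub>R k x))"
      using i by (rule integrable_Re integrable_Im)+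
    then show "set_integrable W A (\<lambda>x. Re (k x))" "set_integrable W A (\<lambda>x. Im (k x))"
      by (simp_all add: set_integrable_def)
    then show "set_integrable W A (\<lambda>x. - Re (k x))" "set_integrable W A (\<lambda>x. - Im (k x))"
      by (simp_all add: set_integrable_def)
    show 1: "Re (\<mu> A) = (LINT x:A|W. Re (k x))" "Im (\<mu> A) = (LINT x:A|W. Im (k x))"
      unfolding \<mu>[OF A] set_lebesgue_integral_def using integral_Re[OF i] integral_Im[OF i] by simp_all
    show "- Re (\<mu> A) = (LINT x:A|W. - Re (k x))" "- Im (\<mu> A) = (LINT x:A|W. - Im (k x))"
      unfolding 1 set_lebesgue_integral_def by simp_all
  qed
  have int4: "set_integrable W {1..} (\<lambda>x. of_real (max 0 (q (k x))) * f' x)"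
    if [measurable]: "q \<in> borel_measurable borel" and q: "\<And>z. \<bar>q z\<bar> \<le> norm z" for q :: "complex \<Rightarrow> real"
    using fk unfolding set_integrable_def
  proof (rule Bochner_Integration.integrable_bound)
    show "AE x in W. norm (indicator {1..} x *\<^sub>R (complex_of_real (max 0 (q (k x))) * f' x))
         \<le> norm (indicator {1..} x *\<^sub>R (f' x * k x))"
    proof (rule AE_I2)
      fix x
      have "\<bar>max 0 (q (k x))\<bar> \<le> norm (k x)" using q[of "k x"] by auto
      then have "norm (f' x) * \<bar>max 0 (q (k x))\<bar> \<le> norm (f' x) * norm (k x)"
        by (intro mult_left_mono) auto
      then show "norm (indicator {1..} x *\<^sub>R (complex_of_real (max 0 (q (k x))) * f' x))
         \<le> norm (indicator {1..} x *\<^sub>R (f' x * k x))"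
        by (simp add: norm_mult indicator_def mult.commute del: abs_of_nonneg)
    qed
  qed simp
  note i4 = int4[of Re, OF _ abs_Re_le_cmod] int4[of "\<lambda>z. - Re z", simplified, OF abs_Re_le_cmod]
    int4[of Im, OF _ abs_Im_le_cmod] int4[of "\<lambda>z. - Im z", simplified, OF abs_Im_le_cmod]
  have "integral_wrt \<mu> f =
      (LINT x:{1..}|W. of_real (max 0 (Re (k x))) * f' x) - (LINT x:{1..}|W. of_real (max 0 (- Re (k x))) * f' x)
     + \<i> * ((LINT x:{1..}|W. of_real (max 0 (Im (k x))) * f' x)
            - (LINT x:{1..}|W. of_real (max 0 (- Im (k x))) * f' x))"
    unfolding integral_wrt_def
    using integral_upper_variation[OF sets_W _ ReI(1,5) f' ff']
      integral_upper_variation[OF sets_W _ ReI(2,6) f' ff']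
      integral_upper_variation[OF sets_W _ ReI(3,7) f' ff']
      integral_upper_variation[OF sets_W _ ReI(4,8) f' ff'] by simp
  also have "\<dots> = (LINT x:{1..}|W. (of_real (max 0 (Re (k x))) * f' x - of_real (max 0 (- Re (k x))) * f' x)
     + \<i> * (of_real (max 0 (Im (k x))) * f' x - of_real (max 0 (- Im (k x))) * f' x))"
    using i4 by (simp add: set_integral_add set_integral_diff)
  also have "\<dots> = (LINT x:{1..}|W. f' x * k x)"
    unfolding set_lebesgue_integral_def
  proof (intro Bochner_Integration.integral_cong refl)
    fix x
    have "(of_real (max 0 (Re (k x))) - of_real (max 0 (- Re (k x))))
     + \<i> * (of_real (max 0 (Im (k x))) - of_real (max 0 (- Im (k x)))) = k x"
      by (auto simp: complex_eq_iff max_def)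
    then have "((of_real (max 0 (Re (k x))) - of_real (max 0 (- Re (k x))))
     + \<i> * (of_real (max 0 (Im (k x))) - of_real (max 0 (- Im (k x))))) * f' x = f' x * k x"
      by simp
    then show "indicator {1..} x *\<^sub>R ((of_real (max 0 (Re (k x))) * f' x - of_real (max 0 (- Re (k x))) * f' x)
     + \<i> * (of_real (max 0 (Im (k x))) * f' x - of_real (max 0 (- Im (k x))) * f' x))
      = indicator {1..} x *\<^sub>R (f' x * k x)"
      by (simp add: algebra_simps)
  qed
  finally show ?thesis .
qed

section \<open>Convolution powers with marks\<close>

lemma ennreal_suminf_commute: "(\<Sum>i. \<Sum>n. f i n) = (\<Sum>n. \<Sum>i. f i n :: ennreal)" for f :: "nat \<Rightarrow> nat \<Rightarrow> ennreal"
  using nn_integral_suminf[of "\<lambda>n i. f i n" "count_space UNIV"]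
  by (simp add: nn_integral_count_space_nat)

definition sum_measure :: "(nat \<Rightarrow> 'a measure) \<Rightarrow> 'a measure" where
  "sum_measure Q = measure_of (space (Q 0)) (sets (Q 0)) (\<lambda>A. \<Sum>n. emeasure (Q n) A)"

context
  fixes Q :: "nat \<Rightarrow> 'a measure" and B :: "'a measure"
  assumes sets_Q: "\<And>n. sets (Q n) = sets B"
begin

lemma sets_sum_measure: "sets (sum_measure Q) = sets B"
  unfolding sum_measure_def using sets_Q[of 0] sets.sets_measure_of_eq[of "Q 0"] by simp

lemma
  shows measurable_sum_measure: "f \<in> measurable (sum_measure Q) N \<longleftrightarrow> f \<in> measurable B N"
  and measurable_sum_component: "f \<in> measurable (Q n) N \<longleftrightarrow> f \<in> measurable B N"
  by (rule arg_cong[of _ _ "\<lambda>A. f \<in> A"], rule measurable_cong_sets; simp add: sets_sum_measure sets_Q)+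

lemma emeasure_sum_measure:
  assumes A: "A \<in> sets B"
  shows "emeasure (sum_measure Q) A = (\<Sum>n. emeasure (Q n) A)"
proof (rule emeasure_measure_of[OF sum_measure_def])
  show "sets (Q 0) \<subseteq> Pow (space (Q 0))" by (rule sets.space_closed)
  show "positive (sets (sum_measure Q)) (\<lambda>A. \<Sum>n. emeasure (Q n) A)"
    by (simp add: positive_def)
  show "countably_additive (sets (sum_measure Q)) (\<lambda>A. \<Sum>n. emeasure (Q n) A)"
  proof (rule countably_additiveI)
    fix A :: "nat \<Rightarrow> 'a set"
    assume A: "range A \<subseteq> sets (sum_measure Q)" "disjoint_family A"
    then have A': "range A \<subseteq> sets (Q n)" for n by (simp add: sets_sum_measure sets_Q)
    have "(\<Sum>i. \<Sum>n. emeasure (Q n) (A i)) = (\<Sum>n. \<Sum>i. emeasure (Q n) (A i))"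
      by (rule ennreal_suminf_commute)
    also have "\<dots> = (\<Sum>n. emeasure (Q n) (\<Union>i. A i))"
      using suminf_emeasure[OF A' A(2)] by simp
    finally show "(\<Sum>i. \<Sum>n. emeasure (Q n) (A i)) = (\<Sum>n. emeasure (Q n) (\<Union>i. A i))" .
  qed
  show "A \<in> sets (sum_measure Q)" using A by (simp add: sets_sum_measure)
qed

lemma nn_integral_sum_measure:
  assumes f: "f \<in> borel_measurable B"
  shows "(\<integral>\<^sup>+x. f x \<partial>sum_measure Q) = (\<Sum>n. \<integral>\<^sup>+x. f x \<partial>Q n)"
  using f
proof (induct rule: borel_measurable_induct)
  case (cong f g)
  have "(\<integral>\<^sup>+x. f x \<partial>sum_measure Q) = (\<integral>\<^sup>+x. g x \<partial>sum_measure Q)"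
    by (rule nn_integral_cong) (use cong(3) sets_eq_imp_space_eq[OF sets_sum_measure] in auto)
  moreover have "(\<integral>\<^sup>+x. f x \<partial>Q n) = (\<integral>\<^sup>+x. g x \<partial>Q n)" for n
    by (rule nn_integral_cong) (use cong(3) sets_eq_imp_space_eq[OF sets_Q] in auto)
  ultimately show ?case using cong(4) by simp
next
  case (set A)
  then show ?case by (simp add: sets_sum_measure sets_Q emeasure_sum_measure)
next
  case (mult u c)
  then show ?case by (simp add: nn_integral_cmult measurable_sum_measure measurable_sum_component)
next
  case (add u v)
  then show ?case by (simp add: nn_integral_add measurable_sum_measure measurable_sum_component suminf_add)
next
  case (seq U)
  have "(\<integral>\<^sup>+x. (SUP i. U i) x \<partial>sum_measure Q) = (SUP i. \<integral>\<^sup>+x. U i x \<partial>sum_measure Q)"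
    using seq by (simp add: nn_integral_monotone_convergence_SUP measurable_sum_measure measurable_sum_component image_comp)
  also have "\<dots> = (SUP i. \<Sum>n. \<integral>\<^sup>+x. U i x \<partial>Q n)" using seq by simp
  also have "\<dots> = (\<Sum>n. SUP i. \<integral>\<^sup>+x. U i x \<partial>Q n)"
    by (rule ennreal_suminf_SUP_eq[symmetric])
       (use seq in \<open>auto simp: incseq_def le_fun_def intro!: nn_integral_mono\<close>)
  also have "\<dots> = (\<Sum>n. \<integral>\<^sup>+x. (SUP i. U i) x \<partial>Q n)"
    using seq by (simp add: nn_integral_monotone_convergence_SUP measurable_sum_measure measurable_sum_component image_comp)
  finally show ?case .
qed

lemma integrable_sum_measure_component:
  fixes f :: "'a \<Rightarrow> 'b::{banach, second_countable_topology}"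
  assumes f: "integrable (sum_measure Q) f"
  shows "integrable (Q n) f"
proof (rule integrableI_bounded)
  have m: "f \<in> borel_measurable B" using borel_measurable_integrable[OF f] by (simp add: measurable_sum_measure)
  then show "f \<in> borel_measurable (Q n)" by (simp add: measurable_sum_component)
  have mn: "(\<lambda>x. ennreal (norm (f x))) \<in> borel_measurable B" using m by simp
  have "(\<integral>\<^sup>+x. norm (f x) \<partial>Q n) \<le> (\<Sum>n. \<integral>\<^sup>+x. norm (f x) \<partial>Q n)"
    using sum_le_suminf[of "\<lambda>n. \<integral>\<^sup>+x. norm (f x) \<partial>Q n" "{n}"] by simp
  also have "\<dots> = (\<integral>\<^sup>+x. norm (f x) \<partial>sum_measure Q)" by (rule nn_integral_sum_measure[OF mn, symmetric])
  also have "\<dots> < \<infinity>" using f by (simp add: integrable_iff_bounded)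
  finally show "(\<integral>\<^sup>+x. norm (f x) \<partial>Q n) < \<infinity>" .
qed

lemma sums_integral_sum_measure_nonneg:
  fixes f :: "'a \<Rightarrow> real"
  assumes f: "integrable (sum_measure Q) f" and nn: "\<And>x. f x \<ge> 0"
  shows "(\<lambda>n. \<integral>x. f x \<partial>Q n) sums (\<integral>x. f x \<partial>sum_measure Q)"
proof -
  have m: "f \<in> borel_measurable B" using borel_measurable_integrable[OF f] by (simp add: measurable_sum_measure)
  have "ennreal (\<integral>x. f x \<partial>sum_measure Q) = (\<integral>\<^sup>+x. f x \<partial>sum_measure Q)"
    by (rule nn_integral_eq_integral[symmetric]) (use f nn in auto)
  also have "\<dots> = (\<Sum>n. \<integral>\<^sup>+x. f x \<partial>Q n)" by (rule nn_integral_sum_measure) (use m in simp)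
  also have "\<dots> = (\<Sum>n. ennreal (\<integral>x. f x \<partial>Q n))"
    using nn by (simp add: nn_integral_eq_integral[OF integrable_sum_measure_component[OF f]])
  finally have *: "(\<Sum>n. ennreal (\<integral>x. f x \<partial>Q n)) = ennreal (\<integral>x. f x \<partial>sum_measure Q)" ..
  have "(\<lambda>n. ennreal (\<integral>x. f x \<partial>Q n)) sums ennreal (\<integral>x. f x \<partial>sum_measure Q)"
    using * by (metis summableI summable_sums)
  then show ?thesis
    by (subst (asm) sums_ennreal) (use nn in \<open>auto intro: integral_nonneg\<close>)
qed

lemma sums_integral_sum_measure:
  fixes f :: "'a \<Rightarrow> complex"
  assumes f: "integrable (sum_measure Q) f"
  shows "(\<lambda>n. \<integral>x. f x \<partial>Q n) sums (\<integral>x. f x \<partial>sum_measure Q)"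
proof -
  have real: "(\<lambda>n. \<integral>x. h x \<partial>Q n) sums (\<integral>x. h x \<partial>sum_measure Q)"
    if h: "integrable (sum_measure Q) h" for h :: "'a \<Rightarrow> real"
  proof -
    have i: "integrable (sum_measure Q) (\<lambda>x. max 0 (h x))" "integrable (sum_measure Q) (\<lambda>x. max 0 (- h x))"
      using h by auto
    have "(\<lambda>n. (\<integral>x. max 0 (h x) \<partial>Q n) - (\<integral>x. max 0 (- h x) \<partial>Q n)) sums
       ((\<integral>x. max 0 (h x) \<partial>sum_measure Q) - (\<integral>x. max 0 (- h x) \<partial>sum_measure Q))"
      by (intro sums_diff sums_integral_sum_measure_nonneg i) auto
    moreover have "(\<integral>x. max 0 (h x) \<partial>R) - (\<integral>x. max 0 (- h x) \<partial>R) = (\<integral>x. h x \<partial>R)"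
      if "integrable R h" for R :: "'a measure"
    proof -
      have "(\<integral>x. h x \<partial>R) = (\<integral>x. max 0 (h x) - max 0 (- h x) \<partial>R)"
        by (intro Bochner_Integration.integral_cong) auto
      also have "\<dots> = (\<integral>x. max 0 (h x) \<partial>R) - (\<integral>x. max 0 (- h x) \<partial>R)"
        using that by (intro Bochner_Integration.integral_diff integrable_max) auto
      finally show ?thesis ..
    qed
    ultimately show ?thesis using h integrable_sum_measure_component[OF h] by simp
  qed
  have "(\<lambda>n. complex_of_real (\<integral>x. Re (f x) \<partial>Q n) + \<i> * complex_of_real (\<integral>x. Im (f x) \<partial>Q n)) sums
     (complex_of_real (\<integral>x. Re (f x) \<partial>sum_measure Q) + \<i> * complex_of_real (\<integral>x. Im (f x) \<partial>sum_measure Q))"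
    by (intro sums_add sums_mult sums_of_real real integrable_Re integrable_Im f)
  moreover have "complex_of_real (\<integral>x. Re (f x) \<partial>R) + \<i> * complex_of_real (\<integral>x. Im (f x) \<partial>R) = (\<integral>x. f x \<partial>R)"
    if "integrable R f" for R
    using that by (simp add: complex_eq_iff integral_Re integral_Im)
  ultimately show ?thesis using f integrable_sum_measure_component[OF f] by simp
qed

end

text \<open>
  Points of the \<open>n\<close>-th power carry the product of the weights \<open>g\<close> as a mark, so that the complex measure
  \<open>exp\<^sup>*(g dM)\<close> is an integral of the mark against a positive measure, even if its total
  variation is infinite.
\<close>

primrec mark_power :: "real measure \<Rightarrow> (real \<Rightarrow> complex) \<Rightarrow> nat \<Rightarrow> (real \<times> complex) measure" where
  "mark_power M g 0 = return (borel \<Otimes>\<^sub>M borel) (1, 1)"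
| "mark_power M g (Suc n) =
     distr (M \<Otimes>\<^sub>M mark_power M g n) (borel \<Otimes>\<^sub>M borel) (\<lambda>(x, p). (x * fst p, g x * snd p))"

definition mark_exp :: "real measure \<Rightarrow> (real \<Rightarrow> complex) \<Rightarrow> (real \<times> complex) measure" where
  "mark_exp M g = sum_measure (\<lambda>n. density (mark_power M g n) (\<lambda>_. ennreal (1 / fact n)))"

lemma sets_fst_less[measurable, simp]:
  "{p. fst p < c} \<in> sets (borel \<Otimes>\<^sub>M borel :: (real \<times> complex) measure)"
proof -
  have "{p. fst p < c} = {..<c} \<times> (UNIV :: complex set)" by auto
  then show ?thesis by simp
qed

lemma sets_mark_power[measurable_cong, simp]: "sets (mark_power M g n) = sets (borel \<Otimes>\<^sub>M borel)"
  by (cases n) auto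

lemma space_mark_power[simp]: "space (mark_power M g n) = UNIV"
  using sets_eq_imp_space_eq[OF sets_mark_power] by (simp add: space_pair_measure)

lemma sets_mark_exp[measurable_cong, simp]: "sets (mark_exp M g) = sets (borel \<Otimes>\<^sub>M borel)"
  unfolding mark_exp_def by (rule sets_sum_measure) simp

lemma space_mark_exp[simp]: "space (mark_exp M g) = UNIV"
  using sets_eq_imp_space_eq[OF sets_mark_exp] by (simp add: space_pair_measure)

lemma nn_integral_mark_exp:
  assumes [measurable]: "f \<in> borel_measurable (borel \<Otimes>\<^sub>M borel)"
  shows "(\<integral>\<^sup>+p. f p \<partial>mark_exp M g) = (\<Sum>n. ennreal (1 / fact n) * (\<integral>\<^sup>+p. f p \<partial>mark_power M g n))"
proof -
  have "(\<integral>\<^sup>+p. f p \<partial>mark_exp M g)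
      = (\<Sum>n. \<integral>\<^sup>+p. f p \<partial>density (mark_power M g n) (\<lambda>_. ennreal (1 / fact n)))"
    unfolding mark_exp_def by (rule nn_integral_sum_measure[of _ "borel \<Otimes>\<^sub>M borel"]) auto
  also have "\<dots> = (\<Sum>n. ennreal (1 / fact n) * (\<integral>\<^sup>+p. f p \<partial>mark_power M g n))"
    by (intro suminf_cong) (simp add: nn_integral_density nn_integral_cmult)
  finally show ?thesis .
qed

lemma integrable_mark_power:
  fixes f :: "real \<times> complex \<Rightarrow> complex"
  assumes f: "integrable (mark_exp M g) f"
  shows "integrable (mark_power M g n) f"
proof -
  have [measurable]: "f \<in> borel_measurable (borel \<Otimes>\<^sub>M borel)"
    using f borel_measurable_integrable[OF f] by measurable
  have "integrable (density (mark_power M g n) (\<lambda>_. ennreal (1 / fact n))) f"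
    by (rule integrable_sum_measure_component[of _ "borel \<Otimes>\<^sub>M borel"]) (use f in \<open>auto simp: mark_exp_def\<close>)
  then have "integrable (mark_power M g n) (\<lambda>p. (1 / fact n) *\<^sub>R f p)"
    by (subst (asm) integrable_density) auto
  then have "integrable (mark_power M g n) (\<lambda>p. fact n *\<^sub>R ((1 / fact n) *\<^sub>R f p))"
    using integrable_scaleR_right[of "fact n" "mark_power M g n" "\<lambda>p. (1 / fact n) *\<^sub>R f p"] by blast
  moreover have "(\<lambda>p. fact n *\<^sub>R ((1 / fact n) *\<^sub>R f p)) = f"
    by (auto simp: fun_eq_iff)
  ultimately show ?thesis by simp
qed

lemma sums_integral_mark_exp:
  fixes f :: "real \<times> complex \<Rightarrow> complex"
  assumes f: "integrable (mark_exp M g) f"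
  shows "(\<lambda>n. (\<integral>p. f p \<partial>mark_power M g n) / fact n) sums (\<integral>p. f p \<partial>mark_exp M g)"
proof -
  have [measurable]: "f \<in> borel_measurable (borel \<Otimes>\<^sub>M borel)"
    using f borel_measurable_integrable[OF f] by measurable
  have "(\<lambda>n. \<integral>p. f p \<partial>density (mark_power M g n) (\<lambda>_. ennreal (1 / fact n))) sums (\<integral>p. f p \<partial>mark_exp M g)"
    unfolding mark_exp_def by (rule sums_integral_sum_measure[of _ "borel \<Otimes>\<^sub>M borel"]) (use f in \<open>auto simp: mark_exp_def\<close>)
  moreover have "(\<integral>p. f p \<partial>density (mark_power M g n) (\<lambda>_. ennreal (1 / fact n))) =
     (\<integral>p. f p \<partial>mark_power M g n) / fact n" for n
    by (subst integral_density) (auto simp: scaleR_conv_of_real)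
  ultimately show ?thesis by simp
qed

lemma sigma_finite_if_atMost_finite:
  fixes M :: "(real \<times> complex) measure"
  assumes [measurable_cong, simp]: "sets M = sets (borel \<Otimes>\<^sub>M borel)" and "\<And>x. emeasure M ({..x} \<times> UNIV) < \<infinity>"
  shows "sigma_finite_measure M"
proof
  have sp: "space M = UNIV" using sets_eq_imp_space_eq[OF assms(1)] by (simp add: space_pair_measure)
  have "(\<Union>i::nat. {..real i} \<times> (UNIV::complex set)) = UNIV"
    by (auto intro: real_arch_simple)
  moreover have "{..real i} \<times> (UNIV::complex set) \<in> sets M" for i
    by simp
  ultimately show "\<exists>A. countable A \<and> A \<subseteq> sets M \<and> \<Union> A = space M \<and> (\<forall>a\<in>A. emeasure M a \<noteq> \<infinity>)"
    using assms(2) by (intro exI[of _ "range (\<lambda>i::nat. {..real i} \<times> UNIV)"]) (auto simp: sp less_top)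
qed

text \<open>\<open>M\<close> plays the part of d\<Pi>: no mass up to 1 and finite mass on bounded
  sets. The weight is merely measurable, so that the locale serves \<open>g1 + g2\<close>,
  \<open>|g2|\<close>, the constant 1 and the various majorants alike.\<close>

locale mark_base =
  fixes M :: "real measure" and g :: "real \<Rightarrow> complex"
  assumes sets_M[measurable_cong, simp]: "sets M = sets borel"
    and g_meas[measurable]: "g \<in> borel_measurable borel"
    and M_null: "emeasure M {..1} = 0"
    and M_fin: "emeasure M {..x} < \<infinity>"
begin

lemma space_M[simp]: "space M = UNIV"
  using sets_eq_imp_space_eq[OF sets_M] by simp

lemma AE_M: "AE x in M. x > 1"
  using M_null by (intro AE_I[of _ _ "{..1}"]) auto

sublocale M: sigma_finite_measure M
proof
  have "(\<Union>i::nat. {..real i}) = UNIV"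
    by (auto intro: real_arch_simple)
  then show "\<exists>A. countable A \<and> A \<subseteq> sets M \<and> \<Union> A = space M \<and> (\<forall>a\<in>A. emeasure M a \<noteq> \<infinity>)"
    using M_fin by (intro exI[of _ "range (\<lambda>i::nat. {..real i})"]) (auto simp: less_top)
qed

text \<open>One induction for three facts: \<sigma>-finiteness of the n-th power makes Fubini
  available for the next one, Fubini gives the support and the bound, and the bound gives
  \<sigma>-finiteness again.\<close>

lemma mark_power_aux:
  "sigma_finite_measure (mark_power M g n) \<and> (AE p in mark_power M g n. fst p \<ge> 1) \<and>
   (\<forall>x. emeasure (mark_power M g n) ({..x} \<times> UNIV) \<le> emeasure M {..x} ^ n)"
proof (induction n)
  case 0
  interpret prob_space "return (borel \<Otimes>\<^sub>M borel) (1::real, 1::complex)" by (rule prob_space_return) (simp add: space_pair_measure)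
  have "sigma_finite_measure (return (borel \<Otimes>\<^sub>M borel) (1::real, 1::complex))" ..
  moreover have "AE p in return (borel \<Otimes>\<^sub>M borel) (1::real, 1::complex). fst p \<ge> 1" by (subst AE_return) (auto simp: space_pair_measure)
  moreover have "emeasure (return (borel \<Otimes>\<^sub>M borel) (1::real, 1::complex)) ({..x} \<times> UNIV) \<le> 1" for x
    by (subst emeasure_return) (auto simp: indicator_def)
  ultimately show ?case by (simp only: mark_power.simps power_0) blast
next
  case (Suc n)
  interpret S: sigma_finite_measure "mark_power M g n" using Suc by blast
  have AE1: "AE p in mark_power M g n. fst p \<ge> 1" using Suc by blast
  have nn: "(\<integral>\<^sup>+p. f p \<partial>mark_power M g (Suc n))
      = (\<integral>\<^sup>+x. \<integral>\<^sup>+p. f (x * fst p, g x * snd p) \<partial>mark_power M g n \<partial>M)"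
    if [measurable]: "f \<in> borel_measurable (borel \<Otimes>\<^sub>M borel)" for f
    unfolding mark_power.simps by (subst nn_integral_distr, measurable) (simp add: split_beta' flip: S.nn_integral_fst)
  have 2: "AE p in mark_power M g (Suc n). fst p \<ge> 1"
  proof -
    have "(\<integral>\<^sup>+p. indicator {p. fst p < 1} p \<partial>mark_power M g (Suc n)) =
       (\<integral>\<^sup>+x. \<integral>\<^sup>+p. indicator {p. fst p < 1} (x * fst p, g x * snd p) \<partial>mark_power M g n \<partial>M)"
      by (rule nn) measurable
    also have "\<dots> = (\<integral>\<^sup>+x. 0 \<partial>M)"
    proof (intro nn_integral_cong_AE, use AE_M in eventually_elim)
      fix x :: real assume x: "x > 1"
      have "(\<integral>\<^sup>+p. indicator {p. fst p < 1} (x * fst p, g x * snd p) \<partial>mark_power M g n) =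
         (\<integral>\<^sup>+p. 0 \<partial>mark_power M g n)"
      proof (intro nn_integral_cong_AE, use AE1 in eventually_elim)
        fix p :: "real \<times> complex" assume "fst p \<ge> 1"
        then have "x * fst p \<ge> 1" using x mult_mono[of 1 x 1 "fst p"] by simp
        then show "(indicator {p. fst p < 1} (x * fst p, g x * snd p) :: ennreal) = 0" by simp
      qed
      then show "(\<integral>\<^sup>+p. indicator {p. fst p < 1} (x * fst p, g x * snd p) \<partial>mark_power M g n) = 0" by simp
    qed
    finally have "emeasure (mark_power M g (Suc n)) {p. fst p < 1} = 0"
      by (subst (asm) nn_integral_indicator) auto
    then show ?thesis by (intro AE_I[of _ _ "{p. fst p < 1}"]) auto
  qed
  have 3: "emeasure (mark_power M g (Suc n)) ({..X} \<times> UNIV) \<le> emeasure M {..X} ^ Suc n" for X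
  proof -
    have "emeasure (mark_power M g (Suc n)) ({..X} \<times> UNIV) = (\<integral>\<^sup>+p. indicator ({..X} \<times> UNIV) p \<partial>mark_power M g (Suc n))"
      by (subst nn_integral_indicator) auto
    also have "\<dots> = (\<integral>\<^sup>+x. \<integral>\<^sup>+p. indicator ({..X} \<times> UNIV) (x * fst p, g x * snd p) \<partial>mark_power M g n \<partial>M)"
      by (rule nn) measurable
    also have "\<dots> \<le> (\<integral>\<^sup>+x. indicator {..X} x * emeasure M {..X} ^ n \<partial>M)"
    proof (intro nn_integral_mono_AE, use AE_M in eventually_elim)
      fix x :: real assume x: "x > 1"
      have "(\<integral>\<^sup>+p. indicator ({..X} \<times> UNIV) (x * fst p, g x * snd p) \<partial>mark_power M g n)
         \<le> (\<integral>\<^sup>+p. indicator {..X} x * indicator ({..X} \<times> UNIV) p \<partial>mark_power M g n)"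
      proof (intro nn_integral_mono_AE, use AE1 in eventually_elim)
        fix p :: "real \<times> complex" assume p: "fst p \<ge> 1"
        \<comment> \<open>A product up to \<open>X\<close> of factors at least 1 has both factors up
          to \<open>X\<close>; hence one and the same number \<open>emeasure M {..X}\<close> serves
          for every factor.\<close>
        have "x * 1 \<le> x * fst p" "1 * fst p \<le> x * fst p"
          using x p by (auto intro!: mult_left_mono mult_right_mono)
        then have "x \<le> X \<and> fst p \<le> X" if "x * fst p \<le> X"
          using that by simp
        then show "(indicator ({..X} \<times> UNIV) (x * fst p, g x * snd p) :: ennreal)
            \<le> indicator {..X} x * indicator ({..X} \<times> UNIV) p"
          by (cases p) (auto simp: indicator_def)
      qed
      also have "\<dots> = indicator {..X} x * emeasure (mark_power M g n) ({..X} \<times> UNIV)"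
        by (subst nn_integral_cmult) auto
      also have "\<dots> \<le> indicator {..X} x * emeasure M {..X} ^ n"
        using Suc by (intro mult_left_mono) auto
      finally show "(\<integral>\<^sup>+p. indicator ({..X} \<times> UNIV) (x * fst p, g x * snd p) \<partial>mark_power M g n)
         \<le> indicator {..X} x * emeasure M {..X} ^ n" .
    qed
    also have "\<dots> = emeasure M {..X} ^ Suc n"
      by (subst nn_integral_multc) auto
    finally show ?thesis .
  qed
  have "emeasure M {..x} ^ Suc n < \<infinity>" for x
    using M_fin[of x] by (simp add: power_less_top_ennreal del: power_Suc)
  then have "sigma_finite_measure (mark_power M g (Suc n))"
    by (intro sigma_finite_if_atMost_finite sets_mark_power) (rule le_less_trans[OF 3])
  with 2 3 show ?case by blast
qed

sublocale S: sigma_finite_measure "mark_power M g n" for n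
  using mark_power_aux by blast

lemma AE_mark_power: "AE p in mark_power M g n. fst p \<ge> 1"
  using mark_power_aux by blast

lemma nn_integral_mark_power_Suc:
  assumes [measurable]: "f \<in> borel_measurable (borel \<Otimes>\<^sub>M borel)"
  shows "(\<integral>\<^sup>+p. f p \<partial>mark_power M g (Suc n))
      = (\<integral>\<^sup>+x. \<integral>\<^sup>+p. f (x * fst p, g x * snd p) \<partial>mark_power M g n \<partial>M)"
  unfolding mark_power.simps by (subst nn_integral_distr, measurable) (simp add: split_beta' flip: S.nn_integral_fst)

lemma AE_mark_exp: "AE p in mark_exp M g. fst p \<ge> 1"
proof -
  have "emeasure (mark_power M g n) {p. fst p < 1} = 0" for n
    using AE_mark_power[of n] by (subst (asm) AE_iff_measurable[OF _ refl]) (auto simp: not_le)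
  moreover have "emeasure (mark_exp M g) {p. fst p < 1} =
      (\<integral>\<^sup>+p. indicator {p. fst p < 1} p \<partial>mark_exp M g)" by (subst nn_integral_indicator) auto
  moreover have "\<dots> = (\<Sum>n. ennreal (1 / fact n) * (\<integral>\<^sup>+p. indicator {p. fst p < 1} p \<partial>mark_power M g n))"
    by (rule nn_integral_mark_exp) auto
  ultimately have "emeasure (mark_exp M g) {p. fst p < 1} = 0" by simp
  then show ?thesis by (intro AE_I[of _ _ "{p. fst p < 1}"]) auto
qed

lemma emeasure_mark_exp_finite: "emeasure (mark_exp M g) ({..x} \<times> UNIV) < \<infinity>"
proof -
  have "emeasure (mark_exp M g) ({..x} \<times> UNIV) = (\<integral>\<^sup>+p. indicator ({..x} \<times> UNIV) p \<partial>mark_exp M g)"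
    by (subst nn_integral_indicator) auto
  also have "\<dots> = (\<Sum>n. ennreal (1 / fact n) * (\<integral>\<^sup>+p. indicator ({..x} \<times> UNIV) p \<partial>mark_power M g n))"
    by (rule nn_integral_mark_exp) auto
  also have "\<dots> \<le> (\<Sum>n. ennreal (measure M {..x} ^ n / fact n))"
  proof (intro suminf_le summableI)
    fix n
    have "(\<integral>\<^sup>+p. indicator ({..x} \<times> UNIV) p \<partial>mark_power M g n) = emeasure (mark_power M g n) ({..x} \<times> UNIV)"
      by (subst nn_integral_indicator) auto
    also have "\<dots> \<le> emeasure M {..x} ^ n" using mark_power_aux by blast
    also have "\<dots> = ennreal (measure M {..x} ^ n)"
      using M_fin[of x] by (simp add: emeasure_eq_ennreal_measure less_top ennreal_power)
    finally have "ennreal (1 / fact n) * (\<integral>\<^sup>+p. indicator ({..x} \<times> UNIV) p \<partial>mark_power M g n)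
      \<le> ennreal (1 / fact n) * ennreal (measure M {..x} ^ n)"
      by (intro mult_left_mono) auto
    also have "\<dots> = ennreal (measure M {..x} ^ n / fact n)"
      by (subst ennreal_mult[symmetric]) auto
    finally show "ennreal (1 / fact n) * (\<integral>\<^sup>+p. indicator ({..x} \<times> UNIV) p \<partial>mark_power M g n)
       \<le> ennreal (measure M {..x} ^ n / fact n)" .
  qed
  also have "\<dots> = ennreal (\<Sum>n. measure M {..x} ^ n / fact n)"
    using summable_exp_generic[of "measure M {..x}"]
    by (intro suminf_ennreal2) (auto simp: field_simps)
  also have "\<dots> < \<infinity>" by simp
  finally show ?thesis .
qed

sublocale E: sigma_finite_measure "mark_exp M g"
  by (rule sigma_finite_if_atMost_finite[OF sets_mark_exp emeasure_mark_exp_finite])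

lemma pair_mark_power: "pair_sigma_finite M (mark_power M g n)"
  by (simp add: pair_sigma_finite_def M.sigma_finite_measure_axioms S.sigma_finite_measure_axioms)

lemma pair_mark_exp: "pair_sigma_finite M (mark_exp M g)"
  by (simp add: pair_sigma_finite_def M.sigma_finite_measure_axioms E.sigma_finite_measure_axioms)

end

declare mark_power.simps(2) [simp del]

section \<open>Multiplicative and logarithmic weights\<close>

context mark_base
begin

text \<open>A submultiplicative weight can be distributed over the factors of a point, after which
  the integrals separate. Instances are \<open>1 / x\<close>, negative powers of \<open>x\<close>,
  and indicators of \<open>{..X}\<close>.\<close>

lemma nn_integral_mark_power_submult:
  fixes \<psi> :: "real \<Rightarrow> ennreal"
  assumes [measurable]: "\<psi> \<in> borel_measurable borel" and one: "\<psi> 1 \<le> 1"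
    and mult: "\<And>x y. x \<ge> 1 \<Longrightarrow> y \<ge> 1 \<Longrightarrow> \<psi> (x * y) \<le> \<psi> x * \<psi> y"
  shows "(\<integral>\<^sup>+p. \<psi> (fst p) * ennreal (norm (snd p)) \<partial>mark_power M g n)
    \<le> (\<integral>\<^sup>+x. \<psi> x * ennreal (norm (g x)) \<partial>M) ^ n"
proof (induction n)
  case 0
  show ?case using one by (simp add: nn_integral_return space_pair_measure)
next
  case (Suc n)
  have "(\<integral>\<^sup>+p. \<psi> (fst p) * ennreal (norm (snd p)) \<partial>mark_power M g (Suc n))
     = (\<integral>\<^sup>+x. \<integral>\<^sup>+p. \<psi> (x * fst p) * ennreal (norm (g x * snd p)) \<partial>mark_power M g n \<partial>M)"
    by (subst nn_integral_mark_power_Suc) auto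
  also have "\<dots> \<le> (\<integral>\<^sup>+x. \<integral>\<^sup>+p. (\<psi> x * ennreal (norm (g x))) * (\<psi> (fst p) * ennreal (norm (snd p))) \<partial>mark_power M g n \<partial>M)"
  proof (intro nn_integral_mono_AE, use AE_M in eventually_elim)
    fix x :: real assume x: "x > 1"
    show "(\<integral>\<^sup>+p. \<psi> (x * fst p) * ennreal (norm (g x * snd p)) \<partial>mark_power M g n)
      \<le> (\<integral>\<^sup>+p. (\<psi> x * ennreal (norm (g x))) * (\<psi> (fst p) * ennreal (norm (snd p))) \<partial>mark_power M g n)"
    proof (intro nn_integral_mono_AE, use AE_mark_power in eventually_elim)
      fix p :: "real \<times> complex" assume p: "fst p \<ge> 1"
      have "\<psi> (x * fst p) * ennreal (norm (g x * snd p)) \<le> (\<psi> x * \<psi> (fst p)) * ennreal (norm (g x * snd p))"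
        using x p by (intro mult_right_mono mult) auto
      also have "\<dots> = (\<psi> x * ennreal (norm (g x))) * (\<psi> (fst p) * ennreal (norm (snd p)))"
        by (simp add: norm_mult ennreal_mult mult_ac)
      finally show "\<psi> (x * fst p) * ennreal (norm (g x * snd p)) \<le>
         (\<psi> x * ennreal (norm (g x))) * (\<psi> (fst p) * ennreal (norm (snd p)))" .
    qed
  qed
  also have "\<dots> = (\<integral>\<^sup>+x. (\<psi> x * ennreal (norm (g x))) * (\<integral>\<^sup>+p. \<psi> (fst p) * ennreal (norm (snd p)) \<partial>mark_power M g n) \<partial>M)"
    by (simp add: nn_integral_cmult)
  also have "\<dots> = (\<integral>\<^sup>+x. \<psi> x * ennreal (norm (g x)) \<partial>M) * (\<integral>\<^sup>+p. \<psi> (fst p) * ennreal (norm (snd p)) \<partial>mark_power M g n)"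
    by (subst nn_integral_multc) auto
  also have "\<dots> \<le> (\<integral>\<^sup>+x. \<psi> x * ennreal (norm (g x)) \<partial>M) ^ Suc n"
    using Suc by (auto intro: mult_left_mono)
  finally show ?case .
qed

lemma nn_integral_mark_exp_submult:
  fixes \<psi> :: "real \<Rightarrow> ennreal"
  assumes \<psi>[measurable]: "\<psi> \<in> borel_measurable borel" and one: "\<psi> 1 \<le> 1"
    and mult: "\<And>x y. x \<ge> 1 \<Longrightarrow> y \<ge> 1 \<Longrightarrow> \<psi> (x * y) \<le> \<psi> x * \<psi> y"
    and r: "(\<integral>\<^sup>+x. \<psi> x * ennreal (norm (g x)) \<partial>M) \<le> ennreal r" "r \<ge> 0"
  shows "(\<integral>\<^sup>+p. \<psi> (fst p) * ennreal (norm (snd p)) \<partial>mark_exp M g) \<le> ennreal (exp r)"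
proof -
  have "(\<integral>\<^sup>+p. \<psi> (fst p) * ennreal (norm (snd p)) \<partial>mark_exp M g) =
    (\<Sum>n. ennreal (1 / fact n) * (\<integral>\<^sup>+p. \<psi> (fst p) * ennreal (norm (snd p)) \<partial>mark_power M g n))"
    by (rule nn_integral_mark_exp) measurable
  also have "\<dots> \<le> (\<Sum>n. ennreal (r ^ n / fact n))"
  proof (intro suminf_le summableI)
    fix n
    have "(\<integral>\<^sup>+p. \<psi> (fst p) * ennreal (norm (snd p)) \<partial>mark_power M g n) \<le> (\<integral>\<^sup>+x. \<psi> x * ennreal (norm (g x)) \<partial>M) ^ n"
      by (rule nn_integral_mark_power_submult[OF \<psi> one mult])
    also have "\<dots> \<le> ennreal r ^ n" by (rule power_mono[OF r(1)]) simp
    finally have "ennreal (1 / fact n) * (\<integral>\<^sup>+p. \<psi> (fst p) * ennreal (norm (snd p)) \<partial>mark_power M g n)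
       \<le> ennreal (1 / fact n) * ennreal r ^ n"
      by (rule mult_left_mono) simp
    also have "\<dots> = ennreal (r ^ n / fact n)"
      using r(2) by (simp add: ennreal_power ennreal_mult[symmetric])
    finally show "ennreal (1 / fact n) * (\<integral>\<^sup>+p. \<psi> (fst p) * ennreal (norm (snd p)) \<partial>mark_power M g n)
       \<le> ennreal (r ^ n / fact n)" .
  qed
  also have "\<dots> = ennreal (\<Sum>n. r ^ n / fact n)"
    using summable_exp_generic[of r] r(2) by (intro suminf_ennreal2) (auto simp: field_simps)
  also have "(\<Sum>n. r ^ n / fact n) = exp r"
    by (simp add: exp_def scaleR_conv_of_real field_simps)
  finally show ?thesis .
qed

lemma integrable_mark_exp_submult:
  fixes \<psi> :: "real \<Rightarrow> complex"
  assumes [measurable]: "\<psi> \<in> borel_measurable borel" and one: "norm (\<psi> 1) \<le> 1"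
    and mult: "\<And>x y. x \<ge> 1 \<Longrightarrow> y \<ge> 1 \<Longrightarrow> norm (\<psi> (x * y)) \<le> norm (\<psi> x) * norm (\<psi> y)"
    and int: "integrable M (\<lambda>x. \<psi> x * g x)"
  shows "integrable (mark_exp M g) (\<lambda>p. \<psi> (fst p) * snd p)"
    and "(\<integral>p. norm (\<psi> (fst p) * snd p) \<partial>mark_exp M g) \<le> exp (\<integral>x. norm (\<psi> x * g x) \<partial>M)"
proof -
  let ?r = "\<integral>x. norm (\<psi> x * g x) \<partial>M"
  have "(\<integral>\<^sup>+x. ennreal (norm (\<psi> x)) * ennreal (norm (g x)) \<partial>M) = (\<integral>\<^sup>+x. ennreal (norm (\<psi> x * g x)) \<partial>M)"
    by (simp add: norm_mult ennreal_mult)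
  also have "\<dots> = ennreal ?r"
    by (rule nn_integral_eq_integral) (use int in auto)
  finally have 1: "(\<integral>\<^sup>+x. ennreal (norm (\<psi> x)) * ennreal (norm (g x)) \<partial>M) \<le> ennreal ?r" by simp
  have nn: "(\<integral>\<^sup>+p. ennreal (norm (\<psi> (fst p) * snd p)) \<partial>mark_exp M g) \<le> ennreal (exp ?r)"
    using nn_integral_mark_exp_submult[of "\<lambda>x. ennreal (norm (\<psi> x))", OF _ _ _ 1] one mult
    by (simp add: norm_mult flip: ennreal_mult)
  then show i: "integrable (mark_exp M g) (\<lambda>p. \<psi> (fst p) * snd p)"
    by (intro integrableI_bounded) (auto intro: le_less_trans)
  have "ennreal (\<integral>p. norm (\<psi> (fst p) * snd p) \<partial>mark_exp M g) \<le> ennreal (exp ?r)"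
    using nn i by (subst nn_integral_eq_integral[symmetric]) auto
  then show "(\<integral>p. norm (\<psi> (fst p) * snd p) \<partial>mark_exp M g) \<le> exp ?r" by simp
qed

lemma integrable_mark_power_SucD:
  fixes f :: "real \<times> complex \<Rightarrow> complex"
  assumes f: "integrable (mark_power M g (Suc n)) f"
  shows "integrable (M \<Otimes>\<^sub>M mark_power M g n) (\<lambda>(x, p). f (x * fst p, g x * snd p))"
proof -
  have [measurable]: "f \<in> borel_measurable (borel \<Otimes>\<^sub>M borel)"
    using borel_measurable_integrable[OF f] by measurable
  show ?thesis
    using f unfolding mark_power.simps
    by (subst (asm) integrable_distr_eq) (auto simp: split_beta')
qed

lemma integral_mark_power_Suc:
  fixes f :: "real \<times> complex \<Rightarrow> complex"
  assumes f: "integrable (mark_power M g (Suc n)) f"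
  shows "(\<integral>p. f p \<partial>mark_power M g (Suc n))
      = (\<integral>x. \<integral>p. f (x * fst p, g x * snd p) \<partial>mark_power M g n \<partial>M)"
proof -
  interpret pair_sigma_finite M "mark_power M g n" by (rule pair_mark_power)
  have [measurable]: "f \<in> borel_measurable (borel \<Otimes>\<^sub>M borel)"
    using borel_measurable_integrable[OF f] by measurable
  have "(\<integral>p. f p \<partial>mark_power M g (Suc n)) =
    (\<integral>q. (\<lambda>(x, p). f (x * fst p, g x * snd p)) q \<partial>(M \<Otimes>\<^sub>M mark_power M g n))"
    unfolding mark_power.simps by (subst integral_distr) (auto simp: split_beta')
  also have "\<dots> = (\<integral>x. \<integral>p. f (x * fst p, g x * snd p) \<partial>mark_power M g n \<partial>M)"
    using integral_fst'[OF integrable_mark_power_SucD[OF f]] by simp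
  finally show ?thesis .
qed

text \<open>The Euler product in integral form: for a completely multiplicative
  \<open>\<psi>\<close> the n-th convolution power integrates to the n-th power of a number, and
  what remains is the exponential series. For \<open>\<psi> x = x^(-s)\<close> it shows that the
  transform of dG is an exponential, which later gives access to its fractional powers.\<close>

lemma integral_mark_exp_mult:
  fixes \<psi> :: "real \<Rightarrow> complex"
  assumes [measurable]: "\<psi> \<in> borel_measurable borel" and one: "\<psi> 1 = 1"
    and mult: "\<And>x y. x \<ge> 1 \<Longrightarrow> y \<ge> 1 \<Longrightarrow> \<psi> (x * y) = \<psi> x * \<psi> y"
    and int: "integrable M (\<lambda>x. \<psi> x * g x)"
  shows "(\<integral>p. \<psi> (fst p) * snd p \<partial>mark_exp M g) = exp (\<integral>x. \<psi> x * g x \<partial>M)"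
proof -
  have i: "integrable (mark_exp M g) (\<lambda>p. \<psi> (fst p) * snd p)"
    by (rule integrable_mark_exp_submult) (use one mult int in \<open>auto simp: norm_mult\<close>)
  have lev: "(\<integral>p. \<psi> (fst p) * snd p \<partial>mark_power M g n) = (\<integral>x. \<psi> x * g x \<partial>M) ^ n" for n
  proof (induction n)
    case 0
    show ?case using one by (simp add: integral_return space_pair_measure)
  next
    case (Suc n)
    have "(\<integral>p. \<psi> (fst p) * snd p \<partial>mark_power M g (Suc n)) =
      (\<integral>x. \<integral>p. \<psi> (x * fst p) * (g x * snd p) \<partial>mark_power M g n \<partial>M)"
      using integral_mark_power_Suc[OF integrable_mark_power[OF i]] by simp
    also have "\<dots> = (\<integral>x. (\<psi> x * g x) * (\<integral>p. \<psi> (fst p) * snd p \<partial>mark_power M g n) \<partial>M)"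
    proof (rule integral_cong_AE)
      show "AE x in M. (\<integral>p. \<psi> (x * fst p) * (g x * snd p) \<partial>mark_power M g n) =
        (\<psi> x * g x) * (\<integral>p. \<psi> (fst p) * snd p \<partial>mark_power M g n)"
        using AE_M
      proof eventually_elim
        case (elim x)
        have "(\<integral>p. \<psi> (x * fst p) * (g x * snd p) \<partial>mark_power M g n) =
          (\<integral>p. (\<psi> x * g x) * (\<psi> (fst p) * snd p) \<partial>mark_power M g n)"
        proof (rule integral_cong_AE)
          show "AE p in mark_power M g n. \<psi> (x * fst p) * (g x * snd p) = (\<psi> x * g x) * (\<psi> (fst p) * snd p)"
            using AE_mark_power by eventually_elim (use elim in \<open>simp add: mult\<close>)
        qed measurable
        then show ?case by simp
      qed
    qed measurable
    also have "\<dots> = (\<integral>x. \<psi> x * g x \<partial>M) ^ Suc n"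
      by (simp add: Suc)
    finally show ?case .
  qed
  have "(\<lambda>n. (\<integral>x. \<psi> x * g x \<partial>M) ^ n / fact n) sums (\<integral>p. \<psi> (fst p) * snd p \<partial>mark_exp M g)"
    using sums_integral_mark_exp[OF i] by (simp add: lev)
  moreover have "(\<lambda>n. (\<integral>x. \<psi> x * g x \<partial>M) ^ n / fact n) sums exp (\<integral>x. \<psi> x * g x \<partial>M)"
    using exp_converges[of "\<integral>x. \<psi> x * g x \<partial>M"] by (simp add: scaleR_conv_of_real field_simps)
  ultimately show ?thesis by (rule sums_unique2)
qed

text \<open>The logarithm of a product is the sum of the logarithms of its n + 1 factors, and by
  symmetry each of them contributes as much as the first.\<close>

lemma nn_integral_log_mark_power:
  assumes f[measurable]: "f \<in> borel_measurable (borel \<Otimes>\<^sub>M borel)"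
  shows "(\<integral>\<^sup>+p. ennreal (ln (fst p)) * f p \<partial>mark_power M g (Suc n)) =
    of_nat (Suc n) * (\<integral>\<^sup>+x. \<integral>\<^sup>+p. ennreal (ln x) * f (x * fst p, g x * snd p) \<partial>mark_power M g n \<partial>M)"
  using f
proof (induction n arbitrary: f)
  case 0
  note [measurable] = 0
  show ?case
    by (subst nn_integral_mark_power_Suc) (auto simp: nn_integral_return space_pair_measure)
next
  case (Suc n)
  note [measurable] = Suc.prems
  interpret MM: pair_sigma_finite M M by (simp add: pair_sigma_finite_def M.sigma_finite_measure_axioms)
  let ?p = "\<lambda>n. mark_power M g n"
  have "(\<integral>\<^sup>+p. ennreal (ln (fst p)) * f p \<partial>?p (Suc (Suc n))) =
     (\<integral>\<^sup>+x. \<integral>\<^sup>+p. ennreal (ln (x * fst p)) * f (x * fst p, g x * snd p) \<partial>?p (Suc n) \<partial>M)"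
    by (subst nn_integral_mark_power_Suc) auto
  also have "\<dots> = (\<integral>\<^sup>+x. \<integral>\<^sup>+p. ennreal (ln x) * f (x * fst p, g x * snd p)
       + ennreal (ln (fst p)) * f (x * fst p, g x * snd p) \<partial>?p (Suc n) \<partial>M)"
  proof (intro nn_integral_cong_AE, use AE_M in eventually_elim)
    fix x :: real assume x: "x > 1"
    show "(\<integral>\<^sup>+p. ennreal (ln (x * fst p)) * f (x * fst p, g x * snd p) \<partial>?p (Suc n)) =
      (\<integral>\<^sup>+p. ennreal (ln x) * f (x * fst p, g x * snd p)
       + ennreal (ln (fst p)) * f (x * fst p, g x * snd p) \<partial>?p (Suc n))"
    proof (intro nn_integral_cong_AE, use AE_mark_power in eventually_elim)
      fix p :: "real \<times> complex" assume p: "fst p \<ge> 1"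
      then have "ennreal (ln (x * fst p)) = ennreal (ln x) + ennreal (ln (fst p))"
        using x by (simp add: ln_mult ennreal_plus)
      then show "ennreal (ln (x * fst p)) * f (x * fst p, g x * snd p) = ennreal (ln x) * f (x * fst p, g x * snd p)
       + ennreal (ln (fst p)) * f (x * fst p, g x * snd p)" by (simp add: distrib_right)
    qed
  qed
  also have "\<dots> = (\<integral>\<^sup>+x. \<integral>\<^sup>+p. ennreal (ln x) * f (x * fst p, g x * snd p) \<partial>?p (Suc n) \<partial>M) +
      (\<integral>\<^sup>+x. \<integral>\<^sup>+p. ennreal (ln (fst p)) * f (x * fst p, g x * snd p) \<partial>?p (Suc n) \<partial>M)"
    by (subst nn_integral_add[symmetric]) (auto simp: nn_integral_add)
  \<comment> \<open>The induction hypothesis singles out a factor \<open>u\<close> of the remaining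
    product; exchanging \<open>u\<close> with the first factor \<open>x\<close> then brings it to
    the front.\<close>
  also have "(\<integral>\<^sup>+x. \<integral>\<^sup>+p. ennreal (ln (fst p)) * f (x * fst p, g x * snd p) \<partial>?p (Suc n) \<partial>M) =
     (\<integral>\<^sup>+x. of_nat (Suc n) * (\<integral>\<^sup>+u. \<integral>\<^sup>+p. ennreal (ln u) * f (x * (u * fst p), g x * (g u * snd p)) \<partial>?p n \<partial>M) \<partial>M)"
    by (intro nn_integral_cong) (subst Suc.IH, auto)
  also have "\<dots> = of_nat (Suc n) * (\<integral>\<^sup>+x. \<integral>\<^sup>+u. \<integral>\<^sup>+p. ennreal (ln u) * f (x * (u * fst p), g x * (g u * snd p)) \<partial>?p n \<partial>M \<partial>M)"
    by (subst nn_integral_cmult) auto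
  also have "(\<integral>\<^sup>+x. \<integral>\<^sup>+u. \<integral>\<^sup>+p. ennreal (ln u) * f (x * (u * fst p), g x * (g u * snd p)) \<partial>?p n \<partial>M \<partial>M)
     = (\<integral>\<^sup>+u. \<integral>\<^sup>+x. \<integral>\<^sup>+p. ennreal (ln u) * f (x * (u * fst p), g x * (g u * snd p)) \<partial>?p n \<partial>M \<partial>M)"
    by (rule MM.Fubini') measurable
  also have "\<dots> = (\<integral>\<^sup>+u. \<integral>\<^sup>+p. ennreal (ln u) * f (u * fst p, g u * snd p) \<partial>?p (Suc n) \<partial>M)"
    by (intro nn_integral_cong) (subst nn_integral_mark_power_Suc, auto simp: mult_ac)
  finally show ?case
    by (simp only: of_nat_Suc distrib_right mult_1_left mult_1)
qed

text \<open>The factor n + 1 cancels against (n + 1)!, which shifts the index of the exponential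
  series by one; the term n = 0 is lost without damage since ln 1 = 0.\<close>

lemma nn_integral_log_mark_exp:
  assumes f[measurable]: "f \<in> borel_measurable (borel \<Otimes>\<^sub>M borel)"
  shows "(\<integral>\<^sup>+p. ennreal (ln (fst p)) * f p \<partial>mark_exp M g) =
    (\<integral>\<^sup>+x. \<integral>\<^sup>+p. ennreal (ln x) * f (x * fst p, g x * snd p) \<partial>mark_exp M g \<partial>M)"
proof -
  let ?p = "\<lambda>n. mark_power M g n"
  let ?t = "\<lambda>n. ennreal (1 / fact n) * (\<integral>\<^sup>+p. ennreal (ln (fst p)) * f p \<partial>?p n)"
  have "(\<integral>\<^sup>+p. ennreal (ln (fst p)) * f p \<partial>mark_exp M g) = (\<Sum>n. ?t n)"
    by (rule nn_integral_mark_exp) measurable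
  also have "\<dots> = (\<Sum>n. ?t (Suc n))"
  proof -
    have "?t 0 = 0" by (simp add: nn_integral_return space_pair_measure)
    then show ?thesis
      using sums_Suc[of ?t, OF summable_sums[OF summableI]] by (simp add: sums_iff)
  qed
  also have "\<dots> = (\<Sum>n. ennreal (1 / fact n) * (\<integral>\<^sup>+x. \<integral>\<^sup>+p. ennreal (ln x) * f (x * fst p, g x * snd p) \<partial>?p n \<partial>M))"
  proof (intro suminf_cong)
    fix n
    have "ennreal (1 / fact (Suc n)) * of_nat (Suc n) = ennreal (1 / fact n)"
      unfolding ennreal_of_nat_eq_real_of_nat
      by (subst ennreal_mult[symmetric]) (auto simp: divide_simps simp flip: of_nat_Suc)
    then show "?t (Suc n) = ennreal (1 / fact n) * (\<integral>\<^sup>+x. \<integral>\<^sup>+p. ennreal (ln x) * f (x * fst p, g x * snd p) \<partial>?p n \<partial>M)"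
      by (subst nn_integral_log_mark_power) (auto simp: mult.assoc[symmetric])
  qed
  also have "\<dots> = (\<integral>\<^sup>+x. (\<Sum>n. ennreal (1 / fact n) * (\<integral>\<^sup>+p. ennreal (ln x) * f (x * fst p, g x * snd p) \<partial>?p n)) \<partial>M)"
    by (subst nn_integral_suminf) (auto simp: nn_integral_cmult)
  also have "\<dots> = (\<integral>\<^sup>+x. \<integral>\<^sup>+p. ennreal (ln x) * f (x * fst p, g x * snd p) \<partial>mark_exp M g \<partial>M)"
    by (intro nn_integral_cong) (subst nn_integral_mark_exp, auto)
  finally show ?thesis .
qed

end

section \<open>Locally integrable weights and the convolution exponential\<close>

locale mark_local = mark_base +
  assumes g_loc: "(\<integral>\<^sup>+x. indicator {..X} x * ennreal (norm (g x)) \<partial>M) < \<infinity>"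
begin

lemma integrable_g_loc: "integrable M (\<lambda>x. indicator {..X} x * g x)"
proof (rule integrableI_bounded)
  have "(\<integral>\<^sup>+x. norm (indicator {..X} x * g x) \<partial>M) = (\<integral>\<^sup>+x. indicator {..X} x * ennreal (norm (g x)) \<partial>M)"
    by (intro nn_integral_cong) (auto simp: indicator_def)
  then show "(\<integral>\<^sup>+x. norm (indicator {..X} x * g x) \<partial>M) < \<infinity>" using g_loc by simp
qed simp

text \<open>Products of numbers at least 1 only grow, so the indicator of \<open>{..X}\<close> is
  submultiplicative on \<open>{1..}\<close> and the exponential bound for submultiplicative weights
  applies to it.\<close>

lemma integrable_mark_exp_bounded_support:
  fixes h :: "real \<Rightarrow> complex"
  assumes [measurable]: "h \<in> borel_measurable borel" and h: "\<And>x. x \<ge> 1 \<Longrightarrow> norm (h x) \<le> C * indicator {..X} x"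
  shows "integrable (mark_exp M g) (\<lambda>p. h (fst p) * snd p)"
proof (rule Bochner_Integration.integrable_bound)
  let ?i = "indicator {..X} :: real \<Rightarrow> complex"
  have m: "norm (?i (x * y)) \<le> norm (?i x) * norm (?i y)" if "x \<ge> 1" "y \<ge> 1" for x y
  proof -
    have "x * 1 \<le> x * y" "1 * y \<le> x * y"
      using that by (auto intro!: mult_left_mono mult_right_mono)
    then show ?thesis by (auto simp: indicator_def)
  qed
  have "integrable (mark_exp M g) (\<lambda>p. ?i (fst p) * snd p)"
    by (rule integrable_mark_exp_submult(1)[OF _ _ m]) (auto simp: integrable_g_loc, simp add: indicator_def)
  then show "integrable (mark_exp M g) (\<lambda>p. of_real C * (?i (fst p) * snd p))"
    by (rule integrable_mult_right)
  show "AE p in mark_exp M g. norm (h (fst p) * snd p) \<le> norm (of_real C * (?i (fst p) * snd p))"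
    using AE_mark_exp
  proof eventually_elim
    case (elim p)
    have "norm (h (fst p)) \<le> \<bar>C\<bar> * norm (?i (fst p))"
      using h[OF elim] by (auto simp: indicator_def split: if_splits)
    then have "norm (h (fst p)) * norm (snd p) \<le> (\<bar>C\<bar> * norm (?i (fst p))) * norm (snd p)"
      by (rule mult_right_mono) simp
    then show ?case by (simp add: norm_mult mult.assoc)
  qed
qed measurable

lemma set_integrable_g: "A \<in> bounded_borel \<Longrightarrow> set_integrable M A g"
proof -
  assume A: "A \<in> bounded_borel"
  then have [measurable]: "A \<in> sets borel" by (rule bounded_borel_sets)
  obtain b where b: "A \<subseteq> {1..b}" using A by (rule bounded_borelE)
  show ?thesis unfolding set_integrable_def
    by (rule Bochner_Integration.integrable_bound[OF integrable_g_loc[of b]])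
       (use b in \<open>auto simp: indicator_def intro!: AE_I2\<close>)
qed

lemma integrable_mark_exp_bounded_borel:
  assumes A: "A \<in> bounded_borel"
  shows "integrable (mark_exp M g) (\<lambda>p. indicator A (fst p) * snd p)"
proof -
  have [measurable]: "A \<in> sets borel" using A by (rule bounded_borel_sets)
  obtain b where b: "A \<subseteq> {1..b}" using A by (rule bounded_borelE)
  show ?thesis
    by (rule integrable_mark_exp_bounded_support[of _ 1 b]) (use b in \<open>auto simp: indicator_def\<close>)
qed

text \<open>The bridge from the set functions of the definitions to marked points. In the induction
  step the section \<open>{y \<in> {1..}. x * y \<in> A}\<close> of a bounded set is bounded because
  \<open>x \<ge> 1\<close>, so the induction hypothesis identifies the inner values.\<close>

lemma conv_power_eq:
  assumes \<mu>: "\<And>A. A \<in> bounded_borel \<Longrightarrow> \<mu> A = weighted g M A" and A: "A \<in> bounded_borel"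
  shows "conv_power \<mu> n A = (\<integral>p. indicator A (fst p) * snd p \<partial>mark_power M g n)"
  using A
proof (induction n arbitrary: A)
  case 0
  then have [measurable]: "A \<in> sets borel" by (rule bounded_borel_sets)
  show ?case by (simp add: integral_return space_pair_measure)
next
  case (Suc n)
  interpret pair_sigma_finite M "mark_power M g n" by (rule pair_mark_power)
  have [measurable]: "A \<in> sets borel" using Suc.prems by (rule bounded_borel_sets)
  obtain b where b: "A \<subseteq> {1..b}" using Suc.prems by (rule bounded_borelE)
  \<comment> \<open>The indicator of \<open>{1..}\<close> mirrors the sections within
    \<open>{1..}\<close> taken by \<open>mult_conv\<close>, so that \<open>f'\<close> agrees with
    their values at every \<open>x \<ge> 1\<close>; for the measure of the power it is almost
    everywhere 1.\<close>
  define f' where "f' x = (\<integral>p. indicator {1..} (fst p) * indicator A (x * fst p) * snd p \<partial>mark_power M g n)" for x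
  have [measurable]: "f' \<in> borel_measurable borel" unfolding f'_def by measurable
  have int: "integrable (mark_power M g (Suc n)) (\<lambda>p. indicator A (fst p) * snd p)"
    by (rule integrable_mark_power[OF integrable_mark_exp_bounded_borel[OF Suc.prems]])
  note int2 = integrable_mark_power_SucD[OF int]
  have eq: "AE x in M. indicator {1..} x *\<^sub>R (f' x * g x) =
     (\<integral>p. indicator A (x * fst p) * (g x * snd p) \<partial>mark_power M g n)"
    using AE_M
  proof eventually_elim
    case (elim x)
    have "(\<integral>p. indicator A (x * fst p) * (g x * snd p) \<partial>mark_power M g n) =
      (\<integral>p. g x * (indicator {1..} (fst p) * indicator A (x * fst p) * snd p) \<partial>mark_power M g n)"
    proof (rule integral_cong_AE)
      show "AE p in mark_power M g n. indicator A (x * fst p) * (g x * snd p) =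
         g x * (indicator {1..} (fst p) * indicator A (x * fst p) * snd p)"
        using AE_mark_power by eventually_elim simp
    qed measurable
    also have "\<dots> = f' x * g x" by (simp add: f'_def)
    finally show ?case using elim by simp
  qed
  have si: "set_integrable M {1..} (\<lambda>x. f' x * g x)"
    unfolding set_integrable_def
    using integrable_fst'[OF int2] by (subst integrable_cong_AE[OF _ _ eq]) (auto simp: split_beta')
  have ff: "conv_power \<mu> n {y \<in> {1..}. x * y \<in> A} = f' x" if x: "x \<ge> 1" for x
  proof -
    have m: "{y \<in> {1..}. x * y \<in> A} \<in> sets borel" by measurable
    have "y \<le> b" if "y \<ge> 1" "x * y \<in> A" for y
    proof -
      have "1 * y \<le> x * y" using x that by (intro mult_right_mono) auto
      moreover have "x * y \<le> b" using b that by auto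
      ultimately show ?thesis by simp
    qed
    then have "{y \<in> {1..}. x * y \<in> A} \<in> bounded_borel" by (intro bounded_borelI[OF m, of b]) auto
    then have "conv_power \<mu> n {y \<in> {1..}. x * y \<in> A} =
      (\<integral>p. indicator {y \<in> {1..}. x * y \<in> A} (fst p) * snd p \<partial>mark_power M g n)"
      by (rule Suc.IH)
    also have "\<dots> = f' x" unfolding f'_def
      by (intro Bochner_Integration.integral_cong) (auto simp: indicator_def)
    finally show ?thesis .
  qed
  have "conv_power \<mu> (Suc n) A = integral_wrt \<mu> (\<lambda>x. conv_power \<mu> n {y \<in> {1..}. x * y \<in> A})"
    by (simp add: mult_conv_def)
  also have "\<dots> = (LINT x:{1..}|M. f' x * g x)"
    by (rule integral_wrt_density[OF sets_M _ set_integrable_g _ _ ff si])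
       (auto simp: \<mu> weighted_def)
  also have "\<dots> = (\<integral>x. \<integral>p. indicator A (x * fst p) * (g x * snd p) \<partial>mark_power M g n \<partial>M)"
    unfolding set_lebesgue_integral_def by (rule integral_cong_AE[OF _ _ eq]) measurable
  also have "\<dots> = (\<integral>p. indicator A (fst p) * snd p \<partial>mark_power M g (Suc n))"
    using integral_mark_power_Suc[OF int] by simp
  finally show ?case .
qed

lemma conv_exp_eq:
  assumes \<mu>: "\<And>A. A \<in> bounded_borel \<Longrightarrow> \<mu> A = weighted g M A" and A: "A \<in> bounded_borel"
  shows "conv_exp \<mu> A = (\<integral>p. indicator A (fst p) * snd p \<partial>mark_exp M g)"
  using sums_integral_mark_exp[OF integrable_mark_exp_bounded_borel[OF A]]
  unfolding conv_exp_def by (simp add: conv_power_eq[OF \<mu> A] sums_iff)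

text \<open>The logarithm identity as an equality of measures of marked points. In this form it
  passes to complex integrands by a change of variables, without splitting them into parts.\<close>

lemma density_log_mark_exp:
  "density (mark_exp M g) (\<lambda>p. ennreal (ln (fst p))) =
   distr (density (M \<Otimes>\<^sub>M mark_exp M g) (\<lambda>(x, p). ennreal (ln x))) (borel \<Otimes>\<^sub>M borel)
     (\<lambda>(x, p). (x * fst p, g x * snd p))"
proof (rule measure_eqI)
  fix A assume "A \<in> sets (density (mark_exp M g) (\<lambda>p. ennreal (ln (fst p))))"
  then have [measurable]: "A \<in> sets (borel \<Otimes>\<^sub>M borel)" by simp
  have "emeasure (density (mark_exp M g) (\<lambda>p. ennreal (ln (fst p)))) A =
     (\<integral>\<^sup>+p. ennreal (ln (fst p)) * indicator A p \<partial>mark_exp M g)"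
    by (subst emeasure_density) auto
  also have "\<dots> = (\<integral>\<^sup>+x. \<integral>\<^sup>+p. ennreal (ln x) * indicator A (x * fst p, g x * snd p) \<partial>mark_exp M g \<partial>M)"
    by (rule nn_integral_log_mark_exp) measurable
  also have "\<dots> = (\<integral>\<^sup>+(x, p). ennreal (ln x) * indicator A (x * fst p, g x * snd p) \<partial>(M \<Otimes>\<^sub>M mark_exp M g))"
    by (subst E.nn_integral_fst[symmetric]) auto
  also have "\<dots> = emeasure (distr (density (M \<Otimes>\<^sub>M mark_exp M g) (\<lambda>(x, p). ennreal (ln x))) (borel \<Otimes>\<^sub>M borel)
     (\<lambda>(x, p). (x * fst p, g x * snd p))) A"
    by (subst nn_integral_indicator[symmetric], simp, subst nn_integral_distr)
       (auto simp: nn_integral_density split_beta')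
  finally show "emeasure (density (mark_exp M g) (\<lambda>p. ennreal (ln (fst p)))) A =
     emeasure (distr (density (M \<Otimes>\<^sub>M mark_exp M g) (\<lambda>(x, p). ennreal (ln x))) (borel \<Otimes>\<^sub>M borel)
     (\<lambda>(x, p). (x * fst p, g x * snd p))) A" .
qed simp

lemma
  fixes f :: "real \<times> complex \<Rightarrow> complex"
  assumes [measurable]: "f \<in> borel_measurable (borel \<Otimes>\<^sub>M borel)"
    and int: "integrable (mark_exp M g) (\<lambda>p. ln (fst p) *\<^sub>R f p)"
  shows integrable_log_mark_exp:
      "integrable M (\<lambda>x. ln x *\<^sub>R (\<integral>p. f (x * fst p, g x * snd p) \<partial>mark_exp M g))"
    and integral_log_mark_exp: "(\<integral>p. ln (fst p) *\<^sub>R f p \<partial>mark_exp M g) =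
      (\<integral>x. ln x *\<^sub>R (\<integral>p. f (x * fst p, g x * snd p) \<partial>mark_exp M g) \<partial>M)"
proof -
  interpret ME: pair_sigma_finite M "mark_exp M g" by (rule pair_mark_exp)
  have max0: "ennreal (max 0 x) = ennreal x" for x by (simp add: max_def ennreal_neg)
  \<comment> \<open>\<open>ln\<close> may be negative below 1, where there is no mass; its positive
    part is a legitimate real density.\<close>
  have dens: "density (mark_exp M g) (\<lambda>p. ennreal (max 0 (ln (fst p)))) =
   distr (density (M \<Otimes>\<^sub>M mark_exp M g) (\<lambda>q. ennreal (max 0 (ln (fst q))))) (borel \<Otimes>\<^sub>M borel)
     (\<lambda>(x, p). (x * fst p, g x * snd p))"
    using density_log_mark_exp by (simp add: max0 split_beta')
  have "AE p in mark_exp M g. max 0 (ln (fst p)) *\<^sub>R f p = ln (fst p) *\<^sub>R f p"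
    using AE_mark_exp by eventually_elim (simp add: max_def)
  note c1 = integrable_cong_AE[OF _ _ this] integral_cong_AE[OF _ _ this]
  let ?F = "\<lambda>(x, p). max 0 (ln x) *\<^sub>R f (x * fst p, g x * snd p)"
  have "integrable (density (mark_exp M g) (\<lambda>p. ennreal (max 0 (ln (fst p))))) f"
    by (subst integrable_density) (use int c1 in auto)
  then have "integrable (density (M \<Otimes>\<^sub>M mark_exp M g) (\<lambda>q. ennreal (max 0 (ln (fst q)))))
     (\<lambda>q. f (fst q * fst (snd q), g (fst q) * snd (snd q)))"
    unfolding dens by (subst (asm) integrable_distr_eq) (auto simp: split_beta')
  then have i2: "integrable (M \<Otimes>\<^sub>M mark_exp M g) ?F"
    by (subst (asm) integrable_density) (auto simp: split_beta')
  have i3: "integrable M (\<lambda>x. \<integral>p. ?F (x, p) \<partial>mark_exp M g)"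
    using ME.integrable_fst'[OF i2] .
  have ae: "AE x in M. (\<integral>p. ?F (x, p) \<partial>mark_exp M g) = ln x *\<^sub>R (\<integral>p. f (x * fst p, g x * snd p) \<partial>mark_exp M g)"
    using AE_M by eventually_elim simp
  show "integrable M (\<lambda>x. ln x *\<^sub>R (\<integral>p. f (x * fst p, g x * snd p) \<partial>mark_exp M g))"
    using i3 by (subst integrable_cong_AE[OF _ _ ae, symmetric]) auto
  have "(\<integral>p. ln (fst p) *\<^sub>R f p \<partial>mark_exp M g) = (\<integral>p. f p \<partial>density (mark_exp M g) (\<lambda>p. ennreal (max 0 (ln (fst p)))))"
    by (subst integral_density) (use c1 in auto)
  also have "\<dots> = (\<integral>q. f (fst q * fst (snd q), g (fst q) * snd (snd q))
      \<partial>density (M \<Otimes>\<^sub>M mark_exp M g) (\<lambda>q. ennreal (max 0 (ln (fst q)))))"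
    unfolding dens by (subst integral_distr) (auto simp: split_beta')
  also have "\<dots> = (\<integral>q. ?F q \<partial>(M \<Otimes>\<^sub>M mark_exp M g))"
    by (subst integral_density) (auto simp: split_beta')
  also have "\<dots> = (\<integral>x. \<integral>p. ?F (x, p) \<partial>mark_exp M g \<partial>M)"
    using ME.integral_fst'[OF i2] by simp
  also have "\<dots> = (\<integral>x. ln x *\<^sub>R (\<integral>p. f (x * fst p, g x * snd p) \<partial>mark_exp M g) \<partial>M)"
    by (rule integral_cong_AE[OF _ _ ae]) measurable
  finally show "(\<integral>p. ln (fst p) *\<^sub>R f p \<partial>mark_exp M g) =
      (\<integral>x. ln x *\<^sub>R (\<integral>p. f (x * fst p, g x * snd p) \<partial>mark_exp M g) \<partial>M)" .
qed

end

section \<open>Majorants: exponentials of nonnegative weights\<close>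

definition abs_power :: "real measure \<Rightarrow> (real \<Rightarrow> real) \<Rightarrow> nat \<Rightarrow> (real \<Rightarrow> ennreal) \<Rightarrow> ennreal" where
  "abs_power M h n f = ennreal (1 / fact n) *
     (\<integral>\<^sup>+p. f (fst p) * ennreal (norm (snd p)) \<partial>mark_power M (\<lambda>x. of_real (h x)) n)"

text \<open>Written as a functional on test functions, so that the convolution of two such measures
  is the composition \<open>abs_exp M h1 (\<lambda>x. abs_exp M h2 (\<lambda>y. f (x * y)))\<close>;
  values in \<open>ennreal\<close> avoid all questions of convergence.\<close>

definition abs_exp :: "real measure \<Rightarrow> (real \<Rightarrow> real) \<Rightarrow> (real \<Rightarrow> ennreal) \<Rightarrow> ennreal" where
  "abs_exp M h f = (\<integral>\<^sup>+p. f (fst p) * ennreal (norm (snd p)) \<partial>mark_exp M (\<lambda>x. of_real (h x)))"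

lemma abs_exp_eq:
  assumes [measurable]: "f \<in> borel_measurable borel"
  shows "abs_exp M h f = (\<Sum>n. abs_power M h n f)"
  unfolding abs_exp_def abs_power_def by (rule nn_integral_mark_exp) measurable

lemma abs_power_cmult:
  assumes [measurable]: "f \<in> borel_measurable borel"
  shows "abs_power M h n (\<lambda>y. c * f y) = c * abs_power M h n f"
  unfolding abs_power_def by (simp add: mult.assoc nn_integral_cmult) (simp add: mult_ac)

text \<open>Power by power, pulling out one factor at a time; the comparison of the weights is asked
  for on \<open>{1..}\<close>, where \<open>M\<close> lives.\<close>

lemma nn_integral_le_abs_exp:
  assumes "mark_base M g" and [measurable]: "f \<in> borel_measurable borel" "h \<in> borel_measurable borel"
    and gh: "\<And>x. x \<ge> 1 \<Longrightarrow> norm (g x) \<le> h x"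
  shows "(\<integral>\<^sup>+p. f (fst p) * ennreal (norm (snd p)) \<partial>mark_exp M g) \<le> abs_exp M h f"
proof -
  interpret mark_base M g by fact
  interpret H: mark_base M "\<lambda>x. of_real (h x)"
    by unfold_locales (use M_null M_fin in auto)
  have "(\<integral>\<^sup>+p. f (fst p) * ennreal (norm (snd p)) \<partial>mark_power M g n)
     \<le> (\<integral>\<^sup>+p. f (fst p) * ennreal (norm (snd p)) \<partial>mark_power M (\<lambda>x. of_real (h x)) n)"
    if [measurable]: "f \<in> borel_measurable borel" for n f
    using that
  proof (induction n arbitrary: f)
    case 0
    then show ?case by simp
  next
    case (Suc n)
    note [measurable] = Suc.prems
    have "(\<integral>\<^sup>+p. f (fst p) * ennreal (norm (snd p)) \<partial>mark_power M g (Suc n)) =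
      (\<integral>\<^sup>+x. \<integral>\<^sup>+p. ennreal (norm (g x)) * (f (x * fst p) * ennreal (norm (snd p))) \<partial>mark_power M g n \<partial>M)"
      by (subst nn_integral_mark_power_Suc) (auto simp: norm_mult ennreal_mult mult_ac)
    also have "\<dots> = (\<integral>\<^sup>+x. ennreal (norm (g x)) * (\<integral>\<^sup>+p. f (x * fst p) * ennreal (norm (snd p)) \<partial>mark_power M g n) \<partial>M)"
      by (simp add: nn_integral_cmult)
    also have "\<dots> \<le> (\<integral>\<^sup>+x. ennreal \<bar>h x\<bar> * (\<integral>\<^sup>+p. f (x * fst p) * ennreal (norm (snd p)) \<partial>mark_power M (\<lambda>x. of_real (h x)) n) \<partial>M)"
    proof (intro nn_integral_mono_AE, use AE_M in eventually_elim)
      fix x :: real assume "x > 1"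
      then show "ennreal (norm (g x)) * (\<integral>\<^sup>+p. f (x * fst p) * ennreal (norm (snd p)) \<partial>mark_power M g n)
         \<le> ennreal \<bar>h x\<bar> * (\<integral>\<^sup>+p. f (x * fst p) * ennreal (norm (snd p)) \<partial>mark_power M (\<lambda>x. of_real (h x)) n)"
        using gh[of x] by (intro mult_mono Suc.IH[of "\<lambda>y. f (x * y)"] ennreal_leI) auto
    qed
    also have "\<dots> = (\<integral>\<^sup>+x. \<integral>\<^sup>+p. ennreal \<bar>h x\<bar> * (f (x * fst p) * ennreal (norm (snd p))) \<partial>mark_power M (\<lambda>x. of_real (h x)) n \<partial>M)"
      by (simp add: nn_integral_cmult)
    also have "\<dots> = (\<integral>\<^sup>+p. f (fst p) * ennreal (norm (snd p)) \<partial>mark_power M (\<lambda>x. of_real (h x)) (Suc n))"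
      by (subst H.nn_integral_mark_power_Suc) (auto simp: norm_mult ennreal_mult mult_ac)
    finally show ?case .
  qed
  then show ?thesis
    unfolding abs_exp_def
    by (subst (1 2) nn_integral_mark_exp) (auto intro!: suminf_le mult_left_mono)
qed

locale mark_base_sum = h1: mark_base M "\<lambda>x. of_real (h1 x)" + h2: mark_base M "\<lambda>x. of_real (h2 x)"
  for M :: "real measure" and h1 h2 :: "real \<Rightarrow> real" +
  assumes h1_nonneg: "h1 x \<ge> 0" and h2_nonneg: "h2 x \<ge> 0"
    and h1_meas[measurable]: "h1 \<in> borel_measurable borel"
    and h2_meas[measurable]: "h2 \<in> borel_measurable borel"
begin

sublocale h12: mark_base M "\<lambda>x. of_real (h1 x + h2 x)"
  by unfold_locales (use h1.M_null h1.M_fin in auto)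

text \<open>Peeling off one factor, with \<open>(n + 1) / (n + 1)! = 1 / n!\<close>. Keeping
  \<open>Suc n\<close> on the left avoids division in \<open>ennreal\<close> and is the form in
  which multiplicities are counted in the binomial theorem below.\<close>

lemma abs_power_Suc:
  assumes "mark_base M (\<lambda>x. of_real (h x))" "\<And>x. h x \<ge> 0" and [measurable]: "f \<in> borel_measurable borel"
  shows "of_nat (Suc n) * abs_power M h (Suc n) f = (\<integral>\<^sup>+x. ennreal (h x) * abs_power M h n (\<lambda>y. f (x * y)) \<partial>M)"
proof -
  interpret mark_base M "\<lambda>x. of_real (h x)" by fact
  have [measurable]: "h \<in> borel_measurable borel"
    using measurable_compose[OF g_meas, of Re borel] by simp
  have f: "of_nat (Suc n) * ennreal (1 / fact (Suc n)) = ennreal (1 / fact n)"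
    unfolding ennreal_of_nat_eq_real_of_nat
    by (subst ennreal_mult[symmetric]) (auto simp: divide_simps simp flip: of_nat_Suc)
  have "(\<integral>\<^sup>+p. f (fst p) * ennreal (norm (snd p)) \<partial>mark_power M (\<lambda>x. of_real (h x)) (Suc n)) =
      (\<integral>\<^sup>+x. \<integral>\<^sup>+p. ennreal (h x) * (f (x * fst p) * ennreal (norm (snd p))) \<partial>mark_power M (\<lambda>x. of_real (h x)) n \<partial>M)"
    using assms(2) by (subst nn_integral_mark_power_Suc) (auto simp: norm_mult ennreal_mult mult_ac)
  also have "\<dots> = (\<integral>\<^sup>+x. ennreal (h x) * (\<integral>\<^sup>+p. f (x * fst p) * ennreal (norm (snd p)) \<partial>mark_power M (\<lambda>x. of_real (h x)) n) \<partial>M)"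
    by (simp add: nn_integral_cmult)
  finally have I: "(\<integral>\<^sup>+p. f (fst p) * ennreal (norm (snd p)) \<partial>mark_power M (\<lambda>x. of_real (h x)) (Suc n)) =
     (\<integral>\<^sup>+x. ennreal (h x) * (\<integral>\<^sup>+p. f (x * fst p) * ennreal (norm (snd p)) \<partial>mark_power M (\<lambda>x. of_real (h x)) n) \<partial>M)" .
  have "of_nat (Suc n) * abs_power M h (Suc n) f = ennreal (1 / fact n) *
      (\<integral>\<^sup>+x. ennreal (h x) * (\<integral>\<^sup>+p. f (x * fst p) * ennreal (norm (snd p)) \<partial>mark_power M (\<lambda>x. of_real (h x)) n) \<partial>M)"
    unfolding abs_power_def I mult.assoc[symmetric] f by (simp only: mult.assoc)
  also have "\<dots> = (\<integral>\<^sup>+x. ennreal (1 / fact n) * (ennreal (h x) * (\<integral>\<^sup>+p. f (x * fst p) * ennreal (norm (snd p)) \<partial>mark_power M (\<lambda>x. of_real (h x)) n)) \<partial>M)"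
    by (rule nn_integral_cmult[symmetric]) measurable
  also have "\<dots> = (\<integral>\<^sup>+x. ennreal (h x) * abs_power M h n (\<lambda>y. f (x * y)) \<partial>M)"
    unfolding abs_power_def by (intro nn_integral_cong) (simp add: mult_ac)
  finally show ?thesis .
qed

lemma abs_power_measurable[measurable]:
  assumes [measurable]: "case_prod F \<in> borel_measurable (N \<Otimes>\<^sub>M borel)"
  shows "(\<lambda>x. abs_power M h1 n (F x)) \<in> borel_measurable N" "(\<lambda>x. abs_power M h2 n (F x)) \<in> borel_measurable N"
  unfolding abs_power_def by measurable

text \<open>A factor \<open>u\<close> with the inner weight \<open>h2\<close> is drawn past the
  outer functional by Fubini, so that factors of both kinds can be peeled off at the outermost
  place.\<close>

lemma abs_power_Suc2:
  assumes [measurable]: "f \<in> borel_measurable borel"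
  shows "of_nat (Suc m) * abs_power M h1 k (\<lambda>x. abs_power M h2 (Suc m) (\<lambda>y. f (x * y)))
    = (\<integral>\<^sup>+u. ennreal (h2 u) * abs_power M h1 k (\<lambda>x. abs_power M h2 m (\<lambda>y. f (u * (x * y)))) \<partial>M)"
proof -
  interpret pair_sigma_finite M "mark_power M (\<lambda>x. of_real (h1 x)) k" by (rule h1.pair_mark_power)
  have "of_nat (Suc m) * abs_power M h1 k (\<lambda>x. abs_power M h2 (Suc m) (\<lambda>y. f (x * y)))
     = abs_power M h1 k (\<lambda>x. of_nat (Suc m) * abs_power M h2 (Suc m) (\<lambda>y. f (x * y)))"
    by (subst abs_power_cmult) auto
  also have "\<dots> = abs_power M h1 k (\<lambda>x. \<integral>\<^sup>+u. ennreal (h2 u) * abs_power M h2 m (\<lambda>y. f (x * (u * y))) \<partial>M)"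
    by (subst abs_power_Suc[OF h2.mark_base_axioms h2_nonneg]) auto
  also have "\<dots> = ennreal (1 / fact k) * (\<integral>\<^sup>+p. \<integral>\<^sup>+u. ennreal (h2 u) * abs_power M h2 m (\<lambda>y. f (fst p * (u * y)))
       * ennreal (norm (snd p)) \<partial>M \<partial>mark_power M (\<lambda>x. of_real (h1 x)) k)"
    unfolding abs_power_def[of M h1] by (subst nn_integral_multc[symmetric]) auto
  also have "(\<integral>\<^sup>+p. \<integral>\<^sup>+u. ennreal (h2 u) * abs_power M h2 m (\<lambda>y. f (fst p * (u * y)))
       * ennreal (norm (snd p)) \<partial>M \<partial>mark_power M (\<lambda>x. of_real (h1 x)) k) =
     (\<integral>\<^sup>+u. \<integral>\<^sup>+p. ennreal (h2 u) * abs_power M h2 m (\<lambda>y. f (fst p * (u * y)))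
       * ennreal (norm (snd p)) \<partial>mark_power M (\<lambda>x. of_real (h1 x)) k \<partial>M)"
    by (rule Fubini') measurable
  also have "\<dots> = (\<integral>\<^sup>+u. ennreal (h2 u) * (\<integral>\<^sup>+p. abs_power M h2 m (\<lambda>y. f (u * (fst p * y)))
       * ennreal (norm (snd p)) \<partial>mark_power M (\<lambda>x. of_real (h1 x)) k) \<partial>M)"
    by (subst nn_integral_cmult[symmetric], measurable) (simp add: mult_ac)
  also have "ennreal (1 / fact k) * \<dots> =
    (\<integral>\<^sup>+u. ennreal (h2 u) * abs_power M h1 k (\<lambda>x. abs_power M h2 m (\<lambda>y. f (u * (x * y)))) \<partial>M)"
    unfolding abs_power_def[of M h1]
    by (subst nn_integral_cmult[symmetric], measurable) (simp add: mult_ac)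
  finally show ?thesis .
qed

text \<open>The binomial theorem with the factorials built in. After multiplication by n + 1 one
  factor of weight \<open>h1 + h2\<close> is peeled off; a term with k factors of the first and m of
  the second kind, where k + m = n + 1, then occurs k times through \<open>h1\<close> and m times
  through \<open>h2\<close>.\<close>

lemma abs_power_sum:
  assumes "f \<in> borel_measurable borel"
  shows "abs_power M (\<lambda>x. h1 x + h2 x) n f = (\<Sum>k\<le>n. abs_power M h1 k (\<lambda>x. abs_power M h2 (n - k) (\<lambda>y. f (x * y))))"
  using assms
proof (induction n arbitrary: f)
  case 0
  note [measurable] = 0
  show ?case by (simp add: abs_power_def nn_integral_return space_pair_measure)
next
  case (Suc n)
  note [measurable] = Suc.prems
  define b where "b k m = abs_power M h1 k (\<lambda>x. abs_power M h2 m (\<lambda>y. f (x * y)))" for k m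
  let ?b = "\<lambda>u k m. abs_power M h1 k (\<lambda>x. abs_power M h2 m (\<lambda>y. f (u * (x * y))))"
  have "of_nat (Suc n) * abs_power M (\<lambda>x. h1 x + h2 x) (Suc n) f =
     (\<integral>\<^sup>+u. ennreal (h1 u + h2 u) * abs_power M (\<lambda>x. h1 x + h2 x) n (\<lambda>y. f (u * y)) \<partial>M)"
    by (rule abs_power_Suc[OF h12.mark_base_axioms]) (auto simp: h1_nonneg h2_nonneg)
  also have "\<dots> = (\<integral>\<^sup>+u. (\<Sum>k\<le>n. ennreal (h1 u) * ?b u k (n - k) + ennreal (h2 u) * ?b u k (n - k)) \<partial>M)"
    by (subst Suc.IH) (auto simp: h1_nonneg h2_nonneg distrib_right sum_distrib_left sum.distrib intro!: nn_integral_cong)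
  also have "\<dots> = (\<Sum>k\<le>n. (\<integral>\<^sup>+u. ennreal (h1 u) * ?b u k (n - k) \<partial>M) + (\<integral>\<^sup>+u. ennreal (h2 u) * ?b u k (n - k) \<partial>M))"
    by (subst nn_integral_sum) (auto simp: nn_integral_add)
  also have "\<dots> = (\<Sum>k\<le>n. of_nat (Suc k) * b (Suc k) (n - k) + of_nat (Suc (n - k)) * b k (Suc (n - k)))"
  proof (intro sum.cong refl arg_cong2[of _ _ _ _ "(+)"])
    fix k
    show "(\<integral>\<^sup>+u. ennreal (h1 u) * ?b u k (n - k) \<partial>M) = of_nat (Suc k) * b (Suc k) (n - k)"
      unfolding b_def by (subst abs_power_Suc[OF h1.mark_base_axioms h1_nonneg]) (auto simp: mult.assoc)
    show "(\<integral>\<^sup>+u. ennreal (h2 u) * ?b u k (n - k) \<partial>M) = of_nat (Suc (n - k)) * b k (Suc (n - k))"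
      unfolding b_def by (subst abs_power_Suc2) auto
  qed
  also have "\<dots> = (\<Sum>k\<le>n. of_nat (Suc k) * b (Suc k) (n - k)) + (\<Sum>k\<le>n. of_nat (Suc (n - k)) * b k (Suc (n - k)))"
    by (rule sum.distrib)
  \<comment> \<open>One sum may start at k = 0 and, below, the other may run to k = n + 1, because
    the added terms have the coefficient 0.\<close>
  also have "(\<Sum>k\<le>n. of_nat (Suc k) * b (Suc k) (n - k)) = (\<Sum>k\<le>Suc n. of_nat k * b k (Suc n - k))"
    by (subst sum.atMost_Suc_shift) simp
  also have "(\<Sum>k\<le>n. of_nat (Suc (n - k)) * b k (Suc (n - k))) = (\<Sum>k\<le>Suc n. of_nat (Suc n - k) * b k (Suc n - k))"
    by (simp add: Suc_diff_le)
  also have "(\<Sum>k\<le>Suc n. of_nat k * b k (Suc n - k)) + (\<Sum>k\<le>Suc n. of_nat (Suc n - k) * b k (Suc n - k))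
     = (\<Sum>k\<le>Suc n. of_nat (Suc n) * b k (Suc n - k))"
    by (subst sum.distrib[symmetric], intro sum.cong refl)
       (auto simp: distrib_right[symmetric] simp flip: of_nat_add)
  also have "\<dots> = of_nat (Suc n) * (\<Sum>k\<le>Suc n. b k (Suc n - k))"
    by (simp only: sum_distrib_left)
  finally show ?case
    unfolding b_def by (subst (asm) ennreal_mult_cancel_left) auto
qed

text \<open>A Cauchy product: the triangular partial sums lie within square ones. It detaches the
  summable weight |g2| from the bounded one in the estimates of |dG|.\<close>

lemma abs_exp_sum_le:
  assumes [measurable]: "f \<in> borel_measurable borel"
  shows "abs_exp M (\<lambda>x. h1 x + h2 x) f \<le> abs_exp M h1 (\<lambda>x. abs_exp M h2 (\<lambda>y. f (x * y)))"
proof -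
  define b where "b k m = abs_power M h1 k (\<lambda>x. abs_power M h2 m (\<lambda>y. f (x * y)))" for k m
  have "abs_exp M h1 (\<lambda>x. abs_exp M h2 (\<lambda>y. f (x * y))) = (\<Sum>k. abs_power M h1 k (\<lambda>x. \<Sum>m. abs_power M h2 m (\<lambda>y. f (x * y))))"
    by (subst abs_exp_eq) (auto simp: abs_exp_eq)
  also have "\<dots> = (\<Sum>k. \<Sum>m. b k m)"
    unfolding b_def abs_power_def[of M h1]
    by (intro suminf_cong, subst ennreal_suminf_multc[symmetric], subst nn_integral_suminf) auto
  finally have 1: "abs_exp M h1 (\<lambda>x. abs_exp M h2 (\<lambda>y. f (x * y))) = (\<Sum>k. \<Sum>m. b k m)" .
  have "abs_exp M (\<lambda>x. h1 x + h2 x) f = (\<Sum>n. \<Sum>k\<le>n. b k (n - k))"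
    unfolding abs_exp_eq[OF assms] b_def by (simp add: abs_power_sum)
  also have "\<dots> \<le> (\<Sum>k. \<Sum>m. b k m)"
  proof (rule suminf_le_const[OF summableI])
    fix N
    have "(\<Sum>n<N. \<Sum>k\<le>n. b k (n - k)) = sum (\<lambda>(k, m). b k m) {(k, m). k + m < N}"
      by (rule sum.triangle_reindex[symmetric])
    also have "\<dots> \<le> sum (\<lambda>(k, m). b k m) ({..<N} \<times> {..<N})"
      by (rule sum_mono2) auto
    also have "\<dots> = (\<Sum>k<N. \<Sum>m<N. b k m)" by (rule sum.cartesian_product[symmetric])
    also have "\<dots> \<le> (\<Sum>k<N. \<Sum>m. b k m)" by (intro sum_mono sum_le_suminf summableI) auto
    also have "\<dots> \<le> (\<Sum>k. \<Sum>m. b k m)" by (intro sum_le_suminf summableI) auto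
    finally show "(\<Sum>n<N. \<Sum>k\<le>n. b k (n - k)) \<le> (\<Sum>k. \<Sum>m. b k m)" .
  qed
  finally show ?thesis unfolding 1 .
qed

end

section \<open>The Fejer kernel\<close>

lemma integrable_inverse_one_plus_square: "integrable lborel (\<lambda>x::real. 1 / (1 + x\<^sup>2))"
proof -
  have nn: "(\<integral>\<^sup>+x. ennreal (1 / (1 + x\<^sup>2)) * indicator {0..} x \<partial>lborel) = ennreal (pi / 2 - arctan 0)"
    by (rule nn_integral_FTC_atLeast) (auto intro!: derivative_eq_intros tendsto_arctan_at_top simp: power2_eq_square field_simps)
  have i: "integrable lborel (\<lambda>x. 1 / (1 + x\<^sup>2) * indicator {0..} x :: real)"
  proof (rule integrableI_bounded)
    have "(\<integral>\<^sup>+x. ennreal (norm (1 / (1 + x\<^sup>2) * indicator {0..} x :: real)) \<partial>lborel)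
       = (\<integral>\<^sup>+x. ennreal (1 / (1 + x\<^sup>2)) * indicator {0..} x \<partial>lborel)"
      by (intro nn_integral_cong) (auto simp: indicator_def)
    then show "(\<integral>\<^sup>+x. ennreal (norm (1 / (1 + x\<^sup>2) * indicator {0..} x :: real)) \<partial>lborel) < \<infinity>"
      using nn by simp
  qed simp
  from lborel_integrable_real_affine[OF i, of "-1" 0]
  have "integrable lborel (\<lambda>x. 1 / (1 + x\<^sup>2) * indicator {0..} (- x) :: real)" by simp
  from Bochner_Integration.integrable_add[OF i this] show ?thesis
    by (rule Bochner_Integration.integrable_bound) (auto simp: indicator_def intro!: AE_I2)
qed

text \<open>The Fourier transform of the triangle \<open>fejer_weight K\<close>; the value at 0 is
  the continuous extension.\<close>

definition fejer :: "real \<Rightarrow> real \<Rightarrow> real" where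
  "fejer K h = (if h = 0 then K else 2 * (1 - cos (K * h)) / (K * h\<^sup>2))"

definition fejer_weight :: "real \<Rightarrow> real \<Rightarrow> real" where
  "fejer_weight K t = indicator {-K..K} t * (1 - \<bar>t\<bar> / K)"

lemma fejer_weight_measurable[measurable]: "fejer_weight K \<in> borel_measurable borel"
  unfolding fejer_weight_def by measurable

lemma fejer_measurable[measurable]: "fejer K \<in> borel_measurable borel"
  unfolding fejer_def by measurable

lemma fejer_weight_bounds:
  assumes "K > 0"
  shows "fejer_weight K t \<ge> 0" "fejer_weight K t \<le> indicator {-K..K} t"
  using assms by (auto simp: fejer_weight_def indicator_def field_simps)

lemma integrable_fejer_weight:
  assumes "K > 0"
  shows "integrable lborel (fejer_weight K)"
proof (rule Bochner_Integration.integrable_bound)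
  show "integrable lborel (indicator {-K..K} :: real \<Rightarrow> real)" by (intro integrable_real_indicator) (auto simp: emeasure_lborel_Icc_eq)
qed (use fejer_weight_bounds[OF assms] in \<open>auto intro!: AE_I2\<close>)

lemma integral_fejer_weight:
  assumes K: "K > 0"
  shows "(\<integral>t. of_real (fejer_weight K t) * exp (- \<i> * of_real (t * h)) \<partial>lborel) = of_real (fejer K h)"
proof -
  let ?G = "\<lambda>t. indicator {0..K} t *\<^sub>R ((1 - t / K) * cos (t * h))"
  have iG: "integrable lborel ?G"
  proof (rule Bochner_Integration.integrable_bound)
    show "integrable lborel (indicator {0..K} :: real \<Rightarrow> real)" by (intro integrable_real_indicator) (auto simp: emeasure_lborel_Icc_eq)
    show "AE t in lborel. norm (?G t) \<le> norm (indicator {0..K} t :: real)"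
    proof (rule AE_I2)
      fix t :: real
      have "\<bar>1 - t / K\<bar> * \<bar>cos (t * h)\<bar> \<le> 1 * 1" if "0 \<le> t" "t \<le> K"
        using that K by (intro mult_mono) auto
      then show "norm (?G t) \<le> norm (indicator {0..K} t :: real)"
        by (auto simp: indicator_def abs_mult)
    qed
  qed simp
  have G: "(\<integral>t. ?G t \<partial>lborel) = fejer K h / 2"
  proof (cases "h = 0")
    case True
    have "(\<integral>t. indicator {0..K} t *\<^sub>R (1 - t / K) \<partial>lborel) = (K - K\<^sup>2 / (2 * K)) - (0 - 0\<^sup>2 / (2 * K))"
      using K by (intro integral_FTC_Icc)
        (auto intro!: derivative_eq_intros continuous_intros simp flip: has_real_derivative_iff_has_vector_derivative)
    then show ?thesis using K True by (simp add: fejer_def power2_eq_square field_simps)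
  next
    case False
    \<comment> \<open>The antiderivative comes from one integration by parts of
      \<open>(1 - t / K) * cos (t * h)\<close>.\<close>
    have "(\<integral>t. ?G t \<partial>lborel) = ((1 - K / K) * sin (K * h) / h - cos (K * h) / (K * h\<^sup>2)) -
       ((1 - 0 / K) * sin (0 * h) / h - cos (0 * h) / (K * h\<^sup>2))"
      using K False by (intro integral_FTC_Icc)
        (auto intro!: derivative_eq_intros continuous_intros simp: field_simps power2_eq_square simp flip: has_real_derivative_iff_has_vector_derivative)
    then show ?thesis using K False by (simp add: fejer_def field_simps)
  qed
  have iG': "integrable lborel (\<lambda>t. ?G (- t))"
    using lborel_integrable_real_affine[OF iG, of "-1" 0] by simp
  have G': "(\<integral>t. ?G (- t) \<partial>lborel) = fejer K h / 2"
    using lborel_integral_real_affine[of "-1" ?G 0] G by simp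
  have c: "(\<integral>t. fejer_weight K t * cos (t * h) \<partial>lborel) = fejer K h"
  proof -
    have "(\<integral>t. fejer_weight K t * cos (t * h) \<partial>lborel) = (\<integral>t. ?G t + ?G (- t) \<partial>lborel)"
    proof (rule integral_cong_AE)
      show "AE t in lborel. fejer_weight K t * cos (t * h) = ?G t + ?G (- t)"
        using AE_lborel_singleton[of 0]
        by eventually_elim (auto simp: fejer_weight_def indicator_def)
    qed measurable
    also have "\<dots> = fejer K h"
      using iG iG' G G' by (subst Bochner_Integration.integral_add) auto
    finally show ?thesis .
  qed
  have s: "(\<integral>t. fejer_weight K t * sin (t * h) \<partial>lborel) = 0"
  proof -
    have ev: "fejer_weight K (- t) = fejer_weight K t" for t
      by (auto simp: fejer_weight_def indicator_def)
    have "(\<integral>t. fejer_weight K t * sin (t * h) \<partial>lborel) = (\<integral>t. - (fejer_weight K t * sin (t * h)) \<partial>lborel)"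
      using lborel_integral_real_affine[of "-1" "\<lambda>t. fejer_weight K t * sin (t * h)" 0] by (simp add: ev)
    then show ?thesis by simp
  qed
  have i: "integrable lborel (\<lambda>t. of_real (fejer_weight K t) * exp (- \<i> * of_real (t * h)))"
    by (rule Bochner_Integration.integrable_bound[OF integrable_fejer_weight[OF K]]) (auto simp: norm_mult)
  show ?thesis
  proof (rule complex_eqI)
    have "Re (\<integral>t. of_real (fejer_weight K t) * exp (- \<i> * of_real (t * h)) \<partial>lborel) =
       (\<integral>t. fejer_weight K t * cos (t * h) \<partial>lborel)"
      by (subst integral_Re[OF i, symmetric]) (simp add: Re_exp)
    then show "Re (\<integral>t. of_real (fejer_weight K t) * exp (- \<i> * of_real (t * h)) \<partial>lborel) = Re (of_real (fejer K h))"
      using c by simp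
    have "Im (\<integral>t. of_real (fejer_weight K t) * exp (- \<i> * of_real (t * h)) \<partial>lborel) =
       (\<integral>t. - (fejer_weight K t * sin (t * h)) \<partial>lborel)"
      by (subst integral_Im[OF i, symmetric]) (simp add: Im_exp)
    then show "Im (\<integral>t. of_real (fejer_weight K t) * exp (- \<i> * of_real (t * h)) \<partial>lborel) = Im (of_real (fejer K h))"
      using s by simp
  qed
qed

lemma fejer_nonneg: "K > 0 \<Longrightarrow> fejer K h \<ge> 0"
  by (simp add: fejer_def)

lemma fejer_scale: "K > 0 \<Longrightarrow> fejer K h = K * fejer 1 (K * h)"
  by (simp add: fejer_def power2_eq_square)

lemma fejer_tail: "K > 0 \<Longrightarrow> h \<noteq> 0 \<Longrightarrow> fejer K h \<le> 4 / (K * h\<^sup>2)"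
proof -
  assume "K > 0" "h \<noteq> 0"
  moreover have "2 * (1 - x) \<le> 4" if "- 1 \<le> x" for x :: real using that by simp
  then have "2 * (1 - cos (K * h)) \<le> 4" using cos_ge_minus_one by blast
  ultimately show "fejer K h \<le> 4 / (K * h\<^sup>2)" by (auto simp: fejer_def intro!: divide_right_mono)
qed

lemma one_minus_cos_le: "1 - cos x \<le> x\<^sup>2 / 2" for x :: real
proof -
  have "cos x = 1 - 2 * (sin (x / 2))\<^sup>2" using cos_double_sin[of "x / 2"] by simp
  moreover have "(sin (x / 2))\<^sup>2 \<le> (x / 2)\<^sup>2"
    using power_mono[OF abs_sin_x_le_abs_x[of "x / 2"], of 2] by (simp add: power_divide)
  ultimately show ?thesis by (simp add: power2_eq_square)
qed

text \<open>\<open>2 * (1 - cos h)\<close> is at most \<open>h\<^sup>2\<close> and at most 4. The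
  first bound is added to \<open>h\<^sup>2\<close> times the second, whence 5 = 1 + 4.\<close>

lemma fejer_1_le: "fejer 1 h \<le> 5 / (1 + h\<^sup>2)"
proof (cases "h = 0")
  case True then show ?thesis by (simp add: fejer_def)
next
  case False
  have "2 * (1 - cos h) \<le> h\<^sup>2" using one_minus_cos_le[of h] by simp
  moreover have "1 - cos h \<le> 2" using cos_ge_minus_one[of h] by linarith
  then have "2 * (1 - cos h) * h\<^sup>2 \<le> 4 * h\<^sup>2"
    using mult_left_mono[of "1 - cos h" 2 2] by (intro mult_right_mono) auto
  ultimately have "2 * (1 - cos h) * (1 + h\<^sup>2) \<le> 5 * h\<^sup>2" by (simp add: distrib_left)
  then show ?thesis using False by (simp add: fejer_def divide_simps add_pos_nonneg)
qed

lemma integrable_fejer_1: "integrable lborel (fejer 1)"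
proof (rule Bochner_Integration.integrable_bound)
  show "integrable lborel (\<lambda>h. 5 * (1 / (1 + h\<^sup>2)) :: real)"
    by (intro integrable_mult_right integrable_inverse_one_plus_square)
  show "AE h in lborel. norm (fejer 1 h) \<le> norm (5 * (1 / (1 + h\<^sup>2)) :: real)"
    using fejer_1_le fejer_nonneg[of 1] by (intro AE_I2) (simp add: add_pos_nonneg)
qed simp

text \<open>The constant 2\<pi> of Plancherel's identity, carried along as an unevaluated positive
  number.\<close>

definition fejer_mass :: real where "fejer_mass = (\<integral>h. fejer 1 h \<partial>lborel)"

lemma integrable_fejer: "K > 0 \<Longrightarrow> integrable lborel (fejer K)"
  using lborel_integrable_real_affine[OF integrable_fejer_1, of K 0]
  by (subst ext[of "fejer K", OF fejer_scale]) auto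

lemma integral_fejer: "K > 0 \<Longrightarrow> (\<integral>h. fejer K h \<partial>lborel) = fejer_mass"
  using lborel_integral_real_affine[of K "fejer 1" 0]
  unfolding fejer_mass_def by (subst fejer_scale) auto

lemma fejer_mass_pos: "fejer_mass > 0"
proof -
  have "fejer_mass \<noteq> 0"
  proof
    assume "fejer_mass = 0"
    then have "AE h in lborel. fejer 1 h = 0"
      unfolding fejer_mass_def
      by (subst (asm) integral_nonneg_eq_0_iff_AE[OF integrable_fejer_1]) (auto simp: fejer_nonneg)
    then have "AE h in lborel. h \<notin> {0<..<1::real}"
    proof eventually_elim
      case (elim h)
      show ?case
      proof
        assume h: "h \<in> {0<..<1}"
        have "cos h < cos 0" using h pi_gt3 by (intro cos_monotone_0_pi) auto
        then show False using elim h by (simp add: fejer_def)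
      qed
    qed
    then have "{0<..<1::real} \<in> null_sets lborel"
      by (subst AE_iff_null_sets) auto
    then show False by (simp add: null_sets_def)
  qed
  moreover have "fejer_mass \<ge> 0" unfolding fejer_mass_def by (intro Bochner_Integration.integral_nonneg) (simp add: fejer_nonneg)
  ultimately show ?thesis by simp
qed

lemma fejer_tail_mass:
  assumes "\<delta> > 0" "\<epsilon> > 0"
  obtains K0 where "K0 > 0" "\<And>K. K \<ge> K0 \<Longrightarrow> (\<integral>h. indicator {h. \<bar>h\<bar> \<ge> \<delta>} h * fejer K h \<partial>lborel) \<le> \<epsilon>"
proof -
  let ?I = "\<integral>h. 1 / (1 + h\<^sup>2) \<partial>lborel :: real"
  have I0: "?I \<ge> 0" by (intro Bochner_Integration.integral_nonneg) (auto simp: add_nonneg_nonneg)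
  let ?C = "4 * (1 + 1 / \<delta>\<^sup>2)"
  \<comment> \<open>For \<open>\<bar>h\<bar> \<ge> \<delta>\<close> the kernel is at most
    \<open>?C / K\<close> times \<open>1 / (1 + h\<^sup>2)\<close>, so the tail has mass at most
    \<open>?C * ?I / K\<close>.\<close>
  define K0 where "K0 = 1 + ?C * ?I / \<epsilon>"
  have K0: "K0 > 0" using I0 assms by (auto simp: K0_def intro!: add_pos_nonneg divide_nonneg_nonneg mult_nonneg_nonneg)
  show thesis
  proof (rule that[OF K0])
    fix K assume K: "K \<ge> K0"
    then have Kp: "K > 0" using K0 by simp
    have "(\<integral>h. indicator {h. \<bar>h\<bar> \<ge> \<delta>} h * fejer K h \<partial>lborel) \<le> (\<integral>h. (?C / K) * (1 / (1 + h\<^sup>2)) \<partial>lborel)"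
    proof (rule integral_mono)
      show "integrable lborel (\<lambda>h. indicator {h. \<bar>h\<bar> \<ge> \<delta>} h * fejer K h)"
        by (rule Bochner_Integration.integrable_bound[OF integrable_fejer[OF Kp]]) (auto simp: indicator_def)
      show "integrable lborel (\<lambda>h. (?C / K) * (1 / (1 + h\<^sup>2)) :: real)"
        by (intro integrable_mult_right integrable_inverse_one_plus_square)
      fix h :: real
      show "indicator {h. \<bar>h\<bar> \<ge> \<delta>} h * fejer K h \<le> (?C / K) * (1 / (1 + h\<^sup>2))"
      proof (cases "\<bar>h\<bar> \<ge> \<delta>")
        case True
        then have h: "h \<noteq> 0" using assms by auto
        have "\<delta>\<^sup>2 \<le> h\<^sup>2" using True assms by (simp add: abs_le_square_iff[symmetric])
        then have "1 + h\<^sup>2 \<le> (1 + 1 / \<delta>\<^sup>2) * h\<^sup>2" using assms by (simp add: field_simps)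
        then have "4 / (K * h\<^sup>2) \<le> (?C / K) * (1 / (1 + h\<^sup>2))"
          using Kp h by (simp add: divide_simps add_pos_nonneg mult_ac)
        with fejer_tail[OF Kp h] show ?thesis using True by simp
      qed (use Kp in \<open>auto intro!: divide_nonneg_nonneg mult_nonneg_nonneg add_nonneg_nonneg\<close>)
    qed
    also have "\<dots> = ?C / K * ?I" by (rule integral_mult_right_zero)
    also have "\<dots> = ?C * ?I / K" by simp
    also have "\<dots> \<le> \<epsilon>"
    proof -
      have "?C * ?I / \<epsilon> \<le> K" using K by (simp add: K0_def)
      then show ?thesis using Kp assms by (simp add: field_simps)
    qed
    finally show "(\<integral>h. indicator {h. \<bar>h\<bar> \<ge> \<delta>} h * fejer K h \<partial>lborel) \<le> \<epsilon>" .
  qed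
qed

section \<open>Plancherel's identity with a Fejer weight\<close>

lemma cnj_measurable[measurable]: "cnj \<in> borel_measurable borel"
  by (intro borel_measurable_continuous_onI continuous_intros)

definition fourier :: "(real \<Rightarrow> complex) \<Rightarrow> real \<Rightarrow> complex" where
  "fourier f t = (\<integral>u. f u * exp (- \<i> * of_real (t * u)) \<partial>lborel)"

lemma fourier_measurable[measurable]:
  assumes [measurable]: "f \<in> borel_measurable borel"
  shows "fourier f \<in> borel_measurable borel"
  unfolding fourier_def by measurable

text \<open>The squared modulus of a transform is the transform of the autocorrelation; the inner
  variable is the lag between the two arguments of \<open>f\<close>.\<close>

lemma fourier_norm_square:
  assumes f: "integrable lborel f"
  shows "of_real ((norm (fourier f t))\<^sup>2) =
    (\<integral>u. \<integral>h. f u * cnj (f (u - h)) * exp (- \<i> * of_real (t * h)) \<partial>lborel \<partial>lborel)"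
proof -
  have "(\<integral>h. f u * cnj (f (u - h)) * exp (- \<i> * of_real (t * h)) \<partial>lborel) =
     (f u * exp (- \<i> * of_real (t * u))) * cnj (fourier f t)" for u
  proof -
    have "(\<integral>h. f u * cnj (f (u - h)) * exp (- \<i> * of_real (t * h)) \<partial>lborel) =
       (\<integral>v. f u * cnj (f v) * exp (- \<i> * of_real (t * (u - v))) \<partial>lborel)"
      using lborel_integral_real_affine[of "-1" "\<lambda>v. f u * cnj (f v) * exp (- \<i> * of_real (t * (u - v)))" u] by simp
    also have "\<dots> = (\<integral>v. (f u * exp (- \<i> * of_real (t * u))) * cnj (f v * exp (- \<i> * of_real (t * v))) \<partial>lborel)"
      by (intro Bochner_Integration.integral_cong refl) (simp add: exp_cnj algebra_simps flip: exp_add)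
    also have "\<dots> = (f u * exp (- \<i> * of_real (t * u))) * cnj (fourier f t)"
      unfolding fourier_def by (simp only: integral_mult_right_zero Bochner_Integration.integral_cnj)
    finally show ?thesis .
  qed
  then have "(\<integral>u. \<integral>h. f u * cnj (f (u - h)) * exp (- \<i> * of_real (t * h)) \<partial>lborel \<partial>lborel) =
     fourier f t * cnj (fourier f t)"
    unfolding fourier_def by (simp only: integral_mult_left_zero)
  then show ?thesis by (simp only: complex_norm_square)
qed

text \<open>Integration against the triangle turns the oscillating factor of the autocorrelation
  formula into the Fejer kernel, and polarization trades the autocorrelation for the modulus of
  continuity \<open>D\<close>. Being an exact identity it serves in both directions:
  \<open>D \<ge> 0\<close> bounds the low frequencies by the norm, and a small \<open>D\<close>
  bounds the norm by the low frequencies.\<close>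

lemma fejer_plancherel:
  fixes f :: "real \<Rightarrow> complex"
  assumes f: "integrable lborel f" and f2: "integrable lborel (\<lambda>u. (norm (f u))\<^sup>2)" and K: "K > 0"
  defines "D \<equiv> \<lambda>h. \<integral>u. (norm (f u - f (u - h)))\<^sup>2 \<partial>lborel"
  shows "integrable lborel (\<lambda>t. fejer_weight K t * (norm (fourier f t))\<^sup>2)"
    and "integrable lborel (\<lambda>h. fejer K h * D h)"
    and "(\<integral>t. fejer_weight K t * (norm (fourier f t))\<^sup>2 \<partial>lborel) =
       fejer_mass * (\<integral>u. (norm (f u))\<^sup>2 \<partial>lborel) - (\<integral>h. fejer K h * D h \<partial>lborel) / 2"
proof -
  have [measurable]: "f \<in> borel_measurable borel" using f by (simp add: borel_measurable_integrable)
  let ?N = "\<integral>u. norm (f u) \<partial>lborel" and ?N2 = "\<integral>u. (norm (f u))\<^sup>2 \<partial>lborel"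
  have fn: "integrable lborel (\<lambda>u. norm (f u))" using f by simp
  have shift: "integrable lborel (\<lambda>h. norm (f (u - h)))" "(\<integral>h. norm (f (u - h)) \<partial>lborel) = ?N" for u
    using lborel_integrable_real_affine[OF fn, of "-1" u] lborel_integral_real_affine[of "-1" "\<lambda>x. norm (f x)" u] by auto
  define g where "g = (\<lambda>(u, h). f u * cnj (f (u - h)))"
  have [measurable]: "g \<in> borel_measurable (lborel \<Otimes>\<^sub>M lborel)"
    unfolding g_def by measurable
  have gi: "integrable lborel (\<lambda>h. g (u, h))" for u
    unfolding g_def using shift(1)[of u]
    by (auto intro!: integrable_mult_right simp flip: complex_cnj_cnj)
       (rule Bochner_Integration.integrable_bound[OF shift(1)[of u]], auto)
  have ig: "integrable (lborel \<Otimes>\<^sub>M lborel) g"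
  proof (rule lborel_pair.Fubini_integrable)
    have "(\<lambda>u. \<integral>h. norm (g (u, h)) \<partial>lborel) = (\<lambda>u. norm (f u) * ?N)"
      by (auto simp: g_def norm_mult shift)
    then show "integrable lborel (\<lambda>u. \<integral>h. norm (g (u, h)) \<partial>lborel)" using fn by simp
  qed (use gi in auto)
  interpret S: sigma_finite_measure "lborel \<Otimes>\<^sub>M lborel :: (real \<times> real) measure"
    by (rule sigma_finite_pair_measure) (rule sigma_finite_lborel)+
  interpret P: pair_sigma_finite lborel "lborel \<Otimes>\<^sub>M lborel :: (real \<times> real) measure" ..
  \<comment> \<open>The triple integrand in \<open>t\<close> and \<open>(u, h)\<close>. The
    compactly supported weight makes it absolutely integrable, which licenses both orders of
    integration.\<close>
  define F where "F = (\<lambda>(t, q). of_real (fejer_weight K t) * (g q * exp (- \<i> * of_real (t * snd q))))"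
  have [measurable]: "F \<in> borel_measurable (lborel \<Otimes>\<^sub>M (lborel \<Otimes>\<^sub>M lborel))"
    unfolding F_def by measurable
  have iF: "integrable (lborel \<Otimes>\<^sub>M (lborel \<Otimes>\<^sub>M lborel)) F"
  proof (rule P.Fubini_integrable)
    have "(\<lambda>t. \<integral>q. norm (F (t, q)) \<partial>(lborel \<Otimes>\<^sub>M lborel)) = (\<lambda>t. \<bar>fejer_weight K t\<bar> * (\<integral>q. norm (g q) \<partial>(lborel \<Otimes>\<^sub>M lborel)))"
      by (auto simp: F_def norm_mult)
    then show "integrable lborel (\<lambda>t. \<integral>q. norm (F (t, q)) \<partial>(lborel \<Otimes>\<^sub>M lborel))"
      using integrable_fejer_weight[OF K] by simp
    show "AE t in lborel. integrable (lborel \<Otimes>\<^sub>M lborel) (\<lambda>q. F (t, q))"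
    proof (rule AE_I2)
      fix t :: real
      show "integrable (lborel \<Otimes>\<^sub>M lborel) (\<lambda>q. F (t, q))"
        unfolding F_def split
        by (intro integrable_mult_right, rule Bochner_Integration.integrable_bound[OF ig]) (auto simp: norm_mult)
    qed
  qed measurable
  have F1: "(\<integral>q. F (t, q) \<partial>(lborel \<Otimes>\<^sub>M lborel)) = of_real (fejer_weight K t * (norm (fourier f t))\<^sup>2)" for t
  proof -
    have i: "integrable (lborel \<Otimes>\<^sub>M lborel) (\<lambda>q. g q * exp (- \<i> * of_real (t * snd q)))"
      by (rule Bochner_Integration.integrable_bound[OF ig]) (auto simp: norm_mult)
    have "(\<integral>q. g q * exp (- \<i> * of_real (t * snd q)) \<partial>(lborel \<Otimes>\<^sub>M lborel)) =
      (\<integral>u. \<integral>h. f u * cnj (f (u - h)) * exp (- \<i> * of_real (t * h)) \<partial>lborel \<partial>lborel)"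
      by (subst lborel_pair.integral_fst'[OF i, symmetric]) (simp add: g_def)
    also have "\<dots> = of_real ((norm (fourier f t))\<^sup>2)"
      by (rule fourier_norm_square[OF f, symmetric])
    finally show ?thesis by (simp add: F_def)
  qed
  have i1: "integrable lborel (\<lambda>t. complex_of_real (fejer_weight K t * (norm (fourier f t))\<^sup>2))"
    using P.integrable_fst'[OF iF] unfolding F1 .
  then show "integrable lborel (\<lambda>t. fejer_weight K t * (norm (fourier f t))\<^sup>2)"
    using integrable_Re[OF i1] by simp
  have F2: "(\<integral>t. F (t, q) \<partial>lborel) = g q * of_real (fejer K (snd q))" for q
  proof -
    have "(\<integral>t. F (t, q) \<partial>lborel) = (\<integral>t. g q * (of_real (fejer_weight K t) * exp (- \<i> * of_real (t * snd q))) \<partial>lborel)"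
      by (simp add: F_def mult_ac)
    also have "\<dots> = g q * (\<integral>t. of_real (fejer_weight K t) * exp (- \<i> * of_real (t * snd q)) \<partial>lborel)"
      by (rule integral_mult_right_zero)
    also have "\<dots> = g q * of_real (fejer K (snd q))" by (simp only: integral_fejer_weight[OF K])
    finally show ?thesis .
  qed
  have i2: "integrable (lborel \<Otimes>\<^sub>M lborel) (\<lambda>q. g q * of_real (fejer K (snd q)))"
    using P.integrable_snd[of "\<lambda>t q. F (t, q)"] iF unfolding F2 by simp
  have "of_real (\<integral>t. fejer_weight K t * (norm (fourier f t))\<^sup>2 \<partial>lborel) =
     (\<integral>t. \<integral>q. F (t, q) \<partial>(lborel \<Otimes>\<^sub>M lborel) \<partial>lborel)"
    unfolding F1 by (rule integral_complex_of_real[symmetric])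
  also have "\<dots> = (\<integral>q. \<integral>t. F (t, q) \<partial>lborel \<partial>(lborel \<Otimes>\<^sub>M lborel))"
    using P.Fubini_integral[of "\<lambda>t q. F (t, q)"] iF by simp
  also have "\<dots> = (\<integral>q. g q * of_real (fejer K (snd q)) \<partial>(lborel \<Otimes>\<^sub>M lborel))" unfolding F2 ..
  also have "\<dots> = (\<integral>h. \<integral>u. f u * cnj (f (u - h)) * of_real (fejer K h) \<partial>lborel \<partial>lborel)"
    using lborel_pair.integral_snd[of "\<lambda>u h. g (u, h) * of_real (fejer K h)"] i2 by (simp add: g_def split_beta')
  finally have 1: "of_real (\<integral>t. fejer_weight K t * (norm (fourier f t))\<^sup>2 \<partial>lborel) =
     (\<integral>h. \<integral>u. f u * cnj (f (u - h)) * of_real (fejer K h) \<partial>lborel \<partial>lborel)" .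
  have i3: "integrable lborel (\<lambda>h. \<integral>u. f u * cnj (f (u - h)) * of_real (fejer K h) \<partial>lborel)"
    using lborel_pair.integrable_snd[of "\<lambda>u h. g (u, h) * of_real (fejer K h)"] i2 by (simp add: g_def split_beta')
  have A: "Re (\<integral>u. f u * cnj (f (u - h)) * of_real (fejer K h) \<partial>lborel) = fejer K h * (?N2 - D h / 2)" for h
  proof -
    have s2: "integrable lborel (\<lambda>u. (norm (f (u - h)))\<^sup>2)" "(\<integral>u. (norm (f (u - h)))\<^sup>2 \<partial>lborel) = ?N2"
      using lborel_integrable_real_affine[OF f2, of "1" "-h"] lborel_integral_real_affine[of "1" "\<lambda>x. (norm (f x))\<^sup>2" "-h"] by auto
    have r: "Re (z * cnj w) = ((norm z)\<^sup>2 + (norm w)\<^sup>2 - (norm (z - w))\<^sup>2) / 2" for z w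
      by (simp only: cmod_power2) (simp add: power2_eq_square algebra_simps)
    have di: "integrable lborel (\<lambda>u. (norm (f u - f (u - h)))\<^sup>2)"
    proof (rule Bochner_Integration.integrable_bound)
      show "integrable lborel (\<lambda>u. 2 * ((norm (f u))\<^sup>2 + (norm (f (u - h)))\<^sup>2))"
        using f2 s2 by simp
      have "(norm (z - w))\<^sup>2 \<le> 2 * ((norm z)\<^sup>2 + (norm w)\<^sup>2)" for z w :: complex
      proof -
        have "(norm (z - w))\<^sup>2 \<le> (norm z + norm w)\<^sup>2" by (intro power_mono norm_triangle_ineq4) auto
        also have "\<dots> \<le> 2 * ((norm z)\<^sup>2 + (norm w)\<^sup>2)"
          using sum_squares_ge_zero[of "norm z - norm w" 0] by (simp add: power2_eq_square algebra_simps)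
        finally show ?thesis .
      qed
      then show "AE u in lborel. norm ((norm (f u - f (u - h)))\<^sup>2) \<le> norm (2 * ((norm (f u))\<^sup>2 + (norm (f (u - h)))\<^sup>2))"
        by (intro AE_I2) simp
    qed simp
    have ic: "integrable lborel (\<lambda>u. f u * cnj (f (u - h)))"
    proof (rule Bochner_Integration.integrable_bound)
      show "integrable lborel (\<lambda>u. (norm (f u))\<^sup>2 + (norm (f (u - h)))\<^sup>2)" using f2 s2 by simp
      have "norm (z * cnj w) \<le> (norm z)\<^sup>2 + (norm w)\<^sup>2" for z w :: complex
      proof -
        have "2 * (norm z * norm w) \<le> (norm z)\<^sup>2 + (norm w)\<^sup>2"
          using sum_squares_bound[of "norm z" "norm w"] by (simp add: mult.assoc)
        moreover have "0 \<le> norm z * norm w" by simp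
        ultimately show ?thesis unfolding norm_mult complex_mod_cnj by linarith
      qed
      then show "AE u in lborel. norm (f u * cnj (f (u - h))) \<le> norm ((norm (f u))\<^sup>2 + (norm (f (u - h)))\<^sup>2)"
        by (intro AE_I2) (simp add: add_nonneg_nonneg)
    qed simp
    have "Re (\<integral>u. f u * cnj (f (u - h)) \<partial>lborel) = (\<integral>u. Re (f u * cnj (f (u - h))) \<partial>lborel)"
      by (rule integral_Re[OF ic, symmetric])
    also have "\<dots> = (\<integral>u. ((norm (f u))\<^sup>2 + (norm (f (u - h)))\<^sup>2 - (norm (f u - f (u - h)))\<^sup>2) / 2 \<partial>lborel)"
      unfolding r ..
    also have "\<dots> = ?N2 - D h / 2"
      using f2 s2 di by (simp add: D_def)
    finally have "Re (\<integral>u. f u * cnj (f (u - h)) \<partial>lborel) = ?N2 - D h / 2" .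
    moreover have "(\<integral>u. f u * cnj (f (u - h)) * of_real (fejer K h) \<partial>lborel) =
      (\<integral>u. f u * cnj (f (u - h)) \<partial>lborel) * of_real (fejer K h)" by (rule integral_mult_left_zero)
    ultimately show ?thesis by simp
  qed
  have i4: "integrable lborel (\<lambda>h. fejer K h * (?N2 - D h / 2))"
    using integrable_Re[OF i3] unfolding A .
  have i5: "integrable lborel (\<lambda>h. fejer K h * ?N2)"
    using integrable_fejer[OF K] by simp
  have "integrable lborel (\<lambda>h. 2 * (fejer K h * ?N2 - fejer K h * (?N2 - D h / 2)))"
    by (intro integrable_mult_right Bochner_Integration.integrable_diff i4 i5)
  moreover have "(\<lambda>h. 2 * (fejer K h * ?N2 - fejer K h * (?N2 - D h / 2))) = (\<lambda>h. fejer K h * D h)"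
    by (auto simp: fun_eq_iff algebra_simps)
  ultimately show i6: "integrable lborel (\<lambda>h. fejer K h * D h)" by simp
  have "(\<integral>t. fejer_weight K t * (norm (fourier f t))\<^sup>2 \<partial>lborel) =
     Re (\<integral>h. \<integral>u. f u * cnj (f (u - h)) * of_real (fejer K h) \<partial>lborel \<partial>lborel)"
    unfolding 1[symmetric] by simp
  also have "\<dots> = (\<integral>h. fejer K h * (?N2 - D h / 2) \<partial>lborel)"
    unfolding A[symmetric] by (rule integral_Re[OF i3, symmetric])
  also have "\<dots> = (\<integral>h. fejer K h * ?N2 - (fejer K h * D h) / 2 \<partial>lborel)"
    by (intro Bochner_Integration.integral_cong) (auto simp: algebra_simps)
  also have "\<dots> = fejer_mass * ?N2 - (\<integral>h. fejer K h * D h \<partial>lborel) / 2"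
    using i5 i6 by (subst Bochner_Integration.integral_diff) (auto simp: integral_fejer[OF K])
  finally show "(\<integral>t. fejer_weight K t * (norm (fourier f t))\<^sup>2 \<partial>lborel) =
       fejer_mass * ?N2 - (\<integral>h. fejer K h * D h \<partial>lborel) / 2" .
qed

section \<open>Pointwise limits from mean values\<close>

text \<open>In the intended instance \<open>q x\<close> is \<open>g x\<close> times
  \<open>x^(-i \<alpha>)\<close>. Its bound is split into \<open>p1 = |g1|\<close> with Chebyshev's
  estimate, phrased as bounded mass per unit length of \<open>ln x\<close>, and
  \<open>p2 = |g2|\<close>, summable against \<open>1 / x\<close>. All that survives of the
  multiplicative structure is the renewal inequality.\<close>

locale log_renewal =
  fixes M :: "real measure" and T :: "real \<Rightarrow> complex" and q :: "real \<Rightarrow> complex"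
    and p1 p2 :: "real \<Rightarrow> real" and B C C1 :: real
  assumes M_sigma: "sigma_finite_measure M"
    and sets_M[measurable_cong, simp]: "sets M = sets borel"
    and AE_M: "AE x in M. x > 1"
    and T_meas[measurable]: "T \<in> borel_measurable borel"
    and q_meas[measurable]: "q \<in> borel_measurable borel"
    and p1_meas[measurable]: "p1 \<in> borel_measurable borel"
    and p2_meas[measurable]: "p2 \<in> borel_measurable borel"
    and T_bound: "\<And>u. norm (T u) \<le> B" and T_neg: "\<And>u. u < 0 \<Longrightarrow> T u = 0"
    and C_nonneg: "C \<ge> 0" and C1_nonneg: "C1 \<ge> 0"
    and T_osc: "\<And>\<epsilon>. \<epsilon> > 0 \<Longrightarrow> \<exists>\<delta>>0. \<exists>u0. \<forall>u\<ge>u0. \<forall>h\<in>{0..\<delta>}. norm (T (u + h) - T u) \<le> \<epsilon>"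
    and p1_nonneg: "\<And>x. p1 x \<ge> 0" and p2_nonneg: "\<And>x. p2 x \<ge> 0"
    and q_bound: "\<And>x. x > 1 \<Longrightarrow> norm (q x) \<le> p1 x + p2 x"
    and renewal_int: "\<And>U. U \<ge> 0 \<Longrightarrow> integrable M (\<lambda>x. T (U - ln x) * q x * of_real (ln x / x))"
    and renewal: "\<And>U. U \<ge> 0 \<Longrightarrow> norm (of_real U * T U - (\<integral>x. T (U - ln x) * q x * of_real (ln x / x) \<partial>M)) \<le> C"
    and p1_window: "\<And>a. (\<integral>\<^sup>+x. indicator {a..a + 1} (ln x) * ennreal (p1 x * (ln x / x)) \<partial>M) \<le> ennreal C1"
    and p2_sum: "(\<integral>\<^sup>+x. ennreal (p2 x / x) \<partial>M) < \<infinity>"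
begin

sublocale M: sigma_finite_measure M by (rule M_sigma)

lemma B_nonneg: "B \<ge> 0"
  using T_bound[of 0] norm_ge_zero order_trans by blast

definition incr :: "real \<Rightarrow> real \<Rightarrow> ennreal" where
  "incr H v = ennreal (norm (T (v + H) - T v))"

lemma incr_measurable[measurable]: "incr H \<in> borel_measurable borel"
  unfolding incr_def by measurable

lemma incr_le: "incr H v \<le> ennreal (2 * B)"
  unfolding incr_def
  using norm_triangle_ineq4[of "T (v + H)" "T v"] T_bound[of "v + H"] T_bound[of v] by (intro ennreal_leI) linarith

lemma incr_eq_0: "H \<ge> 0 \<Longrightarrow> v < - H \<Longrightarrow> incr H v = 0"
  by (simp add: incr_def T_neg)

text \<open>What \<open>p2\<close> can contribute to the renewal sum. Increments of \<open>T\<close>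
  are met there with the trivial bound \<open>2 * B\<close>, since \<open>rest V\<close> is o(V) in
  any case.\<close>

definition rest :: "real \<Rightarrow> ennreal" where
  "rest V = (\<integral>\<^sup>+x. indicator {..V} (ln x) * ennreal (p2 x * (ln x / x)) \<partial>M)"

text \<open>The renewal inequalities at \<open>U + H\<close> and at \<open>U\<close> are subtracted.
  Their left sides have different prefactors, so a term \<open>H * T (U + H)\<close> is left over,
  whence \<open>H * B\<close>.\<close>

lemma renewal_incr:
  assumes U: "U \<ge> 0" and H: "H \<ge> 0"
  shows "ennreal U * incr H U \<le> (\<integral>\<^sup>+x. incr H (U - ln x) * ennreal (p1 x * (ln x / x)) \<partial>M)
     + ennreal (2 * B) * rest (U + H) + ennreal (2 * C + H * B)"
proof -
  let ?I = "\<lambda>U. \<integral>x. T (U - ln x) * q x * of_real (ln x / x) \<partial>M"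
  let ?J = "\<integral>x. (T (U - ln x + H) - T (U - ln x)) * q x * of_real (ln x / x) \<partial>M"
  have iJ: "integrable M (\<lambda>x. (T (U - ln x + H) - T (U - ln x)) * q x * of_real (ln x / x))"
    and J: "?J = ?I (U + H) - ?I U"
    using Bochner_Integration.integrable_diff[OF renewal_int[of "U + H"] renewal_int[of U]]
      Bochner_Integration.integral_diff[OF renewal_int[of "U + H"] renewal_int[of U]] U H
    by (simp_all add: algebra_simps)
  have eq: "of_real U * (T (U + H) - T U) = (of_real (U + H) * T (U + H) - ?I (U + H)) - (of_real U * T U - ?I U)
     - of_real H * T (U + H) + ?J"
    unfolding J by (simp add: algebra_simps)
  have "norm (of_real U * (T (U + H) - T U)) \<le> C + C + H * B + norm ?J"
  proof -
    have tri: "norm (a - b - c + d) \<le> C + C + H * B + norm d"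
      if "norm a \<le> C" "norm b \<le> C" "norm c \<le> H * B" for a b c d :: complex
      using norm_triangle_ineq[of "a - b - c" d] norm_triangle_ineq4[of "a - b" c] norm_triangle_ineq4[of a b] that
      by linarith
    have "norm (of_real H * T (U + H)) \<le> H * B"
      using H T_bound[of "U + H"] by (simp add: norm_mult mult_left_mono)
    moreover have "U + H \<ge> 0" using U H by simp
    ultimately show ?thesis unfolding eq by (intro tri renewal U)
  qed
  then have 1: "U * norm (T (U + H) - T U) \<le> norm ?J + (2 * C + H * B)"
    using U by (simp add: norm_mult)
  have "ennreal U * incr H U = ennreal (U * norm (T (U + H) - T U))"
    using U by (simp add: incr_def ennreal_mult)
  also have "\<dots> \<le> ennreal (norm ?J) + ennreal (2 * C + H * B)"
  proof -
    have "2 * C + H * B \<ge> 0" using C_nonneg H B_nonneg by simp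
    then have "ennreal (norm ?J + (2 * C + H * B)) = ennreal (norm ?J) + ennreal (2 * C + H * B)"
      by (intro ennreal_plus) simp
    then show ?thesis using ennreal_leI[OF 1] by simp
  qed
  also have "ennreal (norm ?J) \<le> (\<integral>\<^sup>+x. ennreal (norm ((T (U - ln x + H) - T (U - ln x)) * q x * of_real (ln x / x))) \<partial>M)"
    by (rule integral_norm_bound_ennreal[OF iJ])
  also have "\<dots> \<le> (\<integral>\<^sup>+x. incr H (U - ln x) * ennreal (p1 x * (ln x / x)) +
      ennreal (2 * B) * (indicator {..U + H} (ln x) * ennreal (p2 x * (ln x / x))) \<partial>M)"
  proof (intro nn_integral_mono_AE, use AE_M in eventually_elim)
    case (elim x)
    have lx: "ln x / x \<ge> 0" using elim by simp
    have "ennreal (norm ((T (U - ln x + H) - T (U - ln x)) * q x * of_real (ln x / x)))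
       = incr H (U - ln x) * ennreal (norm (q x) * (ln x / x))"
    proof -
      have "norm ((T (U - ln x + H) - T (U - ln x)) * q x * of_real (ln x / x)) =
        norm (T (U - ln x + H) - T (U - ln x)) * (norm (q x) * (ln x / x))"
        by (simp only: norm_mult norm_of_real abs_of_nonneg[OF lx] mult.assoc)
      then show ?thesis
        unfolding incr_def using lx by (simp only: ennreal_mult[OF norm_ge_zero mult_nonneg_nonneg[OF norm_ge_zero lx]])
    qed
    also have "\<dots> \<le> incr H (U - ln x) * ennreal ((p1 x + p2 x) * (ln x / x))"
      using lx q_bound[OF elim] by (intro mult_left_mono ennreal_leI mult_right_mono) auto
    also have "\<dots> = incr H (U - ln x) * ennreal (p1 x * (ln x / x)) + incr H (U - ln x) * ennreal (p2 x * (ln x / x))"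
    proof -
      have "ennreal ((p1 x + p2 x) * (ln x / x)) = ennreal (p1 x * (ln x / x)) + ennreal (p2 x * (ln x / x))"
        unfolding distrib_right
        using lx p1_nonneg[of x] p2_nonneg[of x] by (intro ennreal_plus mult_nonneg_nonneg)
      then show ?thesis by (simp only: distrib_left)
    qed
    \<comment> \<open>The increment vanishes once \<open>ln x > U + H\<close>, as \<open>T\<close>
      is 0 on the negative axis; this truncates the sum over \<open>p2\<close>.\<close>
    also have "incr H (U - ln x) * ennreal (p2 x * (ln x / x)) \<le>
      (ennreal (2 * B) * indicator {..U + H} (ln x)) * ennreal (p2 x * (ln x / x))"
      using incr_le[of H "U - ln x"] incr_eq_0[OF H, of "U - ln x"]
      by (intro mult_right_mono) (auto simp: indicator_def)
    finally show ?case by (simp add: mult.assoc)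
  qed
  also have "\<dots> = (\<integral>\<^sup>+x. incr H (U - ln x) * ennreal (p1 x * (ln x / x)) \<partial>M) + ennreal (2 * B) * rest (U + H)"
    unfolding rest_def by (subst nn_integral_add) (auto simp: nn_integral_cmult)
  finally show ?thesis by (simp add: add_right_mono)
qed

text \<open>After Fubini and the substitution \<open>V = ln x + v\<close>, the window confines
  \<open>ln x\<close>, for fixed \<open>v\<close>, to an interval of length at most 1, where the
  weights from \<open>p1\<close> have total mass at most \<open>C1\<close>. Positivity of
  \<open>ln x\<close> confines \<open>v\<close> to \<open>{..U + \<delta>}\<close>.\<close>

lemma nn_integral_incr_window:
  assumes \<delta>: "0 \<le> \<delta>" "\<delta> \<le> 1"
  shows "(\<integral>\<^sup>+V. indicator {U..U + \<delta>} V * (\<integral>\<^sup>+x. incr H (V - ln x) * ennreal (p1 x * (ln x / x)) \<partial>M) \<partial>lborel)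
    \<le> ennreal C1 * (\<integral>\<^sup>+v. indicator {..U + \<delta>} v * incr H v \<partial>lborel)"
proof -
  interpret P: pair_sigma_finite lborel M ..
  let ?k = "\<lambda>x. ennreal (p1 x * (ln x / x))"
  have "(\<integral>\<^sup>+V. indicator {U..U + \<delta>} V * (\<integral>\<^sup>+x. incr H (V - ln x) * ?k x \<partial>M) \<partial>lborel)
     = (\<integral>\<^sup>+V. \<integral>\<^sup>+x. indicator {U..U + \<delta>} V * (incr H (V - ln x) * ?k x) \<partial>M \<partial>lborel)"
    by (simp add: nn_integral_cmult)
  also have "\<dots> = (\<integral>\<^sup>+x. \<integral>\<^sup>+V. indicator {U..U + \<delta>} V * (incr H (V - ln x) * ?k x) \<partial>lborel \<partial>M)"
    by (rule P.Fubini'[symmetric]) measurable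
  also have "\<dots> = (\<integral>\<^sup>+x. \<integral>\<^sup>+v. indicator {U..U + \<delta>} (ln x + v) * (incr H v * ?k x) \<partial>lborel \<partial>M)"
  proof (rule nn_integral_cong)
    fix x
    show "(\<integral>\<^sup>+V. indicator {U..U + \<delta>} V * (incr H (V - ln x) * ?k x) \<partial>lborel) =
      (\<integral>\<^sup>+v. indicator {U..U + \<delta>} (ln x + v) * (incr H v * ?k x) \<partial>lborel)"
      by (subst nn_integral_real_affine[of _ 1 "ln x"]) auto
  qed
  also have "\<dots> = (\<integral>\<^sup>+v. \<integral>\<^sup>+x. indicator {U..U + \<delta>} (ln x + v) * (incr H v * ?k x) \<partial>M \<partial>lborel)"
    by (rule P.Fubini') measurable
  also have "\<dots> \<le> (\<integral>\<^sup>+v. ennreal C1 * (indicator {..U + \<delta>} v * incr H v) \<partial>lborel)"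
  proof (rule nn_integral_mono)
    fix v :: real
    have "(\<integral>\<^sup>+x. indicator {U..U + \<delta>} (ln x + v) * (incr H v * ?k x) \<partial>M) \<le>
      (\<integral>\<^sup>+x. (indicator {..U + \<delta>} v * incr H v) * (indicator {U - v..U - v + 1} (ln x) * ?k x) \<partial>M)"
    proof (intro nn_integral_mono_AE, use AE_M in eventually_elim)
      case (elim x)
      then have "ln x > 0" by simp
      then have "indicator {U..U + \<delta>} (ln x + v) \<le> (indicator {..U + \<delta>} v * indicator {U - v..U - v + 1} (ln x) :: ennreal)"
        using \<delta> by (auto simp: indicator_def)
      then have "indicator {U..U + \<delta>} (ln x + v) * (incr H v * ?k x) \<le>
        (indicator {..U + \<delta>} v * indicator {U - v..U - v + 1} (ln x)) * (incr H v * ?k x)"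
        by (rule mult_right_mono) simp
      then show ?case by (simp add: mult_ac)
    qed
    also have "\<dots> = (indicator {..U + \<delta>} v * incr H v) * (\<integral>\<^sup>+x. indicator {U - v..U - v + 1} (ln x) * ?k x \<partial>M)"
      by (rule nn_integral_cmult) measurable
    also have "\<dots> \<le> (indicator {..U + \<delta>} v * incr H v) * ennreal C1"
      by (intro mult_left_mono p1_window) simp
    finally show "(\<integral>\<^sup>+x. indicator {U..U + \<delta>} (ln x + v) * (incr H v * ?k x) \<partial>M)
       \<le> ennreal C1 * (indicator {..U + \<delta>} v * incr H v)" by (simp add: mult_ac)
  qed
  also have "\<dots> = ennreal C1 * (\<integral>\<^sup>+v. indicator {..U + \<delta>} v * incr H v \<partial>lborel)"
    by (rule nn_integral_cmult) measurable
  finally show ?thesis .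
qed

text \<open>Both ends of an increment are compared with the constant \<open>A\<close>, whence the
  factor 2; on \<open>[-H, 0)\<close> one end lies outside the range of the mean, and the trivial
  bound costs \<open>2 * H * B\<close>.\<close>

lemma nn_integral_incr_le:
  assumes V: "V \<ge> 0" and H: "H \<ge> 0"
  shows "(\<integral>\<^sup>+v. indicator {..V} v * incr H v \<partial>lborel) \<le>
    ennreal (2 * H * B) + 2 * (\<integral>\<^sup>+u. indicator {0..V + H} u * ennreal (norm (T u - A)) \<partial>lborel)"
proof -
  let ?d = "\<lambda>u. ennreal (norm (T u - A))"
  let ?I = "\<integral>\<^sup>+u. indicator {0..V + H} u * ?d u \<partial>lborel"
  have "(\<integral>\<^sup>+v. indicator {..V} v * incr H v \<partial>lborel) \<le>
    (\<integral>\<^sup>+v. indicator {-H..0} v * ennreal (2 * B) + (indicator {0..V + H} (H + v) * ?d (H + v) + indicator {0..V + H} v * ?d v) \<partial>lborel)"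
  proof (rule nn_integral_mono)
    fix v :: real
    have tri: "incr H v \<le> ?d (H + v) + ?d v"
      using ennreal_leI[OF norm_triangle_ineq4[of "T (H + v) - A" "T v - A"]]
      by (simp add: incr_def add.commute)
    consider "v > V" | "v < - H" | "- H \<le> v" "v < 0" "v \<le> V" | "0 \<le> v" "v \<le> V" by linarith
    then show "indicator {..V} v * incr H v \<le> indicator {-H..0} v * ennreal (2 * B)
        + (indicator {0..V + H} (H + v) * ?d (H + v) + indicator {0..V + H} v * ?d v)"
    proof cases
      case 3
      then have "indicator {..V} v * incr H v \<le> indicator {-H..0} v * ennreal (2 * B)"
        using incr_le[of H v] by simp
      then show ?thesis by (meson add_increasing2 zero_le order_trans)
    next
      case 4
      then have "indicator {..V} v * incr H v \<le>
        indicator {0..V + H} (H + v) * ?d (H + v) + indicator {0..V + H} v * ?d v"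
        using tri H by simp
      then show ?thesis by (meson add_increasing zero_le order_trans)
    qed (use incr_eq_0[OF H] in auto)
  qed
  also have "\<dots> = (\<integral>\<^sup>+v. indicator {-H..0} v * ennreal (2 * B) \<partial>lborel) +
     ((\<integral>\<^sup>+v. indicator {0..V + H} (H + v) * ?d (H + v) \<partial>lborel) + ?I)"
    by (subst nn_integral_add, measurable, subst nn_integral_add) auto
  also have "(\<integral>\<^sup>+v. indicator {0..V + H} (H + v) * ?d (H + v) \<partial>lborel) = ?I"
    using nn_integral_real_affine[of "\<lambda>u. indicator {0..V + H} u * ?d u" 1 H] by simp
  also have "(\<integral>\<^sup>+v. indicator {-H..0} v * ennreal (2 * B) \<partial>lborel) = ennreal (2 * H * B)"
  proof -
    have "(\<integral>\<^sup>+v. indicator {-H..0} v * ennreal (2 * B) \<partial>lborel) = emeasure lborel {-H..0} * ennreal (2 * B)"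
      by (subst nn_integral_multc) auto
    also have "\<dots> = ennreal H * ennreal (2 * B)" using H by simp
    also have "\<dots> = ennreal (2 * H * B)" using H B_nonneg by (subst ennreal_mult[symmetric]) (auto simp: mult_ac)
    finally show ?thesis .
  qed
  finally show ?thesis by (simp only: mult_2)
qed

lemma rest_small:
  assumes e: "e > 0"
  obtains V0 where "V0 > 0" "\<And>V. V \<ge> V0 \<Longrightarrow> rest V \<le> ennreal (e * V)"
proof -
  obtain c where c: "(\<integral>\<^sup>+x. ennreal (p2 x / x) \<partial>M) = ennreal c" "c \<ge> 0"
    using p2_sum by (cases "\<integral>\<^sup>+x. ennreal (p2 x / x) \<partial>M") auto
  let ?tail = "\<lambda>W. \<integral>\<^sup>+x. indicator {W<..} (ln x) * ennreal (p2 x / x) \<partial>M"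
  have "((\<lambda>n. \<integral>\<^sup>+x. indicator {real n<..} (ln x) * ennreal (p2 x / x) \<partial>M) \<longlongrightarrow> (\<integral>\<^sup>+x. 0 \<partial>M)) sequentially"
  proof (rule nn_integral_dominated_convergence[where w = "\<lambda>x. ennreal (p2 x / x)"])
    show "AE x in M. (\<lambda>n. indicator {real n<..} (ln x) * ennreal (p2 x / x)) \<longlonglongrightarrow> 0"
    proof (rule AE_I2)
      fix x
      have "\<forall>\<^sub>F n in sequentially. indicator {real n<..} (ln x) * ennreal (p2 x / x) = 0"
        using eventually_ge_at_top[of "nat \<lceil>ln x\<rceil>"] by eventually_elim (auto simp: indicator_def)
      then show "(\<lambda>n. indicator {real n<..} (ln x) * ennreal (p2 x / x)) \<longlonglongrightarrow> 0"
        by (rule tendsto_eventually)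
    qed
    show "AE x in M. indicator {real n<..} (ln x) * ennreal (p2 x / x) \<le> ennreal (p2 x / x)" for n
      by (auto simp: indicator_def)
  qed (use p2_sum in auto)
  then have "\<forall>\<^sub>F n in sequentially. ?tail (real n) < ennreal (e / 2)"
    using e by (intro order_tendstoD) auto
  then obtain n where n: "?tail (real n) < ennreal (e / 2)" by (auto simp: eventually_sequentially)
  \<comment> \<open>From \<open>V0\<close> on, the points with \<open>ln x \<le> n\<close>
    contribute at most \<open>n * c \<le> e * V / 2\<close>; for the others
    \<open>ln x \<le> V\<close> is played off against the tail of the convergent sum.\<close>
  define V0 where "V0 = 1 + 2 * real n * c / e"
  have V0: "V0 > 0" using e c by (auto simp: V0_def intro!: add_pos_nonneg)
  show thesis
  proof (rule that[OF V0])
    fix V assume V: "V \<ge> V0"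
    then have Vp: "V > 0" using V0 by simp
    have "rest V \<le> (\<integral>\<^sup>+x. ennreal (real n) * ennreal (p2 x / x) + ennreal V * (indicator {real n<..} (ln x) * ennreal (p2 x / x)) \<partial>M)"
      unfolding rest_def
    proof (intro nn_integral_mono_AE, use AE_M in eventually_elim)
      case (elim x)
      have p: "p2 x / x \<ge> 0" "ln x \<ge> 0" using elim p2_nonneg[of x] by auto
      have eq: "ennreal (p2 x * (ln x / x)) = ennreal (ln x) * ennreal (p2 x / x)"
        using p by (subst ennreal_mult[symmetric]) (auto simp: mult_ac)
      show ?case
      proof (cases "ln x \<le> real n")
        case True
        then have "indicator {..V} (ln x) * ennreal (p2 x * (ln x / x)) \<le> ennreal (real n) * ennreal (p2 x / x)"
          unfolding eq by (auto simp: indicator_def intro!: mult_right_mono)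
        then show ?thesis by (meson add_increasing2 zero_le order_trans)
      next
        case False
        then have "indicator {..V} (ln x) * ennreal (p2 x * (ln x / x)) \<le> ennreal V * (indicator {real n<..} (ln x) * ennreal (p2 x / x))"
          unfolding eq by (auto simp: indicator_def intro!: mult_right_mono ennreal_leI)
        then show ?thesis by (meson add_increasing zero_le order_trans)
      qed
    qed
    also have "\<dots> = ennreal (real n) * ennreal c + ennreal V * ?tail (real n)"
      by (subst nn_integral_add) (auto simp: nn_integral_cmult c)
    also have "\<dots> \<le> ennreal (real n) * ennreal c + ennreal V * ennreal (e / 2)"
      using n by (intro add_left_mono mult_left_mono) auto
    also have "\<dots> = ennreal (real n * c + V * (e / 2))"
      using c e Vp by (simp add: ennreal_mult[symmetric] ennreal_plus[symmetric] del: ennreal_plus)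
    also have "\<dots> \<le> ennreal (e * V)"
    proof (rule ennreal_leI)
      have "2 * real n * c / e \<le> V" using V by (simp add: V0_def)
      then have "2 * real n * c \<le> V * e" using e by (simp add: field_simps)
      then show "real n * c + V * (e / 2) \<le> e * V" by (simp add: mult_ac)
    qed
    finally show "rest V \<le> ennreal (e * V)" .
  qed
qed

end

context log_renewal
begin

lemma rest_mono: "V \<le> W \<Longrightarrow> rest V \<le> rest W"
  unfolding rest_def by (intro nn_integral_mono mult_right_mono) (auto simp: indicator_def)

text \<open>
  The window of length \<open>\<delta>\<close> makes the sum over the points of \<open>M\<close> in the renewal inequality an integral
  over increments; the price is \<open>\<epsilon>\<close>, the oscillation of \<open>T\<close> in the window.
\<close>

lemma incr_bound:
  assumes U: "U \<ge> 0" and H: "H \<ge> 0" and \<delta>: "0 < \<delta>" "\<delta> \<le> 1" and UH: "U + \<delta> + H \<le> 2 * U"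
    and osc: "\<And>u h. u \<ge> U \<Longrightarrow> h \<in> {0..\<delta>} \<Longrightarrow> norm (T (u + h) - T u) \<le> \<epsilon>"
    and I: "(\<integral>\<^sup>+u. indicator {0..2 * U} u * ennreal (norm (T u - A)) \<partial>lborel) \<le> ennreal (e1 * (2 * U))"
    and R: "rest (2 * U) \<le> ennreal (e2 * (2 * U))" and e: "e1 \<ge> 0" "e2 \<ge> 0"
  shows "\<delta> * U * norm (T (U + H) - T U) \<le>
    C1 * (2 * H * B + 4 * e1 * U) + \<delta> * (4 * B * e2 * U + 2 * C + H * B) + 2 * \<epsilon> * U * \<delta>"
proof -
  have \<epsilon>: "\<epsilon> \<ge> 0" using osc[of U 0] \<delta> by auto
  define c where "c = 2 * B * (e2 * (2 * U)) + (2 * C + H * B)"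
  have c: "c \<ge> 0" using B_nonneg C_nonneg H U e by (auto simp: c_def intro!: add_nonneg_nonneg mult_nonneg_nonneg)
  let ?G = "\<lambda>V. \<integral>\<^sup>+x. incr H (V - ln x) * ennreal (p1 x * (ln x / x)) \<partial>M"
  have pw: "ennreal U * incr H U \<le> ?G V + ennreal (c + 2 * \<epsilon> * U)" if V: "V \<in> {U..U + \<delta>}" for V
  proof -
    \<comment> \<open>The window is no longer than the scale of oscillation, so the increment at
      \<open>U\<close> may be replaced by the one at any \<open>V\<close> in the window, at the cost
      of \<open>\<epsilon>\<close> at either end.\<close>
    have "norm (T (U + H) - T U) \<le> norm (T (V + H) - T V) + norm (T (V + H) - T (U + H)) + norm (T V - T U)"
      using norm_triangle_ineq[of "T (V + H) - T V - (T (V + H) - T (U + H))" "T V - T U"]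
        norm_triangle_ineq4[of "T (V + H) - T V" "T (V + H) - T (U + H)"] by (simp add: algebra_simps)
    also have "norm (T (V + H) - T (U + H)) \<le> \<epsilon>" using osc[of "U + H" "V - U"] V H by (simp add: algebra_simps)
    also have "norm (T V - T U) \<le> \<epsilon>" using osc[of "U" "V - U"] V by simp
    finally have "norm (T (U + H) - T U) \<le> norm (T (V + H) - T V) + 2 * \<epsilon>" by simp
    then have "ennreal (norm (T (U + H) - T U)) \<le> ennreal (norm (T (V + H) - T V) + 2 * \<epsilon>)" by (rule ennreal_leI)
    also have "\<dots> = incr H V + ennreal (2 * \<epsilon>)" unfolding incr_def using \<epsilon> by (intro ennreal_plus) auto
    finally have "ennreal U * incr H U \<le> ennreal U * (incr H V + ennreal (2 * \<epsilon>))"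
      unfolding incr_def by (intro mult_left_mono) auto
    also have "\<dots> = ennreal U * incr H V + ennreal (2 * \<epsilon> * U)"
      using U \<epsilon> by (simp add: distrib_left ennreal_mult[symmetric] mult_ac)
    also have "\<dots> \<le> ?G V + ennreal (2 * B) * ennreal (e2 * (2 * U)) + ennreal (2 * C + H * B) + ennreal (2 * \<epsilon> * U)"
    proof (rule add_right_mono)
      have "ennreal U * incr H V \<le> ennreal V * incr H V"
        using V by (intro mult_right_mono ennreal_leI) auto
      also have "\<dots> \<le> ?G V + ennreal (2 * B) * rest (V + H) + ennreal (2 * C + H * B)"
        by (rule renewal_incr) (use V U H in auto)
      also have "\<dots> \<le> ?G V + ennreal (2 * B) * ennreal (e2 * (2 * U)) + ennreal (2 * C + H * B)"
        using V UH by (intro add_mono mult_left_mono order_refl order_trans[OF rest_mono R]) auto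
      finally show "ennreal U * incr H V \<le> \<dots>" .
    qed
    also have "?G V + ennreal (2 * B) * ennreal (e2 * (2 * U)) + ennreal (2 * C + H * B) + ennreal (2 * \<epsilon> * U)
       = ?G V + ennreal (c + 2 * \<epsilon> * U)"
    proof -
      have "ennreal (2 * B) * ennreal (e2 * (2 * U)) = ennreal (2 * B * (e2 * (2 * U)))"
        using B_nonneg e U by (intro ennreal_mult[symmetric]) auto
      moreover have "ennreal (2 * B * (e2 * (2 * U))) + ennreal (2 * C + H * B) = ennreal c"
        unfolding c_def using B_nonneg C_nonneg H U e by (intro ennreal_plus[symmetric]) auto
      moreover have "ennreal c + ennreal (2 * \<epsilon> * U) = ennreal (c + 2 * \<epsilon> * U)"
        using c \<epsilon> U by (intro ennreal_plus[symmetric]) auto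
      ultimately show ?thesis by (simp only: add.assoc)
    qed
    finally show ?thesis .
  qed
  let ?i = "\<lambda>V. indicator {U..U + \<delta>} V :: ennreal"
  have em: "(\<integral>\<^sup>+V. ?i V * a \<partial>lborel) = ennreal \<delta> * a" for a
    using \<delta> by (subst nn_integral_multc) auto
  have "ennreal \<delta> * (ennreal U * incr H U) = (\<integral>\<^sup>+V. ?i V * (ennreal U * incr H U) \<partial>lborel)"
    by (rule em[symmetric])
  also have "\<dots> \<le> (\<integral>\<^sup>+V. ?i V * ?G V + ?i V * ennreal (c + 2 * \<epsilon> * U) \<partial>lborel)"
    by (intro nn_integral_mono) (use pw in \<open>auto simp: indicator_def\<close>)
  also have "\<dots> = (\<integral>\<^sup>+V. ?i V * ?G V \<partial>lborel) + ennreal \<delta> * ennreal (c + 2 * \<epsilon> * U)"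
    by (subst nn_integral_add) (auto simp: em)
  also have "\<dots> \<le> ennreal C1 * (ennreal (2 * H * B) + 2 * ennreal (e1 * (2 * U))) + ennreal \<delta> * ennreal (c + 2 * \<epsilon> * U)"
  proof (rule add_right_mono)
    have "(\<integral>\<^sup>+V. ?i V * ?G V \<partial>lborel) \<le> ennreal C1 * (\<integral>\<^sup>+v. indicator {..U + \<delta>} v * incr H v \<partial>lborel)"
      by (rule nn_integral_incr_window) (use \<delta> in auto)
    also have "\<dots> \<le> ennreal C1 * (ennreal (2 * H * B) + 2 * (\<integral>\<^sup>+u. indicator {0..U + \<delta> + H} u * ennreal (norm (T u - A)) \<partial>lborel))"
      using U \<delta> H by (intro mult_left_mono nn_integral_incr_le) auto
    also have "\<dots> \<le> ennreal C1 * (ennreal (2 * H * B) + 2 * (\<integral>\<^sup>+u. indicator {0..2 * U} u * ennreal (norm (T u - A)) \<partial>lborel))"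
      using UH by (intro add_mono mult_left_mono order_refl nn_integral_mono mult_right_mono) (auto simp: indicator_def)
    also have "\<dots> \<le> ennreal C1 * (ennreal (2 * H * B) + 2 * ennreal (e1 * (2 * U)))"
      by (intro add_mono mult_left_mono order_refl I) auto
    finally show "(\<integral>\<^sup>+V. ?i V * ?G V \<partial>lborel) \<le> \<dots>" .
  qed
  also have "ennreal C1 * (ennreal (2 * H * B) + 2 * ennreal (e1 * (2 * U))) + ennreal \<delta> * ennreal (c + 2 * \<epsilon> * U) =
     ennreal (C1 * (2 * H * B + 2 * (e1 * (2 * U))) + \<delta> * (c + 2 * \<epsilon> * U))"
  proof -
    have "2 * ennreal (e1 * (2 * U)) = ennreal (2 * (e1 * (2 * U)))"
      using e U by (subst ennreal_mult) auto
    moreover have "ennreal (2 * H * B) + ennreal (2 * (e1 * (2 * U))) = ennreal (2 * H * B + 2 * (e1 * (2 * U)))"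
      using e U H B_nonneg by (intro ennreal_plus[symmetric]) auto
    moreover have "ennreal C1 * ennreal (2 * H * B + 2 * (e1 * (2 * U))) = ennreal (C1 * (2 * H * B + 2 * (e1 * (2 * U))))"
      using e U H B_nonneg C1_nonneg by (intro ennreal_mult[symmetric] add_nonneg_nonneg mult_nonneg_nonneg) auto
    moreover have "ennreal \<delta> * ennreal (c + 2 * \<epsilon> * U) = ennreal (\<delta> * (c + 2 * \<epsilon> * U))"
      using \<delta> c \<epsilon> U by (intro ennreal_mult[symmetric]) auto
    moreover have "ennreal (C1 * (2 * H * B + 2 * (e1 * (2 * U)))) + ennreal (\<delta> * (c + 2 * \<epsilon> * U)) =
       ennreal (C1 * (2 * H * B + 2 * (e1 * (2 * U))) + \<delta> * (c + 2 * \<epsilon> * U))"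
      using e U H B_nonneg C1_nonneg \<delta> c \<epsilon>
      by (intro ennreal_plus[symmetric] add_nonneg_nonneg mult_nonneg_nonneg) auto
    ultimately show ?thesis by (simp only:)
  qed
  finally have "ennreal \<delta> * (ennreal U * incr H U) \<le> ennreal (C1 * (2 * H * B + 2 * (e1 * (2 * U))) + \<delta> * (c + 2 * \<epsilon> * U))"
    .
  moreover have "ennreal \<delta> * (ennreal U * incr H U) = ennreal (\<delta> * U * norm (T (U + H) - T U))"
    unfolding incr_def using \<delta> U by (simp add: ennreal_mult mult.assoc)
  moreover have "C1 * (2 * H * B + 2 * (e1 * (2 * U))) + \<delta> * (c + 2 * \<epsilon> * U) \<ge> 0"
    using e U H B_nonneg C1_nonneg \<delta> c \<epsilon>
    by (intro add_nonneg_nonneg mult_nonneg_nonneg) auto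
  ultimately have "\<delta> * U * norm (T (U + H) - T U) \<le> C1 * (2 * H * B + 2 * (e1 * (2 * U))) + \<delta> * (c + 2 * \<epsilon> * U)"
    by (metis ennreal_le_iff)
  also have "\<dots> = C1 * (2 * H * B + 4 * e1 * U) + \<delta> * (4 * B * e2 * U + 2 * C + H * B) + 2 * \<epsilon> * U * \<delta>"
    by (simp add: c_def algebra_simps)
  finally show ?thesis .
qed

text \<open>Averaging over \<open>0 \<le> H \<le> \<eta> * U\<close> bounds \<open>T U - A\<close>
  by the mean of \<open>T (U + H) - T U\<close> plus the mean of \<open>T (U + H) - A\<close>. The
  constant is the one belonging to \<open>[0, 2 U]\<close>, an interval that contains all points and
  windows involved; hence \<open>A (2 * U)\<close> in the conclusion.\<close>

lemma tendsto_of_mean: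
  fixes A :: "real \<Rightarrow> complex"
  assumes mean: "\<And>e. e > 0 \<Longrightarrow> \<forall>\<^sub>F X in at_top.
     (\<integral>\<^sup>+u. indicator {0..X} u * ennreal (norm (T u - A X)) \<partial>lborel) \<le> ennreal (e * X)"
  shows "((\<lambda>U. T U - A (2 * U)) \<longlongrightarrow> 0) at_top"
proof (rule tendstoI)
  fix \<epsilon>' :: real assume \<epsilon>': "\<epsilon>' > 0"
  \<comment> \<open>Seven \<epsilon> are spent below, six on the increments and one on the mean; 8
    leaves a strict inequality.\<close>
  define \<epsilon> where "\<epsilon> = \<epsilon>' / 8"
  have \<epsilon>: "\<epsilon> > 0" using \<epsilon>' by (simp add: \<epsilon>_def)
  from T_osc[OF \<epsilon>] obtain \<delta>' u0 where \<delta>': "\<delta>' > 0"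
    and osc': "\<forall>u\<ge>u0. \<forall>h\<in>{0..\<delta>'}. norm (T (u + h) - T u) \<le> \<epsilon>" by auto
  define \<delta> where "\<delta> = min \<delta>' 1"
  have \<delta>: "0 < \<delta>" "\<delta> \<le> 1" using \<delta>' by (auto simp: \<delta>_def)
  have osc: "norm (T (u + h) - T u) \<le> \<epsilon>" if "u \<ge> u0" "h \<in> {0..\<delta>}" for u h
    using osc' that by (auto simp: \<delta>_def)
  \<comment> \<open>The second entry keeps the terms of \<open>incr_bound\<close> that are linear in
    \<open>H\<close> below \<open>\<epsilon> * \<delta> * U\<close> for
    \<open>H \<le> \<eta> * U\<close>; the first one keeps \<open>U + \<delta> + H\<close> below
    \<open>2 * U\<close>.\<close>
  define \<eta> where "\<eta> = min (1 / 2) (\<epsilon> * \<delta> / (2 * C1 * B + B + 1))"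
  have den: "2 * C1 * B + B + 1 > 0" using B_nonneg C1_nonneg by (intro add_nonneg_pos) auto
  have \<eta>: "\<eta> > 0" using \<epsilon> \<delta> den by (auto simp: \<eta>_def)
  have \<eta>1: "\<eta> \<le> 1 / 2" unfolding \<eta>_def by (rule min.cobounded1)
  have \<eta>2: "(2 * C1 * B + \<delta> * B) * \<eta> \<le> \<epsilon> * \<delta>"
  proof -
    have "(2 * C1 * B + \<delta> * B) * \<eta> \<le> (2 * C1 * B + B + 1) * (\<epsilon> * \<delta> / (2 * C1 * B + B + 1))"
      using B_nonneg C1_nonneg \<delta> \<eta> den mult_right_mono[OF \<delta>(2) B_nonneg]
      by (intro mult_mono) (auto simp: \<eta>_def)
    then show ?thesis using den by simp
  qed
  \<comment> \<open>Two demands: the increments have to be small, and the error of the mean over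
    \<open>[0, 2 U]\<close> has to be small relative to a subinterval of length
    \<open>\<eta> * U\<close>.\<close>
  define e1 where "e1 = min (\<epsilon> * \<delta> / (4 * C1 + 1)) (\<epsilon> * \<eta> / 2)"
  have "e1 > 0" using \<epsilon> \<delta> \<eta> C1_nonneg by (auto simp: e1_def)
  moreover have "e1 \<le> \<epsilon> * \<eta> / 2" unfolding e1_def by (rule min.cobounded2)
  ultimately have e1: "e1 > 0" "e1 \<le> \<epsilon> * \<eta> / 2" by auto
  have e1': "4 * C1 * e1 \<le> \<epsilon> * \<delta>"
  proof -
    have "4 * C1 * e1 \<le> (4 * C1 + 1) * (\<epsilon> * \<delta> / (4 * C1 + 1))"
      using C1_nonneg e1 by (intro mult_mono) (auto simp: e1_def)
    then show ?thesis using C1_nonneg by simp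
  qed
  define e2 where "e2 = \<epsilon> / (4 * B + 1)"
  have e2: "e2 > 0" using \<epsilon> B_nonneg by (auto simp: e2_def intro!: divide_pos_pos add_nonneg_pos)
  have e2': "4 * B * e2 \<le> \<epsilon>"
  proof -
    have "4 * B * e2 \<le> (4 * B + 1) * e2" using e2 by (intro mult_right_mono) auto
    then show ?thesis using B_nonneg by (simp add: e2_def add_nonneg_pos)
  qed
  obtain V0 where V0: "\<And>V. V \<ge> V0 \<Longrightarrow> rest V \<le> ennreal (e2 * V)"
    using rest_small[OF e2] by metis
  from mean[OF e1(1)] obtain X0 where X0: "\<And>X. X \<ge> X0 \<Longrightarrow>
      (\<integral>\<^sup>+u. indicator {0..X} u * ennreal (norm (T u - A X)) \<partial>lborel) \<le> ennreal (e1 * X)"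
    by (auto simp: eventually_at_top_linorder)
  \<comment> \<open>\<open>U \<ge> 2\<close> gives \<open>\<delta> \<le> U / 2\<close>, and the last
    entry absorbs the constant error \<open>2 * C\<close> of the renewal inequality.\<close>
  define U0 where "U0 = Max {2, u0, V0, X0, 2 * C / \<epsilon>}"
  have bound: "dist (T U - A (2 * U)) 0 < \<epsilon>'" if U: "U \<ge> U0" for U
  proof -
    have U': "U \<ge> 2" "U \<ge> u0" "U \<ge> V0" "U \<ge> X0" "U \<ge> 2 * C / \<epsilon>" using U by (auto simp: U0_def)
    then have Up: "U > 0" "2 * U \<ge> V0" "2 * U \<ge> X0" by auto
    have CU: "2 * C \<le> \<epsilon> * U" using U'(5) \<epsilon> by (simp add: field_simps)
    have \<eta>half: "\<eta> * U \<le> U / 2" using mult_right_mono[OF \<eta>1, of U] Up by simp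
    have incr6: "norm (T (U + H) - T U) \<le> 6 * \<epsilon>" if H: "H \<in> {0..\<eta> * U}" for H
    proof -
      have HU: "H \<le> U / 2" using H \<eta>half by auto
      have "\<delta> * U * norm (T (U + H) - T U) \<le>
        C1 * (2 * H * B + 4 * e1 * U) + \<delta> * (4 * B * e2 * U + 2 * C + H * B) + 2 * \<epsilon> * U * \<delta>"
      proof (rule incr_bound)
        show "U + \<delta> + H \<le> 2 * U" using HU \<delta> U' by linarith
      qed (use Up H \<delta> osc U' X0[OF Up(3)] V0[OF Up(2)] e1 e2 in auto)
      also have "\<dots> = (2 * C1 * B + \<delta> * B) * H + (4 * C1 * e1) * U + \<delta> * (4 * B * e2) * U + \<delta> * (2 * C) + 2 * \<epsilon> * U * \<delta>"
        by (simp add: algebra_simps)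
      \<comment> \<open>Every term but the last becomes one multiple of
        \<open>\<epsilon> * \<delta> * U\<close>, by the choices of \<eta>, \<open>e1\<close>,
        \<open>e2\<close> and \<open>U0\<close> in this order (the first one in the next step); the
        oscillation in the window counts twice, which makes six.\<close>
      also have "\<dots> \<le> (2 * C1 * B + \<delta> * B) * (\<eta> * U) + (\<epsilon> * \<delta>) * U + \<delta> * \<epsilon> * U + \<delta> * (\<epsilon> * U) + 2 * \<epsilon> * U * \<delta>"
        by (intro order_refl add_mono mult_left_mono mult_right_mono e1' e2' CU)
           (use H \<delta> Up B_nonneg C1_nonneg in auto)
      also have "\<dots> \<le> (\<epsilon> * \<delta>) * U + (\<epsilon> * \<delta>) * U + \<delta> * \<epsilon> * U + \<delta> * (\<epsilon> * U) + 2 * \<epsilon> * U * \<delta>"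
      proof (intro add_right_mono)
        show "(2 * C1 * B + \<delta> * B) * (\<eta> * U) \<le> (\<epsilon> * \<delta>) * U"
          using mult_right_mono[OF \<eta>2, of U] Up by (simp add: mult.assoc)
      qed
      also have "\<dots> = \<delta> * U * (6 * \<epsilon>)"
        by (simp add: algebra_simps)
      finally show ?thesis using \<delta> Up by simp
    qed
    let ?Y = "norm (T U - A (2 * U))"
    let ?i = "\<lambda>H. indicator {0..\<eta> * U} H :: ennreal"
    have \<eta>U: "\<eta> * U \<ge> 0" "U + \<eta> * U \<le> 2 * U"
      using \<eta> \<eta>half Up by auto
    have em: "(\<integral>\<^sup>+H. ?i H * a \<partial>lborel) = ennreal (\<eta> * U) * a" for a
      using \<eta>U by (subst nn_integral_multc) auto
    have "ennreal (\<eta> * U) * ennreal ?Y = (\<integral>\<^sup>+H. ?i H * ennreal ?Y \<partial>lborel)" by (rule em[symmetric])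
    also have "\<dots> \<le> (\<integral>\<^sup>+H. ?i H * ennreal (6 * \<epsilon>) + ?i H * ennreal (norm (T (U + H) - A (2 * U))) \<partial>lborel)"
    proof (rule nn_integral_mono)
      fix H :: real
      show "?i H * ennreal ?Y \<le> ?i H * ennreal (6 * \<epsilon>) + ?i H * ennreal (norm (T (U + H) - A (2 * U)))"
      proof (cases "H \<in> {0..\<eta> * U}")
        case True
        have "?Y \<le> 6 * \<epsilon> + norm (T (U + H) - A (2 * U))"
          using norm_triangle_ineq4[of "T (U + H) - A (2 * U)" "T (U + H) - T U"] incr6[OF True] by simp
        then have "ennreal ?Y \<le> ennreal (6 * \<epsilon> + norm (T (U + H) - A (2 * U)))" by (rule ennreal_leI)
        also have "\<dots> = ennreal (6 * \<epsilon>) + ennreal (norm (T (U + H) - A (2 * U)))"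
          using \<epsilon> by (intro ennreal_plus) auto
        finally show ?thesis using True by simp
      qed simp
    qed
    also have "\<dots> = ennreal (\<eta> * U) * ennreal (6 * \<epsilon>) + (\<integral>\<^sup>+H. ?i H * ennreal (norm (T (U + H) - A (2 * U))) \<partial>lborel)"
      by (subst nn_integral_add) (auto simp: em)
    also have "\<dots> \<le> ennreal (\<eta> * U) * ennreal (6 * \<epsilon>) + ennreal (\<eta> * U * \<epsilon>)"
    proof (rule add_left_mono)
      have "(\<integral>\<^sup>+H. ?i H * ennreal (norm (T (U + H) - A (2 * U))) \<partial>lborel) \<le>
        (\<integral>\<^sup>+H. indicator {0..2 * U} (U + H) * ennreal (norm (T (U + H) - A (2 * U))) \<partial>lborel)"
      proof (intro nn_integral_mono mult_right_mono)
        fix H :: real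
        have "U + H \<le> 2 * U" if "H \<le> \<eta> * U" using that \<eta>U by linarith
        then show "?i H \<le> indicator {0..2 * U} (U + H)"
          using Up by (auto simp: indicator_def)
      qed simp
      also have "\<dots> = (\<integral>\<^sup>+u. indicator {0..2 * U} u * ennreal (norm (T u - A (2 * U))) \<partial>lborel)"
        using nn_integral_real_affine[of "\<lambda>u. indicator {0..2 * U} u * ennreal (norm (T u - A (2 * U)))" 1 U] by simp
      also have "\<dots> \<le> ennreal (e1 * (2 * U))" by (rule X0[OF Up(3)])
      also have "\<dots> \<le> ennreal (\<eta> * U * \<epsilon>)"
      proof (rule ennreal_leI)
        have "e1 * (2 * U) \<le> (\<epsilon> * \<eta> / 2) * (2 * U)" using e1 Up by (intro mult_right_mono) auto
        then show "e1 * (2 * U) \<le> \<eta> * U * \<epsilon>" by (simp add: mult_ac)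
      qed
      finally show "(\<integral>\<^sup>+H. ?i H * ennreal (norm (T (U + H) - A (2 * U))) \<partial>lborel) \<le> \<dots>" .
    qed
    also have "ennreal (\<eta> * U) * ennreal (6 * \<epsilon>) + ennreal (\<eta> * U * \<epsilon>) = ennreal (\<eta> * U * (7 * \<epsilon>))"
    proof -
      have "ennreal (\<eta> * U) * ennreal (6 * \<epsilon>) = ennreal (\<eta> * U * (6 * \<epsilon>))"
        using \<eta>U \<epsilon> by (intro ennreal_mult[symmetric]) auto
      moreover have "ennreal (\<eta> * U * (6 * \<epsilon>)) + ennreal (\<eta> * U * \<epsilon>) = ennreal (\<eta> * U * (6 * \<epsilon>) + \<eta> * U * \<epsilon>)"
        using \<eta>U \<epsilon> by (intro ennreal_plus[symmetric]) auto
      ultimately show ?thesis by (simp add: algebra_simps)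
    qed
    finally have "ennreal (\<eta> * U) * ennreal ?Y \<le> ennreal (\<eta> * U * (7 * \<epsilon>))" .
    moreover have "ennreal (\<eta> * U) * ennreal ?Y = ennreal (\<eta> * U * ?Y)"
      using \<eta>U by (intro ennreal_mult[symmetric]) auto
    ultimately have "\<eta> * U * ?Y \<le> \<eta> * U * (7 * \<epsilon>)"
      using \<eta>U \<epsilon> ennreal_le_iff[of "\<eta> * U * (7 * \<epsilon>)"] by simp
    then have "?Y \<le> 7 * \<epsilon>" using \<eta> Up by simp
    then show ?thesis using \<epsilon>' by (simp add: \<epsilon>_def)
  qed
  then show "\<forall>\<^sub>F U in at_top. dist (T U - A (2 * U)) 0 < \<epsilon>'"
    using eventually_at_top_linorder by blast
qed

end

section \<open>Mean values from transforms\<close>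

lemma nn_integral_exp_decay:
  fixes a :: real
  assumes "a > 0"
  shows "(\<integral>\<^sup>+u. indicator {0..} u * ennreal (exp (- a * u)) \<partial>lborel) = ennreal (1 / a)"
proof -
  have lim: "((\<lambda>u. - exp (- a * u) / a) \<longlongrightarrow> 0) at_top"
  proof -
    have "filterlim (\<lambda>u. - a * u) at_bot at_top"
      using assms filterlim_tendsto_neg_mult_at_bot[of "\<lambda>_. - a" "- a" at_top "\<lambda>u. u"]
      by (simp add: filterlim_ident)
    then have "((\<lambda>u. exp (- a * u)) \<longlongrightarrow> 0) at_top"
      by (rule filterlim_compose[OF exp_at_bot])
    then have "((\<lambda>u. - (exp (- a * u) / a)) \<longlongrightarrow> - (0 / a)) at_top"
      by (intro tendsto_intros) (use assms in auto)
    then show ?thesis by simp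
  qed
  have "(\<integral>\<^sup>+u. ennreal (exp (- a * u)) * indicator {0..} u \<partial>lborel) = ennreal (0 - (- exp (- a * 0) / a))"
    by (rule nn_integral_FTC_atLeast[OF _ _ _ lim]) (use assms in \<open>auto intro!: derivative_eq_intros\<close>)
  then show ?thesis by (simp add: mult.commute)
qed

lemma
  fixes a :: real
  assumes "a > 0"
  shows integrable_exp_decay: "integrable lborel (\<lambda>u. indicator {0..} u * exp (- a * u))"
    and integral_exp_decay: "(\<integral>u. indicator {0..} u * exp (- a * u) \<partial>lborel) = 1 / a"
proof -
  have e: "ennreal (indicator {0..} u * exp (- a * u)) = indicator {0..} u * ennreal (exp (- a * u))" for u :: real
    by (auto simp: indicator_def)
  have "(\<integral>\<^sup>+u. ennreal (indicator {0..} u * exp (- a * u)) \<partial>lborel) = ennreal (1 / a)"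
    unfolding e by (rule nn_integral_exp_decay[OF assms])
  then have "has_bochner_integral lborel (\<lambda>u. indicator {0..} u * exp (- a * u)) (1 / a)"
    using assms by (intro has_bochner_integral_nn_integral) auto
  then show "integrable lborel (\<lambda>u. indicator {0..} u * exp (- a * u))"
    "(\<integral>u. indicator {0..} u * exp (- a * u) \<partial>lborel) = 1 / a"
    by (auto simp: has_bochner_integral_iff)
qed

lemma
  assumes z: "Re z > 0"
  shows integrable_cexp_decay: "integrable lborel (\<lambda>u. indicator {0..} u * exp (- z * of_real u) :: complex)"
    and integral_cexp_decay: "(\<integral>u. indicator {0..} u * exp (- z * of_real u) \<partial>lborel) = 1 / z"
proof -
  let ?f = "\<lambda>u. indicator {0..} u * exp (- z * of_real u) :: complex"
  have z0: "z \<noteq> 0" using z by auto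
  show i: "integrable lborel ?f"
    by (rule Bochner_Integration.integrable_bound[OF integrable_exp_decay[OF z]]) (auto simp: norm_mult indicator_def)
  have "((\<lambda>n. \<integral>u. indicator {0..real n} u *\<^sub>R exp (- z * of_real u) \<partial>lborel) \<longlongrightarrow> (\<integral>u. ?f u \<partial>lborel)) sequentially"
  proof (rule integral_dominated_convergence)
    show "integrable lborel (\<lambda>u. indicator {0..} u * exp (- Re z * u))" by (rule integrable_exp_decay[OF z])
    show "AE u in lborel. (\<lambda>n. indicator {0..real n} u *\<^sub>R exp (- z * of_real u)) \<longlonglongrightarrow> ?f u"
    proof (rule AE_I2)
      fix u :: real
      have "\<forall>\<^sub>F n in sequentially. indicator {0..real n} u *\<^sub>R exp (- z * of_real u) = ?f u"
        using eventually_ge_at_top[of "nat \<lceil>u\<rceil>"] by eventually_elim (auto simp: indicator_def)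
      then show "(\<lambda>n. indicator {0..real n} u *\<^sub>R exp (- z * of_real u)) \<longlonglongrightarrow> ?f u"
        by (rule tendsto_eventually)
    qed
    show "AE u in lborel. norm (indicator {0..real n} u *\<^sub>R exp (- z * of_real u)) \<le> indicator {0..} u * exp (- Re z * u)" for n
      by (auto simp: indicator_def)
  qed auto
  moreover have "(\<integral>u. indicator {0..real n} u *\<^sub>R exp (- z * of_real u) \<partial>lborel) =
    - exp (- z * of_real (real n)) / z - (- exp (- z * of_real 0) / z)" for n
  proof (rule integral_FTC_Icc)
    fix x :: real
    have "((\<lambda>s. - exp (- z * s) / z) has_field_derivative exp (- z * of_real x)) (at (of_real x))"
      using z0 by (auto intro!: derivative_eq_intros)
    then show "((\<lambda>u. - exp (- z * of_real u) / z) has_vector_derivative exp (- z * of_real x)) (at x within {0..real n})"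
      using has_vector_derivative_real_field has_vector_derivative_at_within by blast
  qed (auto intro!: continuous_intros)
  moreover have "((\<lambda>n. - exp (- z * of_real (real n)) / z - (- exp (- z * of_real 0) / z)) \<longlongrightarrow> - 0 / z - (- exp (- z * of_real 0) / z)) sequentially"
  proof (intro tendsto_intros)
    have "((\<lambda>n. exp (- Re z * real n)) \<longlongrightarrow> 0) sequentially"
    proof (rule filterlim_compose[OF exp_at_bot])
      show "filterlim (\<lambda>n. - Re z * real n) at_bot sequentially"
        using z filterlim_tendsto_neg_mult_at_bot[of "\<lambda>_. - Re z" "- Re z" sequentially real]
        by (simp add: filterlim_real_sequentially)
    qed
    then show "((\<lambda>n. exp (- z * of_real (real n))) \<longlongrightarrow> 0) sequentially"
      by (subst tendsto_norm_zero_iff[symmetric]) simp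
  qed (use z0 in auto)
  ultimately show "(\<integral>u. ?f u \<partial>lborel) = 1 / z"
    using LIMSEQ_unique by fastforce
qed

section \<open>Mean squares of a slowly oscillating function\<close>

locale slowly_oscillating =
  fixes T :: "real \<Rightarrow> complex" and B :: real
  assumes T_meas[measurable]: "T \<in> borel_measurable borel"
    and T_bound: "\<And>u. norm (T u) \<le> B" and T_neg: "\<And>u. u < 0 \<Longrightarrow> T u = 0"
    and T_osc: "\<And>\<epsilon>. \<epsilon> > 0 \<Longrightarrow> \<exists>\<delta>>0. \<exists>u0. \<forall>u\<ge>u0. \<forall>h\<in>{0..\<delta>}. norm (T (u + h) - T u) \<le> \<epsilon>"
begin

lemma B_nonneg: "B \<ge> 0"
  using T_bound[of 0] norm_ge_zero order_trans by blast

text \<open>The constant \<open>A\<close> stands for the slowly varying main term at the scale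
  \<open>1 / w\<close>. On the side of the transform its subtraction removes the simple pole
  \<open>A / (w + i t)\<close>.\<close>

definition damped :: "complex \<Rightarrow> real \<Rightarrow> real \<Rightarrow> complex" where
  "damped A w u = indicator {0..} u * ((T u - A) * of_real (exp (- w * u)))"

lemma damped_measurable[measurable]: "damped A w \<in> borel_measurable borel"
  unfolding damped_def by measurable

lemma norm_damped_le: "norm (damped A w u) \<le> (B + norm A) * (indicator {0..} u * exp (- w * u))"
proof -
  have "norm (T u - A) \<le> B + norm A" using norm_triangle_ineq4[of "T u" A] T_bound[of u] by linarith
  then show ?thesis by (auto simp: damped_def indicator_def norm_mult intro!: mult_right_mono)
qed

lemma integrable_damped: "w > 0 \<Longrightarrow> integrable lborel (damped A w)"
proof -
  assume w: "w > 0"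
  show "integrable lborel (damped A w)"
  proof (rule Bochner_Integration.integrable_bound)
    show "integrable lborel (\<lambda>u. (B + norm A) * (indicator {0..} u * exp (- w * u)))"
      by (intro integrable_mult_right integrable_exp_decay w)
    show "AE u in lborel. norm (damped A w u) \<le> norm ((B + norm A) * (indicator {0..} u * exp (- w * u)))"
      unfolding real_norm_def by (intro AE_I2 order_trans[OF norm_damped_le abs_ge_self])
  qed simp
qed

lemma
  assumes w: "w > 0"
  shows integrable_damped_square: "integrable lborel (\<lambda>u. (norm (damped A w u))\<^sup>2)"
    and integral_damped_square_le: "(\<integral>u. (norm (damped A w u))\<^sup>2 \<partial>lborel) \<le> (B + norm A)\<^sup>2 / (2 * w)"
proof -
  have le: "(norm (damped A w u))\<^sup>2 \<le> (B + norm A)\<^sup>2 * (indicator {0..} u * exp (- (2 * w) * u))" for u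
  proof -
    have "(norm (damped A w u))\<^sup>2 \<le> ((B + norm A) * (indicator {0..} u * exp (- w * u)))\<^sup>2"
      by (intro power_mono norm_damped_le) simp
    also have "\<dots> = (B + norm A)\<^sup>2 * (indicator {0..} u * exp (- (2 * w) * u))"
      by (auto simp: power_mult_distrib indicator_def power2_eq_square simp flip: exp_add)
    finally show ?thesis .
  qed
  have i: "integrable lborel (\<lambda>u. (B + norm A)\<^sup>2 * (indicator {0..} u * exp (- (2 * w) * u)))"
    using w by (intro integrable_mult_right integrable_exp_decay) auto
  show i2: "integrable lborel (\<lambda>u. (norm (damped A w u))\<^sup>2)"
  proof (rule Bochner_Integration.integrable_bound[OF i])
    show "AE u in lborel. norm ((norm (damped A w u))\<^sup>2) \<le> norm ((B + norm A)\<^sup>2 * (indicator {0..} u * exp (- (2 * w) * u)))"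
      using order_trans[OF le abs_ge_self] by (intro AE_I2) simp
  qed simp
  have "(\<integral>u. (norm (damped A w u))\<^sup>2 \<partial>lborel) \<le> (\<integral>u. (B + norm A)\<^sup>2 * (indicator {0..} u * exp (- (2 * w) * u)) \<partial>lborel)"
    by (rule integral_mono[OF i2 i le])
  also have "\<dots> = (B + norm A)\<^sup>2 * (1 / (2 * w))"
    using w by (simp only: integral_mult_right_zero integral_exp_decay)
  finally show "(\<integral>u. (norm (damped A w u))\<^sup>2 \<partial>lborel) \<le> (B + norm A)\<^sup>2 / (2 * w)" by simp
qed

lemma fourier_damped:
  assumes w: "w > 0"
  shows "fourier (damped A w) t = fourier (damped 0 w) t - A / Complex w t"
proof -
  have eq: "damped A w u * exp (- \<i> * of_real (t * u)) = damped 0 w u * exp (- \<i> * of_real (t * u))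
     - A * (indicator {0..} u * exp (- Complex w t * of_real u))" for u
  proof -
    have "- Complex w t * of_real u = of_real (- w * u) + (- \<i> * of_real (t * u))"
      by (simp add: complex_eq_iff)
    then have "exp (- Complex w t * of_real u) = of_real (exp (- w * u)) * exp (- \<i> * of_real (t * u))"
      by (simp only: exp_add exp_of_real)
    then show ?thesis by (auto simp: damped_def indicator_def algebra_simps)
  qed
  have "integrable lborel (\<lambda>u. damped 0 w u * exp (- \<i> * of_real (t * u)))"
    by (rule Bochner_Integration.integrable_bound[OF integrable_damped[OF w]]) (auto simp: norm_mult)
  moreover have "integrable lborel (\<lambda>u. A * (indicator {0..} u * exp (- Complex w t * of_real u)))"
    by (intro integrable_mult_right integrable_cexp_decay) (use w in auto)
  ultimately have "fourier (damped A w) t = fourier (damped 0 w) t - (\<integral>u. A * (indicator {0..} u * exp (- Complex w t * of_real u)) \<partial>lborel)"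
    unfolding fourier_def eq by (rule Bochner_Integration.integral_diff)
  also have "(\<integral>u. A * (indicator {0..} u * exp (- Complex w t * of_real u)) \<partial>lborel) = A * (1 / Complex w t)"
    using w by (subst integral_mult_right_zero, subst integral_cexp_decay) auto
  finally show ?thesis by simp
qed

text \<open>Three ranges of \<open>u\<close>: below \<open>h\<close> the translate is absent, up to
  \<open>h + u0\<close> only trivial bounds hold, and both contributions stay bounded as
  \<open>w\<close> tends to 0. Beyond, the oscillation \<open>\<epsilon>\<close> and the drift
  \<open>(B + a) * w\<close> of the weight are multiplied by the shifted weight, whose square has
  integral \<open>1 / (2 * w)\<close>.\<close>

lemma damped_increment:
  assumes w: "w > 0" "w \<le> 1" and h: "0 \<le> h" "h \<le> \<delta>" "\<delta> \<le> 1" and u0: "u0 \<ge> 0" and \<epsilon>: "\<epsilon> \<ge> 0"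
    and osc: "\<And>u h. u \<ge> u0 \<Longrightarrow> h \<in> {0..\<delta>} \<Longrightarrow> norm (T (u + h) - T u) \<le> \<epsilon>"
    and A: "norm A \<le> a"
  shows "(\<integral>u. (norm (damped A w u - damped A w (u - h)))\<^sup>2 \<partial>lborel) \<le>
     (B + a)\<^sup>2 + u0 * (2 * B + (B + a))\<^sup>2 + (\<epsilon> + (B + a) * w)\<^sup>2 / (2 * w)"
proof -
  define B1 where "B1 = B + a"
  have a: "a \<ge> 0" using A norm_ge_zero order_trans by blast
  have B1: "B1 \<ge> 0" using B_nonneg a by (simp add: B1_def)
  have TA: "norm (T u - A) \<le> B1" for u
    using norm_triangle_ineq4[of "T u" A] T_bound[of u] A unfolding B1_def by linarith
  have db: "norm (damped A w u) \<le> B1" for u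
  proof -
    have "norm (T u - A) * exp (- w * u) \<le> B1 * 1" if "u \<ge> 0"
      using that TA w by (intro mult_mono) (auto simp: B1)
    then show ?thesis by (auto simp: damped_def indicator_def norm_mult B1)
  qed
  have step: "norm (damped A w (v + h) - damped A w v) \<le> (norm (T (v + h) - T v) + B1 * w) * exp (- w * v)" if v: "v \<ge> 0" for v
  proof -
    have vh: "v + h \<ge> 0" using v h by simp
    have e: "exp (- w * (v + h)) = exp (- w * v) * exp (- w * h)" by (simp add: algebra_simps flip: exp_add)
    have "damped A w (v + h) - damped A w v = of_real (exp (- w * v)) *
      ((T (v + h) - T v) + (T (v + h) - A) * of_real (exp (- w * h) - 1))"
      unfolding damped_def using v vh e by (simp add: algebra_simps)
    also have "norm \<dots> \<le> exp (- w * v) * (norm (T (v + h) - T v) + B1 * w)"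
      unfolding norm_mult
    proof (rule mult_mono)
      have "exp (- w * h) \<ge> 1 - w"
      proof -
        have "1 + (- w * h) \<le> exp (- w * h)" by (rule exp_ge_add_one_self)
        moreover have "w * h \<le> w * 1" using w h by (intro mult_left_mono) auto
        ultimately show ?thesis by simp
      qed
      moreover have "exp (- w * h) \<le> 1" using w h by simp
      ultimately have "\<bar>exp (- w * h) - 1\<bar> \<le> w" by simp
      then have "norm ((T (v + h) - A) * of_real (exp (- w * h) - 1)) \<le> B1 * w"
        unfolding norm_mult norm_of_real using TA B1 by (intro mult_mono) auto
      then show "norm ((T (v + h) - T v) + (T (v + h) - A) * of_real (exp (- w * h) - 1)) \<le> norm (T (v + h) - T v) + B1 * w"
        by (intro order_trans[OF norm_triangle_ineq]) auto
    qed auto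
    finally show ?thesis by (simp add: mult.commute)
  qed
  let ?D = "\<lambda>u. (norm (damped A w u - damped A w (u - h)))\<^sup>2"
  let ?G = "\<lambda>u. B1\<^sup>2 * indicator {0..h} u + (2 * B + B1)\<^sup>2 * indicator {h..h + u0} u
     + (\<epsilon> + B1 * w)\<^sup>2 * (indicator {0..} (- h + u) * exp (- (2 * w) * (- h + u)))"
  have pw: "?D u \<le> ?G u" for u
  proof -
    have nn: "0 \<le> (\<epsilon> + B1 * w)\<^sup>2 * (indicator {0..} (- h + u) * exp (- (2 * w) * (- h + u)))"
      "0 \<le> B1\<^sup>2 * indicator {0..h} u" "0 \<le> (2 * B + B1)\<^sup>2 * indicator {h..h + u0} u"
      by (auto simp: indicator_def)
    consider "u < 0" | "0 \<le> u" "u < h" | "h \<le> u" "u \<le> h + u0" | "u > h + u0" by linarith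
    then show ?thesis
    proof cases
      case 1
      then show ?thesis using h nn by (simp add: damped_def)
    next
      case 2
      then have "?D u = (norm (damped A w u))\<^sup>2" by (simp add: damped_def)
      also have "\<dots> \<le> B1\<^sup>2" by (intro power_mono db) auto
      finally show ?thesis using 2 by simp
    next
      case 3
      have "norm (damped A w u - damped A w (u - h)) \<le> (norm (T u - T (u - h)) + B1 * w) * exp (- w * (u - h))"
        using step[of "u - h"] 3 by simp
      also have "\<dots> \<le> (2 * B + B1) * 1"
      proof (intro mult_mono add_mono)
        show "norm (T u - T (u - h)) \<le> 2 * B"
          using norm_triangle_ineq4[of "T u" "T (u - h)"] T_bound[of u] T_bound[of "u - h"] by linarith
        show "B1 * w \<le> B1" using w B1 mult_left_mono[of w 1 B1] by simp
      qed (use B_nonneg B1 w 3 in auto)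
      finally have "?D u \<le> (2 * B + B1)\<^sup>2" by (intro power_mono) auto
      then show ?thesis using 3 nn(1) nn(2) by (simp add: add_increasing add_increasing2 del: mult_minus_left)
    next
      case 4
      have "norm (damped A w u - damped A w (u - h)) \<le> (norm (T u - T (u - h)) + B1 * w) * exp (- w * (u - h))"
        using step[of "u - h"] 4 u0 by simp
      also have "\<dots> \<le> (\<epsilon> + B1 * w) * exp (- w * (u - h))"
        using osc[of "u - h" h] 4 h by (intro mult_right_mono add_right_mono) auto
      finally have "?D u \<le> ((\<epsilon> + B1 * w) * exp (- w * (u - h)))\<^sup>2" by (intro power_mono) auto
      also have "\<dots> = (\<epsilon> + B1 * w)\<^sup>2 * exp (- (2 * w) * (- h + u))"
        by (simp add: power_mult_distrib power2_eq_square algebra_simps flip: exp_add)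
      finally show ?thesis using 4 u0 by simp
    qed
  qed
  have gi: "integrable lborel (\<lambda>u. indicator {0..} (- h + u) * exp (- (2 * w) * (- h + u)))"
    "(\<integral>u. indicator {0..} (- h + u) * exp (- (2 * w) * (- h + u)) \<partial>lborel) = 1 / (2 * w)"
    using lborel_integrable_real_affine[OF integrable_exp_decay[of "2 * w"], of 1 "- h"] w
      lborel_integral_real_affine[of 1 "\<lambda>u. indicator {0..} u * exp (- (2 * w) * u)" "- h"] integral_exp_decay[of "2 * w"] by auto
  have ii: "integrable lborel (indicator {x..y} :: real \<Rightarrow> real)" for x y :: real
    by (intro integrable_real_indicator) (auto simp: emeasure_lborel_Icc_eq)
  have iG: "integrable lborel ?G"
    by (intro Bochner_Integration.integrable_add integrable_mult_right gi ii)
  have iD: "integrable lborel ?D"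
  proof (rule Bochner_Integration.integrable_bound[OF iG])
    show "AE u in lborel. norm (?D u) \<le> norm (?G u)"
      using order_trans[OF pw abs_ge_self] by (intro AE_I2) simp
  qed simp
  have "(\<integral>u. ?D u \<partial>lborel) \<le> (\<integral>u. ?G u \<partial>lborel)"
    by (rule integral_mono[OF iD iG pw])
  also have "\<dots> = B1\<^sup>2 * h + (2 * B + B1)\<^sup>2 * u0 + (\<epsilon> + B1 * w)\<^sup>2 * (1 / (2 * w))"
    using h u0 by (simp only: Bochner_Integration.integral_add Bochner_Integration.integrable_add integrable_mult_right gi ii integral_mult_right_zero) simp
  also have "B1\<^sup>2 * h \<le> B1\<^sup>2 * 1" using h by (intro mult_left_mono) auto
  finally show ?thesis by (simp add: B1_def mult.commute)
qed

end

lemma nn_integral_inverse_square: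
  fixes b :: real
  assumes b: "b > 0"
  shows "(\<integral>\<^sup>+t. indicator {t. \<bar>t\<bar> \<ge> b} t * ennreal (1 / t\<^sup>2) \<partial>lborel) = ennreal (2 / b)"
proof -
  have lim: "((\<lambda>t::real. - (1 / t)) \<longlongrightarrow> 0) at_top"
    using tendsto_minus[OF tendsto_inverse_0_at_top[OF filterlim_ident]] by (simp add: inverse_eq_divide)
  have "(\<integral>\<^sup>+t. ennreal (1 / t\<^sup>2) * indicator {b..} t \<partial>lborel) = ennreal (0 - - (1 / b))"
    by (rule nn_integral_FTC_atLeast[OF _ _ _ lim])
       (use b in \<open>auto intro!: derivative_eq_intros simp: power2_eq_square field_simps\<close>)
  then have half: "(\<integral>\<^sup>+t. indicator {b..} t * ennreal (1 / t\<^sup>2) \<partial>lborel) = ennreal (1 / b)"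
    by (simp add: mult.commute)
  have "(\<integral>\<^sup>+t. indicator {t. \<bar>t\<bar> \<ge> b} t * ennreal (1 / t\<^sup>2) \<partial>lborel) =
     (\<integral>\<^sup>+t. indicator {b..} t * ennreal (1 / t\<^sup>2) + indicator {b..} (- t) * ennreal (1 / (- t)\<^sup>2) \<partial>lborel)"
    using b by (intro nn_integral_cong) (auto simp: indicator_def)
  also have "\<dots> = (\<integral>\<^sup>+t. indicator {b..} t * ennreal (1 / t\<^sup>2) \<partial>lborel) +
     (\<integral>\<^sup>+t. indicator {b..} (- t) * ennreal (1 / (- t)\<^sup>2) \<partial>lborel)"
    by (intro nn_integral_add) auto
  also have "(\<integral>\<^sup>+t. indicator {b..} (- t) * ennreal (1 / (- t)\<^sup>2) \<partial>lborel) = ennreal (1 / b)"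
    using nn_integral_real_affine[of "\<lambda>t. indicator {b..} t * ennreal (1 / t\<^sup>2)" "-1" 0] half by simp
  finally show ?thesis using b half by (simp add: ennreal_plus[symmetric] del: ennreal_plus)
qed

lemma power2_sum_le: "(x + y)\<^sup>2 \<le> 2 * x\<^sup>2 + 2 * y\<^sup>2" for x y :: real
  using sum_squares_ge_zero[of "x - y" 0] by (simp add: power2_eq_square algebra_simps)

context slowly_oscillating
begin

text \<open>
  By slow oscillation the damped function changes little in mean square under the small translations
  on which the Fejer kernel is concentrated. This is why frequencies beyond \<open>K\<close> do not matter.
\<close>

lemma integral_damped_square_le_fejer:
  assumes a: "a \<ge> 0" and \<epsilon>: "\<epsilon> > 0"
  obtains K w0 where "K > 0" "0 < w0" "w0 \<le> 1" "\<And>w (A :: complex). 0 < w \<Longrightarrow> w \<le> w0 \<Longrightarrow> norm A \<le> a \<Longrightarrow>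
     w * (\<integral>u. (norm (damped A w u))\<^sup>2 \<partial>lborel)
       \<le> \<epsilon> + w * (\<integral>t. fejer_weight K t * (norm (fourier (damped A w) t))\<^sup>2 \<partial>lborel) / fejer_mass"
proof -
  define B1 where "B1 = B + a"
  have B1: "B1 \<ge> 0" using B_nonneg a by (simp add: B1_def)
  \<comment> \<open>With \<open>B1 * w \<le> sqrt \<epsilon> / 2\<close> from the choice of
    \<open>w0\<close>, the square occurring in \<open>damped_increment\<close> is at most
    \<open>\<epsilon>\<close>.\<close>
  define \<epsilon>1 where "\<epsilon>1 = sqrt \<epsilon> / 2"
  have \<epsilon>1: "\<epsilon>1 > 0" using \<epsilon> by (simp add: \<epsilon>1_def)
  from T_osc[OF \<epsilon>1] obtain \<delta>' u0' where \<delta>': "\<delta>' > 0"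
    and osc': "\<forall>u\<ge>u0'. \<forall>h\<in>{0..\<delta>'}. norm (T (u + h) - T u) \<le> \<epsilon>1" by auto
  define \<delta> where "\<delta> = min \<delta>' 1"
  define u0 where "u0 = max u0' 0"
  have \<delta>: "0 < \<delta>" "\<delta> \<le> 1" using \<delta>' by (auto simp: \<delta>_def)
  have u0: "u0 \<ge> 0" by (simp add: u0_def)
  have osc: "norm (T (u + h) - T u) \<le> \<epsilon>1" if "u \<ge> u0" "h \<in> {0..\<delta>}" for u h
    using osc' that by (auto simp: \<delta>_def u0_def)
  \<comment> \<open>For \<open>\<bar>h\<bar> \<ge> \<delta>\<close> only
    \<open>D h \<le> 2 * B1\<^sup>2 / w\<close> is available. Half of it, against a tail of mass
    \<open>\<tau>\<close> and multiplied by \<open>w\<close>, is \<open>\<tau> * B1\<^sup>2\<close>,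
    at most \<open>fejer_mass * \<epsilon> / 2\<close>.\<close>
  define \<tau> where "\<tau> = \<epsilon> * fejer_mass / (2 * (B1\<^sup>2 + 1))"
  have \<tau>: "\<tau> > 0" using \<epsilon> fejer_mass_pos by (auto simp: \<tau>_def intro!: divide_pos_pos add_nonneg_pos)
  obtain K where K: "K > 0" and tail: "(\<integral>h. indicator {h. \<bar>h\<bar> \<ge> \<delta>} h * fejer K h \<partial>lborel) \<le> \<tau>"
    using fejer_tail_mass[OF \<delta>(1) \<tau>] by (metis order_refl)
  define Q where "Q = B1\<^sup>2 + u0 * (2 * B + B1)\<^sup>2"
  have Q: "Q \<ge> 0" using u0 by (simp add: Q_def)
  \<comment> \<open>The middle entry makes the bounded contributions small,
    \<open>w * Q \<le> \<epsilon> / 2\<close>; the last one controls the drift of the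
    weight.\<close>
  define w0 where "w0 = min 1 (min (\<epsilon> / (2 * (Q + 1))) (sqrt \<epsilon> / (2 * (B1 + 1))))"
  have w0: "0 < w0" "w0 \<le> 1" using \<epsilon> Q B1 by (auto simp: w0_def)
  show thesis
  proof (rule that[OF K w0])
    fix w :: real and A :: complex assume w: "0 < w" "w \<le> w0" and A: "norm A \<le> a"
    have w1: "w \<le> 1" using w w0 by simp
    define N2 where "N2 = (\<integral>u. (norm (damped A w u))\<^sup>2 \<partial>lborel)"
    define D where "D h = (\<integral>u. (norm (damped A w u - damped A w (u - h)))\<^sup>2 \<partial>lborel)" for h
    define s where "s = Q + (\<epsilon>1 + B1 * w)\<^sup>2 / (2 * w)"
    have s: "s \<ge> 0" using Q w by (simp add: s_def)
    note ii = integrable_damped[OF w(1), of A] integrable_damped_square[OF w(1), of A]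
    have D_pos: "D h \<le> s" if "0 \<le> h" "h \<le> \<delta>" for h
      using damped_increment[OF w(1) w1 that \<delta>(2) u0 less_imp_le[OF \<epsilon>1] osc A]
      unfolding D_def s_def Q_def B1_def by simp
    \<comment> \<open>Slow oscillation is formulated for forward shifts; translation invariance
      makes \<open>D\<close> even and settles backward shifts.\<close>
    have D_sym: "D (- h) = D h" for h
      unfolding D_def
      using lborel_integral_real_affine[of 1 "\<lambda>u. (norm (damped A w u - damped A w (u + h)))\<^sup>2" "-h"]
      by (simp add: norm_minus_commute)
    have D_small: "D h \<le> s" if "\<bar>h\<bar> < \<delta>" for h
      using D_pos[of "\<bar>h\<bar>"] D_sym[of h] that by (cases "h \<ge> 0") auto
    have N2: "N2 \<le> B1\<^sup>2 / (2 * w)"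
    proof -
      have "(B + norm A)\<^sup>2 \<le> B1\<^sup>2" using A B_nonneg by (intro power_mono) (auto simp: B1_def)
      then have "(B + norm A)\<^sup>2 / (2 * w) \<le> B1\<^sup>2 / (2 * w)" using w by (intro divide_right_mono) auto
      then show ?thesis using integral_damped_square_le[OF w(1), of A] unfolding N2_def by linarith
    qed
    have D_all: "D h \<le> 2 * B1\<^sup>2 / w" for h
    proof -
      have s2: "integrable lborel (\<lambda>u. (norm (damped A w (u - h)))\<^sup>2)" "(\<integral>u. (norm (damped A w (u - h)))\<^sup>2 \<partial>lborel) = N2"
        using lborel_integrable_real_affine[OF ii(2), of "1" "-h"]
          lborel_integral_real_affine[of "1" "\<lambda>x. (norm (damped A w x))\<^sup>2" "-h"] by (auto simp: N2_def)
      have le: "(norm (z - z'))\<^sup>2 \<le> 2 * (norm z)\<^sup>2 + 2 * (norm z')\<^sup>2" for z z' :: complex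
      proof -
        have "(norm (z - z'))\<^sup>2 \<le> (norm z + norm z')\<^sup>2" by (intro power_mono norm_triangle_ineq4) auto
        also have "\<dots> \<le> 2 * (norm z)\<^sup>2 + 2 * (norm z')\<^sup>2"
          by (rule power2_sum_le)
        finally show ?thesis .
      qed
      have i: "integrable lborel (\<lambda>u. 2 * (norm (damped A w u))\<^sup>2 + 2 * (norm (damped A w (u - h)))\<^sup>2)"
        using ii(2) s2 by simp
      have "D h \<le> (\<integral>u. 2 * (norm (damped A w u))\<^sup>2 + 2 * (norm (damped A w (u - h)))\<^sup>2 \<partial>lborel)"
        unfolding D_def
      proof (rule integral_mono[OF _ i le])
        show "integrable lborel (\<lambda>u. (norm (damped A w u - damped A w (u - h)))\<^sup>2)"
          by (rule Bochner_Integration.integrable_bound[OF i]) (use le in auto)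
      qed
      also have "\<dots> = 4 * N2" using ii(2) s2 by (simp add: N2_def)
      also have "\<dots> \<le> 4 * (B1\<^sup>2 / (2 * w))" using N2 by simp
      finally show ?thesis by simp
    qed
    have pl: "integrable lborel (\<lambda>h. fejer K h * D h)"
      "(\<integral>t. fejer_weight K t * (norm (fourier (damped A w) t))\<^sup>2 \<partial>lborel) =
       fejer_mass * N2 - (\<integral>h. fejer K h * D h \<partial>lborel) / 2"
      unfolding N2_def D_def using fejer_plancherel(2,3)[OF ii K] by auto
    have it: "integrable lborel (\<lambda>h. indicator {h. \<bar>h\<bar> \<ge> \<delta>} h * fejer K h)"
      by (rule Bochner_Integration.integrable_bound[OF integrable_fejer[OF K]]) (auto simp: indicator_def)
    have "(\<integral>h. fejer K h * D h \<partial>lborel) \<le> (\<integral>h. fejer K h * s + (indicator {h. \<bar>h\<bar> \<ge> \<delta>} h * fejer K h) * (2 * B1\<^sup>2 / w) \<partial>lborel)"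
    proof (rule integral_mono[OF pl(1)])
      show "integrable lborel (\<lambda>h. fejer K h * s + (indicator {h. \<bar>h\<bar> \<ge> \<delta>} h * fejer K h) * (2 * B1\<^sup>2 / w))"
        by (intro Bochner_Integration.integrable_add integrable_mult_left it integrable_fejer[OF K])
      fix h :: real
      have f: "fejer K h \<ge> 0" by (rule fejer_nonneg[OF K])
      show "fejer K h * D h \<le> fejer K h * s + (indicator {h. \<bar>h\<bar> \<ge> \<delta>} h * fejer K h) * (2 * B1\<^sup>2 / w)"
      proof (cases "\<bar>h\<bar> < \<delta>")
        case True
        then show ?thesis using D_small[OF True] f by (auto simp: indicator_def intro!: mult_left_mono)
      next
        case False
        have "fejer K h * D h \<le> fejer K h * (2 * B1\<^sup>2 / w)" by (intro mult_left_mono D_all f)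
        moreover have "0 \<le> fejer K h * s" using f s by simp
        ultimately show ?thesis using False by (simp add: indicator_def)
      qed
    qed
    also have "\<dots> = fejer_mass * s + (\<integral>h. indicator {h. \<bar>h\<bar> \<ge> \<delta>} h * fejer K h \<partial>lborel) * (2 * B1\<^sup>2 / w)"
      by (subst Bochner_Integration.integral_add)
         (use it integrable_fejer[OF K] integral_fejer[OF K] in \<open>simp_all only: integrable_mult_left integral_mult_left_zero\<close>)
    also have "\<dots> \<le> fejer_mass * s + \<tau> * (2 * B1\<^sup>2 / w)"
      using tail w by (intro add_left_mono mult_right_mono) auto
    finally have J: "(\<integral>h. fejer K h * D h \<partial>lborel) \<le> fejer_mass * s + \<tau> * (2 * B1\<^sup>2 / w)" .
    let ?W = "\<integral>t. fejer_weight K t * (norm (fourier (damped A w) t))\<^sup>2 \<partial>lborel"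
    have "fejer_mass * N2 = ?W + (\<integral>h. fejer K h * D h \<partial>lborel) / 2" using pl(2) by simp
    also have "\<dots> \<le> ?W + (fejer_mass * s + \<tau> * (2 * B1\<^sup>2 / w)) / 2" using J by simp
    finally have "w * (fejer_mass * N2) \<le> w * (?W + (fejer_mass * s + \<tau> * (2 * B1\<^sup>2 / w)) / 2)"
      using w by (intro mult_left_mono) auto
    also have "\<dots> = w * ?W + fejer_mass * (w * s) / 2 + \<tau> * B1\<^sup>2"
      using w by (simp add: field_simps)
    also have "\<dots> \<le> w * ?W + fejer_mass * \<epsilon> / 2 + fejer_mass * \<epsilon> / 2"
    proof (intro add_mono order_refl)
      have "w * s = w * Q + (\<epsilon>1 + B1 * w)\<^sup>2 / 2" using w by (simp add: s_def field_simps)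
      also have "w * Q \<le> \<epsilon> / (2 * (Q + 1)) * (Q + 1)"
        using w Q \<epsilon> by (intro mult_mono) (auto simp: w0_def)
      also have "\<dots> = \<epsilon> / 2" using Q by (simp add: divide_simps)
      also have "(\<epsilon>1 + B1 * w)\<^sup>2 \<le> (sqrt \<epsilon>)\<^sup>2"
      proof (intro power_mono)
        have "B1 * w \<le> (B1 + 1) * (sqrt \<epsilon> / (2 * (B1 + 1)))"
          using w B1 \<epsilon> by (intro mult_mono) (auto simp: w0_def)
        also have "(B1 + 1) * (sqrt \<epsilon> / (2 * (B1 + 1))) = sqrt \<epsilon> / 2" using B1 by (simp add: divide_simps)
        finally have "B1 * w \<le> sqrt \<epsilon> / 2" .
        then show "\<epsilon>1 + B1 * w \<le> sqrt \<epsilon>" by (simp add: \<epsilon>1_def)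
      qed (use \<epsilon>1 B1 w in auto)
      finally have "w * s \<le> \<epsilon>" using \<epsilon> by simp
      then show "fejer_mass * (w * s) / 2 \<le> fejer_mass * \<epsilon> / 2" using fejer_mass_pos by simp
      have "\<tau> * B1\<^sup>2 \<le> \<tau> * (B1\<^sup>2 + 1)" using \<tau> by simp
      also have "\<dots> = \<epsilon> * fejer_mass / 2"
      proof -
        have "B1\<^sup>2 + 1 > 0" by (intro add_nonneg_pos) auto
        then show ?thesis by (simp add: \<tau>_def divide_simps)
      qed
      finally show "\<tau> * B1\<^sup>2 \<le> fejer_mass * \<epsilon> / 2" by (simp add: mult.commute)
    qed
    finally have "fejer_mass * (w * N2) \<le> fejer_mass * (\<epsilon> + w * ?W / fejer_mass)"
      using fejer_mass_pos by (simp add: algebra_simps)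
    then show "w * (\<integral>u. (norm (damped A w u))\<^sup>2 \<partial>lborel) \<le> \<epsilon> + w * ?W / fejer_mass"
      using fejer_mass_pos by (simp add: N2_def)
  qed
qed

text \<open>
  For \<open>|t| \<le> b w\<close> the hypothesis \<open>near\<close> is used directly; for larger \<open>|t|\<close> it only provides a small
  factor \<open>|F|\<^bsup>1/2\<^esup>\<close>, the pole contributing at most \<open>a / |t|\<close> there.
\<close>

lemma fejer_transform_le:
  assumes w: "w > 0" and K: "K > 0" and b: "b > 0" and e: "e \<ge> 0" and a: "norm A \<le> a" and C: "C \<ge> 0"
    and near: "\<And>t. \<bar>t\<bar> \<le> K \<Longrightarrow> norm (fourier (damped A w) t) \<le> e / w"
    and \<psi>[measurable]: "\<psi> \<in> borel_measurable borel" and \<psi>0: "\<And>t. \<psi> t \<ge> 0"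
    and \<psi>1: "\<And>t. \<bar>t\<bar> \<le> K \<Longrightarrow> (norm (fourier (damped 0 w) t))\<^sup>2 \<le> sqrt (norm (fourier (damped 0 w) t)) * \<psi> t"
    and \<psi>2: "(\<integral>\<^sup>+t. indicator {-K..K} t * ennreal (\<psi> t) \<partial>lborel) \<le> ennreal (C / sqrt w)"
  shows "w * (\<integral>t. fejer_weight K t * (norm (fourier (damped A w) t))\<^sup>2 \<partial>lborel)
     \<le> 2 * b * e\<^sup>2 + 4 * a\<^sup>2 / b + 2 * sqrt (e + a / b) * C"
proof -
  let ?F = "fourier (damped A w)" and ?\<Phi> = "fourier (damped 0 w)"
  have a0: "a \<ge> 0" using a norm_ge_zero order_trans by blast
  \<comment> \<open>For \<open>\<bar>t\<bar> > b * w\<close> the pole is at most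
    \<open>a / (b * w)\<close>, so \<open>?\<Phi>\<close> is at most \<open>\<sigma> / w\<close>
    there.\<close>
  define \<sigma> where "\<sigma> = e + a / b"
  have \<sigma>: "\<sigma> \<ge> 0" using e a0 b by (simp add: \<sigma>_def)
  \<comment> \<open>Near the pole the pointwise bound \<open>e / w\<close> holds on an interval of
    length \<open>2 * b * w\<close>; elsewhere \<open>power2_sum_le\<close> separates the pole from
    \<open>?\<Phi>\<close>.\<close>
  let ?R = "\<lambda>t. indicator {-b*w..b*w} t * ennreal (e\<^sup>2 / w\<^sup>2) + (ennreal (2 * a\<^sup>2) * (indicator {t. \<bar>t\<bar> \<ge> b * w} t * ennreal (1 / t\<^sup>2))
     + ennreal (2 * sqrt (\<sigma> / w)) * (indicator {-K..K} t * ennreal (\<psi> t)))"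
  have pw: "ennreal (fejer_weight K t * (norm (?F t))\<^sup>2) \<le> ?R t" for t
  proof (cases "\<bar>t\<bar> \<le> K")
    case False
    then have "fejer_weight K t = 0" by (auto simp: fejer_weight_def indicator_def)
    then show ?thesis by simp
  next
    case tK: True
    have fw: "fejer_weight K t * (norm (?F t))\<^sup>2 \<le> (norm (?F t))\<^sup>2"
    proof -
      have "fejer_weight K t \<le> 1" using order_trans[OF fejer_weight_bounds(2)[OF K, of t]] by (simp add: indicator_def)
      then show ?thesis using mult_right_mono[of "fejer_weight K t" 1 "(norm (?F t))\<^sup>2"] by simp
    qed
    show ?thesis
    proof (cases "\<bar>t\<bar> \<le> b * w")
      case True
      have "(norm (?F t))\<^sup>2 \<le> (e / w)\<^sup>2" by (intro power_mono near tK) auto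
      then have "ennreal (fejer_weight K t * (norm (?F t))\<^sup>2) \<le> ennreal (e\<^sup>2 / w\<^sup>2)"
        using fw by (intro ennreal_leI) (simp add: power_divide)
      also have "\<dots> = indicator {-b*w..b*w} t * ennreal (e\<^sup>2 / w\<^sup>2)" using True by (auto simp: indicator_def)
      also have "\<dots> \<le> ?R t" by (rule add_increasing2) auto
      finally show ?thesis .
    next
      case False
      moreover have "b * w > 0" using b w by simp
      ultimately have t: "\<bar>t\<bar> > b * w" "t \<noteq> 0" by auto
      have cmp: "\<bar>t\<bar> \<le> norm (Complex w t)" using abs_Im_le_cmod[of "Complex w t"] by simp
      have Aq: "norm (A / Complex w t) \<le> a / \<bar>t\<bar>"
        unfolding norm_divide using a cmp t a0 by (intro frac_le) auto
      have "a / \<bar>t\<bar> \<le> a / (b * w)" using t a0 b w by (intro divide_left_mono) auto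
      then have "norm (?\<Phi> t) \<le> \<sigma> / w"
        using fourier_damped[OF w, of A t] near[OF tK] Aq norm_triangle_ineq[of "?F t" "A / Complex w t"]
        by (simp add: \<sigma>_def add_divide_distrib)
      then have "sqrt (norm (?\<Phi> t)) \<le> sqrt (\<sigma> / w)" by simp
      then have \<Phi>2: "(norm (?\<Phi> t))\<^sup>2 \<le> sqrt (\<sigma> / w) * \<psi> t"
        using \<psi>1[OF tK] \<psi>0[of t] by (meson mult_right_mono order_trans)
      have "(norm (?F t))\<^sup>2 \<le> (norm (?\<Phi> t) + a / \<bar>t\<bar>)\<^sup>2"
        unfolding fourier_damped[OF w, of A t] using Aq norm_triangle_ineq4[of "?\<Phi> t" "A / Complex w t"]
        by (intro power_mono) auto
      also have "\<dots> \<le> 2 * (norm (?\<Phi> t))\<^sup>2 + 2 * (a / \<bar>t\<bar>)\<^sup>2"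
        by (rule power2_sum_le)
      also have "\<dots> \<le> 2 * sqrt (\<sigma> / w) * \<psi> t + 2 * a\<^sup>2 * (1 / t\<^sup>2)"
        using \<Phi>2 by (simp add: power_divide)
      finally have "ennreal (fejer_weight K t * (norm (?F t))\<^sup>2) \<le> ennreal (2 * a\<^sup>2 * (1 / t\<^sup>2) + 2 * sqrt (\<sigma> / w) * \<psi> t)"
        using fw by (intro ennreal_leI) linarith
      also have "\<dots> = ennreal (2 * a\<^sup>2 * (1 / t\<^sup>2)) + ennreal (2 * sqrt (\<sigma> / w) * \<psi> t)"
        using \<sigma> w \<psi>0[of t] by (intro ennreal_plus) auto
      also have "ennreal (2 * a\<^sup>2 * (1 / t\<^sup>2)) = ennreal (2 * a\<^sup>2) * (indicator {t. \<bar>t\<bar> \<ge> b * w} t * ennreal (1 / t\<^sup>2))"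
        using t by (subst ennreal_mult) auto
      also have "ennreal (2 * sqrt (\<sigma> / w) * \<psi> t) = ennreal (2 * sqrt (\<sigma> / w)) * (indicator {-K..K} t * ennreal (\<psi> t))"
        using tK \<sigma> w \<psi>0[of t] by (subst ennreal_mult) (auto simp: indicator_def)
      also have "ennreal (2 * a\<^sup>2) * (indicator {t. \<bar>t\<bar> \<ge> b * w} t * ennreal (1 / t\<^sup>2)) +
        ennreal (2 * sqrt (\<sigma> / w)) * (indicator {-K..K} t * ennreal (\<psi> t)) \<le> ?R t"
        by (rule add_increasing) auto
      finally show ?thesis .
    qed
  qed
  have bw: "b * w > 0" using b w by simp
  let ?tot = "2 * (b * w) * (e\<^sup>2 / w\<^sup>2) + (2 * a\<^sup>2 * (2 / (b * w)) + 2 * sqrt (\<sigma> / w) * (C / sqrt w))"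
  have "(\<integral>\<^sup>+t. ?R t \<partial>lborel) = ennreal (2 * (b * w)) * ennreal (e\<^sup>2 / w\<^sup>2) +
     (ennreal (2 * a\<^sup>2) * (\<integral>\<^sup>+t. indicator {t. \<bar>t\<bar> \<ge> b * w} t * ennreal (1 / t\<^sup>2) \<partial>lborel)
     + ennreal (2 * sqrt (\<sigma> / w)) * (\<integral>\<^sup>+t. indicator {-K..K} t * ennreal (\<psi> t) \<partial>lborel))"
  proof -
    have "(\<integral>\<^sup>+t. indicator {-b*w..b*w} t * ennreal (e\<^sup>2 / w\<^sup>2) \<partial>lborel) = ennreal (2 * (b * w)) * ennreal (e\<^sup>2 / w\<^sup>2)"
      using bw by (subst nn_integral_multc) auto
    then show ?thesis
      by (subst nn_integral_add, measurable, subst nn_integral_add, measurable, subst nn_integral_cmult, measurable, subst nn_integral_cmult) auto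
  qed
  also have "\<dots> \<le> ennreal (2 * (b * w)) * ennreal (e\<^sup>2 / w\<^sup>2) +
     (ennreal (2 * a\<^sup>2) * ennreal (2 / (b * w)) + ennreal (2 * sqrt (\<sigma> / w)) * ennreal (C / sqrt w))"
    unfolding nn_integral_inverse_square[OF bw] by (intro add_left_mono mult_left_mono \<psi>2) auto
  also have "\<dots> = ennreal ?tot"
  proof -
    have 1: "ennreal (2 * (b * w)) * ennreal (e\<^sup>2 / w\<^sup>2) = ennreal (2 * (b * w) * (e\<^sup>2 / w\<^sup>2))"
      using bw by (intro ennreal_mult[symmetric]) auto
    have 2: "ennreal (2 * a\<^sup>2) * ennreal (2 / (b * w)) = ennreal (2 * a\<^sup>2 * (2 / (b * w)))"
      using bw by (intro ennreal_mult[symmetric]) auto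
    have 3: "ennreal (2 * sqrt (\<sigma> / w)) * ennreal (C / sqrt w) = ennreal (2 * sqrt (\<sigma> / w) * (C / sqrt w))"
      using \<sigma> w C by (intro ennreal_mult[symmetric]) auto
    have nn: "0 \<le> 2 * (b * w) * (e\<^sup>2 / w\<^sup>2)" "0 \<le> 2 * a\<^sup>2 * (2 / (b * w))" "0 \<le> 2 * sqrt (\<sigma> / w) * (C / sqrt w)"
      using bw \<sigma> w C by auto
    show ?thesis unfolding 1 2 3 using nn by (simp only: ennreal_plus add_nonneg_nonneg)
  qed
  finally have R: "(\<integral>\<^sup>+t. ?R t \<partial>lborel) \<le> ennreal ?tot" .
  have i: "integrable lborel (\<lambda>t. fejer_weight K t * (norm (?F t))\<^sup>2)"
    by (rule fejer_plancherel(1)[OF integrable_damped[OF w] integrable_damped_square[OF w] K])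
  have "ennreal (\<integral>t. fejer_weight K t * (norm (?F t))\<^sup>2 \<partial>lborel) = (\<integral>\<^sup>+t. ennreal (fejer_weight K t * (norm (?F t))\<^sup>2) \<partial>lborel)"
    by (rule nn_integral_eq_integral[OF i, symmetric]) (auto intro!: mult_nonneg_nonneg fejer_weight_bounds K)
  also have "\<dots> \<le> (\<integral>\<^sup>+t. ?R t \<partial>lborel)" by (rule nn_integral_mono[OF pw])
  also note R
  finally have "(\<integral>t. fejer_weight K t * (norm (?F t))\<^sup>2 \<partial>lborel) \<le> ?tot"
    using bw \<sigma> w C by (subst (asm) ennreal_le_iff) auto
  then have "w * (\<integral>t. fejer_weight K t * (norm (?F t))\<^sup>2 \<partial>lborel) \<le> w * ?tot" using w by (intro mult_left_mono) auto
  \<comment> \<open>All three terms are of order \<open>1 / w\<close>, the scale of the mean square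
    itself, so the factor \<open>w\<close> removes every trace of \<open>w\<close>.\<close>
  also have "w * ?tot = 2 * b * e\<^sup>2 + 4 * a\<^sup>2 / b + 2 * sqrt \<sigma> * C"
  proof -
    have "w * (2 * sqrt (\<sigma> / w) * (C / sqrt w)) = 2 * sqrt \<sigma> * C * (w / (sqrt w * sqrt w))"
      by (simp add: real_sqrt_divide)
    also have "\<dots> = 2 * sqrt \<sigma> * C" using w by simp
    finally have 3: "w * (2 * sqrt (\<sigma> / w) * (C / sqrt w)) = 2 * sqrt \<sigma> * C" .
    have 1: "w * (2 * (b * w) * (e\<^sup>2 / w\<^sup>2)) = 2 * b * e\<^sup>2" using w by (simp add: power2_eq_square)
    have 2: "w * (2 * a\<^sup>2 * (2 / (b * w))) = 4 * a\<^sup>2 / b" using w by simp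
    show ?thesis unfolding distrib_left 1 2 3 by simp
  qed
  finally show ?thesis unfolding \<sigma>_def .
qed

end

context slowly_oscillating
begin

text \<open>The order of the choices matters: \<open>K\<close> comes from slow oscillation alone,
  then \<open>C\<close> from the domination on \<open>[-K, K]\<close>, then \<open>b\<close>; only
  at the end is the transform required to be within \<open>(1 / b) / w\<close>. Thus
  \<open>C\<close> is fixed before \<open>b\<close> has to beat it.\<close>

lemma mean_of_transform:
  fixes A :: "real \<Rightarrow> complex"
  assumes A: "\<And>w. w > 0 \<Longrightarrow> norm (A w) \<le> a"
    and near: "\<And>K e. K > 0 \<Longrightarrow> e > 0 \<Longrightarrow>
       \<forall>\<^sub>F w in at_right 0. \<forall>t. \<bar>t\<bar> \<le> K \<longrightarrow> norm (fourier (damped (A w) w) t) \<le> e / w"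
    and dom: "\<And>K. K > 0 \<Longrightarrow> \<exists>C\<ge>0. \<forall>w. 0 < w \<and> w \<le> 1 \<longrightarrow>
       (\<exists>\<psi> \<in> borel_measurable borel. (\<forall>t. \<psi> t \<ge> 0) \<and>
          (\<forall>t. \<bar>t\<bar> \<le> K \<longrightarrow> (norm (fourier (damped 0 w) t))\<^sup>2 \<le> sqrt (norm (fourier (damped 0 w) t)) * \<psi> t) \<and>
          (\<integral>\<^sup>+t. indicator {-K..K} t * ennreal (\<psi> t) \<partial>lborel) \<le> ennreal (C / sqrt w))"
    and e: "e > 0"
  shows "\<forall>\<^sub>F X in at_top. (\<integral>\<^sup>+u. indicator {0..X} u * ennreal (norm (T u - A (1 / X))) \<partial>lborel) \<le> ennreal (e * X)"
proof -
  have a0: "a \<ge> 0" using A[of 1] norm_ge_zero order_trans zero_less_one by blast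
  \<comment> \<open>On \<open>[0, 1 / w]\<close> the squared weight is at least
    \<open>exp (- 2)\<close>, and \<open>x \<le> e / 2 + x\<^sup>2 / (2 * e)\<close>. With this
    \<open>\<epsilon>\<close> the two halves each integrate to at most
    \<open>e / (2 * w)\<close>.\<close>
  define \<epsilon> where "\<epsilon> = e\<^sup>2 / exp 2"
  have \<epsilon>: "\<epsilon> > 0" using e by (simp add: \<epsilon>_def)
  obtain K w0 where K: "K > 0" and w0: "0 < w0" "w0 \<le> 1" and low: "\<And>w (A :: complex). 0 < w \<Longrightarrow> w \<le> w0 \<Longrightarrow> norm A \<le> a \<Longrightarrow>
     w * (\<integral>u. (norm (damped A w u))\<^sup>2 \<partial>lborel)
       \<le> \<epsilon> / 2 + w * (\<integral>t. fejer_weight K t * (norm (fourier (damped A w) t))\<^sup>2 \<partial>lborel) / fejer_mass"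
    by (rule integral_damped_square_le_fejer[OF a0 half_gt_zero[OF \<epsilon>]]) (rule that)
  obtain C where C: "C \<ge> 0" and dom': "\<And>w. 0 < w \<Longrightarrow> w \<le> 1 \<Longrightarrow>
       (\<exists>\<psi> \<in> borel_measurable borel. (\<forall>t. \<psi> t \<ge> 0) \<and>
          (\<forall>t. \<bar>t\<bar> \<le> K \<longrightarrow> (norm (fourier (damped 0 w) t))\<^sup>2 \<le> sqrt (norm (fourier (damped 0 w) t)) * \<psi> t) \<and>
          (\<integral>\<^sup>+t. indicator {-K..K} t * ennreal (\<psi> t) \<partial>lborel) \<le> ennreal (C / sqrt w))"
    using dom[OF K] by blast
  \<comment> \<open>With the accuracy \<open>e = 1 / b\<close> every term of
    \<open>fejer_transform_le\<close> tends to 0 as \<open>b\<close> grows, the last one like the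
    inverse square root of \<open>b\<close>.\<close>
  obtain b where b: "b > 0" and bb: "2 * b * (1 / b)\<^sup>2 + 4 * a\<^sup>2 / b + 2 * sqrt (1 / b + a / b) * C < \<epsilon> * fejer_mass / 2"
  proof -
    have inv: "((\<lambda>b. 1 / b) \<longlongrightarrow> (0 :: real)) at_top"
      using tendsto_inverse_0_at_top[OF filterlim_ident] by (simp add: inverse_eq_divide)
    have "((\<lambda>b. 2 * (1 / b) + 4 * a\<^sup>2 * (1 / b) + 2 * sqrt (1 / b + a * (1 / b)) * C) \<longlongrightarrow>
       2 * 0 + 4 * a\<^sup>2 * 0 + 2 * sqrt (0 + a * 0) * C) at_top"
      by (intro tendsto_intros inv)
    then have "\<forall>\<^sub>F b in at_top. 2 * (1 / b) + 4 * a\<^sup>2 * (1 / b) + 2 * sqrt (1 / b + a * (1 / b)) * C < \<epsilon> * fejer_mass / 2"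
      using \<epsilon> fejer_mass_pos by (intro order_tendstoD) auto
    then have "\<forall>\<^sub>F b in at_top. b > 0 \<and> 2 * (1 / b) + 4 * a\<^sup>2 * (1 / b) + 2 * sqrt (1 / b + a * (1 / b)) * C < \<epsilon> * fejer_mass / 2"
      using eventually_gt_at_top[of 0] by eventually_elim simp
    then obtain b where "b > 0" "2 * (1 / b) + 4 * a\<^sup>2 * (1 / b) + 2 * sqrt (1 / b + a * (1 / b)) * C < \<epsilon> * fejer_mass / 2"
      by (metis (no_types, lifting) eventually_happens' trivial_limit_at_top_linorder)
    moreover have "2 * b * (1 / b)\<^sup>2 = 2 * (1 / b)" using \<open>b > 0\<close> by (simp add: power2_eq_square)
    ultimately show ?thesis by (intro that[of b]) auto
  qed
  have "\<forall>\<^sub>F w in at_right 0. \<forall>t. \<bar>t\<bar> \<le> K \<longrightarrow> norm (fourier (damped (A w) w) t) \<le> (1 / b) / w"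
    by (rule near[OF K]) (use b in auto)
  moreover have "\<forall>\<^sub>F w in at_right 0. w \<in> {0<..<w0}"
    using w0 by (intro eventually_at_right_real) auto
  ultimately have "\<forall>\<^sub>F w in at_right 0. (\<integral>\<^sup>+u. indicator {0..1 / w} u * ennreal (norm (T u - A w)) \<partial>lborel) \<le> ennreal (e * (1 / w))"
  proof eventually_elim
    case (elim w)
    then have w: "w > 0" "w \<le> w0" "w \<le> 1" using w0 by auto
    from dom'[OF w(1,3)] obtain \<psi> where \<psi>: "\<psi> \<in> borel_measurable borel" "\<And>t. \<psi> t \<ge> 0"
          "\<And>t. \<bar>t\<bar> \<le> K \<Longrightarrow> (norm (fourier (damped 0 w) t))\<^sup>2 \<le> sqrt (norm (fourier (damped 0 w) t)) * \<psi> t"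
          "(\<integral>\<^sup>+t. indicator {-K..K} t * ennreal (\<psi> t) \<partial>lborel) \<le> ennreal (C / sqrt w)" by blast
    let ?N2 = "\<integral>u. (norm (damped (A w) w u))\<^sup>2 \<partial>lborel"
    have "w * ?N2 \<le> \<epsilon> / 2 + w * (\<integral>t. fejer_weight K t * (norm (fourier (damped (A w) w) t))\<^sup>2 \<partial>lborel) / fejer_mass"
      by (rule low[OF w(1,2) A[OF w(1)]])
    moreover have "w * (\<integral>t. fejer_weight K t * (norm (fourier (damped (A w) w) t))\<^sup>2 \<partial>lborel)
      \<le> 2 * b * (1 / b)\<^sup>2 + 4 * a\<^sup>2 / b + 2 * sqrt (1 / b + a / b) * C"
      by (rule fejer_transform_le[OF w(1) K b _ A[OF w(1)] C _ \<psi>]) (use elim b in auto)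
    then have "w * (\<integral>t. fejer_weight K t * (norm (fourier (damped (A w) w) t))\<^sup>2 \<partial>lborel) / fejer_mass
      \<le> (\<epsilon> * fejer_mass / 2) / fejer_mass"
      using bb fejer_mass_pos by (intro divide_right_mono) auto
    moreover have "(\<epsilon> * fejer_mass / 2) / fejer_mass = \<epsilon> / 2" using fejer_mass_pos by simp
    ultimately have "w * ?N2 \<le> \<epsilon>" by linarith
    then have N2: "?N2 \<le> \<epsilon> / w" using w by (simp add: field_simps)
    have pw: "indicator {0..1 / w} u * norm (T u - A w) \<le> indicator {0..1 / w} u * (e / 2) + exp 2 / (2 * e) * (norm (damped (A w) w u))\<^sup>2" for u
    proof (cases "u \<in> {0..1 / w}")
      case True
      let ?x = "norm (T u - A w)"
      have "w * u \<le> 1" using True w by (simp add: field_simps)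
      then have "1 \<le> exp 2 * (exp (- w * u))\<^sup>2" by (simp add: power2_eq_square mult.commute flip: exp_add)
      then have "?x\<^sup>2 * 1 \<le> ?x\<^sup>2 * (exp 2 * (exp (- w * u))\<^sup>2)" by (intro mult_left_mono) auto
      also have "\<dots> = exp 2 * (norm (damped (A w) w u))\<^sup>2"
        using True by (simp add: damped_def norm_mult power_mult_distrib)
      finally have x2: "?x\<^sup>2 \<le> exp 2 * (norm (damped (A w) w u))\<^sup>2" by simp
      have "2 * e * ?x \<le> e\<^sup>2 + ?x\<^sup>2" by (rule sum_squares_bound)
      then have "2 * e * ?x \<le> e\<^sup>2 + exp 2 * (norm (damped (A w) w u))\<^sup>2" using x2 by linarith
      then have "?x \<le> e / 2 + exp 2 / (2 * e) * (norm (damped (A w) w u))\<^sup>2"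
        using e by (simp add: field_simps power2_eq_square)
      then show ?thesis using True by simp
    next
      case False
      then show ?thesis using e by simp
    qed
    have i2: "integrable lborel (\<lambda>u. indicator {0..1 / w} u * (e / 2) + exp 2 / (2 * e) * (norm (damped (A w) w u))\<^sup>2)"
      using integrable_damped_square[OF w(1)] w
      by (intro Bochner_Integration.integrable_add integrable_mult_left integrable_mult_right integrable_real_indicator)
         (auto simp: emeasure_lborel_Icc_eq)
    have "(\<integral>\<^sup>+u. indicator {0..1 / w} u * ennreal (norm (T u - A w)) \<partial>lborel) =
      (\<integral>\<^sup>+u. ennreal (indicator {0..1 / w} u * norm (T u - A w)) \<partial>lborel)"
      by (intro nn_integral_cong) (auto simp: indicator_def)
    also have "\<dots> \<le> (\<integral>\<^sup>+u. ennreal (indicator {0..1 / w} u * (e / 2) + exp 2 / (2 * e) * (norm (damped (A w) w u))\<^sup>2) \<partial>lborel)"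
      by (intro nn_integral_mono ennreal_leI pw)
    also have "\<dots> = ennreal (\<integral>u. indicator {0..1 / w} u * (e / 2) + exp 2 / (2 * e) * (norm (damped (A w) w u))\<^sup>2 \<partial>lborel)"
      by (rule nn_integral_eq_integral[OF i2]) (use e in \<open>auto intro!: AE_I2\<close>)
    also have "\<dots> \<le> ennreal (e * (1 / w))"
    proof (rule ennreal_leI)
      have ind: "integrable lborel (\<lambda>u. indicator {0..1 / w} u * (e / 2))" "(\<integral>u. indicator {0..1 / w} u * (e / 2) \<partial>lborel) = 1 / w * (e / 2)"
        using w by (auto simp: emeasure_lborel_Icc_eq integrable_real_indicator)
      have "(\<integral>u. indicator {0..1 / w} u * (e / 2) + exp 2 / (2 * e) * (norm (damped (A w) w u))\<^sup>2 \<partial>lborel) =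
        (1 / w) * (e / 2) + exp 2 / (2 * e) * ?N2"
        using integrable_damped_square[OF w(1)] ind by (subst Bochner_Integration.integral_add) auto
      also have "\<dots> \<le> (1 / w) * (e / 2) + exp 2 / (2 * e) * (\<epsilon> / w)"
        using N2 e by (intro add_left_mono mult_left_mono) auto
      also have "\<dots> = e * (1 / w)"
        using e w by (simp add: \<epsilon>_def field_simps power2_eq_square)
      finally show "(\<integral>u. indicator {0..1 / w} u * (e / 2) + exp 2 / (2 * e) * (norm (damped (A w) w u))\<^sup>2 \<partial>lborel) \<le> e * (1 / w)" .
    qed
    finally show ?case .
  qed
  then have "\<forall>\<^sub>F X in at_top. (\<integral>\<^sup>+u. indicator {0..1 / inverse X} u * ennreal (norm (T u - A (inverse X))) \<partial>lborel) \<le> ennreal (e * (1 / inverse X))"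
    by (simp only: at_right_to_top eventually_filtermap)
  then show ?thesis by (simp add: inverse_eq_divide)
qed

end

section \<open>Multiplicative measures over a Beurling system\<close>

lemma mark_base_cong_weight:
  assumes "mark_base M g" and "h \<in> borel_measurable borel"
  shows "mark_base M h"
  using assms unfolding mark_base_def by auto

lemma AE_mark_exp_one:
  assumes "mark_base M (\<lambda>_. 1)"
  shows "AE p in mark_exp M (\<lambda>_. 1). snd p = 1"
proof -
  interpret mark_base M "\<lambda>_. 1" by fact
  let ?S = "{p :: real \<times> complex. snd p \<noteq> 1}"
  have [measurable]: "?S \<in> sets (borel \<Otimes>\<^sub>M borel)"
  proof -
    have "?S = UNIV \<times> (- {1})" by auto
    then show ?thesis by simp
  qed
  have "(\<integral>\<^sup>+p. indicator ?S p \<partial>mark_power M (\<lambda>_. 1) n) = 0" for n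
  proof (induction n)
    case (Suc n)
    have "(\<integral>\<^sup>+p. indicator ?S p \<partial>mark_power M (\<lambda>_. 1) (Suc n)) =
      (\<integral>\<^sup>+x. \<integral>\<^sup>+p. indicator ?S (x * fst p, 1 * snd p) \<partial>mark_power M (\<lambda>_. 1) n \<partial>M)"
      by (rule nn_integral_mark_power_Suc) measurable
    also have "\<dots> = (\<integral>\<^sup>+x. \<integral>\<^sup>+p. indicator ?S p \<partial>mark_power M (\<lambda>_. 1) n \<partial>M)"
      by (intro nn_integral_cong) (auto simp: indicator_def)
    finally show ?case by (simp add: Suc)
  qed (simp add: nn_integral_return space_pair_measure)
  then have "(\<integral>\<^sup>+p. indicator ?S p \<partial>mark_exp M (\<lambda>_. 1)) = 0"
    by (subst nn_integral_mark_exp) auto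
  then have "emeasure (mark_exp M (\<lambda>_. 1)) ?S = 0" by (subst (asm) nn_integral_indicator) auto
  then show ?thesis by (intro AE_I[of _ _ ?S]) auto
qed

lemma abs_exp_mono:
  assumes "mark_base M (\<lambda>x. of_real (h x))" and "\<And>x. x \<ge> 1 \<Longrightarrow> f x \<le> f' x"
  shows "abs_exp M h f \<le> abs_exp M h f'"
proof -
  interpret mark_base M "\<lambda>x. of_real (h x)" by fact
  show ?thesis unfolding abs_exp_def
    by (intro nn_integral_mono_AE, use AE_mark_exp in eventually_elim) (auto intro!: mult_right_mono assms)
qed

lemma abs_exp_cmult:
  assumes [measurable]: "f \<in> borel_measurable borel"
  shows "abs_exp M h (\<lambda>x. c * f x) = c * abs_exp M h f"
  unfolding abs_exp_def by (simp add: mult.assoc nn_integral_cmult)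

lemma abs_exp_add:
  assumes [measurable]: "f \<in> borel_measurable borel" "f' \<in> borel_measurable borel"
  shows "abs_exp M h (\<lambda>x. f x + f' x) = abs_exp M h f + abs_exp M h f'"
  unfolding abs_exp_def by (simp add: distrib_right nn_integral_add)

lemma asymp_linear_bounds:
  fixes N :: "real \<Rightarrow> real"
  assumes a: "a > 0" and N: "N \<sim>[at_top] (\<lambda>x. a * x)" and mono: "mono N" and N0: "\<And>x. x < 1 \<Longrightarrow> N x = 0"
  shows "\<exists>C\<ge>0. \<forall>x\<ge>0. N x \<le> C * x"
    and "\<eta> > 0 \<Longrightarrow> \<exists>Y\<ge>1. \<forall>x\<ge>Y. \<bar>N x - a * x\<bar> \<le> \<eta> * x"
proof -
  have lim: "((\<lambda>x. N x / (a * x)) \<longlongrightarrow> 1) at_top"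
    using N by (rule asymp_equivD_strong) (use a in \<open>auto intro: eventually_mono[OF eventually_gt_at_top[of 0]]\<close>)
  have ev: "\<exists>Y\<ge>1. \<forall>x\<ge>Y. \<bar>N x - a * x\<bar> \<le> \<eta> * x" if \<eta>: "\<eta> > 0" for \<eta>
  proof -
    have "\<forall>\<^sub>F x in at_top. dist (N x / (a * x)) 1 < \<eta> / a"
      using lim \<eta> a by (intro tendstoD) auto
    then obtain Y where Y: "\<And>x. x \<ge> Y \<Longrightarrow> dist (N x / (a * x)) 1 < \<eta> / a"
      by (auto simp: eventually_at_top_linorder)
    have "\<bar>N x - a * x\<bar> \<le> \<eta> * x" if "x \<ge> max 1 Y" for x
    proof -
      have x: "x > 0" "x \<ge> Y" using that by auto
      have "\<bar>N x / (a * x) - 1\<bar> \<le> \<eta> / a" using Y[OF x(2)] by (simp add: dist_real_def)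
      then have "\<bar>N x / (a * x) - 1\<bar> * (a * x) \<le> \<eta> / a * (a * x)" using a x by (intro mult_right_mono) auto
      also have "\<eta> / a * (a * x) = \<eta> * x" using a by simp
      also have "\<bar>N x / (a * x) - 1\<bar> * (a * x) = \<bar>(N x / (a * x) - 1) * (a * x)\<bar>" using a x by (simp add: abs_mult)
      also have "(N x / (a * x) - 1) * (a * x) = N x - a * x" using a x by (simp add: left_diff_distrib)
      finally show ?thesis .
    qed
    then show ?thesis by (intro exI[of _ "max 1 Y"]) auto
  qed
  then show "\<eta> > 0 \<Longrightarrow> \<exists>Y\<ge>1. \<forall>x\<ge>Y. \<bar>N x - a * x\<bar> \<le> \<eta> * x" .
  obtain Y where Y: "Y \<ge> 1" "\<And>x. x \<ge> Y \<Longrightarrow> \<bar>N x - a * x\<bar> \<le> 1 * x" using ev[of 1] by auto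
  have "N Y \<ge> 0" using monoD[OF mono, of 0 Y] N0[of 0] Y by simp
  then have "N x \<le> (a + 1 + N Y) * x" if x: "x \<ge> 0" for x
  proof -
    consider "x < 1" | "1 \<le> x" "x \<le> Y" | "x \<ge> Y" by linarith
    then show ?thesis
    proof cases
      case 1 then show ?thesis using N0 a \<open>N Y \<ge> 0\<close> x by simp
    next
      case 2
      have "N x \<le> N Y" using monoD[OF mono 2(2)] .
      also have "\<dots> \<le> N Y * x" using 2 \<open>N Y \<ge> 0\<close> mult_left_mono[of 1 x "N Y"] by simp
      also have "\<dots> \<le> (a + 1 + N Y) * x" using x a by (intro mult_right_mono) auto
      finally show ?thesis .
    next
      case 3
      have "N x \<le> (a + 1) * x" using Y(2)[OF 3] by (simp add: algebra_simps)
      also have "\<dots> \<le> (a + 1 + N Y) * x" using x \<open>N Y \<ge> 0\<close> by (intro mult_right_mono) auto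
      finally show ?thesis .
    qed
  qed
  then show "\<exists>C\<ge>0. \<forall>x\<ge>0. N x \<le> C * x"
    using a \<open>N Y \<ge> 0\<close> by (intro exI[of _ "a + 1 + N Y"]) auto
qed

text \<open>The equation between dN and d\<Pi> enters through distribution functions
  (\<open>N_exp\<close>). The bound for \<open>g1\<close> is asked for on the whole line, which
  extension by 0 provides, and the Chebyshev constant \<open>Cc\<close> is uniform from
  \<open>x = 1\<close> on.\<close>

locale beurling_weight =
  fixes M :: "real measure" and N :: "real \<Rightarrow> real" and a :: real and g1 g2 :: "real \<Rightarrow> complex" and Cc :: real
  assumes base: "mark_base M (\<lambda>_. 1)"
    and N_exp: "\<And>x. abs_exp M (\<lambda>_. 1) (indicator {..x}) = ennreal (N x)"
    and N_mono: "mono N" and N_zero: "\<And>x. x < 1 \<Longrightarrow> N x = 0"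
    and a_pos: "a > 0" and density: "N \<sim>[at_top] (\<lambda>x. a * x)"
    and g1_meas[measurable]: "g1 \<in> borel_measurable borel" and g2_meas[measurable]: "g2 \<in> borel_measurable borel"
    and g1_le: "\<And>x. norm (g1 x) \<le> 1"
    and Cc_nonneg: "Cc \<ge> 0"
    and g1_cheb: "\<And>x. x \<ge> 1 \<Longrightarrow> (\<integral>\<^sup>+u. indicator {..x} u * ennreal (norm (g1 u) * ln u) \<partial>M) \<le> ennreal (Cc * x)"
    and g2_sum: "(\<integral>\<^sup>+x. ennreal (norm (g2 x) / x) \<partial>M) < \<infinity>"
begin

abbreviation g :: "real \<Rightarrow> complex" where "g x \<equiv> g1 x + g2 x"

sublocale one: mark_base M "\<lambda>_. 1" by (rule base)

lemma base_of: "h \<in> borel_measurable borel \<Longrightarrow> mark_base M h"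
  by (rule mark_base_cong_weight[OF base])

lemma N_nonneg: "N x \<ge> 0"
  using monoD[OF N_mono, of "min x 0" x] N_zero[of "min x 0"] by simp

definition CN :: real where "CN = (SOME C. C \<ge> 0 \<and> (\<forall>x\<ge>0. N x \<le> C * x))"

lemma CN: "CN \<ge> 0" "x \<ge> 0 \<Longrightarrow> N x \<le> CN * x"
proof -
  have "CN \<ge> 0 \<and> (\<forall>x\<ge>0. N x \<le> CN * x)"
    unfolding CN_def by (rule someI_ex) (use asymp_linear_bounds(1)[OF a_pos density N_mono N_zero] in blast)
  then show "CN \<ge> 0" "x \<ge> 0 \<Longrightarrow> N x \<le> CN * x" by auto
qed

abbreviation h2 :: "real \<Rightarrow> real" where "h2 x \<equiv> norm (g2 x)"

sublocale h2: mark_base M "\<lambda>x. of_real (h2 x)" by (rule base_of) measurable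

text \<open>Bounds the contribution of \<open>g2\<close> to the logarithm of the transform
  throughout the half-plane \<open>Re s > 1\<close>.\<close>

definition c2 :: real where "c2 = enn2real (\<integral>\<^sup>+x. ennreal (h2 x / x) \<partial>M)"

lemma c2: "c2 \<ge> 0" "(\<integral>\<^sup>+x. ennreal (h2 x / x) \<partial>M) = ennreal c2"
  using g2_sum by (auto simp: c2_def)

lemma nn_integral_weight_inverse:
  "(\<integral>\<^sup>+x. ennreal (1 / x) * ennreal (norm (complex_of_real (h2 x))) \<partial>M) \<le> ennreal c2"
proof -
  have "(\<integral>\<^sup>+x. ennreal (1 / x) * ennreal (norm (complex_of_real (h2 x))) \<partial>M) = (\<integral>\<^sup>+x. ennreal (h2 x / x) \<partial>M)"
    by (intro nn_integral_cong_AE, use one.AE_M in eventually_elim) (simp add: ennreal_mult[symmetric] mult.commute)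
  then show ?thesis using c2 by simp
qed

lemma abs_exp_h2_inverse: "abs_exp M h2 (\<lambda>x. ennreal (1 / x)) \<le> ennreal (exp c2)"
  unfolding abs_exp_def
  by (rule h2.nn_integral_mark_exp_submult[OF _ _ _ nn_integral_weight_inverse c2(1)])
     (auto simp: ennreal_mult[symmetric])

lemma abs_exp_one_scale:
  assumes x: "x > 0"
  shows "abs_exp M (\<lambda>_. 1) (\<lambda>y. indicator {..v} (x * y)) = ennreal (N (v / x))"
proof -
  have "abs_exp M (\<lambda>_. 1) (\<lambda>y. indicator {..v} (x * y)) = abs_exp M (\<lambda>_. 1) (indicator {..v / x})"
    using x by (intro arg_cong[of _ _ "abs_exp M (\<lambda>_. 1)"]) (auto simp: indicator_def field_simps)
  then show ?thesis by (simp add: N_exp)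
qed

lemma abs_exp_one_scale_Ioc:
  assumes x: "x > 0" and v: "v \<le> v'"
  shows "abs_exp M (\<lambda>_. 1) (\<lambda>y. indicator {v<..v'} (x * y)) = ennreal (N (v' / x) - N (v / x))"
proof -
  have "abs_exp M (\<lambda>_. 1) (\<lambda>y. indicator {..v'} (x * y)) =
     abs_exp M (\<lambda>_. 1) (\<lambda>y. indicator {..v} (x * y) + indicator {v<..v'} (x * y))"
    using v by (intro arg_cong[of _ _ "abs_exp M (\<lambda>_. 1)"]) (auto simp: indicator_def fun_eq_iff)
  also have "\<dots> = abs_exp M (\<lambda>_. 1) (\<lambda>y. indicator {..v} (x * y)) + abs_exp M (\<lambda>_. 1) (\<lambda>y. indicator {v<..v'} (x * y))"
    by (rule abs_exp_add) measurable
  finally have eq: "ennreal (N (v' / x)) = ennreal (N (v / x)) + abs_exp M (\<lambda>_. 1) (\<lambda>y. indicator {v<..v'} (x * y))"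
    unfolding abs_exp_one_scale[OF x] .
  have "N (v / x) \<le> N (v' / x)" using x v by (intro monoD[OF N_mono] divide_right_mono) auto
  then have "ennreal (N (v / x) + (N (v' / x) - N (v / x))) = ennreal (N (v / x)) + ennreal (N (v' / x) - N (v / x))"
    using N_nonneg by (intro ennreal_plus) auto
  then have "ennreal (N (v / x)) + abs_exp M (\<lambda>_. 1) (\<lambda>y. indicator {v<..v'} (x * y)) =
      ennreal (N (v / x)) + ennreal (N (v' / x) - N (v / x))"
    using eq by simp
  then show ?thesis unfolding ennreal_add_left_cancel by simp
qed

text \<open>By \<open>|g| \<le> |g2| + 1\<close> and the Cauchy product, |dG| is at most the
  convolution of \<open>exp\<^sup>*(|g2| d\<Pi>)\<close> with dN. Sums over |dG| thereby turn into
  sums over values of \<open>N\<close> at quotients \<open>v / x\<close>.\<close>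

lemma W_le_factor:
  assumes [measurable]: "f \<in> borel_measurable borel"
  shows "(\<integral>\<^sup>+p. f (fst p) * ennreal (norm (snd p)) \<partial>mark_exp M g)
     \<le> abs_exp M h2 (\<lambda>x. abs_exp M (\<lambda>_. 1) (\<lambda>y. f (x * y)))"
proof -
  interpret mark_base_sum M h2 "\<lambda>_. 1"
    by unfold_locales (use one.mark_base_axioms in \<open>auto simp: one.M_null one.M_fin[simplified]\<close>)
  have "(\<integral>\<^sup>+p. f (fst p) * ennreal (norm (snd p)) \<partial>mark_exp M g) \<le> abs_exp M (\<lambda>x. h2 x + 1) f"
  proof (rule nn_integral_le_abs_exp)
    show "norm (g x) \<le> h2 x + 1" for x using norm_triangle_ineq[of "g1 x" "g2 x"] g1_le[of x] by linarith
  qed (auto intro!: base_of)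
  also have "\<dots> \<le> abs_exp M h2 (\<lambda>x. abs_exp M (\<lambda>_. 1) (\<lambda>y. f (x * y)))"
    by (rule abs_exp_sum_le) measurable
  finally show ?thesis .
qed

definition CW :: real where "CW = CN * exp c2"

lemma CW_nonneg: "CW \<ge> 0" using CN by (simp add: CW_def)

text \<open>\<open>N (v / x) \<le> CN * v / x\<close>, and \<open>1 / x\<close> is summable against
  the exponential of the weight |g2|.\<close>

lemma W_le:
  assumes v: "v \<ge> 0"
  shows "(\<integral>\<^sup>+p. indicator {..v} (fst p) * ennreal (norm (snd p)) \<partial>mark_exp M g) \<le> ennreal (CW * v)"
proof -
  have "(\<integral>\<^sup>+p. indicator {..v} (fst p) * ennreal (norm (snd p)) \<partial>mark_exp M g)
     \<le> abs_exp M h2 (\<lambda>x. abs_exp M (\<lambda>_. 1) (\<lambda>y. indicator {..v} (x * y)))"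
    by (rule W_le_factor) measurable
  also have "\<dots> \<le> abs_exp M h2 (\<lambda>x. ennreal (CN * v) * ennreal (1 / x))"
  proof (rule abs_exp_mono)
    fix x :: real assume x: "x \<ge> 1"
    have "N (v / x) \<le> CN * v * (1 / x)" using CN(2)[of "v / x"] v x by simp
    then show "abs_exp M (\<lambda>_. 1) (\<lambda>y. indicator {..v} (x * y)) \<le> ennreal (CN * v) * ennreal (1 / x)"
      using x v CN(1) by (subst abs_exp_one_scale) (auto simp: ennreal_mult[symmetric] intro!: ennreal_leI)
  qed (rule h2.mark_base_axioms)
  also have "\<dots> = ennreal (CN * v) * abs_exp M h2 (\<lambda>x. ennreal (1 / x))"
    by (rule abs_exp_cmult) measurable
  also have "\<dots> \<le> ennreal (CN * v) * ennreal (exp c2)"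
    by (intro mult_left_mono abs_exp_h2_inverse) simp
  also have "\<dots> = ennreal (CW * v)"
    using CN(1) v by (subst ennreal_mult[symmetric]) (auto simp: CW_def mult_ac)
  finally show ?thesis .
qed

lemma abs_exp_h2_tail:
  assumes e: "e > 0"
  obtains R where "R \<ge> 1" "abs_exp M h2 (\<lambda>x. indicator {R<..} x * ennreal (1 / x)) \<le> ennreal e"
proof -
  let ?E = "mark_exp M (\<lambda>x. complex_of_real (h2 x))"
  let ?w = "\<lambda>p. ennreal (1 / fst p) * ennreal (norm (snd p))"
  have "((\<lambda>n. \<integral>\<^sup>+p. indicator {real n<..} (fst p) * ?w p \<partial>?E) \<longlongrightarrow> (\<integral>\<^sup>+p. 0 \<partial>?E)) sequentially"
  proof (rule nn_integral_dominated_convergence[where w = ?w])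
    show "AE p in ?E. (\<lambda>n. indicator {real n<..} (fst p) * ?w p) \<longlonglongrightarrow> 0"
    proof (rule AE_I2)
      fix p :: "real \<times> complex"
      have "\<forall>\<^sub>F n in sequentially. indicator {real n<..} (fst p) * ?w p = 0"
        using eventually_ge_at_top[of "nat \<lceil>fst p\<rceil>"] by eventually_elim (auto simp: indicator_def)
      then show "(\<lambda>n. indicator {real n<..} (fst p) * ?w p) \<longlonglongrightarrow> 0"
        by (rule tendsto_eventually)
    qed
    show "(\<integral>\<^sup>+p. ?w p \<partial>?E) < \<infinity>"
      using abs_exp_h2_inverse unfolding abs_exp_def by (auto intro: le_less_trans)
    show "AE p in ?E. indicator {real n<..} (fst p) * ?w p \<le> ?w p" for n
      by (auto simp: indicator_def)
  qed auto
  then have "\<forall>\<^sub>F n in sequentially. (\<integral>\<^sup>+p. indicator {real n<..} (fst p) * ?w p \<partial>?E) < ennreal e"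
    using e by (intro order_tendstoD) auto
  then have "\<forall>\<^sub>F n in sequentially. n \<ge> 1 \<and> (\<integral>\<^sup>+p. indicator {real n<..} (fst p) * ?w p \<partial>?E) < ennreal e"
    using eventually_ge_at_top[of 1] by eventually_elim simp
  then obtain n where n: "n \<ge> 1" "(\<integral>\<^sup>+p. indicator {real n<..} (fst p) * ?w p \<partial>?E) < ennreal e"
    by (auto simp: eventually_sequentially)
  show thesis
    by (rule that[of "real n"]) (use n in \<open>auto simp: abs_exp_def mult.assoc less_imp_le\<close>)
qed

text \<open>Here the asymptotic law for \<open>N\<close> is used and not just an upper bound. For
  \<open>x \<le> R\<close> a short interval near \<open>v / x\<close> has an \<open>N\<close>-mass
  proportional to its length up to a small error; for \<open>x > R\<close> the bound
  \<open>N y \<le> CN * y\<close> meets a small tail of the sum of \<open>1 / x\<close>. This is the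
  source of the slow oscillation of \<open>T\<close>.\<close>

lemma W_slow:
  assumes e: "e > 0"
  shows "\<exists>\<delta>>0. \<exists>v0\<ge>1. \<forall>v\<ge>v0. \<forall>v'\<in>{v..(1 + \<delta>) * v}.
    (\<integral>\<^sup>+p. indicator {v<..v'} (fst p) * ennreal (norm (snd p)) \<partial>mark_exp M g) \<le> ennreal (e * v)"
proof -
  \<comment> \<open>The two ranges of \<open>x\<close> will contribute
    \<open>e' * (exp c2 + 2 * CN) * v\<close> altogether.\<close>
  define e' where "e' = e / (exp c2 + 2 * CN + 1)"
  have den: "exp c2 + 2 * CN + 1 > 0" using CN(1) by (intro add_nonneg_pos add_nonneg_nonneg) auto
  have e': "e' > 0" using e den by (simp add: e'_def)
  obtain R where R: "R \<ge> 1" "abs_exp M h2 (\<lambda>x. indicator {R<..} x * ennreal (1 / x)) \<le> ennreal e'"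
    by (rule abs_exp_h2_tail[OF e']) (rule that)
  define \<delta> where "\<delta> = min 1 (e' / (2 * a))"
  have \<delta>: "\<delta> > 0" "\<delta> \<le> 1" using e' a_pos by (auto simp: \<delta>_def)
  have ad: "a * \<delta> \<le> e' / 2"
  proof -
    have "a * \<delta> \<le> a * (e' / (2 * a))" using a_pos by (intro mult_left_mono) (auto simp: \<delta>_def)
    then show ?thesis using a_pos by simp
  qed
  have "e' / 6 > 0" using e' by simp
  from asymp_linear_bounds(2)[OF a_pos density N_mono N_zero this]
  obtain Y where Y: "Y \<ge> 1" "\<And>y. y \<ge> Y \<Longrightarrow> \<bar>N y - a * y\<bar> \<le> e' / 6 * y" by auto
  \<comment> \<open>The errors e'/2 from the length of the interval, e'/3 at its upper end (where 1
    + \<delta> \<le> 2) and e'/6 at its lower end add up to e'.\<close>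
  have slow: "N (y') - N y \<le> e' * y" if y: "y \<ge> Y" "y \<le> y'" "y' \<le> (1 + \<delta>) * y" for y y'
  proof -
    have y0: "y \<ge> 0" using y Y by simp
    have "N y' \<le> N ((1 + \<delta>) * y)" using y by (intro monoD[OF N_mono])
    also have "\<dots> \<le> a * ((1 + \<delta>) * y) + e' / 6 * ((1 + \<delta>) * y)"
    proof -
      have "(1 + \<delta>) * y \<ge> Y" using y by linarith
      then show ?thesis using Y(2)[of "(1 + \<delta>) * y"] by linarith
    qed
    also have "e' / 6 * ((1 + \<delta>) * y) \<le> e' / 6 * (2 * y)"
      using \<delta> y0 e' by (intro mult_left_mono mult_right_mono) auto
    finally have "N y' \<le> a * y + (a * \<delta>) * y + e' / 3 * y" by (simp add: algebra_simps)
    moreover have "(a * \<delta>) * y \<le> e' / 2 * y" using ad y0 by (intro mult_right_mono)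
    moreover have "N y \<ge> a * y - e' / 6 * y" using Y(2)[OF y(1)] by linarith
    ultimately have "N y' - N y \<le> e' / 3 * y + e' / 2 * y + e' / 6 * y" by linarith
    then show ?thesis by (simp add: algebra_simps)
  qed
  have key: "(\<integral>\<^sup>+p. indicator {v<..v'} (fst p) * ennreal (norm (snd p)) \<partial>mark_exp M g) \<le> ennreal (e * v)"
    if v: "v \<ge> R * Y" "v' \<in> {v..(1 + \<delta>) * v}" for v v'
  proof -
    have "R * Y \<ge> 1 * 1" using R Y by (intro mult_mono) auto
    then have v0: "v > 0" using v by linarith
    have "(\<integral>\<^sup>+p. indicator {v<..v'} (fst p) * ennreal (norm (snd p)) \<partial>mark_exp M g)
       \<le> abs_exp M h2 (\<lambda>x. abs_exp M (\<lambda>_. 1) (\<lambda>y. indicator {v<..v'} (x * y)))"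
      by (rule W_le_factor) measurable
    also have "\<dots> \<le> abs_exp M h2 (\<lambda>x. ennreal (e' * v) * ennreal (1 / x) +
        ennreal (2 * CN * v) * (indicator {R<..} x * ennreal (1 / x)))"
    proof (rule abs_exp_mono)
      fix x :: real assume x: "x \<ge> 1"
      have eq: "abs_exp M (\<lambda>_. 1) (\<lambda>y. indicator {v<..v'} (x * y)) = ennreal (N (v' / x) - N (v / x))"
        by (rule abs_exp_one_scale_Ioc) (use x v in auto)
      show "abs_exp M (\<lambda>_. 1) (\<lambda>y. indicator {v<..v'} (x * y)) \<le>
        ennreal (e' * v) * ennreal (1 / x) + ennreal (2 * CN * v) * (indicator {R<..} x * ennreal (1 / x))"
      proof (cases "x \<le> R")
        case True
        have "Y * x \<le> v"
        proof -
          have "Y * x \<le> Y * R" using True Y by (intro mult_left_mono) auto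
          then show ?thesis using v by (simp add: mult.commute)
        qed
        then have "N (v' / x) - N (v / x) \<le> e' * (v / x)"
          using x v by (intro slow) (auto simp: field_simps)
        then have "ennreal (N (v' / x) - N (v / x)) \<le> ennreal (e' * v) * ennreal (1 / x)"
          using x v0 e' by (subst ennreal_mult[symmetric]) (auto intro!: ennreal_leI)
        then show ?thesis unfolding eq by (rule add_increasing2[rotated]) simp
      next
        case False
        have "N (v' / x) - N (v / x) \<le> CN * (v' / x)"
          using CN(2)[of "v' / x"] N_nonneg[of "v / x"] v v0 x by simp
        also have "v' \<le> 2 * v"
        proof -
          have "(1 + \<delta>) * v \<le> 2 * v" using \<delta> v0 by (intro mult_right_mono) auto
          then show ?thesis using v by auto
        qed
        then have "CN * (v' / x) \<le> CN * (2 * v / x)"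
          using x CN(1) by (intro mult_left_mono divide_right_mono) auto
        finally have "ennreal (N (v' / x) - N (v / x)) \<le> ennreal (2 * CN * v) * (indicator {R<..} x * ennreal (1 / x))"
          using x v0 CN(1) False by (simp add: ennreal_mult[symmetric] ennreal_leI mult_ac)
        then show ?thesis unfolding eq by (rule add_increasing[rotated]) simp
      qed
    qed (rule h2.mark_base_axioms)
    also have "\<dots> = ennreal (e' * v) * abs_exp M h2 (\<lambda>x. ennreal (1 / x)) +
        ennreal (2 * CN * v) * abs_exp M h2 (\<lambda>x. indicator {R<..} x * ennreal (1 / x))"
      by (subst abs_exp_add, measurable, subst abs_exp_cmult, measurable, subst abs_exp_cmult) auto
    also have "\<dots> \<le> ennreal (e' * v) * ennreal (exp c2) + ennreal (2 * CN * v) * ennreal e'"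
      by (intro add_mono mult_left_mono abs_exp_h2_inverse R) auto
    also have "\<dots> = ennreal ((e' * v) * exp c2 + (2 * CN * v) * e')"
      using e' v0 CN(1) by (simp add: ennreal_mult[symmetric])
    also have "\<dots> \<le> ennreal (e * v)"
    proof (rule ennreal_leI)
      have "(e' * v) * exp c2 + (2 * CN * v) * e' = e' * (exp c2 + 2 * CN) * v" by (simp add: algebra_simps)
      also have "\<dots> \<le> e' * (exp c2 + 2 * CN + 1) * v" using e' v0 by (intro mult_right_mono mult_left_mono) auto
      also have "\<dots> = e * v" using den by (simp add: e'_def)
      finally show "(e' * v) * exp c2 + (2 * CN * v) * e' \<le> e * v" .
    qed
    finally show ?thesis .
  qed
  have "R * Y \<ge> 1 * 1" using R Y by (intro mult_mono) auto
  then show ?thesis using \<delta>(1) key by (intro exI[of _ \<delta>] conjI exI[of _ "R * Y"]) auto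
qed

end

section \<open>Mellin transforms by partial summation\<close>

lemma le_exp_iff: "y > 0 \<Longrightarrow> y \<le> exp u \<longleftrightarrow> ln y \<le> u" for y u :: real
  by (metis exp_le_cancel_iff exp_ln)

lemma borel_measurable_indicator_atMost[measurable (raw)]:
  fixes f g :: "'a \<Rightarrow> real"
  assumes [measurable]: "f \<in> borel_measurable M" "g \<in> borel_measurable M"
  shows "(\<lambda>x. indicator {..f x} (g x) :: 'b :: {zero_neq_one, topological_space}) \<in> borel_measurable M"
proof -
  have "(\<lambda>x. indicator {..f x} (g x) :: 'b) = (\<lambda>x. if g x \<le> f x then 1 else 0)"
    by (auto simp: indicator_def)
  then show ?thesis by simp
qed

definition mellin_kernel :: "complex \<Rightarrow> real \<Rightarrow> complex" where
  "mellin_kernel s x = exp (- s * of_real (ln x))"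

lemma mellin_kernel_measurable[measurable]: "mellin_kernel s \<in> borel_measurable borel"
  unfolding mellin_kernel_def by measurable

lemma mellin_kernel_1[simp]: "mellin_kernel s 1 = 1"
  by (simp add: mellin_kernel_def)

lemma mellin_kernel_mult: "x \<ge> 1 \<Longrightarrow> y \<ge> 1 \<Longrightarrow> mellin_kernel s (x * y) = mellin_kernel s x * mellin_kernel s y"
  by (simp add: mellin_kernel_def ln_mult distrib_left flip: exp_add)

lemma norm_mellin_kernel: "norm (mellin_kernel s x) = exp (- Re s * ln x)"
  by (simp add: mellin_kernel_def)

text \<open>The germ of partial summation: a shift by \<open>ln y\<close> reduces the integral over
  \<open>u \<ge> ln y\<close> to \<open>1 / s\<close>, and Fubini will turn the condition
  \<open>y \<le> exp u\<close> into a summatory function.\<close>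

lemma mellin_kernel_decay:
  assumes s: "Re s > 0" and y: "y \<ge> 1"
  shows "(\<integral>u. indicator {0..} u * (indicator {..exp u} y * (s * exp (- s * of_real u))) \<partial>lborel) = mellin_kernel s y"
proof -
  have s0: "s \<noteq> 0" using s by auto
  have ind: "indicator {0..} u * (indicator {..exp u} y * (s * exp (- s * of_real u))) =
     s * mellin_kernel s y * (indicator {0..} (- ln y + 1 * u) * exp (- s * of_real (- ln y + 1 * u)))" for u
  proof -
    have "y \<le> exp u \<longleftrightarrow> ln y \<le> u" using y by (intro le_exp_iff) simp
    moreover have "ln y \<ge> 0" using y by simp
    ultimately show ?thesis by (auto simp: indicator_def mellin_kernel_def algebra_simps simp flip: exp_add)
  qed
  have "(\<integral>u. indicator {0..} u * (indicator {..exp u} y * (s * exp (- s * of_real u))) \<partial>lborel) =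
     s * mellin_kernel s y * (\<integral>u. indicator {0..} (- ln y + 1 * u) * exp (- s * of_real (- ln y + 1 * u)) \<partial>lborel)"
    unfolding ind by (rule integral_mult_right_zero)
  also have "(\<integral>u. indicator {0..} (- ln y + 1 * u) * exp (- s * of_real (- ln y + 1 * u)) \<partial>lborel) =
     (\<integral>u. indicator {0..} u * exp (- s * of_real u) \<partial>lborel)"
    using lborel_integral_real_affine[of 1 "\<lambda>u. indicator {0..} u * exp (- s * of_real u)" "- ln y"] by simp
  also have "\<dots> = 1 / s" by (rule integral_cexp_decay[OF s])
  finally show ?thesis using s0 by simp
qed

lemma nn_mellin_kernel_decay:
  assumes s: "s > 0" and y: "y \<ge> 1"
  shows "(\<integral>\<^sup>+u. indicator {0..} u * (indicator {..exp u} y * ennreal (s * exp (- s * u))) \<partial>lborel) = ennreal (exp (- s * ln y))"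
proof -
  have "(\<integral>\<^sup>+u. indicator {0..} u * (indicator {..exp u} y * ennreal (s * exp (- s * u))) \<partial>lborel) =
     (\<integral>\<^sup>+u. ennreal (s * exp (- s * ln y)) * (indicator {0..} (- ln y + 1 * u) * ennreal (exp (- s * (- ln y + 1 * u)))) \<partial>lborel)"
  proof (rule nn_integral_cong)
    fix u :: real
    have "y \<le> exp u \<longleftrightarrow> ln y \<le> u" using y by (intro le_exp_iff) simp
    moreover have "ln y \<ge> 0" using y by simp
    moreover have "s * exp (- s * u) = s * exp (- s * ln y) * exp (- s * (- ln y + 1 * u))"
      by (simp add: algebra_simps flip: exp_add)
    then have "ennreal (s * exp (- s * u)) = ennreal (s * exp (- s * ln y)) * ennreal (exp (- s * (- ln y + 1 * u)))"
      using s by (simp only:) (rule ennreal_mult, auto)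
    ultimately show "indicator {0..} u * (indicator {..exp u} y * ennreal (s * exp (- s * u))) =
      ennreal (s * exp (- s * ln y)) * (indicator {0..} (- ln y + 1 * u) * ennreal (exp (- s * (- ln y + 1 * u))))"
      by (auto simp: indicator_def)
  qed
  also have "\<dots> = ennreal (s * exp (- s * ln y)) * (\<integral>\<^sup>+u. indicator {0..} (- ln y + 1 * u) * ennreal (exp (- s * (- ln y + 1 * u))) \<partial>lborel)"
    by (rule nn_integral_cmult) measurable
  also have "(\<integral>\<^sup>+u. indicator {0..} (- ln y + 1 * u) * ennreal (exp (- s * (- ln y + 1 * u))) \<partial>lborel) =
     (\<integral>\<^sup>+u. indicator {0..} u * ennreal (exp (- s * u)) \<partial>lborel)"
    using nn_integral_real_affine[of "\<lambda>u. indicator {0..} u * ennreal (exp (- s * u))" 1 "- ln y"] by simp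
  also have "\<dots> = ennreal (1 / s)" by (rule nn_integral_exp_decay[OF s])
  also have "ennreal (s * exp (- s * ln y)) * ennreal (1 / s) = ennreal (exp (- s * ln y))"
    using s by (subst ennreal_mult[symmetric]) auto
  finally show ?thesis .
qed

context mark_base
begin

definition summ :: "real \<Rightarrow> complex" where
  "summ v = (\<integral>p. indicator {..v} (fst p) * snd p \<partial>mark_exp M g)"

lemma summ_measurable[measurable]: "summ \<in> borel_measurable borel"
  unfolding summ_def by measurable

lemma summ_less_1: "v < 1 \<Longrightarrow> summ v = 0"
proof -
  assume v: "v < 1"
  have "summ v = (\<integral>p. 0 \<partial>mark_exp M g)"
    unfolding summ_def
    by (rule integral_cong_AE, measurable, use AE_mark_exp in eventually_elim) (use v in \<open>auto simp: indicator_def\<close>)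
  then show ?thesis by simp
qed

lemma nn_integral_mellin:
  assumes s: "s > 0"
  shows "(\<integral>\<^sup>+p. ennreal (exp (- s * ln (fst p))) * ennreal (norm (snd p)) \<partial>mark_exp M g) =
    (\<integral>\<^sup>+u. indicator {0..} u * ennreal (s * exp (- s * u)) *
       (\<integral>\<^sup>+p. indicator {..exp u} (fst p) * ennreal (norm (snd p)) \<partial>mark_exp M g) \<partial>lborel)"
proof -
  interpret P: pair_sigma_finite "mark_exp M g" lborel
    by (simp add: pair_sigma_finite_def E.sigma_finite_measure_axioms sigma_finite_lborel)
  have "(\<integral>\<^sup>+p. ennreal (exp (- s * ln (fst p))) * ennreal (norm (snd p)) \<partial>mark_exp M g) =
    (\<integral>\<^sup>+p. (\<integral>\<^sup>+u. indicator {0..} u * (indicator {..exp u} (fst p) * ennreal (s * exp (- s * u))) \<partial>lborel) * ennreal (norm (snd p)) \<partial>mark_exp M g)"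
    by (intro nn_integral_cong_AE, use AE_mark_exp in eventually_elim) (simp only: nn_mellin_kernel_decay[OF s])
  also have "\<dots> = (\<integral>\<^sup>+p. \<integral>\<^sup>+u. indicator {0..} u * ennreal (s * exp (- s * u)) * (indicator {..exp u} (fst p) * ennreal (norm (snd p))) \<partial>lborel \<partial>mark_exp M g)"
    by (intro nn_integral_cong, subst nn_integral_multc[symmetric]) (auto simp: mult_ac)
  also have "\<dots> = (\<integral>\<^sup>+u. \<integral>\<^sup>+p. indicator {0..} u * ennreal (s * exp (- s * u)) * (indicator {..exp u} (fst p) * ennreal (norm (snd p))) \<partial>mark_exp M g \<partial>lborel)"
    by (rule P.Fubini'[symmetric]) measurable
  also have "\<dots> = (\<integral>\<^sup>+u. indicator {0..} u * ennreal (s * exp (- s * u)) *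
       (\<integral>\<^sup>+p. indicator {..exp u} (fst p) * ennreal (norm (snd p)) \<partial>mark_exp M g) \<partial>lborel)"
    by (intro nn_integral_cong nn_integral_cmult) measurable
  finally show ?thesis .
qed

text \<open>Fubini for the double integral in \<open>p\<close> and \<open>u\<close>. The modulus of
  the integrand is the same expression with \<open>Re s\<close> in place of \<open>s\<close>, up to
  the factor \<open>norm s / Re s\<close>, so it is integrable as soon as the transform converges
  absolutely.\<close>

lemma mellin_eq_summ:
  assumes s: "Re s > 0" and int: "integrable (mark_exp M g) (\<lambda>p. mellin_kernel s (fst p) * snd p)"
  shows "(\<integral>p. mellin_kernel s (fst p) * snd p \<partial>mark_exp M g) = s * (\<integral>u. indicator {0..} u * (summ (exp u) * exp (- s * of_real u)) \<partial>lborel)"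
proof -
  interpret P: pair_sigma_finite "mark_exp M g" lborel
    by (simp add: pair_sigma_finite_def E.sigma_finite_measure_axioms sigma_finite_lborel)
  define k where "k = (\<lambda>(p, u). indicator {0..} u * (indicator {..exp u} (fst p) * (s * exp (- s * of_real u))) * snd p :: complex)"
  have [measurable]: "k \<in> borel_measurable (mark_exp M g \<Otimes>\<^sub>M lborel)"
    unfolding k_def by measurable
  have s0: "s \<noteq> 0" using s by auto
  have ik: "integrable (mark_exp M g \<Otimes>\<^sub>M lborel) k"
  proof (rule integrableI_bounded)
    have "(\<integral>\<^sup>+q. ennreal (norm (k q)) \<partial>(mark_exp M g \<Otimes>\<^sub>M lborel)) = (\<integral>\<^sup>+p. \<integral>\<^sup>+u. ennreal (norm (k (p, u))) \<partial>lborel \<partial>mark_exp M g)"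
      by (rule lborel.nn_integral_fst[symmetric]) measurable
    also have "\<dots> = (\<integral>\<^sup>+p. ennreal (norm s / Re s) * ennreal (norm (mellin_kernel s (fst p) * snd p)) \<partial>mark_exp M g)"
    proof (intro nn_integral_cong_AE, use AE_mark_exp in eventually_elim)
      case (elim p)
      have "(\<integral>\<^sup>+u. ennreal (norm (k (p, u))) \<partial>lborel) =
         (\<integral>\<^sup>+u. (ennreal (norm s / Re s) * ennreal (norm (snd p))) * (indicator {0..} u * (indicator {..exp u} (fst p) * ennreal (Re s * exp (- Re s * u)))) \<partial>lborel)"
        using s by (intro nn_integral_cong) (auto simp: k_def norm_mult indicator_def ennreal_mult[symmetric] field_simps)
      also have "\<dots> = (ennreal (norm s / Re s) * ennreal (norm (snd p))) * ennreal (exp (- Re s * ln (fst p)))"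
        by (subst nn_integral_cmult, measurable) (simp only: nn_mellin_kernel_decay[OF s elim])
      finally show ?case using s by (simp add: norm_mult norm_mellin_kernel ennreal_mult mult_ac)
    qed
    also have "\<dots> = ennreal (norm s / Re s) * (\<integral>\<^sup>+p. ennreal (norm (mellin_kernel s (fst p) * snd p)) \<partial>mark_exp M g)"
      by (rule nn_integral_cmult) measurable
    also have "\<dots> < \<infinity>" using int by (simp add: integrable_iff_bounded ennreal_mult_less_top)
    finally show "(\<integral>\<^sup>+q. ennreal (norm (k q)) \<partial>(mark_exp M g \<Otimes>\<^sub>M lborel)) < \<infinity>" .
  qed simp
  have "(\<integral>p. mellin_kernel s (fst p) * snd p \<partial>mark_exp M g) = (\<integral>p. \<integral>u. k (p, u) \<partial>lborel \<partial>mark_exp M g)"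
  proof (rule integral_cong_AE)
    show "AE p in mark_exp M g. mellin_kernel s (fst p) * snd p = (\<integral>u. k (p, u) \<partial>lborel)"
      using AE_mark_exp
    proof eventually_elim
      case (elim p)
      have "(\<integral>u. k (p, u) \<partial>lborel) = (\<integral>u. indicator {0..} u * (indicator {..exp u} (fst p) * (s * exp (- s * of_real u))) \<partial>lborel) * snd p"
        unfolding k_def split by (rule integral_mult_left_zero)
      then show ?case by (simp only: mellin_kernel_decay[OF s elim])
    qed
  qed measurable
  also have "\<dots> = (\<integral>u. \<integral>p. k (p, u) \<partial>mark_exp M g \<partial>lborel)"
    using P.Fubini_integral[of "\<lambda>p u. k (p, u)"] ik by simp
  also have "\<dots> = (\<integral>u. s * (indicator {0..} u * (summ (exp u) * exp (- s * of_real u))) \<partial>lborel)"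
  proof (rule Bochner_Integration.integral_cong[OF refl])
    fix u :: real
    have "(\<integral>p. k (p, u) \<partial>mark_exp M g) = (\<integral>p. (indicator {0..} u * (s * exp (- s * of_real u))) * (indicator {..exp u} (fst p) * snd p) \<partial>mark_exp M g)"
      unfolding k_def by (intro Bochner_Integration.integral_cong) (auto simp: mult_ac)
    also have "\<dots> = (indicator {0..} u * (s * exp (- s * of_real u))) * summ (exp u)"
      unfolding summ_def by (rule integral_mult_right_zero)
    finally show "(\<integral>p. k (p, u) \<partial>mark_exp M g) = s * (indicator {0..} u * (summ (exp u) * exp (- s * of_real u)))"
      by (simp add: mult_ac)
  qed
  also have "\<dots> = s * (\<integral>u. indicator {0..} u * (summ (exp u) * exp (- s * of_real u)) \<partial>lborel)"
    by (rule integral_mult_right_zero)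
  finally show ?thesis .
qed

lemma norm_summ_le:
  assumes "(\<integral>\<^sup>+p. indicator {..v} (fst p) * ennreal (norm (snd p)) \<partial>mark_exp M g) \<le> ennreal b" and "b \<ge> 0"
  shows "norm (summ v) \<le> b"
proof -
  have "integrable (mark_exp M g) (\<lambda>p. indicator {..v} (fst p) * snd p)"
  proof (rule integrableI_bounded)
    have "(\<integral>\<^sup>+p. ennreal (norm (indicator {..v} (fst p) * snd p)) \<partial>mark_exp M g) =
      (\<integral>\<^sup>+p. indicator {..v} (fst p) * ennreal (norm (snd p)) \<partial>mark_exp M g)"
      by (intro nn_integral_cong) (auto simp: indicator_def)
    then show "(\<integral>\<^sup>+p. ennreal (norm (indicator {..v} (fst p) * snd p)) \<partial>mark_exp M g) < \<infinity>"
      using assms by (auto intro: le_less_trans)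
  qed simp
  then have "ennreal (norm (summ v)) \<le> (\<integral>\<^sup>+p. ennreal (norm (indicator {..v} (fst p) * snd p)) \<partial>mark_exp M g)"
    unfolding summ_def by (rule integral_norm_bound_ennreal)
  also have "\<dots> = (\<integral>\<^sup>+p. indicator {..v} (fst p) * ennreal (norm (snd p)) \<partial>mark_exp M g)"
    by (intro nn_integral_cong) (auto simp: indicator_def)
  also note assms(1)
  finally show ?thesis using assms(2) by (simp add: ennreal_le_iff)
qed

end

section \<open>The zeta function of the system and the majorant with weight 3/4\<close>

context beurling_weight
begin

text \<open>The left side is the zeta function of the system at \<open>1 + w\<close>; partial
  summation from \<open>N x \<le> CN * x\<close> gives the bound.\<close>

lemma nn_zeta_le:
  assumes w: "w > 0"
  shows "abs_exp M (\<lambda>_. 1) (\<lambda>x. ennreal (exp (- (1 + w) * ln x))) \<le> ennreal (CN * (1 + w) / w)"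
proof -
  have "abs_exp M (\<lambda>_. 1) (\<lambda>x. ennreal (exp (- (1 + w) * ln x))) =
     (\<integral>\<^sup>+u. indicator {0..} u * ennreal ((1 + w) * exp (- (1 + w) * u)) * abs_exp M (\<lambda>_. 1) (indicator {..exp u}) \<partial>lborel)"
    unfolding abs_exp_def of_real_1 by (rule one.nn_integral_mellin) (use w in auto)
  also have "\<dots> \<le> (\<integral>\<^sup>+u. ennreal (CN * (1 + w)) * (indicator {0..} u * ennreal (exp (- w * u))) \<partial>lborel)"
  proof (rule nn_integral_mono)
    fix u :: real
    have "(1 + w) * exp (- (1 + w) * u) * N (exp u) \<le> (1 + w) * exp (- (1 + w) * u) * (CN * exp u)"
      using w by (intro mult_left_mono CN) auto
    also have "\<dots> = CN * (1 + w) * exp (- w * u)" by (simp add: algebra_simps flip: exp_add)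
    finally have "ennreal ((1 + w) * exp (- (1 + w) * u) * N (exp u)) \<le> ennreal (CN * (1 + w) * exp (- w * u))"
      by (rule ennreal_leI)
    then have "ennreal ((1 + w) * exp (- (1 + w) * u)) * ennreal (N (exp u)) \<le> ennreal (CN * (1 + w)) * ennreal (exp (- w * u))"
      using w N_nonneg CN(1) by (simp only: ennreal_mult[symmetric] mult_nonneg_nonneg add_nonneg_nonneg exp_ge_zero zero_le_one less_imp_le)
    then show "indicator {0..} u * ennreal ((1 + w) * exp (- (1 + w) * u)) * abs_exp M (\<lambda>_. 1) (indicator {..exp u}) \<le>
      ennreal (CN * (1 + w)) * (indicator {0..} u * ennreal (exp (- w * u)))"
      unfolding N_exp by (auto simp: indicator_def)
  qed
  also have "\<dots> = ennreal (CN * (1 + w)) * ennreal (1 / w)"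
    by (subst nn_integral_cmult, measurable) (simp only: nn_integral_exp_decay[OF w])
  also have "\<dots> = ennreal (CN * (1 + w) / w)"
    using w CN(1) by (subst ennreal_mult[symmetric]) auto
  finally show ?thesis .
qed

text \<open>The logarithm of the zeta function of the system at \<open>1 + w\<close>.\<close>

definition lz :: "real \<Rightarrow> real" where "lz w = (\<integral>x. exp (- (1 + w) * ln x) \<partial>M)"

lemma
  assumes w: "w > 0"
  shows integrable_lz: "integrable M (\<lambda>x. exp (- (1 + w) * ln x))"
    and exp_lz_le: "exp (lz w) \<le> CN * (1 + w) / w"
proof -
  let ?\<kappa> = "mellin_kernel (of_real (1 + w))"
  have \<kappa>: "?\<kappa> x = of_real (exp (- (1 + w) * ln x))" for x
    unfolding mellin_kernel_def by (simp add: exp_of_real[symmetric])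
  let ?f = "\<lambda>p :: real \<times> complex. ennreal (exp (- (1 + w) * ln (fst p))) * ennreal (norm (snd p))"
  have fin: "(\<integral>\<^sup>+p. ?f p \<partial>mark_exp M (\<lambda>_. 1)) \<le> ennreal (CN * (1 + w) / w)"
    using nn_zeta_le[OF w] unfolding abs_exp_def by simp
  \<comment> \<open>The first convolution power is one term of the exponential series. This gives
    integrability over \<open>M\<close>, which the exponential formula presupposes.\<close>
  have "(\<integral>\<^sup>+x. ennreal (exp (- (1 + w) * ln x)) \<partial>M) = (\<integral>\<^sup>+p. ?f p \<partial>mark_power M (\<lambda>_. 1) (Suc 0))"
    by (subst one.nn_integral_mark_power_Suc) (auto simp: nn_integral_return space_pair_measure)
  also have "\<dots> \<le> (\<Sum>n. ennreal (1 / fact n) * (\<integral>\<^sup>+p. ?f p \<partial>mark_power M (\<lambda>_. 1) n))"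
    using sum_le_suminf[of "\<lambda>n. ennreal (1 / fact n) * (\<integral>\<^sup>+p. ?f p \<partial>mark_power M (\<lambda>_. 1) n)" "{Suc 0}"] by simp
  also have "\<dots> = (\<integral>\<^sup>+p. ?f p \<partial>mark_exp M (\<lambda>_. 1))"
    by (rule nn_integral_mark_exp[symmetric]) measurable
  also note fin
  finally show i: "integrable M (\<lambda>x. exp (- (1 + w) * ln x))"
    by (intro integrableI_bounded) (auto intro: le_less_trans)
  have ic: "integrable M (\<lambda>x. ?\<kappa> x * 1)" unfolding \<kappa> using i by simp
  have i2: "integrable (mark_exp M (\<lambda>_. 1)) (\<lambda>p. ?\<kappa> (fst p) * snd p)"
    by (rule one.integrable_mark_exp_submult(1)[OF _ _ _ ic]) (auto simp: mellin_kernel_mult norm_mult)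
  have "ennreal (norm (\<integral>p. ?\<kappa> (fst p) * snd p \<partial>mark_exp M (\<lambda>_. 1))) \<le>
     (\<integral>\<^sup>+p. ennreal (norm (?\<kappa> (fst p) * snd p)) \<partial>mark_exp M (\<lambda>_. 1))"
    by (rule integral_norm_bound_ennreal[OF i2])
  also have "\<dots> = (\<integral>\<^sup>+p. ?f p \<partial>mark_exp M (\<lambda>_. 1))"
    by (simp add: \<kappa> norm_mult ennreal_mult del: of_real_add)
  also note fin
  finally have "norm (\<integral>p. ?\<kappa> (fst p) * snd p \<partial>mark_exp M (\<lambda>_. 1)) \<le> CN * (1 + w) / w"
    using w CN(1) by (subst (asm) ennreal_le_iff) auto
  also have "(\<integral>p. ?\<kappa> (fst p) * snd p \<partial>mark_exp M (\<lambda>_. 1)) = exp (\<integral>x. ?\<kappa> x * 1 \<partial>M)"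
    by (rule one.integral_mark_exp_mult[OF _ _ _ ic]) (auto simp: mellin_kernel_mult)
  also have "(\<integral>x. ?\<kappa> x * 1 \<partial>M) = of_real (lz w)"
    unfolding lz_def by (simp only: \<kappa> mult_1_right integral_complex_of_real)
  finally show "exp (lz w) \<le> CN * (1 + w) / w" by simp
qed

text \<open>The part of |F|^(3/2) due to \<open>g1\<close> is the square of the modulus of an
  exponential with the weight \<open>3 / 4 * g1\<close>; hence the factor.\<close>

definition hh :: "real \<Rightarrow> real" where "hh x = 3 / 4 * norm (g1 x)"

lemma hh_measurable[measurable]: "hh \<in> borel_measurable borel"
  unfolding hh_def by measurable

lemma hh_nonneg: "hh x \<ge> 0" by (simp add: hh_def)

sublocale hh: mark_base M "\<lambda>x. of_real (hh x)" by (rule base_of) measurable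

text \<open>By the logarithm identity a single factor \<open>x\<close> carries the logarithm; for a
  fixed cofactor \<open>y\<close> Chebyshev's bound at \<open>X / y\<close> sums it to at most
  \<open>Cc * X / y\<close>.\<close>

lemma abs_exp_hh_log:
  assumes X: "X \<ge> 1"
  shows "(\<integral>\<^sup>+p. ennreal (ln (fst p)) * (indicator {..X} (fst p) * ennreal (norm (snd p))) \<partial>mark_exp M (\<lambda>x. of_real (hh x)))
     \<le> ennreal (Cc * X) * abs_exp M hh (\<lambda>y. indicator {..X} y * ennreal (1 / y))"
proof -
  let ?E = "mark_exp M (\<lambda>x. complex_of_real (hh x))"
  interpret P: pair_sigma_finite M ?E by (rule hh.pair_mark_exp)
  have "(\<integral>\<^sup>+p. ennreal (ln (fst p)) * (indicator {..X} (fst p) * ennreal (norm (snd p))) \<partial>?E)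
    = (\<integral>\<^sup>+x. \<integral>\<^sup>+p. ennreal (ln x) * (indicator {..X} (x * fst p) * ennreal (norm (of_real (hh x) * snd p))) \<partial>?E \<partial>M)"
    using hh.nn_integral_log_mark_exp[of "\<lambda>p. indicator {..X} (fst p) * ennreal (norm (snd p))"] by simp
  also have "\<dots> = (\<integral>\<^sup>+p. \<integral>\<^sup>+x. ennreal (ln x) * (indicator {..X} (x * fst p) * ennreal (norm (of_real (hh x) * snd p))) \<partial>M \<partial>?E)"
    by (rule P.Fubini'[symmetric]) measurable
  also have "\<dots> \<le> (\<integral>\<^sup>+p. ennreal (Cc * X) * (indicator {..X} (fst p) * ennreal (1 / fst p) * ennreal (norm (snd p))) \<partial>?E)"
  proof (intro nn_integral_mono_AE, use hh.AE_mark_exp in eventually_elim)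
    case (elim p)
    define y where "y = fst p"
    have y: "y \<ge> 1" using elim by (simp add: y_def)
    show "(\<integral>\<^sup>+x. ennreal (ln x) * (indicator {..X} (x * fst p) * ennreal (norm (of_real (hh x) * snd p))) \<partial>M)
        \<le> ennreal (Cc * X) * (indicator {..X} (fst p) * ennreal (1 / fst p) * ennreal (norm (snd p)))"
      unfolding y_def[symmetric]
    proof (cases "y \<le> X")
      case True
      have "(\<integral>\<^sup>+x. ennreal (ln x) * (indicator {..X} (x * y) * ennreal (norm (of_real (hh x) * snd p))) \<partial>M)
        \<le> (\<integral>\<^sup>+x. (indicator {..X / y} x * ennreal (norm (g1 x) * ln x)) * ennreal (norm (snd p)) \<partial>M)"
      proof (intro nn_integral_mono_AE, use one.AE_M in eventually_elim)
        case (elim x)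
        have "ennreal (ln x) * ennreal (norm (of_real (hh x) * snd p)) \<le> ennreal (norm (g1 x) * ln x) * ennreal (norm (snd p))"
        proof -
          have "ln x * (hh x * norm (snd p)) \<le> ln x * (norm (g1 x) * norm (snd p))"
            using elim by (intro mult_left_mono mult_right_mono) (auto simp: hh_def)
          then have "ennreal (ln x * (hh x * norm (snd p))) \<le> ennreal (norm (g1 x) * ln x * norm (snd p))"
            by (intro ennreal_leI) (simp add: mult_ac)
          then show ?thesis using elim hh_nonneg[of x] by (simp add: ennreal_mult norm_mult)
        qed
        moreover have "indicator {..X} (x * y) = (indicator {..X / y} x :: ennreal)"
          using y by (auto simp: indicator_def field_simps)
        ultimately show ?case by (auto simp: indicator_def)
      qed
      also have "\<dots> = (\<integral>\<^sup>+x. indicator {..X / y} x * ennreal (norm (g1 x) * ln x) \<partial>M) * ennreal (norm (snd p))"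
        by (rule nn_integral_multc) measurable
      also have "\<dots> \<le> ennreal (Cc * (X / y)) * ennreal (norm (snd p))"
        using y True by (intro mult_right_mono g1_cheb) auto
      also have "\<dots> = ennreal (Cc * X) * (indicator {..X} y * ennreal (1 / y) * ennreal (norm (snd p)))"
      proof -
        have "ennreal (Cc * (X / y)) = ennreal (Cc * X) * ennreal (1 / y)"
          using X y Cc_nonneg by (subst ennreal_mult[symmetric]) auto
        then show ?thesis using True by (simp add: mult.assoc)
      qed
      finally show "(\<integral>\<^sup>+x. ennreal (ln x) * (indicator {..X} (x * y) * ennreal (norm (of_real (hh x) * snd p))) \<partial>M)
        \<le> ennreal (Cc * X) * (indicator {..X} y * ennreal (1 / y) * ennreal (norm (snd p)))" .
    next
      case False
      have "(\<integral>\<^sup>+x. ennreal (ln x) * (indicator {..X} (x * y) * ennreal (norm (of_real (hh x) * snd p))) \<partial>M) = (\<integral>\<^sup>+x. 0 \<partial>M)"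
      proof (intro nn_integral_cong_AE, use one.AE_M in eventually_elim)
        case (elim x)
        have "1 * y \<le> x * y" using elim y by (intro mult_right_mono) auto
        then show ?case using False by (simp add: indicator_def)
      qed
      then show "(\<integral>\<^sup>+x. ennreal (ln x) * (indicator {..X} (x * y) * ennreal (norm (of_real (hh x) * snd p))) \<partial>M)
        \<le> ennreal (Cc * X) * (indicator {..X} y * ennreal (1 / y) * ennreal (norm (snd p)))" by simp
    qed
  qed
  also have "\<dots> = ennreal (Cc * X) * abs_exp M hh (\<lambda>y. indicator {..X} y * ennreal (1 / y))"
    unfolding abs_exp_def by (rule nn_integral_cmult) measurable
  finally show ?thesis .
qed

text \<open>The classical device for nonnegative multiplicative functions:
  \<open>ln X = ln y + ln (X / y)\<close>, where \<open>ln (X / y) \<le> X / y\<close> and the sum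
  with \<open>ln y\<close> is covered by \<open>abs_exp_hh_log\<close>. It gains a full logarithm
  over the trivial comparison of \<open>1\<close> with \<open>X / y\<close>.\<close>

lemma abs_exp_hh_le_inverse:
  assumes X: "X \<ge> 1"
  shows "ennreal (1 + ln X) * abs_exp M hh (indicator {..X}) \<le>
    ennreal ((Cc + 2) * X) * abs_exp M hh (\<lambda>y. indicator {..X} y * ennreal (1 / y))"
proof -
  let ?J = "abs_exp M hh (\<lambda>y. indicator {..X} y * ennreal (1 / y))"
  have "ennreal (1 + ln X) * abs_exp M hh (indicator {..X}) = abs_exp M hh (\<lambda>y. ennreal (1 + ln X) * indicator {..X} y)"
    by (rule abs_exp_cmult[symmetric]) measurable
  also have "\<dots> \<le> abs_exp M hh (\<lambda>y. ennreal (2 * X) * (indicator {..X} y * ennreal (1 / y)) + ennreal (ln y) * indicator {..X} y)"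
  proof (rule abs_exp_mono[OF hh.mark_base_axioms])
    fix y :: real assume y: "y \<ge> 1"
    show "ennreal (1 + ln X) * indicator {..X} y \<le> ennreal (2 * X) * (indicator {..X} y * ennreal (1 / y)) + ennreal (ln y) * indicator {..X} y"
    proof (cases "y \<le> X")
      case True
      have "ln (X / y) \<le> X / y" using X y by (intro ln_bound) auto
      moreover have "ln (X / y) = ln X - ln y" using X y by (simp add: ln_div)
      moreover have "1 \<le> X / y" using True y by simp
      ultimately have "1 + ln X \<le> 2 * X * (1 / y) + ln y" by simp
      then have "ennreal (1 + ln X) \<le> ennreal (2 * X * (1 / y) + ln y)" by (rule ennreal_leI)
      also have "\<dots> = ennreal (2 * X * (1 / y)) + ennreal (ln y)" using X y by (intro ennreal_plus) auto
      also have "ennreal (2 * X * (1 / y)) = ennreal (2 * X) * ennreal (1 / y)" using X y by (intro ennreal_mult) auto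
      finally show ?thesis using True by simp
    qed simp
  qed
  also have "\<dots> = ennreal (2 * X) * ?J + abs_exp M hh (\<lambda>y. ennreal (ln y) * indicator {..X} y)"
    by (subst abs_exp_add, measurable, subst abs_exp_cmult) auto
  also have "abs_exp M hh (\<lambda>y. ennreal (ln y) * indicator {..X} y) =
     (\<integral>\<^sup>+p. ennreal (ln (fst p)) * (indicator {..X} (fst p) * ennreal (norm (snd p))) \<partial>mark_exp M (\<lambda>x. of_real (hh x)))"
    unfolding abs_exp_def by (simp add: mult.assoc)
  also have "ennreal (2 * X) * ?J + \<dots> \<le> ennreal (2 * X) * ?J + ennreal (Cc * X) * ?J"
    by (intro add_left_mono abs_exp_hh_log X)
  also have "\<dots> = ennreal ((Cc + 2) * X) * ?J"
  proof -
    have "ennreal ((Cc + 2) * X) = ennreal (2 * X + Cc * X)" by (simp add: algebra_simps)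
    also have "\<dots> = ennreal (2 * X) + ennreal (Cc * X)" using X Cc_nonneg by (intro ennreal_plus) auto
    finally show ?thesis by (simp only: distrib_right)
  qed
  finally show ?thesis .
qed

definition CH :: real where "CH = (Cc + 2) * (exp 1 * (2 * CN) powr (3 / 4))"

lemma CH_nonneg: "CH \<ge> 0" using Cc_nonneg by (simp add: CH_def)

text \<open>Rankin's method with \<open>w = 1 / (1 + u)\<close>: up to \<open>exp u\<close> the
  kernel \<open>y^(-1-w)\<close> is at least \<open>exp (- 1) / y\<close>, so the sum of
  \<open>1 / y\<close> is at most \<open>exp 1\<close> times the zeta function to the power 3/4,
  which is of order \<open>(1 + u)^(3/4)\<close>. The logarithm gained before is
  \<open>1 + u\<close> and leaves the exponent -1/4.\<close>

lemma abs_exp_hh_le: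
  assumes u: "u \<ge> 0"
  shows "abs_exp M hh (indicator {..exp u}) \<le> ennreal (CH * exp u * (1 + u) powr (- 1 / 4))"
proof -
  define w where "w = 1 / (1 + u)"
  have w: "w > 0" "w \<le> 1" using u by (auto simp: w_def)
  let ?J = "abs_exp M hh (\<lambda>y. indicator {..exp u} y * ennreal (1 / y))"
  have r: "(\<integral>\<^sup>+x. ennreal (exp (- (1 + w) * ln x)) * ennreal (norm (complex_of_real (hh x))) \<partial>M) \<le> ennreal (3 / 4 * lz w)"
  proof -
    have "(\<integral>\<^sup>+x. ennreal (exp (- (1 + w) * ln x)) * ennreal (norm (complex_of_real (hh x))) \<partial>M) \<le>
      (\<integral>\<^sup>+x. ennreal (3 / 4 * exp (- (1 + w) * ln x)) \<partial>M)"
    proof (rule nn_integral_mono)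
      fix x
      have "exp (- (1 + w) * ln x) * hh x \<le> exp (- (1 + w) * ln x) * (3 / 4)"
        using g1_le[of x] by (intro mult_left_mono) (auto simp: hh_def)
      then show "ennreal (exp (- (1 + w) * ln x)) * ennreal (norm (complex_of_real (hh x))) \<le> ennreal (3 / 4 * exp (- (1 + w) * ln x))"
        using hh_nonneg[of x] by (subst ennreal_mult[symmetric]) (auto intro!: ennreal_leI simp: mult.commute)
    qed
    also have "\<dots> = ennreal (\<integral>x. 3 / 4 * exp (- (1 + w) * ln x) \<partial>M)"
      by (rule nn_integral_eq_integral) (use integrable_lz[OF w(1)] in auto)
    finally show ?thesis by (simp add: lz_def)
  qed
  have lz0: "lz w \<ge> 0" unfolding lz_def by (intro Bochner_Integration.integral_nonneg) auto
  have "?J \<le> abs_exp M hh (\<lambda>y. ennreal (exp 1) * ennreal (exp (- (1 + w) * ln y)))"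
  proof (rule abs_exp_mono[OF hh.mark_base_axioms])
    fix y :: real assume y: "y \<ge> 1"
    show "indicator {..exp u} y * ennreal (1 / y) \<le> ennreal (exp 1) * ennreal (exp (- (1 + w) * ln y))"
    proof (cases "y \<le> exp u")
      case True
      have "ln y \<le> u" using True y le_exp_iff[of y u] by simp
      then have "w * ln y \<le> 1" using u by (simp add: w_def field_simps)
      have "1 / y = exp (- ln y)" using y by (simp add: exp_minus inverse_eq_divide)
      also have "\<dots> \<le> exp (1 + (- (1 + w) * ln y))"
        using \<open>w * ln y \<le> 1\<close> by (simp add: algebra_simps)
      finally have "ennreal (1 / y) \<le> ennreal (exp 1 * exp (- (1 + w) * ln y))" by (intro ennreal_leI) (simp only: exp_add)
      then show ?thesis using True by (simp add: ennreal_mult)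
    qed simp
  qed
  also have "\<dots> = ennreal (exp 1) * abs_exp M hh (\<lambda>y. ennreal (exp (- (1 + w) * ln y)))"
    by (rule abs_exp_cmult) measurable
  also have "\<dots> \<le> ennreal (exp 1) * ennreal (exp (3 / 4 * lz w))"
  proof (rule mult_left_mono)
    show "abs_exp M hh (\<lambda>y. ennreal (exp (- (1 + w) * ln y))) \<le> ennreal (exp (3 / 4 * lz w))"
      unfolding abs_exp_def
      by (rule hh.nn_integral_mark_exp_submult[OF _ _ _ r])
         (use lz0 in \<open>auto simp: ln_mult ennreal_mult[symmetric] algebra_simps simp flip: exp_add\<close>)
  qed simp
  also have "\<dots> \<le> ennreal (exp 1 * ((2 * CN) powr (3 / 4) * (1 + u) powr (3 / 4)))"
  proof -
    have "exp (3 / 4 * lz w) = exp (lz w) powr (3 / 4)" by (simp add: powr_def)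
    also have "\<dots> \<le> (2 * CN * (1 + u)) powr (3 / 4)"
    proof (rule powr_mono2)
      have "exp (lz w) \<le> CN * (1 + w) / w" by (rule exp_lz_le[OF w(1)])
      also have "\<dots> \<le> CN * 2 / w" using w CN(1) by (intro divide_right_mono mult_left_mono) auto
      also have "\<dots> = 2 * CN * (1 + u)" by (simp add: w_def)
      finally show "exp (lz w) \<le> 2 * CN * (1 + u)" .
    qed auto
    also have "\<dots> = (2 * CN) powr (3 / 4) * (1 + u) powr (3 / 4)" using CN(1) u by (simp add: powr_mult)
    finally have "exp 1 * exp (3 / 4 * lz w) \<le> exp 1 * ((2 * CN) powr (3 / 4) * (1 + u) powr (3 / 4))"
      by (rule mult_left_mono) simp
    then show ?thesis by (subst ennreal_mult[symmetric]) (auto intro: ennreal_leI)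
  qed
  finally have J: "?J \<le> ennreal (exp 1 * ((2 * CN) powr (3 / 4) * (1 + u) powr (3 / 4)))" .
  have "ennreal (1 + u) * abs_exp M hh (indicator {..exp u}) \<le> ennreal ((Cc + 2) * exp u) * ?J"
    using abs_exp_hh_le_inverse[of "exp u"] u by simp
  also have "\<dots> \<le> ennreal ((Cc + 2) * exp u) * ennreal (exp 1 * ((2 * CN) powr (3 / 4) * (1 + u) powr (3 / 4)))"
    by (intro mult_left_mono J) simp
  also have "\<dots> = ennreal ((Cc + 2) * exp u * (exp 1 * ((2 * CN) powr (3 / 4) * (1 + u) powr (3 / 4))))"
    using Cc_nonneg by (subst ennreal_mult) auto
  also have "(Cc + 2) * exp u * (exp 1 * ((2 * CN) powr (3 / 4) * (1 + u) powr (3 / 4))) =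
    (1 + u) * (CH * exp u * (1 + u) powr (- 1 / 4))"
  proof -
    have "(1 + u) powr (3 / 4) = (1 + u) * (1 + u) powr (- 1 / 4)"
      using powr_add[of "1 + u" 1 "- 1 / 4"] u by simp
    then show ?thesis by (simp add: CH_def mult_ac)
  qed
  also have "ennreal \<dots> = ennreal (1 + u) * ennreal (CH * exp u * (1 + u) powr (- 1 / 4))"
    using u CH_nonneg by (intro ennreal_mult) auto
  finally show ?thesis using u by (subst (asm) ennreal_mult_le_mult_iff) auto
qed

end

section \<open>The transform \<open>F\<close> and the normalized function \<open>T\<close>\<close>

context beurling_weight
begin

lemma g_loc: "(\<integral>\<^sup>+x. indicator {..X} x * ennreal (norm (g x)) \<partial>M) < \<infinity>"
proof -
  have "(\<integral>\<^sup>+x. indicator {..X} x * ennreal (norm (g x)) \<partial>M) \<le> (\<integral>\<^sup>+x. indicator {..X} x + ennreal \<bar>X\<bar> * ennreal (h2 x / x) \<partial>M)"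
  proof (intro nn_integral_mono_AE, use one.AE_M in eventually_elim)
    case (elim x)
    show ?case
    proof (cases "x \<le> X")
      case True
      have "norm (g x) \<le> 1 + h2 x" using norm_triangle_ineq[of "g1 x" "g2 x"] g1_le[of x] by linarith
      also have "h2 x \<le> \<bar>X\<bar> * (h2 x / x)"
        using True elim mult_right_mono[of x X "h2 x"] by (simp add: field_simps)
      finally have "ennreal (norm (g x)) \<le> ennreal (1 + \<bar>X\<bar> * (h2 x / x))" by (intro ennreal_leI) simp
      also have "\<dots> = 1 + ennreal \<bar>X\<bar> * ennreal (h2 x / x)"
        using elim by (subst ennreal_plus) (auto simp: ennreal_mult[symmetric])
      finally show ?thesis using True by simp
    qed simp
  qed
  also have "\<dots> = emeasure M {..X} + ennreal \<bar>X\<bar> * ennreal c2"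
    by (subst nn_integral_add) (auto simp: nn_integral_cmult c2)
  also have "\<dots> < \<infinity>" using one.M_fin[of X] by (simp add: ennreal_mult_less_top)
  finally show ?thesis .
qed

sublocale G: mark_local M g
proof (rule mark_local.intro)
  show "mark_base M g" by (rule base_of) measurable
  show "mark_local_axioms M g" by (rule mark_local_axioms.intro) (rule g_loc)
qed

lemma
  assumes s: "Re s > 1"
  shows integrable_kernel_g1: "integrable M (\<lambda>x. mellin_kernel s x * g1 x)"
    and integrable_kernel_g2: "integrable M (\<lambda>x. mellin_kernel s x * g2 x)"
    and norm_kernel_g2: "norm (\<integral>x. mellin_kernel s x * g2 x \<partial>M) \<le> c2"
proof -
  show "integrable M (\<lambda>x. mellin_kernel s x * g1 x)"
  proof (rule Bochner_Integration.integrable_bound)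
    show "integrable M (\<lambda>x. exp (- (1 + (Re s - 1)) * ln x))" by (rule integrable_lz) (use s in simp)
    show "AE x in M. norm (mellin_kernel s x * g1 x) \<le> norm (exp (- (1 + (Re s - 1)) * ln x))"
    proof (rule AE_I2)
      fix x
      show "norm (mellin_kernel s x * g1 x) \<le> norm (exp (- (1 + (Re s - 1)) * ln x))"
        using mult_left_mono[OF g1_le[of x], of "exp (- Re s * ln x)"] by (simp add: norm_mult norm_mellin_kernel)
    qed
  qed simp
  have le: "AE x in M. ennreal (norm (mellin_kernel s x * g2 x)) \<le> ennreal (h2 x / x)"
    using one.AE_M
  proof eventually_elim
    case (elim x)
    have "exp (- Re s * ln x) \<le> exp (- ln x)"
      using s elim by simp
    also have "\<dots> = 1 / x" using elim by (simp add: exp_minus inverse_eq_divide)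
    finally have "exp (- Re s * ln x) * h2 x \<le> 1 / x * h2 x" by (rule mult_right_mono) simp
    then show ?case by (intro ennreal_leI) (simp add: norm_mult norm_mellin_kernel)
  qed
  then have nn: "(\<integral>\<^sup>+x. ennreal (norm (mellin_kernel s x * g2 x)) \<partial>M) \<le> ennreal c2"
    unfolding c2(2)[symmetric] by (rule nn_integral_mono_AE)
  then show i: "integrable M (\<lambda>x. mellin_kernel s x * g2 x)"
    by (intro integrableI_bounded) (auto intro: le_less_trans)
  have "ennreal (norm (\<integral>x. mellin_kernel s x * g2 x \<partial>M)) \<le> ennreal c2"
    using integral_norm_bound_ennreal[OF i] nn by (rule order_trans)
  then show "norm (\<integral>x. mellin_kernel s x * g2 x \<partial>M) \<le> c2" using c2(1) by simp
qed

definition F :: "complex \<Rightarrow> complex" where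
  "F s = (\<integral>p. mellin_kernel s (fst p) * snd p \<partial>mark_exp M g)"

lemma integrable_kernel_g: "Re s > 1 \<Longrightarrow> integrable M (\<lambda>x. mellin_kernel s x * g x)"
  unfolding distrib_left by (intro Bochner_Integration.integrable_add integrable_kernel_g1 integrable_kernel_g2)

lemma integrable_F: "Re s > 1 \<Longrightarrow> integrable (mark_exp M g) (\<lambda>p. mellin_kernel s (fst p) * snd p)"
  by (rule G.integrable_mark_exp_submult(1)[OF _ _ _ integrable_kernel_g]) (auto simp: mellin_kernel_mult norm_mult)

lemma F_eq: "Re s > 1 \<Longrightarrow> F s = exp (\<integral>x. mellin_kernel s x * g x \<partial>M)"
  unfolding F_def by (rule G.integral_mark_exp_mult[OF _ _ _ integrable_kernel_g]) (auto simp: mellin_kernel_mult)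

text \<open>As an exponential, \<open>F\<close> has a modulus that splits into real powers. With r1
  and r2 the real parts of the integrals over g1 and g2, |F|^(3/2) is
  \<open>exp (3 / 2 * r1) * exp (3 / 2 * r2)\<close>; the first factor is the square of a modulus,
  the second is bounded since \<open>r2 \<le> c2\<close>.\<close>

lemma F_square_le:
  assumes s: "Re s > 1"
  shows "(norm (F s))\<^sup>2 \<le> sqrt (norm (F s)) * (exp (3 / 2 * c2) * (norm (exp (3 / 4 * (\<integral>x. mellin_kernel s x * g1 x \<partial>M))))\<^sup>2)"
proof -
  let ?I1 = "\<integral>x. mellin_kernel s x * g1 x \<partial>M" and ?I2 = "\<integral>x. mellin_kernel s x * g2 x \<partial>M"
  define r1 r2 where "r1 = Re ?I1" and "r2 = Re ?I2"
  have I: "(\<integral>x. mellin_kernel s x * g x \<partial>M) = ?I1 + ?I2"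
    unfolding distrib_left by (rule Bochner_Integration.integral_add[OF integrable_kernel_g1[OF s] integrable_kernel_g2[OF s]])
  have nF: "norm (F s) = exp (r1 + r2)" unfolding F_eq[OF s] I by (simp add: r1_def r2_def)
  have r2: "r2 \<le> c2" using abs_Re_le_cmod[of ?I2] norm_kernel_g2[OF s] by (simp add: r2_def)
  have sq: "sqrt (exp (r1 + r2)) = exp ((r1 + r2) / 2)"
    by (rule real_sqrt_unique) (simp_all add: power2_eq_square flip: exp_add)
  have "(exp (r1 + r2))\<^sup>2 = exp ((r1 + r2) / 2) * (exp (3 / 2 * r2) * exp (3 / 2 * r1))"
    by (simp add: power2_eq_square flip: exp_add) (simp add: field_simps)
  also have "\<dots> \<le> exp ((r1 + r2) / 2) * (exp (3 / 2 * c2) * exp (3 / 2 * r1))"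
    using r2 by (intro mult_left_mono mult_right_mono) auto
  also have "exp (3 / 2 * r1) = (norm (exp (3 / 4 * ?I1)))\<^sup>2"
    by (simp add: r1_def power2_eq_square flip: exp_add)
  finally show ?thesis unfolding nF sq .
qed

definition T :: "real \<Rightarrow> real \<Rightarrow> complex" where
  "T \<alpha> u = indicator {0..} u * (exp (- (1 + \<i> * of_real \<alpha>) * of_real u) * G.summ (exp u))"

lemma T_measurable[measurable]: "T \<alpha> \<in> borel_measurable borel"
  unfolding T_def by measurable

lemma norm_summ: "v \<ge> 0 \<Longrightarrow> norm (G.summ v) \<le> CW * v"
  by (rule G.norm_summ_le[OF W_le]) (auto simp: CW_nonneg)

lemma norm_T: "norm (T \<alpha> u) \<le> CW"
proof (cases "u \<ge> 0")
  case True
  have "norm (T \<alpha> u) = exp (- u) * norm (G.summ (exp u))" using True by (simp add: T_def norm_mult)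
  also have "\<dots> \<le> exp (- u) * (CW * exp u)" by (intro mult_left_mono norm_summ) auto
  also have "\<dots> = CW" by (simp add: exp_minus)
  finally show ?thesis .
qed (simp add: T_def CW_nonneg)

lemma norm_summ_diff:
  assumes v: "v \<le> v'" "b \<ge> 0"
    and le: "(\<integral>\<^sup>+p. indicator {v<..v'} (fst p) * ennreal (norm (snd p)) \<partial>mark_exp M g) \<le> ennreal b"
  shows "norm (G.summ v' - G.summ v) \<le> b"
proof -
  have i: "integrable (mark_exp M g) (\<lambda>p. indicator {..x} (fst p) * snd p)" for x
    by (rule G.integrable_mark_exp_bounded_support[of _ 1 x]) (auto simp: indicator_def)
  have eq: "G.summ v' - G.summ v = (\<integral>p. indicator {v<..v'} (fst p) * snd p \<partial>mark_exp M g)"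
    unfolding G.summ_def
    by (subst Bochner_Integration.integral_diff[OF i i, symmetric], intro Bochner_Integration.integral_cong)
       (use v in \<open>auto simp: indicator_def\<close>)
  have i2: "integrable (mark_exp M g) (\<lambda>p. indicator {v<..v'} (fst p) * snd p)"
    by (rule G.integrable_mark_exp_bounded_support[of _ 1 v']) (auto simp: indicator_def)
  have "ennreal (norm (\<integral>p. indicator {v<..v'} (fst p) * snd p \<partial>mark_exp M g)) \<le>
    (\<integral>\<^sup>+p. ennreal (norm (indicator {v<..v'} (fst p) * snd p)) \<partial>mark_exp M g)"
    by (rule integral_norm_bound_ennreal[OF i2])
  also have "\<dots> = (\<integral>\<^sup>+p. indicator {v<..v'} (fst p) * ennreal (norm (snd p)) \<partial>mark_exp M g)"
    by (intro nn_integral_cong) (auto simp: indicator_def)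
  also note le
  finally show ?thesis unfolding eq using v by simp
qed

text \<open>The mass of |dG| in short intervals controls the change of the summatory function, and
  continuity of the exponential at 0 that of the normalizing factor.\<close>

lemma T_osc:
  assumes e: "e > 0"
  shows "\<exists>\<delta>>0. \<exists>u0. \<forall>u\<ge>u0. \<forall>h\<in>{0..\<delta>}. norm (T \<alpha> (u + h) - T \<alpha> u) \<le> e"
proof -
  have "e / 2 > 0" using e by simp
  from W_slow[OF this] obtain \<delta>1 v0 where \<delta>1: "\<delta>1 > 0" and v0: "v0 \<ge> 1"
    and W: "\<And>v v'. v \<ge> v0 \<Longrightarrow> v' \<in> {v..(1 + \<delta>1) * v} \<Longrightarrow>
      (\<integral>\<^sup>+p. indicator {v<..v'} (fst p) * ennreal (norm (snd p)) \<partial>mark_exp M g) \<le> ennreal (e / 2 * v)"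
    by blast
  let ?c = "- (1 + \<i> * of_real \<alpha>)"
  have "((\<lambda>h. exp (?c * of_real h)) \<longlongrightarrow> exp (?c * of_real 0)) (at 0)"
    by (intro tendsto_intros)
  then have "\<forall>\<^sub>F h in at 0. dist (exp (?c * of_real h)) 1 < e / (2 * (CW + 1))"
    using e CW_nonneg by (intro tendstoD) auto
  then obtain d where d: "d > 0" "\<And>h. h \<noteq> 0 \<Longrightarrow> \<bar>h\<bar> < d \<Longrightarrow> dist (exp (?c * of_real h)) 1 < e / (2 * (CW + 1))"
    by (auto simp: eventually_at dist_real_def)
  define \<delta> where "\<delta> = min (ln (1 + \<delta>1)) (d / 2)"
  have \<delta>: "\<delta> > 0" using \<delta>1 d by (auto simp: \<delta>_def)
  have "norm (T \<alpha> (u + h) - T \<alpha> u) \<le> e" if u: "u \<ge> ln v0" and h: "h \<in> {0..\<delta>}" for u h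
  proof -
    have u0: "u \<ge> 0" using u v0 ln_ge_zero[of v0] by linarith
    have eh: "exp (u + h) \<in> {exp u..(1 + \<delta>1) * exp u}"
    proof -
      have "h \<le> ln (1 + \<delta>1)" using h by (simp add: \<delta>_def)
      then have "exp h \<le> 1 + \<delta>1" using \<delta>1 by (metis add_pos_pos exp_le_cancel_iff exp_ln zero_less_one)
      then have "exp h * exp u \<le> (1 + \<delta>1) * exp u" by (intro mult_right_mono) auto
      then show ?thesis using h by (simp add: exp_add mult.commute)
    qed
    have "exp u \<ge> v0" using u v0 by (subst le_exp_iff) auto
    then have s: "norm (G.summ (exp (u + h)) - G.summ (exp u)) \<le> e / 2 * exp u"
      using h e by (intro norm_summ_diff W eh) auto
    \<comment> \<open>First the summatory function is changed, then the normalizing factor.\<close>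
    have "T \<alpha> (u + h) - T \<alpha> u = exp (?c * of_real (u + h)) * (G.summ (exp (u + h)) - G.summ (exp u))
      + (exp (?c * of_real h) - 1) * T \<alpha> u"
    proof -
      have E: "exp (?c * of_real (u + h)) = exp (?c * of_real h) * exp (?c * of_real u)"
        unfolding of_real_add distrib_left exp_add by (rule mult.commute)
      have T1: "T \<alpha> (u + h) = exp (?c * of_real (u + h)) * G.summ (exp (u + h))"
        and T0: "T \<alpha> u = exp (?c * of_real u) * G.summ (exp u)"
        using u0 h by (simp_all add: T_def)
      show ?thesis unfolding T1 T0 E by (simp only: ring_distribs mult_1_left) (simp add: mult.assoc)
    qed
    also have "norm \<dots> \<le> exp (- (u + h)) * norm (G.summ (exp (u + h)) - G.summ (exp u)) + norm (exp (?c * of_real h) - 1) * norm (T \<alpha> u)"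
      by (rule order_trans[OF norm_triangle_ineq]) (simp add: norm_mult)
    also have "\<dots> \<le> e / 2 + e / 2"
    proof (rule add_mono)
      have "exp (- (u + h)) * norm (G.summ (exp (u + h)) - G.summ (exp u)) \<le> exp (- u) * (e / 2 * exp u)"
        using h s by (intro mult_mono) auto
      also have "exp (- u) * (e / 2 * exp u) = e / 2" by (simp add: exp_minus)
      finally show "exp (- (u + h)) * norm (G.summ (exp (u + h)) - G.summ (exp u)) \<le> e / 2" .
      have "norm (exp (?c * of_real h) - 1) \<le> e / (2 * (CW + 1))"
      proof (cases "h = 0")
        case False
        have "\<bar>h\<bar> < d" using h d by (simp add: \<delta>_def)
        from d(2)[OF False this] show ?thesis by (simp add: dist_norm)
      qed (use e CW_nonneg in simp)
      then have "norm (exp (?c * of_real h) - 1) * norm (T \<alpha> u) \<le> e / (2 * (CW + 1)) * (CW + 1)"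
        using norm_T[of \<alpha> u] e CW_nonneg by (intro mult_mono) auto
      also have "\<dots> = e / 2" using CW_nonneg by (simp add: divide_simps)
      finally show "norm (exp (?c * of_real h) - 1) * norm (T \<alpha> u) \<le> e / 2" .
    qed
    finally show ?thesis by simp
  qed
  then show ?thesis using \<delta> by blast
qed

sublocale TS: slowly_oscillating "T \<alpha>" CW for \<alpha>
  by unfold_locales (auto simp: norm_T T_osc, simp add: T_def)

text \<open>The factor \<open>exp (- i \<alpha> u)\<close> in \<open>T\<close> shifts the ordinates
  by \<alpha>, which places the expected pole at \<open>t = 0\<close>.\<close>

lemma fourier_T:
  fixes \<alpha> w :: real
  assumes w: "w > 0"
  defines "s \<equiv> \<lambda>t. Complex (1 + w) (t + \<alpha>)"
  shows "fourier (TS.damped \<alpha> 0 w) t = F (s t) / s t"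
proof -
  have s: "Re (s t) > 1" "s t \<noteq> 0" using w by (auto simp: s_def complex_eq_iff)
  have "F (s t) = s t * (\<integral>u. indicator {0..} u * (G.summ (exp u) * exp (- s t * of_real u)) \<partial>lborel)"
    unfolding F_def using s by (intro G.mellin_eq_summ integrable_F) auto
  also have "(\<integral>u. indicator {0..} u * (G.summ (exp u) * exp (- s t * of_real u)) \<partial>lborel) = fourier (TS.damped \<alpha> 0 w) t"
    unfolding fourier_def
  proof (rule Bochner_Integration.integral_cong[OF refl])
    fix u :: real
    have "- s t * of_real u = - (1 + \<i> * of_real \<alpha>) * of_real u + (of_real (- w * u) + (- \<i> * of_real (t * u)))"
      by (simp add: s_def complex_eq_iff algebra_simps)
    then have "exp (- s t * of_real u) = exp (- (1 + \<i> * of_real \<alpha>) * of_real u) * (of_real (exp (- w * u)) * exp (- \<i> * of_real (t * u)))"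
      by (simp only: exp_add exp_of_real)
    then show "indicator {0..} u * (G.summ (exp u) * exp (- s t * of_real u)) = TS.damped \<alpha> 0 w u * exp (- \<i> * of_real (t * u))"
      by (simp add: TS.damped_def T_def indicator_def)
  qed
  finally show ?thesis using s by simp
qed

end

text \<open>In essence a Gamma integral of order \<open>1 / sqrt w\<close>. Weakening the
  exponential to a multiple of \<open>1 / (1 + w * (1 + u))\<close> gives an integrand with an
  elementary antiderivative, a multiple of
  \<open>2 / sqrt w * arctan (sqrt (w * (1 + u)))\<close>.\<close>

lemma nn_integral_half_power_decay:
  assumes w: "0 < w" "w \<le> 1"
  shows "(\<integral>\<^sup>+u. indicator {0..} u * ennreal ((1 + u) powr (- 1 / 2) * exp (- 2 * w * u)) \<partial>lborel) \<le> ennreal (exp 2 * pi / sqrt w)"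
proof -
  let ?f = "\<lambda>u. exp 2 * (1 / ((1 + w * (1 + u)) * sqrt (1 + u)))"
  let ?F = "\<lambda>u. exp 2 * (2 / sqrt w * arctan (sqrt (w * (1 + u))))"
  have pw: "(1 + u) powr (- 1 / 2) * exp (- 2 * w * u) \<le> ?f u" if u: "u \<ge> 0" for u
  proof -
    have "1 + w * (1 + u) \<le> exp (w * (1 + u))" by (rule exp_ge_add_one_self)
    also have "\<dots> \<le> exp (2 * w * (1 + u))" using w u by simp
    finally have "exp (- (2 * w * (1 + u))) \<le> 1 / (1 + w * (1 + u))"
      using w u by (simp add: exp_minus inverse_eq_divide frac_le add_pos_nonneg)
    moreover have "exp (- 2 * w * u) \<le> exp 2 * exp (- (2 * w * (1 + u)))"
      using w by (simp add: algebra_simps flip: exp_add)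
    moreover have "exp 2 * exp (- (2 * w * (1 + u))) \<le> exp 2 * (1 / (1 + w * (1 + u)))"
      using calculation(1) by (intro mult_left_mono) auto
    ultimately have "exp (- 2 * w * u) \<le> exp 2 * (1 / (1 + w * (1 + u)))" by linarith
    then have "(1 + u) powr (- 1 / 2) * exp (- 2 * w * u) \<le> (1 / sqrt (1 + u)) * (exp 2 * (1 / (1 + w * (1 + u))))"
      using u by (intro mult_mono) (auto simp: powr_minus powr_half_sqrt inverse_eq_divide)
    then show ?thesis by (simp add: mult_ac)
  qed
  have lim: "(?F \<longlongrightarrow> exp 2 * (2 / sqrt w * (pi / 2))) at_top"
  proof (intro tendsto_intros filterlim_compose[OF tendsto_arctan_at_top])
    have "filterlim (\<lambda>u. w * (1 + u)) at_top at_top"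
      using w by (intro filterlim_tendsto_pos_mult_at_top[OF tendsto_const] filterlim_tendsto_add_at_top[OF tendsto_const] filterlim_ident) auto
    then show "filterlim (\<lambda>u. sqrt (w * (1 + u))) at_top at_top"
      by (rule filterlim_compose[OF sqrt_at_top])
  qed
  have deriv: "(?F has_real_derivative ?f u) (at u)" if u: "u \<ge> 0" for u
  proof -
    have pos: "w * (1 + u) > 0" using w u by simp
    have "((\<lambda>u. exp 2 * (c * arctan (sqrt (w * (1 + u))))) has_real_derivative
        exp 2 * (c * (inverse (1 + (sqrt (w * (1 + u)))\<^sup>2) * (inverse (sqrt (w * (1 + u))) / 2 * w)))) (at u)" for c :: real
      using pos by (auto intro!: derivative_eq_intros)
    from this[of "2 / sqrt w"]
    have "(?F has_real_derivative exp 2 * (2 / sqrt w * (inverse (1 + (sqrt (w * (1 + u)))\<^sup>2) * (inverse (sqrt (w * (1 + u))) / 2 * w)))) (at u)" .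
    moreover have "exp 2 * (2 / sqrt w * (inverse (1 + (sqrt (w * (1 + u)))\<^sup>2) * (inverse (sqrt (w * (1 + u))) / 2 * w))) = ?f u"
    proof -
      have "2 / sqrt w * (inverse (1 + (sqrt (w * (1 + u)))\<^sup>2) * (inverse (sqrt (w * (1 + u))) / 2 * w)) =
        (w / (sqrt w * sqrt w)) * (1 / ((1 + w * (1 + u)) * sqrt (1 + u)))"
      proof -
        have sq1: "(sqrt (w * (1 + u)))\<^sup>2 = w * (1 + u)" using pos by simp
        have sq2: "sqrt (w * (1 + u)) = sqrt w * sqrt (1 + u)" by (rule real_sqrt_mult)
        have "sqrt w \<noteq> 0" "sqrt (1 + u) \<noteq> 0" using w u by auto
        moreover have "1 + w * (1 + u) \<noteq> 0" using pos by linarith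
        ultimately show ?thesis unfolding sq1 unfolding sq2 by (simp add: divide_simps del: real_sqrt_mult_self)
      qed
      then show ?thesis using w by simp
    qed
    ultimately show ?thesis by simp
  qed
  have "(\<integral>\<^sup>+u. indicator {0..} u * ennreal ((1 + u) powr (- 1 / 2) * exp (- 2 * w * u)) \<partial>lborel) \<le> (\<integral>\<^sup>+u. ennreal (?f u) * indicator {0..} u \<partial>lborel)"
    using pw by (intro nn_integral_mono) (auto simp: indicator_def intro!: ennreal_leI)
  also have "\<dots> = ennreal (exp 2 * (2 / sqrt w * (pi / 2)) - ?F 0)"
    by (rule nn_integral_FTC_atLeast[OF _ deriv _ lim]) (use w in \<open>auto intro!: divide_nonneg_nonneg mult_nonneg_nonneg add_nonneg_nonneg\<close>)
  also have "\<dots> \<le> ennreal (exp 2 * pi / sqrt w)"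
  proof (rule ennreal_leI)
    have "?F 0 \<ge> 0" using w by (simp add: zero_le_arctan_iff)
    then show "exp 2 * (2 / sqrt w * (pi / 2)) - ?F 0 \<le> exp 2 * pi / sqrt w" by simp
  qed
  finally show ?thesis .
qed

section \<open>Domination of the transform, and the renewal equation\<close>

context beurling_weight
begin

abbreviation gq :: "real \<Rightarrow> complex" where "gq x \<equiv> of_real (3 / 4) * g1 x"

sublocale Q: mark_base M gq by (rule base_of) measurable

lemma norm_summ_gq:
  assumes u: "u \<ge> 0"
  shows "norm (Q.summ (exp u)) \<le> CH * exp u * (1 + u) powr (- 1 / 4)"
proof (rule Q.norm_summ_le)
  have "(\<integral>\<^sup>+p. indicator {..exp u} (fst p) * ennreal (norm (snd p)) \<partial>mark_exp M gq) \<le> abs_exp M hh (indicator {..exp u})"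
    by (rule nn_integral_le_abs_exp[OF Q.mark_base_axioms]) (auto simp: hh_def norm_mult)
  also have "\<dots> \<le> ennreal (CH * exp u * (1 + u) powr (- 1 / 4))" by (rule abs_exp_hh_le[OF u])
  finally show "(\<integral>\<^sup>+p. indicator {..exp u} (fst p) * ennreal (norm (snd p)) \<partial>mark_exp M gq) \<le> ennreal (CH * exp u * (1 + u) powr (- 1 / 4))" .
qed (use CH_nonneg in auto)

definition dampedQ :: "real \<Rightarrow> real \<Rightarrow> complex" where
  "dampedQ w u = indicator {0..} u * (of_real (exp (- (1 + w) * u)) * Q.summ (exp u))"

lemma dampedQ_measurable[measurable]: "dampedQ w \<in> borel_measurable borel"
  unfolding dampedQ_def by measurable

lemma norm_dampedQ: "norm (dampedQ w u) \<le> CH * (indicator {0..} u * ((1 + u) powr (- 1 / 4) * exp (- w * u)))"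
proof (cases "u \<ge> 0")
  case True
  have "norm (dampedQ w u) = exp (- (1 + w) * u) * norm (Q.summ (exp u))" using True by (simp add: dampedQ_def norm_mult)
  also have "\<dots> \<le> exp (- (1 + w) * u) * (CH * exp u * (1 + u) powr (- 1 / 4))"
    by (intro mult_left_mono norm_summ_gq True) auto
  also have "\<dots> = CH * ((1 + u) powr (- 1 / 4) * exp (- w * u))"
  proof -
    have "exp (- (1 + w) * u) * exp u = exp (- w * u)" by (simp add: algebra_simps flip: exp_add)
    then show ?thesis by (metis mult.assoc mult.commute)
  qed
  finally show ?thesis using True by simp
qed (simp add: dampedQ_def)

lemma integrable_dampedQ:
  assumes w: "w > 0"
  shows "integrable lborel (dampedQ w)"
proof (rule Bochner_Integration.integrable_bound)
  show "integrable lborel (\<lambda>u. CH * (indicator {0..} u * exp (- w * u)))"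
    by (intro integrable_mult_right integrable_exp_decay w)
  show "AE u in lborel. norm (dampedQ w u) \<le> norm (CH * (indicator {0..} u * exp (- w * u)))"
  proof (rule AE_I2)
    fix u :: real
    have "(1 + u) powr (- 1 / 4) \<le> 1" if "u \<ge> 0" using that powr_le1[of "1/4" "inverse (1 + u)"]
      by (simp add: powr_minus inverse_powr inverse_le_1_iff)
    then have "CH * (indicator {0..} u * ((1 + u) powr (- 1 / 4) * exp (- w * u))) \<le> CH * (indicator {0..} u * exp (- w * u))"
      by (intro mult_left_mono[OF _ CH_nonneg]) (cases "u \<ge> 0", auto)
    then show "norm (dampedQ w u) \<le> norm (CH * (indicator {0..} u * exp (- w * u)))"
      unfolding real_norm_def by (intro order_trans[OF norm_dampedQ] order_trans[OF _ abs_ge_self])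
  qed
qed simp

definition CQ :: real where "CQ = CH\<^sup>2 * (exp 2 * pi)"

lemma CQ_nonneg: "CQ \<ge> 0" by (simp add: CQ_def)

lemma
  assumes w: "0 < w" "w \<le> 1"
  shows integrable_dampedQ_square: "integrable lborel (\<lambda>u. (norm (dampedQ w u))\<^sup>2)"
    and integral_dampedQ_square: "(\<integral>u. (norm (dampedQ w u))\<^sup>2 \<partial>lborel) \<le> CQ / sqrt w"
proof -
  have "(\<integral>\<^sup>+u. ennreal ((norm (dampedQ w u))\<^sup>2) \<partial>lborel) \<le>
     (\<integral>\<^sup>+u. ennreal (CH\<^sup>2) * (indicator {0..} u * ennreal ((1 + u) powr (- 1 / 2) * exp (- 2 * w * u))) \<partial>lborel)"
  proof (rule nn_integral_mono)
    fix u :: real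
    show "ennreal ((norm (dampedQ w u))\<^sup>2) \<le> ennreal (CH\<^sup>2) * (indicator {0..} u * ennreal ((1 + u) powr (- 1 / 2) * exp (- 2 * w * u)))"
    proof (cases "u \<ge> 0")
      case True
      have "(norm (dampedQ w u))\<^sup>2 \<le> (CH * ((1 + u) powr (- 1 / 4) * exp (- w * u)))\<^sup>2"
        using norm_dampedQ[of w u] True by (intro power_mono) auto
      also have "\<dots> = CH\<^sup>2 * ((1 + u) powr (- 1 / 2) * exp (- 2 * w * u))"
      proof -
        have "((1 + u) powr (- 1 / 4))\<^sup>2 = (1 + u) powr (- 1 / 2)"
          using True by (simp add: power2_eq_square flip: powr_add)
        moreover have "(exp (- w * u))\<^sup>2 = exp (- 2 * w * u)" by (simp add: power2_eq_square flip: exp_add)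
        ultimately show ?thesis by (simp only: power_mult_distrib)
      qed
      finally show ?thesis using True by (simp add: ennreal_mult[symmetric] ennreal_leI)
    qed (simp add: dampedQ_def)
  qed
  also have "\<dots> = ennreal (CH\<^sup>2) * (\<integral>\<^sup>+u. indicator {0..} u * ennreal ((1 + u) powr (- 1 / 2) * exp (- 2 * w * u)) \<partial>lborel)"
    by (rule nn_integral_cmult) measurable
  also have "\<dots> \<le> ennreal (CH\<^sup>2) * ennreal (exp 2 * pi / sqrt w)"
    by (intro mult_left_mono nn_integral_half_power_decay w) simp
  also have "\<dots> = ennreal (CQ / sqrt w)"
    using w by (subst ennreal_mult[symmetric]) (auto simp: CQ_def)
  finally have nn: "(\<integral>\<^sup>+u. ennreal ((norm (dampedQ w u))\<^sup>2) \<partial>lborel) \<le> ennreal (CQ / sqrt w)" .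
  show i: "integrable lborel (\<lambda>u. (norm (dampedQ w u))\<^sup>2)"
    by (rule integrableI_bounded) (use nn in \<open>auto intro: le_less_trans\<close>)
  have "ennreal (\<integral>u. (norm (dampedQ w u))\<^sup>2 \<partial>lborel) \<le> ennreal (CQ / sqrt w)"
    using nn by (subst nn_integral_eq_integral[OF i, symmetric]) auto
  then show "(\<integral>u. (norm (dampedQ w u))\<^sup>2 \<partial>lborel) \<le> CQ / sqrt w"
    using CQ_nonneg w by simp
qed

lemma fourier_dampedQ:
  assumes w: "w > 0"
  defines "s \<equiv> \<lambda>t. Complex (1 + w) t"
  shows "fourier (dampedQ w) t = exp (3 / 4 * (\<integral>x. mellin_kernel (s t) x * g1 x \<partial>M)) / s t"
proof -
  have s: "Re (s t) > 1" "s t \<noteq> 0" using w by (auto simp: s_def complex_eq_iff)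
  have iq: "integrable M (\<lambda>x. mellin_kernel (s t) x * gq x)"
    using integrable_mult_right[OF integrable_kernel_g1[OF s(1)], of "3 / 4"] by (simp add: mult_ac)
  have "exp (3 / 4 * (\<integral>x. mellin_kernel (s t) x * g1 x \<partial>M)) = exp (\<integral>x. mellin_kernel (s t) x * gq x \<partial>M)"
    by (subst integral_mult_right_zero[symmetric]) (simp add: mult_ac)
  also have "\<dots> = (\<integral>p. mellin_kernel (s t) (fst p) * snd p \<partial>mark_exp M gq)"
    by (rule Q.integral_mark_exp_mult[OF _ _ _ iq, symmetric]) (auto simp: mellin_kernel_mult)
  also have "\<dots> = s t * (\<integral>u. indicator {0..} u * (Q.summ (exp u) * exp (- s t * of_real u)) \<partial>lborel)"
    by (rule Q.mellin_eq_summ, use s in simp, rule Q.integrable_mark_exp_submult(1)[OF _ _ _ iq])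
       (auto simp: mellin_kernel_mult norm_mult)
  also have "(\<integral>u. indicator {0..} u * (Q.summ (exp u) * exp (- s t * of_real u)) \<partial>lborel) = fourier (dampedQ w) t"
    unfolding fourier_def
  proof (rule Bochner_Integration.integral_cong[OF refl])
    fix u :: real
    have "- s t * of_real u = of_real (- (1 + w) * u) + (- \<i> * of_real (t * u))"
      by (simp add: s_def complex_eq_iff algebra_simps)
    then have "exp (- s t * of_real u) = of_real (exp (- (1 + w) * u)) * exp (- \<i> * of_real (t * u))"
      by (simp only: exp_add exp_of_real)
    then show "indicator {0..} u * (Q.summ (exp u) * exp (- s t * of_real u)) = dampedQ w u * exp (- \<i> * of_real (t * u))"
      by (simp add: dampedQ_def indicator_def)
  qed
  finally show ?thesis using s by simp
qed

lemma nn_integral_fourier_dampedQ: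
  assumes w: "0 < w" "w \<le> 1" and K: "K > 0"
  shows "(\<integral>\<^sup>+t. indicator {-K..K} t * ennreal ((norm (fourier (dampedQ w) t))\<^sup>2) \<partial>lborel) \<le> ennreal (2 * fejer_mass * CQ / sqrt w)"
proof -
  note ii = integrable_dampedQ[OF w(1)] integrable_dampedQ_square[OF w]
  have K2: "2 * K > 0" using K by simp
  let ?P = "\<integral>t. fejer_weight (2 * K) t * (norm (fourier (dampedQ w) t))\<^sup>2 \<partial>lborel"
  let ?D = "\<integral>h. fejer (2 * K) h * (\<integral>u. (norm (dampedQ w u - dampedQ w (u - h)))\<^sup>2 \<partial>lborel) \<partial>lborel"
  have D: "?D \<ge> 0"
    by (intro Bochner_Integration.integral_nonneg mult_nonneg_nonneg fejer_nonneg K2) auto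
  have "?P = fejer_mass * (\<integral>u. (norm (dampedQ w u))\<^sup>2 \<partial>lborel) - ?D / 2"
    by (rule fejer_plancherel(3)[OF ii K2])
  also have "\<dots> \<le> fejer_mass * (\<integral>u. (norm (dampedQ w u))\<^sup>2 \<partial>lborel)" using D by simp
  also have "\<dots> \<le> fejer_mass * (CQ / sqrt w)"
    using fejer_mass_pos integral_dampedQ_square[OF w] by (intro mult_left_mono) auto
  finally have P: "?P \<le> fejer_mass * (CQ / sqrt w)" .
  have "(\<integral>\<^sup>+t. indicator {-K..K} t * ennreal ((norm (fourier (dampedQ w) t))\<^sup>2) \<partial>lborel) \<le>
     (\<integral>\<^sup>+t. ennreal (2 * (fejer_weight (2 * K) t * (norm (fourier (dampedQ w) t))\<^sup>2)) \<partial>lborel)"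
  proof (rule nn_integral_mono)
    fix t :: real
    show "indicator {-K..K} t * ennreal ((norm (fourier (dampedQ w) t))\<^sup>2) \<le> ennreal (2 * (fejer_weight (2 * K) t * (norm (fourier (dampedQ w) t))\<^sup>2))"
    proof (cases "t \<in> {-K..K}")
      case True
      then have "1 \<le> 2 * fejer_weight (2 * K) t" using K by (auto simp: fejer_weight_def indicator_def field_simps)
      then have "1 * (norm (fourier (dampedQ w) t))\<^sup>2 \<le> 2 * fejer_weight (2 * K) t * (norm (fourier (dampedQ w) t))\<^sup>2"
        by (rule mult_right_mono) simp
      then show ?thesis using True by (simp add: ennreal_leI mult.assoc)
    qed simp
  qed
  also have "\<dots> = ennreal (\<integral>t. 2 * (fejer_weight (2 * K) t * (norm (fourier (dampedQ w) t))\<^sup>2) \<partial>lborel)"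
    by (rule nn_integral_eq_integral)
       (use fejer_plancherel(1)[OF ii K2] fejer_weight_bounds(1)[OF K2] in \<open>auto intro!: AE_I2 mult_nonneg_nonneg\<close>)
  also have "\<dots> \<le> ennreal (2 * fejer_mass * CQ / sqrt w)"
    using P by (intro ennreal_leI) simp
  finally show ?thesis .
qed

text \<open>Up to a constant the majorant is the squared modulus of the transform of
  \<open>dampedQ\<close>. Passing from \<open>F\<close> to \<open>F / s\<close> leaves an excess
  factor \<open>sqrt (norm s)\<close>, bounded on compact ranges of \<open>t\<close>; hence the
  dependence of the constant on \<open>K\<close>.\<close>

lemma transform_domination:
  assumes K: "K > 0"
  shows "\<exists>C\<ge>0. \<forall>w. 0 < w \<and> w \<le> 1 \<longrightarrow>
       (\<exists>\<psi> \<in> borel_measurable borel. (\<forall>t. \<psi> t \<ge> 0) \<and>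
          (\<forall>t. \<bar>t\<bar> \<le> K \<longrightarrow> (norm (fourier (TS.damped \<alpha> 0 w) t))\<^sup>2 \<le> sqrt (norm (fourier (TS.damped \<alpha> 0 w) t)) * \<psi> t) \<and>
          (\<integral>\<^sup>+t. indicator {-K..K} t * ennreal (\<psi> t) \<partial>lborel) \<le> ennreal (C / sqrt w))"
proof -
  define K' where "K' = K + \<bar>\<alpha>\<bar>"
  have K': "K' > 0" using K by (simp add: K'_def)
  \<comment> \<open>\<open>2 + K'\<close> bounds \<open>norm s\<close>, hence also its square root,
    as \<open>norm s \<ge> 1\<close>; the exponential is the contribution of
    \<open>g2\<close>.\<close>
  define D where "D = (2 + K') * exp (3 / 2 * c2)"
  have D: "D \<ge> 0" using K' by (simp add: D_def)
  define C where "C = D * (2 * fejer_mass * CQ)"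
  have C: "C \<ge> 0" using D fejer_mass_pos CQ_nonneg by (simp add: C_def)
  show ?thesis
  proof (intro exI[of _ C] conjI allI impI C)
    fix w :: real assume "0 < w \<and> w \<le> 1"
    then have w: "0 < w" "w \<le> 1" by auto
    define \<psi> where "\<psi> t = D * (norm (fourier (dampedQ w) (t + \<alpha>)))\<^sup>2" for t
    have m: "\<psi> \<in> borel_measurable borel" unfolding \<psi>_def by measurable
    have nn: "\<psi> t \<ge> 0" for t using D by (simp add: \<psi>_def)
    have dom: "(norm (fourier (TS.damped \<alpha> 0 w) t))\<^sup>2 \<le> sqrt (norm (fourier (TS.damped \<alpha> 0 w) t)) * \<psi> t" if t: "\<bar>t\<bar> \<le> K" for t
    proof -
      define s where "s = Complex (1 + w) (t + \<alpha>)"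
      have s: "Re s > 1" "s \<noteq> 0" using w by (auto simp: s_def complex_eq_iff)
      have s1: "norm s \<ge> 1" using abs_Re_le_cmod[of s] s by simp
      have s2: "norm s \<le> 2 + K'"
        using cmod_le[of s] w t unfolding s_def K'_def by simp
      have ss: "sqrt (norm s) \<le> norm s" using self_le_power[OF s1, of 2] by (intro real_le_lsqrt) auto
      let ?H = "exp (3 / 4 * (\<integral>x. mellin_kernel s x * g1 x \<partial>M))"
      have FT: "fourier (TS.damped \<alpha> 0 w) t = F s / s" unfolding s_def by (rule fourier_T[OF w(1)])
      have FQ: "fourier (dampedQ w) (t + \<alpha>) = ?H / s" unfolding s_def by (rule fourier_dampedQ[OF w(1)])
      have "(norm (F s / s))\<^sup>2 = (norm (F s))\<^sup>2 / (norm s)\<^sup>2" by (simp add: norm_divide power_divide)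
      also have "\<dots> \<le> sqrt (norm (F s)) * (exp (3 / 2 * c2) * (norm ?H)\<^sup>2) / (norm s)\<^sup>2"
        by (intro divide_right_mono F_square_le s) auto
      also have "\<dots> = sqrt (norm (F s / s)) * (sqrt (norm s) * exp (3 / 2 * c2) * (norm (?H / s))\<^sup>2)"
        using s by (simp add: norm_divide real_sqrt_divide power_divide)
      also have "\<dots> \<le> sqrt (norm (F s / s)) * \<psi> t"
        unfolding \<psi>_def FQ D_def
        using ss s2 by (intro mult_left_mono mult_right_mono) auto
      finally show ?thesis unfolding FT .
    qed
    have "(\<integral>\<^sup>+t. indicator {-K..K} t * ennreal (\<psi> t) \<partial>lborel) \<le>
      (\<integral>\<^sup>+t. ennreal D * (indicator {-K'..K'} (\<alpha> + 1 * t) * ennreal ((norm (fourier (dampedQ w) (\<alpha> + 1 * t)))\<^sup>2)) \<partial>lborel)"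
    proof (rule nn_integral_mono)
      fix t :: real
      show "indicator {-K..K} t * ennreal (\<psi> t) \<le> ennreal D * (indicator {-K'..K'} (\<alpha> + 1 * t) * ennreal ((norm (fourier (dampedQ w) (\<alpha> + 1 * t)))\<^sup>2))"
        using D by (auto simp: indicator_def \<psi>_def K'_def ennreal_mult add.commute)
    qed
    also have "\<dots> = ennreal D * (\<integral>\<^sup>+t. indicator {-K'..K'} (\<alpha> + 1 * t) * ennreal ((norm (fourier (dampedQ w) (\<alpha> + 1 * t)))\<^sup>2) \<partial>lborel)"
      by (rule nn_integral_cmult) measurable
    also have "(\<integral>\<^sup>+t. indicator {-K'..K'} (\<alpha> + 1 * t) * ennreal ((norm (fourier (dampedQ w) (\<alpha> + 1 * t)))\<^sup>2) \<partial>lborel) =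
      (\<integral>\<^sup>+t. indicator {-K'..K'} t * ennreal ((norm (fourier (dampedQ w) t))\<^sup>2) \<partial>lborel)"
      using nn_integral_real_affine[of "\<lambda>t. indicator {-K'..K'} t * ennreal ((norm (fourier (dampedQ w) t))\<^sup>2)" 1 \<alpha>] by simp
    also have "ennreal D * \<dots> \<le> ennreal D * ennreal (2 * fejer_mass * CQ / sqrt w)"
      by (intro mult_left_mono nn_integral_fourier_dampedQ w K') simp
    also have "\<dots> = ennreal (C / sqrt w)"
      using D w CQ_nonneg fejer_mass_pos by (subst ennreal_mult[symmetric]) (auto simp: C_def)
    finally have "(\<integral>\<^sup>+t. indicator {-K..K} t * ennreal (\<psi> t) \<partial>lborel) \<le> ennreal (C / sqrt w)" .
    with m nn dom show "\<exists>\<psi> \<in> borel_measurable borel. (\<forall>t. \<psi> t \<ge> 0) \<and>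
          (\<forall>t. \<bar>t\<bar> \<le> K \<longrightarrow> (norm (fourier (TS.damped \<alpha> 0 w) t))\<^sup>2 \<le> sqrt (norm (fourier (TS.damped \<alpha> 0 w) t)) * \<psi> t) \<and>
          (\<integral>\<^sup>+t. indicator {-K..K} t * ennreal (\<psi> t) \<partial>lborel) \<le> ennreal (C / sqrt w)" by blast
  qed
qed

text \<open>\<open>U - ln y\<close> is the length of the interval of all \<open>v\<close> with
  \<open>ln y \<le> v \<le> U\<close>. The sum thus becomes an integral over \<open>v\<close> of the
  mass up to \<open>exp v\<close>, whose exponential bound integrates to the size of its last
  value.\<close>

lemma nn_integral_log_defect:
  assumes U: "U \<ge> 0"
  shows "(\<integral>\<^sup>+p. indicator {..exp U} (fst p) * ennreal (U - ln (fst p)) * ennreal (norm (snd p)) \<partial>mark_exp M g) \<le> ennreal (CW * exp U)"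
proof -
  interpret P: pair_sigma_finite "mark_exp M g" lborel
    by (simp add: pair_sigma_finite_def G.E.sigma_finite_measure_axioms sigma_finite_lborel)
  have "(\<integral>\<^sup>+p. indicator {..exp U} (fst p) * ennreal (U - ln (fst p)) * ennreal (norm (snd p)) \<partial>mark_exp M g) =
    (\<integral>\<^sup>+p. \<integral>\<^sup>+v. indicator {0..U} v * (indicator {..exp v} (fst p) * ennreal (norm (snd p))) \<partial>lborel \<partial>mark_exp M g)"
  proof (intro nn_integral_cong_AE, use G.AE_mark_exp in eventually_elim)
    case (elim p)
    have lnp: "ln (fst p) \<ge> 0" using elim by simp
    have "(\<integral>\<^sup>+v. indicator {0..U} v * (indicator {..exp v} (fst p) * ennreal (norm (snd p))) \<partial>lborel) =
      (\<integral>\<^sup>+v. indicator {ln (fst p)..U} v * ennreal (norm (snd p)) \<partial>lborel)"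
    proof (rule nn_integral_cong)
      fix v :: real
      have "0 \<le> v" if "ln (fst p) \<le> v" using that lnp by linarith
      then show "indicator {0..U} v * (indicator {..exp v} (fst p) * ennreal (norm (snd p))) = indicator {ln (fst p)..U} v * ennreal (norm (snd p))"
        using elim by (auto simp: indicator_def le_exp_iff)
    qed
    also have "\<dots> = emeasure lborel {ln (fst p)..U} * ennreal (norm (snd p))"
      by (subst nn_integral_multc) auto
    also have "emeasure lborel {ln (fst p)..U} = indicator {..exp U} (fst p) * ennreal (U - ln (fst p))"
      using elim by (auto simp: emeasure_lborel_Icc_eq indicator_def le_exp_iff)
    finally show ?case by simp
  qed
  also have "\<dots> = (\<integral>\<^sup>+v. \<integral>\<^sup>+p. indicator {0..U} v * (indicator {..exp v} (fst p) * ennreal (norm (snd p))) \<partial>mark_exp M g \<partial>lborel)"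
    by (rule P.Fubini'[symmetric]) measurable
  also have "\<dots> = (\<integral>\<^sup>+v. indicator {0..U} v * (\<integral>\<^sup>+p. indicator {..exp v} (fst p) * ennreal (norm (snd p)) \<partial>mark_exp M g) \<partial>lborel)"
    by (intro nn_integral_cong nn_integral_cmult) measurable
  also have "\<dots> \<le> (\<integral>\<^sup>+v. ennreal (CW * exp v) * indicator {0..U} v \<partial>lborel)"
  proof (rule nn_integral_mono)
    fix v :: real
    show "indicator {0..U} v * (\<integral>\<^sup>+p. indicator {..exp v} (fst p) * ennreal (norm (snd p)) \<partial>mark_exp M g) \<le> ennreal (CW * exp v) * indicator {0..U} v"
      using W_le[of "exp v"] by (auto simp: indicator_def)
  qed
  also have "\<dots> = ennreal (CW * exp U - CW * exp 0)"
    by (rule nn_integral_FTC_Icc) (use U CW_nonneg in \<open>auto intro!: derivative_eq_intros\<close>)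
  also have "\<dots> \<le> ennreal (CW * exp U)" using CW_nonneg by (intro ennreal_leI) simp
  finally show ?thesis .
qed

text \<open>The logarithm identity for points up to \<open>exp U\<close>, normalized by
  \<open>exp (- (1 + i \<alpha>) U)\<close>. The error arises from replacing the logarithm of a
  point by \<open>U\<close> on the left, and is the content of
  \<open>nn_integral_log_defect\<close>.\<close>

lemma
  assumes U: "U \<ge> 0"
  shows integrable_renewal: "integrable M (\<lambda>x. T \<alpha> (U - ln x) * (g x * exp (- \<i> * of_real (\<alpha> * ln x))) * of_real (ln x / x))"
    and norm_renewal: "norm (of_real U * T \<alpha> U -
       (\<integral>x. T \<alpha> (U - ln x) * (g x * exp (- \<i> * of_real (\<alpha> * ln x))) * of_real (ln x / x) \<partial>M)) \<le> CW"
proof -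
  define E where "E = exp (- (1 + \<i> * of_real \<alpha>) * of_real U)"
  let ?f = "\<lambda>p :: real \<times> complex. indicator {..exp U} (fst p) * snd p"
  have int: "integrable (mark_exp M g) (\<lambda>p. ln (fst p) *\<^sub>R ?f p)"
  proof -
    have "integrable (mark_exp M g) (\<lambda>p. (of_real (ln (fst p)) * indicator {..exp U} (fst p)) * snd p)"
      by (rule G.integrable_mark_exp_bounded_support[of _ U "exp U"])
         (auto simp: norm_mult indicator_def le_exp_iff abs_of_nonneg)
    then show ?thesis by (simp add: scaleR_conv_of_real mult.assoc)
  qed
  let ?G = "\<lambda>x. \<integral>p. ?f (x * fst p, g x * snd p) \<partial>mark_exp M g"
  have ae: "AE x in M. T \<alpha> (U - ln x) * (g x * exp (- \<i> * of_real (\<alpha> * ln x))) * of_real (ln x / x) = E * (ln x *\<^sub>R ?G x)"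
    using one.AE_M
  proof eventually_elim
    case (elim x)
    have "?G x = (\<integral>p. g x * (indicator {..exp U / x} (fst p) * snd p) \<partial>mark_exp M g)"
      using elim by (intro Bochner_Integration.integral_cong) (auto simp: indicator_def field_simps)
    also have "\<dots> = g x * G.summ (exp U / x)" unfolding G.summ_def by (rule integral_mult_right_zero)
    finally have G: "?G x = g x * G.summ (exp U / x)" .
    have eq: "exp (U - ln x) = exp U / x" using elim by (simp add: exp_diff)
    show ?case
    proof (cases "ln x \<le> U")
      case True
      have "exp (- (1 + \<i> * of_real \<alpha>) * of_real (U - ln x)) * exp (- \<i> * of_real (\<alpha> * ln x)) = E * of_real x"
      proof -
        have "exp (- (1 + \<i> * of_real \<alpha>) * of_real (U - ln x)) * exp (- \<i> * of_real (\<alpha> * ln x)) =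
          E * exp (of_real (ln x))"
          unfolding E_def exp_add[symmetric] by (simp add: algebra_simps)
        also have "exp (of_real (ln x)) = complex_of_real x" using elim by (simp add: exp_of_real)
        finally show ?thesis .
      qed
      then have "T \<alpha> (U - ln x) * (g x * exp (- \<i> * of_real (\<alpha> * ln x))) * of_real (ln x / x) =
         (E * of_real x) * (g x * G.summ (exp U / x)) * of_real (ln x / x)"
        using True unfolding T_def eq by (simp add: mult_ac)
      also have "\<dots> = E * (ln x *\<^sub>R ?G x)" using elim unfolding G by (simp add: scaleR_conv_of_real)
      finally show ?thesis .
    next
      case False
      then have "exp U / x < 1" using elim le_exp_iff[of x U] by (simp add: field_simps)
      then have "?G x = 0" unfolding G by (simp add: G.summ_less_1)
      then show ?thesis using False by (simp add: T_def)
    qed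
  qed
  have ig: "integrable M (\<lambda>x. E * (ln x *\<^sub>R ?G x))"
    by (intro integrable_mult_right G.integrable_log_mark_exp int) measurable
  then show "integrable M (\<lambda>x. T \<alpha> (U - ln x) * (g x * exp (- \<i> * of_real (\<alpha> * ln x))) * of_real (ln x / x))"
    by (subst integrable_cong_AE[OF _ _ ae]) auto
  have iz: "integrable (mark_exp M g) ?f"
    by (rule G.integrable_mark_exp_bounded_support[of _ 1 "exp U"]) (auto simp: indicator_def)
  have "(\<integral>x. T \<alpha> (U - ln x) * (g x * exp (- \<i> * of_real (\<alpha> * ln x))) * of_real (ln x / x) \<partial>M) = (\<integral>x. E * (ln x *\<^sub>R ?G x) \<partial>M)"
    by (rule integral_cong_AE[OF _ _ ae]) measurable
  also have "\<dots> = E * (\<integral>x. ln x *\<^sub>R ?G x \<partial>M)" by (rule integral_mult_right_zero)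
  also have "(\<integral>x. ln x *\<^sub>R ?G x \<partial>M) = (\<integral>p. ln (fst p) *\<^sub>R ?f p \<partial>mark_exp M g)"
    by (rule G.integral_log_mark_exp[OF _ int, symmetric]) measurable
  finally have I: "(\<integral>x. T \<alpha> (U - ln x) * (g x * exp (- \<i> * of_real (\<alpha> * ln x))) * of_real (ln x / x) \<partial>M)
     = E * (\<integral>p. ln (fst p) *\<^sub>R ?f p \<partial>mark_exp M g)" .
  have iU: "integrable (mark_exp M g) (\<lambda>p. of_real U * ?f p)" using iz by (rule integrable_mult_right)
  have TU: "of_real U * T \<alpha> U = E * (\<integral>p. of_real U * ?f p \<partial>mark_exp M g)"
    using U by (simp add: T_def E_def G.summ_def)
  have "of_real U * T \<alpha> U - (\<integral>x. T \<alpha> (U - ln x) * (g x * exp (- \<i> * of_real (\<alpha> * ln x))) * of_real (ln x / x) \<partial>M)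
     = E * (\<integral>p. of_real U * ?f p - ln (fst p) *\<^sub>R ?f p \<partial>mark_exp M g)"
    unfolding I TU Bochner_Integration.integral_diff[OF iU int] by (simp add: right_diff_distrib)
  also have "norm \<dots> \<le> exp (- U) * (CW * exp U)"
    unfolding norm_mult
  proof (rule mult_mono)
    show "norm E \<le> exp (- U)" by (simp add: E_def)
    have "ennreal (norm (\<integral>p. of_real U * ?f p - ln (fst p) *\<^sub>R ?f p \<partial>mark_exp M g)) \<le>
       (\<integral>\<^sup>+p. ennreal (norm (of_real U * ?f p - ln (fst p) *\<^sub>R ?f p)) \<partial>mark_exp M g)"
      by (rule integral_norm_bound_ennreal[OF Bochner_Integration.integrable_diff[OF iU int]])
    also have "\<dots> = (\<integral>\<^sup>+p. indicator {..exp U} (fst p) * ennreal (U - ln (fst p)) * ennreal (norm (snd p)) \<partial>mark_exp M g)"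
    proof (intro nn_integral_cong_AE, use G.AE_mark_exp in eventually_elim)
      case (elim p)
      have "of_real U * ?f p - ln (fst p) *\<^sub>R ?f p = of_real (U - ln (fst p)) * ?f p"
        by (simp add: scaleR_conv_of_real left_diff_distrib)
      moreover have "ln (fst p) \<le> U" if "fst p \<le> exp U" using that elim by (simp add: le_exp_iff)
      ultimately show ?case
        by (auto simp: norm_mult indicator_def abs_of_nonneg ennreal_mult simp del: of_real_diff)
    qed
    also have "\<dots> \<le> ennreal (CW * exp U)" by (rule nn_integral_log_defect[OF U])
    finally show "norm (\<integral>p. of_real U * ?f p - ln (fst p) *\<^sub>R ?f p \<partial>mark_exp M g) \<le> CW * exp U"
      using CW_nonneg by simp
  qed auto
  also have "\<dots> = CW" by (simp add: exp_minus)
  finally show "norm (of_real U * T \<alpha> U -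
       (\<integral>x. T \<alpha> (U - ln x) * (g x * exp (- \<i> * of_real (\<alpha> * ln x))) * of_real (ln x / x) \<partial>M)) \<le> CW" .
qed

text \<open>In the window \<open>1 / x \<le> exp (- b)\<close>, and the sum of
  \<open>|g1| ln x\<close> is at most \<open>Cc * exp (b + 1)\<close>. As Chebyshev's bound starts
  at 1, windows with \<open>b + 1 < 0\<close> are set apart; they carry no mass.\<close>

lemma cheb_window:
  "(\<integral>\<^sup>+x. indicator {b..b + 1} (ln x) * ennreal (norm (g1 x) * (ln x / x)) \<partial>M) \<le> ennreal (exp 1 * Cc)"
proof (cases "b + 1 < 0")
  case True
  have "(\<integral>\<^sup>+x. indicator {b..b + 1} (ln x) * ennreal (norm (g1 x) * (ln x / x)) \<partial>M) = (\<integral>\<^sup>+x. 0 \<partial>M)"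
  proof (intro nn_integral_cong_AE, use one.AE_M in eventually_elim)
    case (elim x)
    then have "ln x > 0" by simp
    then show ?case using True by (simp add: indicator_def)
  qed
  then show ?thesis by simp
next
  case False
  have "(\<integral>\<^sup>+x. indicator {b..b + 1} (ln x) * ennreal (norm (g1 x) * (ln x / x)) \<partial>M)
     \<le> (\<integral>\<^sup>+x. ennreal (exp (- b)) * (indicator {..exp (b + 1)} x * ennreal (norm (g1 x) * ln x)) \<partial>M)"
  proof (intro nn_integral_mono_AE, use one.AE_M in eventually_elim)
    case (elim x)
    show ?case
    proof (cases "ln x \<in> {b..b + 1}")
      case True
      have "exp b \<le> x" using True elim by (metis atLeastAtMost_iff exp_le_cancel_iff exp_ln less_trans zero_less_one)
      then have "1 / x \<le> exp (- b)" using elim by (simp add: exp_minus inverse_eq_divide frac_le)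
      then have "norm (g1 x) * ln x * (1 / x) \<le> norm (g1 x) * ln x * exp (- b)"
        using elim by (intro mult_left_mono) auto
      then have "ennreal (norm (g1 x) * (ln x / x)) \<le> ennreal (exp (- b) * (norm (g1 x) * ln x))"
        by (intro ennreal_leI) (simp add: mult_ac)
      also have "\<dots> = ennreal (exp (- b)) * ennreal (norm (g1 x) * ln x)"
        using elim by (intro ennreal_mult) auto
      finally show ?thesis using True elim by (simp add: le_exp_iff)
    qed simp
  qed
  also have "\<dots> = ennreal (exp (- b)) * (\<integral>\<^sup>+x. indicator {..exp (b + 1)} x * ennreal (norm (g1 x) * ln x) \<partial>M)"
    by (rule nn_integral_cmult) measurable
  also have "\<dots> \<le> ennreal (exp (- b)) * ennreal (Cc * exp (b + 1))"
    using False by (intro mult_left_mono g1_cheb) auto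
  also have "\<dots> = ennreal (exp 1 * Cc)"
    using Cc_nonneg by (subst ennreal_mult[symmetric]) (auto simp: exp_add exp_minus)
  finally show ?thesis .
qed

lemma log_renewal_T:
  "log_renewal M (T \<alpha>) (\<lambda>x. g x * exp (- \<i> * of_real (\<alpha> * ln x))) (\<lambda>x. norm (g1 x)) (\<lambda>x. norm (g2 x)) CW CW (exp 1 * Cc)"
proof (rule log_renewal.intro)
  show "sigma_finite_measure M" by (rule one.M.sigma_finite_measure_axioms)
  fix x :: real
  have "norm (exp (- \<i> * of_real (\<alpha> * ln x))) = 1" by simp
  then show "norm (g x * exp (- \<i> * of_real (\<alpha> * ln x))) \<le> norm (g1 x) + norm (g2 x)"
    using norm_triangle_ineq[of "g1 x" "g2 x"] by (simp only: norm_mult mult_1_right)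
next
  fix u :: real assume "u < 0"
  then show "T \<alpha> u = 0" by (simp add: T_def)
next
  fix \<epsilon> :: real assume "\<epsilon> > 0"
  then show "\<exists>\<delta>>0. \<exists>u0. \<forall>u\<ge>u0. \<forall>h\<in>{0..\<delta>}. norm (T \<alpha> (u + h) - T \<alpha> u) \<le> \<epsilon>" by (rule T_osc)
next
  show "(\<lambda>x. g x * exp (- \<i> * of_real (\<alpha> * ln x))) \<in> borel_measurable borel" by measurable
next
  fix U :: real assume "U \<ge> 0"
  then show "integrable M (\<lambda>x. T \<alpha> (U - ln x) * (g x * exp (- \<i> * of_real (\<alpha> * ln x))) * of_real (ln x / x))"
    by (rule integrable_renewal)
next
  fix U :: real assume "U \<ge> 0"
  then show "norm (of_real U * T \<alpha> U -
       (\<integral>x. T \<alpha> (U - ln x) * (g x * exp (- \<i> * of_real (\<alpha> * ln x))) * of_real (ln x / x) \<partial>M)) \<le> CW"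
    by (rule norm_renewal)
next
  fix b :: real
  show "(\<integral>\<^sup>+x. indicator {b..b + 1} (ln x) * ennreal (norm (g1 x) * (ln x / x)) \<partial>M) \<le> ennreal (exp 1 * Cc)"
    by (rule cheb_window)
qed (use Cc_nonneg CW_nonneg in \<open>simp_all add: one.AE_M norm_T g2_sum[simplified]\<close>)

end

section \<open>The equivalence\<close>

context mark_local
begin

text \<open>\<open>\<phi>\<close> will be one of the four parts of the mark. Both measures are
  images under the same first coordinate, which gives absolute continuity;
  \<open>\<phi> z \<le> norm z\<close> makes the image finite on bounded sets, so that the
  derivative is almost everywhere finite and may be taken real.\<close>

lemma density_representation:
  fixes \<phi> :: "complex \<Rightarrow> real"
  assumes [measurable]: "\<phi> \<in> borel_measurable borel" and \<phi>: "\<And>z. 0 \<le> \<phi> z" "\<And>z. \<phi> z \<le> norm z"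
  defines "W \<equiv> distr (mark_exp M g) borel fst"
  shows "\<exists>k \<in> borel_measurable borel. (\<forall>x. 0 \<le> k x) \<and>
    density W (\<lambda>x. ennreal (k x)) = distr (density (mark_exp M g) (\<lambda>p. ennreal (\<phi> (snd p)))) borel fst"
proof -
  let ?\<mu> = "distr (density (mark_exp M g) (\<lambda>p. ennreal (\<phi> (snd p)))) borel fst"
  have [measurable_cong, simp]: "sets W = sets borel" by (simp add: W_def)
  have sp: "space W = UNIV" by (simp add: W_def)
  interpret W: sigma_finite_measure W
  proof
    have "(\<Union>i::nat. {..real i}) = UNIV" by (auto intro: real_arch_simple)
    moreover have "emeasure W {..x} < \<infinity>" for x
    proof -
      have "emeasure W {..x} = emeasure (mark_exp M g) (fst -` {..x} \<inter> space (mark_exp M g))"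
        unfolding W_def by (rule emeasure_distr) auto
      also have "fst -` {..x} \<inter> space (mark_exp M g) = {..x} \<times> UNIV" by auto
      finally show ?thesis using emeasure_mark_exp_finite by simp
    qed
    ultimately show "\<exists>A. countable A \<and> A \<subseteq> sets W \<and> \<Union> A = space W \<and> (\<forall>a\<in>A. emeasure W a \<noteq> \<infinity>)"
      by (intro exI[of _ "range (\<lambda>i::nat. {..real i})"]) (auto simp: sp less_top)
  qed
  have ac: "absolutely_continuous W ?\<mu>"
    unfolding absolutely_continuous_def
  proof
    fix A assume "A \<in> null_sets W"
    then have A[measurable]: "A \<in> sets borel" and 0: "emeasure W A = 0" by auto
    have "AE p in mark_exp M g. fst p \<notin> A"
    proof (rule AE_I)
      show "{p \<in> space (mark_exp M g). \<not> fst p \<notin> A} \<subseteq> fst -` A \<inter> space (mark_exp M g)" by auto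
      show "emeasure (mark_exp M g) (fst -` A \<inter> space (mark_exp M g)) = 0"
        using 0 unfolding W_def by (subst (asm) emeasure_distr) auto
    qed measurable
    then have "(\<integral>\<^sup>+p. ennreal (\<phi> (snd p)) * indicator A (fst p) \<partial>mark_exp M g) = 0"
      by (subst nn_integral_0_iff_AE) (auto elim: eventually_mono)
    moreover have "emeasure ?\<mu> A = (\<integral>\<^sup>+p. ennreal (\<phi> (snd p)) * indicator A (fst p) \<partial>mark_exp M g)"
      by (subst nn_integral_indicator[symmetric], simp, subst nn_integral_distr) (auto simp: nn_integral_density)
    ultimately show "A \<in> null_sets ?\<mu>" by (auto simp: null_sets_def)
  qed
  obtain r where r[measurable]: "r \<in> borel_measurable W" and d: "density W r = ?\<mu>"
    using W.Radon_Nikodym[OF ac] by auto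
  have rm[measurable]: "r \<in> borel_measurable borel" using r by measurable
  have fin: "AE x in W. r x * indicator {..real n} x \<noteq> \<infinity>" for n :: nat
  proof (rule nn_integral_PInf_AE)
    have "(\<integral>\<^sup>+x. r x * indicator {..real n} x \<partial>W) = emeasure ?\<mu> {..real n}"
      by (subst d[symmetric]) (simp add: emeasure_density)
    also have "\<dots> = (\<integral>\<^sup>+p. ennreal (\<phi> (snd p)) * indicator {..real n} (fst p) \<partial>mark_exp M g)"
      by (subst nn_integral_indicator[symmetric], simp, subst nn_integral_distr) (auto simp: nn_integral_density)
    also have "\<dots> \<le> (\<integral>\<^sup>+p. ennreal (norm (indicator {..real n} (fst p) * snd p)) \<partial>mark_exp M g)"
      using \<phi> by (intro nn_integral_mono) (auto simp: indicator_def intro: ennreal_leI)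
    also have "\<dots> < \<infinity>"
      using integrable_mark_exp_bounded_support[of "indicator {..real n}" 1 "real n"]
      by (auto simp: integrable_iff_bounded indicator_def)
    finally show "(\<integral>\<^sup>+x. r x * indicator {..real n} x \<partial>W) \<noteq> \<infinity>" by simp
  qed simp
  have "AE x in W. \<forall>n::nat. r x * indicator {..real n} x \<noteq> \<infinity>"
    by (subst AE_all_countable) (use fin in auto)
  then have "AE x in W. ennreal (enn2real (r x)) = r x"
  proof eventually_elim
    case (elim x)
    obtain n :: nat where "x \<le> real n" using real_arch_simple by blast
    then have "r x \<noteq> \<infinity>" using elim[rule_format, of n] by auto
    then show ?case by (simp add: less_top)
  qed
  then have "density W (\<lambda>x. ennreal (enn2real (r x))) = density W r"
    by (intro density_cong) auto
  then show ?thesis using d by (intro bexI[of _ "\<lambda>x. enn2real (r x)"]) auto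
qed

text \<open>
  Positive and negative parts of the mark have densities with respect to the first marginal of
  \<open>mark_exp M g\<close> by Radon-Nikodym, which brings \<open>\<mu>\<close> into the form of \<open>integral_wrt_density\<close>.
\<close>

lemma integral_wrt_eq:
  assumes \<mu>: "\<And>A. A \<in> bounded_borel \<Longrightarrow> \<mu> A = (\<integral>p. indicator A (fst p) * snd p \<partial>mark_exp M g)"
    and f'[measurable]: "f' \<in> borel_measurable borel" and ff': "\<And>x. x \<ge> 1 \<Longrightarrow> f x = f' x"
    and int: "integrable (mark_exp M g) (\<lambda>p. f' (fst p) * snd p)"
  shows "integral_wrt \<mu> f = (\<integral>p. f' (fst p) * snd p \<partial>mark_exp M g)"
proof -
  define W where "W = distr (mark_exp M g) borel fst"
  have [measurable_cong, simp]: "sets W = sets borel" by (simp add: W_def)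
  have part: "\<exists>k \<in> borel_measurable borel. \<forall>h \<in> borel_measurable borel. integrable (mark_exp M g) (\<lambda>p. h (fst p) * snd p) \<longrightarrow>
      integrable W (\<lambda>x. of_real (k x) * h x) \<and> (\<integral>x. of_real (k x) * h x \<partial>W) = (\<integral>p. of_real (\<phi> (snd p)) * h (fst p) \<partial>mark_exp M g) \<and>
      integrable (mark_exp M g) (\<lambda>p. of_real (\<phi> (snd p)) * h (fst p))"
    if \<phi>m[measurable]: "\<phi> \<in> borel_measurable borel" and \<phi>: "\<And>z. 0 \<le> \<phi> z" "\<And>z. \<phi> z \<le> norm z"
    for \<phi> :: "complex \<Rightarrow> real"
  proof -
    obtain k where [measurable]: "k \<in> borel_measurable borel" and k0: "\<And>x. 0 \<le> k x"
      and d: "density W (\<lambda>x. ennreal (k x)) = distr (density (mark_exp M g) (\<lambda>p. ennreal (\<phi> (snd p)))) borel fst"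
      using density_representation[OF \<phi>m \<phi>] unfolding W_def by blast
    show ?thesis
    proof (intro bexI[of _ k] ballI impI)
      fix h :: "real \<Rightarrow> complex" assume [measurable]: "h \<in> borel_measurable borel"
        and i: "integrable (mark_exp M g) (\<lambda>p. h (fst p) * snd p)"
      have i1: "integrable (mark_exp M g) (\<lambda>p. \<phi> (snd p) *\<^sub>R h (fst p))"
      proof (rule Bochner_Integration.integrable_bound[OF i])
        show "AE p in mark_exp M g. norm (\<phi> (snd p) *\<^sub>R h (fst p)) \<le> norm (h (fst p) * snd p)"
        proof (intro AE_I2)
          fix p :: "real \<times> complex"
          show "norm (\<phi> (snd p) *\<^sub>R h (fst p)) \<le> norm (h (fst p) * snd p)"
            using mult_right_mono[OF \<phi>(2)[of "snd p"] norm_ge_zero[of "h (fst p)"]] \<phi>(1)[of "snd p"]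
            by (simp add: norm_mult mult.commute)
        qed
      qed simp
      then have "integrable (distr (density (mark_exp M g) (\<lambda>p. ennreal (\<phi> (snd p)))) borel fst) h"
        by (subst integrable_distr_eq, simp, simp, subst integrable_density) (auto simp: \<phi>)
      then have i2: "integrable W (\<lambda>x. k x *\<^sub>R h x)"
        unfolding d[symmetric] by (subst (asm) integrable_density) (auto simp: k0)
      have "(\<integral>x. k x *\<^sub>R h x \<partial>W) = (\<integral>x. h x \<partial>density W (\<lambda>x. ennreal (k x)))"
        by (subst integral_density) (auto simp: k0)
      also have "\<dots> = (\<integral>p. h (fst p) \<partial>density (mark_exp M g) (\<lambda>p. ennreal (\<phi> (snd p))))"
        unfolding d by (subst integral_distr) auto
      also have "\<dots> = (\<integral>p. \<phi> (snd p) *\<^sub>R h (fst p) \<partial>mark_exp M g)"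
        by (subst integral_density) (auto simp: \<phi>)
      finally show "integrable W (\<lambda>x. of_real (k x) * h x) \<and> (\<integral>x. of_real (k x) * h x \<partial>W) = (\<integral>p. of_real (\<phi> (snd p)) * h (fst p) \<partial>mark_exp M g) \<and>
          integrable (mark_exp M g) (\<lambda>p. of_real (\<phi> (snd p)) * h (fst p))"
        using i1 i2 by (simp add: scaleR_conv_of_real)
    qed simp
  qed
  have b: "max 0 (Re z) \<le> norm z" "max 0 (- Re z) \<le> norm z" "max 0 (Im z) \<le> norm z" "max 0 (- Im z) \<le> norm z" for z
    using abs_Re_le_cmod[of z] abs_Im_le_cmod[of z] by (auto simp: abs_le_iff)
  \<comment> \<open>\<open>R k \<phi>\<close> expresses that \<open>k\<close> is the conditional
    expectation of \<open>\<phi>\<close> of the mark given the point, tested against all admissible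
    \<open>h\<close>.\<close>
  define R where "R k \<phi> \<longleftrightarrow> (\<forall>h \<in> borel_measurable borel. integrable (mark_exp M g) (\<lambda>p. h (fst p) * snd p) \<longrightarrow>
      integrable W (\<lambda>x. of_real (k x) * h x) \<and> (\<integral>x. of_real (k x) * h x \<partial>W) = (\<integral>p. of_real (\<phi> (snd p)) * h (fst p) \<partial>mark_exp M g) \<and>
      integrable (mark_exp M g) (\<lambda>p. of_real (\<phi> (snd p)) * h (fst p)))" for k :: "real \<Rightarrow> real" and \<phi> :: "complex \<Rightarrow> real"
  obtain k1 where k1[measurable]: "k1 \<in> borel_measurable borel" and R1: "R k1 (\<lambda>z. max 0 (Re z))"
    using part[of "\<lambda>z. max 0 (Re z)"] b unfolding R_def by auto
  obtain k2 where k2[measurable]: "k2 \<in> borel_measurable borel" and R2: "R k2 (\<lambda>z. max 0 (- Re z))"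
    using part[of "\<lambda>z. max 0 (- Re z)"] b unfolding R_def by auto
  obtain k3 where k3[measurable]: "k3 \<in> borel_measurable borel" and R3: "R k3 (\<lambda>z. max 0 (Im z))"
    using part[of "\<lambda>z. max 0 (Im z)"] b unfolding R_def by auto
  obtain k4 where k4[measurable]: "k4 \<in> borel_measurable borel" and R4: "R k4 (\<lambda>z. max 0 (- Im z))"
    using part[of "\<lambda>z. max 0 (- Im z)"] b unfolding R_def by auto
  \<comment> \<open>The conditional expectation of the mark itself, hence a density of
    \<open>\<mu>\<close> with respect to the marginal \<open>W\<close>.\<close>
  define k where "k x = complex_of_real (k1 x) - of_real (k2 x) + \<i> * (of_real (k3 x) - of_real (k4 x))" for x
  have [measurable]: "k \<in> borel_measurable borel" unfolding k_def by measurable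
  have rep: "integrable W (\<lambda>x. h x * k x)" "(\<integral>x. h x * k x \<partial>W) = (\<integral>p. h (fst p) * snd p \<partial>mark_exp M g)"
    if h: "h \<in> borel_measurable borel" and i: "integrable (mark_exp M g) (\<lambda>p. h (fst p) * snd p)" for h
  proof -
    note r = R1[unfolded R_def, rule_format, OF h i] R2[unfolded R_def, rule_format, OF h i]
       R3[unfolded R_def, rule_format, OF h i] R4[unfolded R_def, rule_format, OF h i]
    have eq: "h x * k x = (of_real (k1 x) * h x - of_real (k2 x) * h x) + \<i> * (of_real (k3 x) * h x - of_real (k4 x) * h x)" for x
      by (simp add: k_def algebra_simps)
    show "integrable W (\<lambda>x. h x * k x)"
      unfolding eq using r by (intro Bochner_Integration.integrable_add Bochner_Integration.integrable_diff integrable_mult_right) auto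
    have z: "z = (of_real (max 0 (Re z)) - of_real (max 0 (- Re z))) + \<i> * (of_real (max 0 (Im z)) - of_real (max 0 (- Im z)))" for z
      by (auto simp: complex_eq_iff max_def)
    have eq2: "h (fst p) * snd p = (of_real (max 0 (Re (snd p))) * h (fst p) - of_real (max 0 (- Re (snd p))) * h (fst p))
      + \<i> * (of_real (max 0 (Im (snd p))) * h (fst p) - of_real (max 0 (- Im (snd p))) * h (fst p))" for p :: "real \<times> complex"
      by (subst (1) z[of "snd p"]) (simp only: algebra_simps)
    show "(\<integral>x. h x * k x \<partial>W) = (\<integral>p. h (fst p) * snd p \<partial>mark_exp M g)"
      unfolding eq eq2 using r
      by (simp only: Bochner_Integration.integral_add Bochner_Integration.integral_diff Bochner_Integration.integrable_diff integrable_mult_right integral_mult_right_zero)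
  qed
  have W1: "AE x in W. x \<ge> 1"
    unfolding W_def by (subst AE_distr_iff) (use AE_mark_exp in auto)
  have si: "set_integrable W A k" and sa: "\<mu> A = (LINT x:A|W. k x)" if A: "A \<in> bounded_borel" for A
  proof -
    have [measurable]: "A \<in> sets borel" using A by (rule bounded_borel_sets)
    have "(indicator A :: real \<Rightarrow> complex) \<in> borel_measurable borel" by measurable
    note r = rep[OF this integrable_mark_exp_bounded_borel[OF A]]
    have e: "indicator A x *\<^sub>R k x = indicator A x * k x" for x by (simp add: indicator_def)
    show "set_integrable W A k" using r(1) unfolding set_integrable_def e .
    show "\<mu> A = (LINT x:A|W. k x)" unfolding \<mu>[OF A] set_lebesgue_integral_def e using r(2) by simp
  qed
  note r = rep[OF f' int]
  have "set_integrable W {1..} (\<lambda>x. f' x * k x)"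
    unfolding set_integrable_def using r(1) by (intro integrable_mult_indicator) auto
  then have "integral_wrt \<mu> f = (LINT x:{1..}|W. f' x * k x)"
    by (intro integral_wrt_density[where W = W] si sa ff') auto
  also have "\<dots> = (\<integral>x. f' x * k x \<partial>W)"
    unfolding set_lebesgue_integral_def
    by (rule integral_cong_AE, measurable, use W1 in eventually_elim) auto
  finally show ?thesis using r(2) by simp
qed

end

section \<open>The equivalence for the normalized function\<close>

context beurling_weight
begin

text \<open>From left to right, the substitution \<open>u = v / w\<close> writes the L1 norm of the
  damped difference as \<open>1 / w\<close> times an integral that tends to 0 by dominated
  convergence, because \<open>T (X v)\<close>, \<open>c L (X v)\<close> and \<open>c L X\<close>
  approach each other for every fixed \<open>v > 0\<close>; an L1 bound is uniform in
  \<open>t\<close>. Conversely, \<open>mean_of_transform\<close> supplies the hypothesis of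
  \<open>tendsto_of_mean\<close>, and slow variation exchanges \<open>L (2 * U)\<close> for
  \<open>L U\<close>.\<close>

lemma transform_tendsto_iff:
  fixes c :: complex and L :: "real \<Rightarrow> complex"
  assumes L1: "\<And>u. u > 0 \<Longrightarrow> norm (L u) = 1" and Ls: "\<And>l. l > 0 \<Longrightarrow> ((\<lambda>u. L (l * u) / L u) \<longlongrightarrow> 1) at_top"
  shows "((\<lambda>u. T \<alpha> u - c * L u) \<longlongrightarrow> 0) at_top \<longleftrightarrow>
    (\<forall>K>0. \<forall>e>0. \<forall>\<^sub>F w in at_right 0. \<forall>t. \<bar>t\<bar> \<le> K \<longrightarrow> norm (fourier (TS.damped \<alpha> (c * L (1 / w)) w) t) \<le> e / w)"
    (is "?lhs \<longleftrightarrow> ?rhs")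
proof -
  have Ld: "((\<lambda>u. c * L (l * u) - c * L u) \<longlongrightarrow> 0) at_top" if l: "l > 0" for l
  proof -
    have "((\<lambda>u. L (l * u) / L u - 1) \<longlongrightarrow> 1 - 1) at_top" by (intro tendsto_intros Ls l)
    then have "((\<lambda>u. norm (L (l * u) / L u - 1)) \<longlongrightarrow> 0) at_top" by (intro tendsto_norm_zero) simp
    then have "((\<lambda>u. norm c * norm (L (l * u) / L u - 1)) \<longlongrightarrow> norm c * 0) at_top" by (intro tendsto_intros)
    then have "((\<lambda>u. norm c * norm (L (l * u) / L u - 1)) \<longlongrightarrow> 0) at_top" by simp
    moreover have "\<forall>\<^sub>F u in at_top. norm c * norm (L (l * u) / L u - 1) = norm (c * L (l * u) - c * L u)"
      using eventually_gt_at_top[of 0]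
    proof eventually_elim
      case (elim u)
      then have "L u \<noteq> 0" using L1[of u] by auto
      then have "c * L (l * u) - c * L u = c * (L (l * u) / L u - 1) * L u" by (simp add: field_simps)
      then show ?case using L1[OF elim] by (simp add: norm_mult)
    qed
    ultimately have "((\<lambda>u. norm (c * L (l * u) - c * L u)) \<longlongrightarrow> 0) at_top" by (rule Lim_transform_eventually)
    then show ?thesis by (rule tendsto_norm_zero_cancel)
  qed
  show ?thesis
  proof
    assume lhs: ?lhs
    let ?s = "\<lambda>X v. indicator {0..} v * (norm (T \<alpha> (X * v) - c * L X) * exp (- v)) :: real"
    have "((\<lambda>X. \<integral>v. ?s X v \<partial>lborel) \<longlongrightarrow> integral\<^sup>L (lborel :: real measure) (\<lambda>_. 0)) at_top"
    proof (rule integral_dominated_convergence_at_top[where s = ?s and f = "\<lambda>_. 0" and w = "\<lambda>v. (CW + norm c) * (indicator {0..} v * exp (- 1 * v))" and M = lborel])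
      show "integrable lborel (\<lambda>v. (CW + norm c) * (indicator {0..} v * exp (- 1 * v)))"
        by (intro integrable_mult_right integrable_exp_decay) simp
      show "AE v in lborel. ((\<lambda>X. ?s X v) \<longlongrightarrow> 0) at_top"
        using AE_lborel_singleton[of 0]
      proof eventually_elim
        case (elim v)
        show ?case
        proof (cases "v > 0")
          case True
          have "filterlim (\<lambda>X. X * v) at_top at_top"
            using True by (intro filterlim_at_top_mult_tendsto_pos[OF tendsto_const] filterlim_ident) auto
          then have "((\<lambda>X. T \<alpha> (X * v) - c * L (X * v)) \<longlongrightarrow> 0) at_top" by (rule filterlim_compose[OF lhs])
          from tendsto_add[OF this Ld[OF True]]
          have "((\<lambda>X. T \<alpha> (X * v) - c * L X) \<longlongrightarrow> 0) at_top" by (simp add: mult.commute)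
          then have "((\<lambda>X. norm (T \<alpha> (X * v) - c * L X)) \<longlongrightarrow> 0) at_top" by (rule tendsto_norm_zero)
          then have "((\<lambda>X. ?s X v) \<longlongrightarrow> indicator {0..} v * (0 * exp (- v))) at_top" by (intro tendsto_intros)
          then show ?thesis by simp
        next
          case False
          then show ?thesis using elim by simp
        qed
      qed
      show "\<forall>\<^sub>F X in at_top. AE v in lborel. norm (?s X v) \<le> (CW + norm c) * (indicator {0..} v * exp (- 1 * v))"
        using eventually_gt_at_top[of 0]
      proof eventually_elim
        case (elim X)
        have "norm (T \<alpha> (X * v) - c * L X) \<le> CW + norm c" for v
          using norm_triangle_ineq4[of "T \<alpha> (X * v)" "c * L X"] norm_T[of \<alpha> "X * v"] L1[OF elim] by (simp add: norm_mult)
        then show ?case by (intro AE_I2) (auto simp: indicator_def intro!: mult_right_mono)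
      qed
    qed auto
    then have lim: "((\<lambda>X. \<integral>v. ?s X v \<partial>lborel) \<longlongrightarrow> 0) at_top" by simp
    show ?rhs
    proof (intro allI impI)
      fix K e :: real assume "K > 0" "e > 0"
      have "\<forall>\<^sub>F X in at_top. (\<integral>v. ?s X v \<partial>lborel) < e" using lim \<open>e > 0\<close> by (rule order_tendstoD)
      then have "\<forall>\<^sub>F w in at_right 0. (\<integral>v. ?s (inverse w) v \<partial>lborel) < e"
        by (simp add: at_top_to_right eventually_filtermap)
      moreover have "\<forall>\<^sub>F w in at_right (0::real). w > 0" by (rule eventually_at_right_less)
      ultimately show "\<forall>\<^sub>F w in at_right 0. \<forall>t. \<bar>t\<bar> \<le> K \<longrightarrow> norm (fourier (TS.damped \<alpha> (c * L (1 / w)) w) t) \<le> e / w"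
      proof eventually_elim
        case (elim w)
        let ?A = "c * L (1 / w)"
        show ?case
        proof (intro allI impI)
          fix t
          have "norm (fourier (TS.damped \<alpha> ?A w) t) \<le> (\<integral>u. norm (TS.damped \<alpha> ?A w u * exp (- \<i> * of_real (t * u))) \<partial>lborel)"
            unfolding fourier_def by (rule integral_norm_bound)
          also have "\<dots> = (\<integral>u. norm (TS.damped \<alpha> ?A w u) \<partial>lborel)" by (simp add: norm_mult)
          also have "\<dots> = (1 / w) * (\<integral>v. norm (TS.damped \<alpha> ?A w ((1 / w) * v)) \<partial>lborel)"
            using lborel_integral_real_affine[of "1 / w" "\<lambda>u. norm (TS.damped \<alpha> ?A w u)" 0] elim by simp
          also have "(\<lambda>v. norm (TS.damped \<alpha> ?A w ((1 / w) * v))) = ?s (inverse w)"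
            using elim by (auto simp: fun_eq_iff TS.damped_def norm_mult indicator_def inverse_eq_divide zero_le_divide_iff)
          also have "(1 / w) * (\<integral>v. ?s (inverse w) v \<partial>lborel) \<le> (1 / w) * e"
            using elim by (intro mult_left_mono) auto
          finally show "norm (fourier (TS.damped \<alpha> ?A w) t) \<le> e / w" by simp
        qed
      qed
    qed
  next
    assume rhs: ?rhs
    interpret R: log_renewal M "T \<alpha>" "\<lambda>x. g x * exp (- \<i> * of_real (\<alpha> * ln x))" "\<lambda>x. norm (g1 x)" "\<lambda>x. norm (g2 x)" CW CW "exp 1 * Cc"
      by (rule log_renewal_T)
    have "\<forall>\<^sub>F X in at_top. (\<integral>\<^sup>+u. indicator {0..X} u * ennreal (norm (T \<alpha> u - c * L X)) \<partial>lborel) \<le> ennreal (e * X)"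
      if e: "e > 0" for e
    proof -
      have "\<forall>\<^sub>F X in at_top. (\<integral>\<^sup>+u. indicator {0..X} u * ennreal (norm (T \<alpha> u - c * L (1 / (1 / X)))) \<partial>lborel) \<le> ennreal (e * X)"
      proof (rule TS.mean_of_transform[where A = "\<lambda>w. c * L (1 / w)" and a = "norm c"])
        show "norm (c * L (1 / w)) \<le> norm c" if "w > 0" for w using L1[of "1 / w"] that by (simp add: norm_mult)
        show "\<forall>\<^sub>F w in at_right 0. \<forall>t. \<bar>t\<bar> \<le> K \<longrightarrow> norm (fourier (TS.damped \<alpha> (c * L (1 / w)) w) t) \<le> e / w"
          if "K > 0" "e > 0" for K e using rhs that by blast
      qed (rule transform_domination e, assumption?)+
      then show ?thesis by simp
    qed
    then have "((\<lambda>U. T \<alpha> U - c * L (2 * U)) \<longlongrightarrow> 0) at_top" by (rule R.tendsto_of_mean)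
    from tendsto_add[OF this Ld[of 2]] show ?lhs by simp
  qed
qed

end

section \<open>Interval measures and distribution functions\<close>

lemma emeasure_interval_measure_atMost:
  assumes mono: "mono F" and rc: "\<And>x. continuous (at_right x) F" and F0: "\<And>x. x < 1 \<Longrightarrow> F x = (0::real)"
  shows "emeasure (interval_measure F) {..x} = ennreal (F x)"
proof -
  have Ioc: "emeasure (interval_measure F) {a<..b} = ennreal (F b - F a)" if "a \<le> b" for a b
    using that by (rule emeasure_interval_measure_Ioc) (auto intro: monoD[OF mono] rc)
  let ?y = "min 0 x"
  have "(\<Union>n::nat. {?y - real n<..?y}) = {..?y}"
  proof (intro equalityI subsetI)
    fix z assume "z \<in> {..?y}"
    obtain n :: nat where "?y - z < real n" using reals_Archimedean2 by blast
    then have "z \<in> {?y - real n<..?y}" using \<open>z \<in> {..?y}\<close> by auto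
    then show "z \<in> (\<Union>n::nat. {?y - real n<..?y})" by blast
  qed auto
  moreover have "{?y - real n<..?y} \<in> null_sets (interval_measure F)" for n
    by (simp add: null_sets_def, subst Ioc) (auto simp: F0)
  ultimately have "{..?y} \<in> null_sets (interval_measure F)"
    using null_sets_UN[of "\<lambda>n::nat. {?y - real n<..?y}" "interval_measure F"] by simp
  then have "emeasure (interval_measure F) ({?y<..x} \<union> {..?y}) = emeasure (interval_measure F) {?y<..x}"
    by (intro emeasure_Un_null_set) auto
  moreover have "{?y<..x} \<union> {..?y} = {..x}" by auto
  ultimately show ?thesis by (simp add: Ioc F0)
qed

text \<open>The interval is closed at 1 since a point mass there, such as that of dN, has to be
  counted. The rays ending below 1 are null sets and exhaust \<open>{..<1}\<close>.\<close>

lemma measure_interval_measure_Icc_1: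
  assumes "mono F" and "\<And>x. continuous (at_right x) F" and F0: "\<And>x. x < 1 \<Longrightarrow> F x = (0::real)"
  shows "measure (interval_measure F) {1..x} = F x"
proof (cases "x \<ge> 1")
  case True
  note at = emeasure_interval_measure_atMost[OF assms]
  have "(\<Union>n. {..1 - 1 / real (Suc n)}) = {..<1}"
  proof (intro equalityI subsetI)
    fix z :: real assume z: "z \<in> {..<1}"
    then obtain n where "inverse (real (Suc n)) < 1 - z" using reals_Archimedean[of "1 - z"] by auto
    then have "z \<in> {..1 - 1 / real (Suc n)}" by (simp add: inverse_eq_divide)
    then show "z \<in> (\<Union>n. {..1 - 1 / real (Suc n)})" by blast
  next
    fix z :: real assume "z \<in> (\<Union>n. {..1 - 1 / real (Suc n)})"
    then obtain n where "z \<le> 1 - 1 / real (Suc n)" by auto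
    moreover have "1 / real (Suc n) > 0" by simp
    ultimately show "z \<in> {..<1}" by (simp only: lessThan_iff)
  qed
  moreover have "{..1 - 1 / real (Suc n)} \<in> null_sets (interval_measure F)" for n
    using F0[of "1 - 1 / real (Suc n)"] by (auto simp: null_sets_def at)
  ultimately have "{..<1} \<in> null_sets (interval_measure F)"
    using null_sets_UN[of "\<lambda>n. {..1 - 1 / real (Suc n)}" "interval_measure F"] by simp
  then have "emeasure (interval_measure F) ({1..x} \<union> {..<1}) = emeasure (interval_measure F) {1..x}"
    by (intro emeasure_Un_null_set) auto
  moreover have "{1..x} \<union> {..<1} = {..x}" using True by auto
  ultimately have "emeasure (interval_measure F) {1..x} = ennreal (F x)" by (simp add: at)
  moreover have "F x \<ge> 0" using monoD[OF assms(1), of 0 x] F0[of 0] True by simp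
  ultimately show ?thesis by (simp add: measure_def)
qed (use F0[of x] in simp)

lemma mark_base_interval_measure:
  assumes "mono P" and "\<And>x. continuous (at_right x) P" and "\<And>x. x < 1 \<Longrightarrow> P x = 0" and "P 1 = 0"
    and "h \<in> borel_measurable borel"
  shows "mark_base (interval_measure P) h"
  using assms by unfold_locales (auto simp: emeasure_interval_measure_atMost)

lemma (in mark_base) weighted_one:
  assumes A: "A \<in> bounded_borel"
  shows "weighted (\<lambda>_. 1) M A = of_real (measure M A)"
proof -
  obtain b where b: "A \<subseteq> {1..b}" using A by (rule bounded_borelE)
  have [measurable]: "A \<in> sets borel" using A by (rule bounded_borel_sets)
  have "emeasure M A \<le> emeasure M {..b}" using b by (intro emeasure_mono) auto
  then have "emeasure M A < \<infinity>" using M_fin[of b] by (rule le_less_trans)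
  then have "has_bochner_integral M (\<lambda>x. indicator A x *\<^sub>R (1::complex)) (measure M A *\<^sub>R 1)"
    by (intro has_bochner_integral_indicator) auto
  then show ?thesis
    by (simp add: weighted_def set_lebesgue_integral_def has_bochner_integral_integral_eq scaleR_conv_of_real)
qed

lemma (in mark_base) integral_Icc_eq_summ: "(\<integral>p. indicator {1..x} (fst p) * snd p \<partial>mark_exp M g) = summ x"
  unfolding summ_def
  by (rule integral_cong_AE, measurable, use AE_mark_exp in eventually_elim) (auto simp: indicator_def)

text \<open>With weight 1 almost all marks are 1, so the complex integral that computes the
  convolution exponential is the measure of the points up to \<open>x\<close>; its finiteness
  permits the return from complex numbers to \<open>ennreal\<close>.\<close>

lemma abs_exp_one_atMost:
  assumes "mark_base M (\<lambda>_. 1)" and "N x \<ge> 0" and "x < 1 \<Longrightarrow> N x = 0"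
    and N: "x \<ge> 1 \<Longrightarrow> of_real (N x) = conv_exp (\<lambda>A. of_real (measure M A)) {1..x}"
  shows "abs_exp M (\<lambda>_. 1) (indicator {..x}) = ennreal (N x)"
proof -
  interpret mark_base M "\<lambda>_. 1" by fact
  interpret mark_local M "\<lambda>_. 1"
  proof
    fix X
    have "(\<integral>\<^sup>+x. indicator {..X} x * ennreal (norm (1::complex)) \<partial>M) = emeasure M {..X}" by simp
    then show "(\<integral>\<^sup>+x. indicator {..X} x * ennreal (norm (1::complex)) \<partial>M) < \<infinity>" using M_fin[of X] by simp
  qed
  have eq: "abs_exp M (\<lambda>_. 1) (indicator {..x}) = emeasure (mark_exp M (\<lambda>_. 1)) ({..x} \<times> UNIV)"
  proof -
    have "abs_exp M (\<lambda>_. 1) (indicator {..x}) = (\<integral>\<^sup>+p. indicator ({..x} \<times> UNIV) p \<partial>mark_exp M (\<lambda>_. 1))"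
      unfolding abs_exp_def of_real_1
    proof (rule nn_integral_cong_AE)
      show "AE p in mark_exp M (\<lambda>_. 1). indicator {..x} (fst p) * ennreal (norm (snd p)) = indicator ({..x} \<times> UNIV) p"
        using AE_mark_exp_one[OF assms(1)] by eventually_elim (auto simp: indicator_def)
    qed
    then show ?thesis by simp
  qed
  show ?thesis
  proof (cases "x < 1")
    case True
    have "AE p in mark_exp M (\<lambda>_. 1). p \<notin> {..x} \<times> UNIV"
      using AE_mark_exp by eventually_elim (use True in auto)
    then have "emeasure (mark_exp M (\<lambda>_. 1)) ({..x} \<times> UNIV) = 0"
      by (subst (asm) AE_iff_measurable[OF _ refl]) auto
    then show ?thesis using eq assms(3) True by simp
  next
    case False
    have m: "(\<lambda>p. indicator ({..x} \<times> UNIV) p *\<^sub>R (1::complex)) \<in> borel_measurable (borel \<Otimes>\<^sub>M borel)"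
      by (intro borel_measurable_scaleR borel_measurable_indicator) auto
    have "complex_of_real (N x) = (\<integral>p. indicator {1..x} (fst p) * snd p \<partial>mark_exp M (\<lambda>_. 1))"
      using False by (subst N) (auto intro!: conv_exp_eq bounded_borelI simp: weighted_one)
    also have "\<dots> = (\<integral>p. indicator ({..x} \<times> UNIV) p *\<^sub>R 1 \<partial>mark_exp M (\<lambda>_. 1))"
      unfolding integral_Icc_eq_summ summ_def
    proof (rule integral_cong_AE)
      show "(\<lambda>p. indicator ({..x} \<times> UNIV) p *\<^sub>R (1::complex)) \<in> borel_measurable (mark_exp M (\<lambda>_. 1))"
        by (rule measurable_cong_sets[THEN equalityD1, THEN subsetD, OF _ refl m]) simp
      show "AE p in mark_exp M (\<lambda>_. 1). indicator {..x} (fst p) * snd p = indicator ({..x} \<times> UNIV) p *\<^sub>R 1"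
        using AE_mark_exp_one[OF assms(1)] by eventually_elim (auto simp: indicator_def)
    qed measurable
    also have "\<dots> = measure (mark_exp M (\<lambda>_. 1)) ({..x} \<times> UNIV) *\<^sub>R 1"
      by (rule has_bochner_integral_integral_eq, rule has_bochner_integral_indicator) (use emeasure_mark_exp_finite in auto)
    finally have "N x = measure (mark_exp M (\<lambda>_. 1)) ({..x} \<times> UNIV)"
      by (simp add: scaleR_conv_of_real)
    moreover have "emeasure (mark_exp M (\<lambda>_. 1)) ({..x} \<times> UNIV) = ennreal (measure (mark_exp M (\<lambda>_. 1)) ({..x} \<times> UNIV))"
      using emeasure_mark_exp_finite[of x] by (intro emeasure_eq_ennreal_measure) auto
    ultimately show ?thesis using eq by simp
  qed
qed

text \<open>The O-relation speaks of large \<open>x\<close> only. Below the threshold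
  \<open>Y\<close> monotonicity in \<open>x\<close> gives the value at \<open>Y\<close>, so the
  constant \<open>C * Y\<close> is valid from 1 on.\<close>

lemma (in mark_base) nn_integral_chebyshev:
  fixes k :: "real \<Rightarrow> complex"
  assumes k[measurable]: "k \<in> borel_measurable borel" and k1: "\<And>x. norm (k x) \<le> 1"
    and O: "(\<lambda>x. LINT u:{1..x}|M. norm (k u) * ln u) \<in> O(\<lambda>x. x)"
  shows "\<exists>C\<ge>0. \<forall>x\<ge>1. (\<integral>\<^sup>+u. indicator {..x} u * ennreal (norm (k u) * ln u) \<partial>M) \<le> ennreal (C * x)"
proof -
  let ?I = "\<lambda>x. \<integral>\<^sup>+u. indicator {..x} u * ennreal (norm (k u) * ln u) \<partial>M"
  have I: "?I x = ennreal (LINT u:{1..x}|M. norm (k u) * ln u)" if "x \<ge> 1" for x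
  proof -
    have "integrable M (\<lambda>u. indicator {1..x} u *\<^sub>R (norm (k u) * ln u))"
    proof (rule Bochner_Integration.integrable_bound)
      have "emeasure M {1..x} \<le> emeasure M {..x}" by (intro emeasure_mono) auto
      then have "emeasure M {1..x} < \<infinity>" using M_fin[of x] by (rule le_less_trans)
      then show "integrable M (\<lambda>u. indicator {1..x} u *\<^sub>R ln x)"
        by (intro integrable_scaleR_left integrable_real_indicator) auto
      show "AE u in M. norm (indicator {1..x} u *\<^sub>R (norm (k u) * ln u)) \<le> norm (indicator {1..x} u *\<^sub>R ln x)"
      proof (intro AE_I2)
        fix u :: real
        show "norm (indicator {1..x} u *\<^sub>R (norm (k u) * ln u)) \<le> norm (indicator {1..x} u *\<^sub>R ln x)"
        proof (cases "u \<in> {1..x}")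
          case True
          then have "norm (k u) * ln u \<le> 1 * ln x" using k1 by (intro mult_mono) auto
          then show ?thesis using True by (simp add: abs_mult)
        qed simp
      qed
    qed measurable
    then have "ennreal (\<integral>u. indicator {1..x} u *\<^sub>R (norm (k u) * ln u) \<partial>M) = (\<integral>\<^sup>+u. ennreal (indicator {1..x} u *\<^sub>R (norm (k u) * ln u)) \<partial>M)"
      by (intro nn_integral_eq_integral[symmetric] AE_I2) (auto simp: indicator_def)
    also have "\<dots> = ?I x"
      by (rule nn_integral_cong_AE, use AE_M in eventually_elim) (auto simp: indicator_def)
    finally show ?thesis by (simp add: set_lebesgue_integral_def)
  qed
  obtain C where "C > 0" and "\<forall>\<^sub>F x in at_top. norm (LINT u:{1..x}|M. norm (k u) * ln u) \<le> C * norm (x::real)"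
    using O by (rule landau_o.bigE)
  then obtain X where X: "norm (LINT u:{1..x}|M. norm (k u) * ln u) \<le> C * norm x" if "x \<ge> X" for x
    by (auto simp: eventually_at_top_linorder)
  define Y where "Y = max 1 X"
  have Y: "?I x \<le> ennreal (C * x)" if "x \<ge> Y" for x
    using X[of x] that by (subst I) (auto simp: Y_def intro!: ennreal_leI)
  have "?I x \<le> ennreal (C * Y * x)" if x: "x \<ge> 1" for x
  proof (cases "x \<ge> Y")
    case True
    have "C * x \<le> C * Y * x" using \<open>C > 0\<close> x by (simp add: Y_def)
    then show ?thesis using Y[OF True] by (meson ennreal_leI order_trans)
  next
    case False
    have "?I x \<le> ?I Y" using False by (intro nn_integral_mono) (auto simp: indicator_def)
    also have "\<dots> \<le> ennreal (C * Y)" by (rule Y) simp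
    also have "\<dots> \<le> ennreal (C * Y * x)"
      using mult_left_mono[OF x, of "C * Y"] \<open>C > 0\<close> by (intro ennreal_leI) (simp add: Y_def)
    finally show ?thesis .
  qed
  moreover have "C * Y \<ge> 0" using \<open>C > 0\<close> by (simp add: Y_def)
  ultimately show ?thesis by blast
qed

section \<open>From \<open>T\<close> back to the summatory function and to \<open>F\<close>\<close>

context beurling_weight
begin

text \<open>With b = 1 + i \<alpha>, z = w + i t and s = b + z one has s / (b z) = 1 / z + 1 / b.
  Multiplication by s thus converts the pole subtracted from the transform of \<open>T\<close> into
  the pole of \<open>F\<close> and a bounded term.\<close>

lemma F_eq_fourier:
  assumes w: "w > 0"
  shows "F (Complex (1 + w) (t + \<alpha>)) - c / Complex w t * l = Complex (1 + w) (t + \<alpha>)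
    * fourier (TS.damped \<alpha> (c / (1 + \<i> * of_real \<alpha>) * l) w) t + c / (1 + \<i> * of_real \<alpha>) * l"
proof -
  let ?b = "1 + \<i> * complex_of_real \<alpha>" and ?z = "Complex w t"
  have nz: "?b \<noteq> 0" "?z \<noteq> 0" "?b + ?z \<noteq> 0" using w by (auto simp: complex_eq_iff)
  have s: "Complex (1 + w) (t + \<alpha>) = ?b + ?z" by (simp add: complex_eq_iff)
  have 1: "(?b + ?z) * (F (?b + ?z) / (?b + ?z)) = F (?b + ?z)" using nz by simp
  have 2: "(b + z) * (c / b * l / z) = c / z * l + c / b * l" if "b \<noteq> 0" "z \<noteq> 0" for b z
    using that by (simp add: field_simps)
  have 3: "x - y = x - (y + u) + u" for x y u :: complex by simp
  show ?thesis unfolding TS.fourier_damped[OF w, of _ "c / ?b * l"] fourier_T[OF w] s right_diff_distrib 1 2[OF nz(1,2)] by (rule 3)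
qed

text \<open>On compact ranges of \<open>t\<close> the factor s by which the two differences differ
  has modulus between 1 and a constant, and the extra term of \<open>F_eq_fourier\<close> has a
  constant modulus, which is o(1 / w). The ranges of \<open>t\<close> are shifted by \<alpha>
  against each other.\<close>

lemma transform_uniform_iff:
  fixes c :: complex
  assumes L1: "\<And>u. u > 0 \<Longrightarrow> norm (L u) = 1"
  shows "(\<forall>K>0. \<forall>e>0. \<forall>\<^sub>F w in at_right 0. \<forall>t. \<bar>t\<bar> \<le> K \<longrightarrow>
      norm (fourier (TS.damped \<alpha> (c / (1 + \<i> * of_real \<alpha>) * L (1 / w)) w) t) \<le> e / w) \<longleftrightarrow>
    (\<forall>t0 t1 :: real. \<forall>\<epsilon>>0. \<forall>\<^sub>F \<sigma> in at_right 1. \<forall>t \<in> {t0..t1}.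
      norm (F (Complex \<sigma> t) - c / (Complex \<sigma> t - 1 - \<i> * of_real \<alpha>) * L (1 / (\<sigma> - 1))) \<le> \<epsilon> / (\<sigma> - 1))"
    (is "?lhs \<longleftrightarrow> ?rhs")
proof -
  let ?c = "c / (1 + \<i> * complex_of_real \<alpha>)"
  let ?\<Phi> = "\<lambda>w t. fourier (TS.damped \<alpha> (?c * L (1 / w)) w) t"
  let ?D = "\<lambda>\<sigma> t. F (Complex \<sigma> t) - c / (Complex \<sigma> t - 1 - \<i> * of_real \<alpha>) * L (1 / (\<sigma> - 1))"
  have D: "?D (w + 1) (t + \<alpha>) = Complex (1 + w) (t + \<alpha>) * ?\<Phi> w t + ?c * L (1 / w)" if "w > 0" for w t
  proof -
    have "Complex (w + 1) (t + \<alpha>) - 1 - \<i> * of_real \<alpha> = Complex w t" by (simp add: complex_eq_iff)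
    then show ?thesis using F_eq_fourier[OF that, of t \<alpha> c "L (1 / w)"] by (simp add: add.commute)
  qed
  have A: "norm (?c * L (1 / w)) = norm ?c" if "w > 0" for w
    using L1[of "1 / w"] that by (simp only: norm_mult) simp
  have small: "\<forall>\<^sub>F w in at_right 0. w > 0 \<and> w < 1 \<and> norm ?c \<le> e / 2 / w" if e: "e > 0" for e :: real
  proof -
    have pos: "0 < norm ?c + 1" by (rule add_nonneg_pos) auto
    then have "0 < min 1 (e / 2 / (norm ?c + 1))" using e by simp
    from eventually_at_right_real[OF this] show ?thesis
    proof eventually_elim
      case (elim w)
      then have "w < e / 2 / (norm ?c + 1)" by simp
      then have "w * (norm ?c + 1) < e / 2" by (simp only: pos_less_divide_eq[OF pos])
      then have "norm ?c * w \<le> e / 2" using elim by (simp add: distrib_left mult.commute)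
      then have "norm ?c \<le> e / 2 / w" using elim by (simp add: pos_le_divide_eq)
      then show ?case using elim by simp
    qed
  qed
  show ?thesis
  proof
    assume lhs: ?lhs
    show ?rhs
    proof (intro allI impI)
      fix t0 t1 \<epsilon> :: real assume \<epsilon>: "\<epsilon> > 0"
      \<comment> \<open>Bounds the modulus of s for \<open>w < 1\<close> and, increased by
        \<open>\<bar>\<alpha>\<bar>\<close>, also the shifted ordinate
        \<open>t - \<alpha>\<close>.\<close>
      define B where "B = 2 + \<bar>t0\<bar> + \<bar>t1\<bar>"
      have B: "B > 0" by (simp add: B_def)
      have "\<forall>\<^sub>F w in at_right 0. \<forall>t. \<bar>t\<bar> \<le> B + \<bar>\<alpha>\<bar> \<longrightarrow> norm (?\<Phi> w t) \<le> \<epsilon> / (2 * B) / w"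
        by (rule lhs[THEN spec, THEN mp, THEN spec, THEN mp]) (use B \<epsilon> in auto)
      with small[OF \<epsilon>] have "\<forall>\<^sub>F w in at_right 0. \<forall>t \<in> {t0..t1}. norm (?D (w + 1) t) \<le> \<epsilon> / (w + 1 - 1)"
      proof eventually_elim
        case (elim w)
        show ?case
        proof
          fix t assume t: "t \<in> {t0..t1}"
          have "norm (Complex (1 + w) t) \<le> \<bar>1 + w\<bar> + \<bar>t\<bar>" using cmod_le[of "Complex (1 + w) t"] by simp
          then have s: "norm (Complex (1 + w) t) \<le> B" using elim t by (auto simp: B_def)
          have "\<bar>t - \<alpha>\<bar> \<le> B + \<bar>\<alpha>\<bar>" using t by (auto simp: B_def)
          then have "norm (?\<Phi> w (t - \<alpha>)) \<le> \<epsilon> / (2 * B) / w" using elim by blast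
          then have "norm (Complex (1 + w) t * ?\<Phi> w (t - \<alpha>)) \<le> B * (\<epsilon> / (2 * B) / w)"
            unfolding norm_mult using s B by (intro mult_mono) auto
          also have "\<dots> = \<epsilon> / 2 / w" using B by simp
          finally have 1: "norm (Complex (1 + w) t * ?\<Phi> w (t - \<alpha>)) \<le> \<epsilon> / 2 / w" .
          have "?D (w + 1) t = Complex (1 + w) t * ?\<Phi> w (t - \<alpha>) + ?c * L (1 / w)"
            using D[of w "t - \<alpha>"] elim by simp
          then have "norm (?D (w + 1) t) \<le> norm (Complex (1 + w) t * ?\<Phi> w (t - \<alpha>)) + norm (?c * L (1 / w))"
            by (simp only: norm_triangle_ineq)
          also have "\<dots> \<le> \<epsilon> / 2 / w + \<epsilon> / 2 / w" using 1 elim A[of w] by (intro add_mono) auto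
          also have "\<dots> = \<epsilon> / (w + 1 - 1)" by simp
          finally show "norm (?D (w + 1) t) \<le> \<epsilon> / (w + 1 - 1)" .
        qed
      qed
      then show "\<forall>\<^sub>F \<sigma> in at_right 1. \<forall>t \<in> {t0..t1}. norm (?D \<sigma> t) \<le> \<epsilon> / (\<sigma> - 1)"
        by (subst at_right_to_0) (simp only: eventually_filtermap)
    qed
  next
    assume rhs: ?rhs
    show ?lhs
    proof (intro allI impI)
      fix K e :: real assume K: "K > 0" and e: "e > 0"
      have "\<forall>\<^sub>F \<sigma> in at_right 1. \<forall>t \<in> {- K + \<alpha>..K + \<alpha>}. norm (?D \<sigma> t) \<le> e / 2 / (\<sigma> - 1)"
        by (rule rhs[THEN spec, THEN spec, THEN spec, THEN mp]) (use e in simp)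
      then have "\<forall>\<^sub>F w in at_right 0. \<forall>t \<in> {- K + \<alpha>..K + \<alpha>}. norm (?D (w + 1) t) \<le> e / 2 / (w + 1 - 1)"
        by (subst (asm) at_right_to_0) (simp only: eventually_filtermap)
      with small[OF e] show "\<forall>\<^sub>F w in at_right 0. \<forall>t. \<bar>t\<bar> \<le> K \<longrightarrow> norm (?\<Phi> w t) \<le> e / w"
      proof eventually_elim
        case (elim w)
        show ?case
        proof (intro allI impI)
          fix t :: real assume t: "\<bar>t\<bar> \<le> K"
          let ?s = "Complex (1 + w) (t + \<alpha>)"
          have "t + \<alpha> \<in> {- K + \<alpha>..K + \<alpha>}" using t by auto
          then have 1: "norm (?D (w + 1) (t + \<alpha>)) \<le> e / 2 / w" using elim by fastforce
          have "1 \<le> norm ?s" using abs_Re_le_cmod[of ?s] elim by simp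
          then have "1 * norm (?\<Phi> w t) \<le> norm ?s * norm (?\<Phi> w t)" by (intro mult_right_mono) auto
          then have "norm (?\<Phi> w t) \<le> norm (?s * ?\<Phi> w t)" by (simp add: norm_mult)
          also have "?s * ?\<Phi> w t = ?D (w + 1) (t + \<alpha>) - ?c * L (1 / w)" using D[of w t] elim by simp
          finally have "norm (?\<Phi> w t) \<le> norm (?D (w + 1) (t + \<alpha>) - ?c * L (1 / w))" .
          also have "\<dots> \<le> norm (?D (w + 1) (t + \<alpha>)) + norm (?c * L (1 / w))" by (rule norm_triangle_ineq4)
          also have "\<dots> \<le> e / 2 / w + e / 2 / w" using 1 elim A[of w] by (intro add_mono) auto
          also have "\<dots> = e / w" by simp
          finally show "norm (?\<Phi> w t) \<le> e / w" .
        qed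
      qed
    qed
  qed
qed

text \<open>The substitution \<open>x = exp u\<close>; dividing by \<open>x^(1 + i \<alpha>)\<close>
  instead of \<open>x\<close> does not change the modulus.\<close>

lemma summ_smallo_iff:
  "(\<lambda>x. G.summ x - c * of_real x powr (1 + \<i> * of_real \<alpha>) / (1 + \<i> * of_real \<alpha>) * L (ln x)) \<in> o(\<lambda>x. of_real x) \<longleftrightarrow>
    ((\<lambda>u. T \<alpha> u - c / (1 + \<i> * of_real \<alpha>) * L u) \<longlongrightarrow> 0) at_top" (is "?D \<in> _ \<longleftrightarrow> (?h \<longlongrightarrow> 0) _")
proof -
  have eq: "norm (?D x / of_real x) = norm (?h (ln x))" if x: "x \<ge> 1" for x
  proof -
    let ?b = "1 + \<i> * complex_of_real \<alpha>"
    have p: "complex_of_real x powr ?b = exp (?b * of_real (ln x))"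
      using x by (simp add: powr_def Ln_of_real)
    have "exp (- ?b * of_real (ln x)) * exp (?b * of_real (ln x)) = exp (- ?b * of_real (ln x) + ?b * of_real (ln x))"
      by (simp only: exp_add)
    also have "- ?b * of_real (ln x) + ?b * of_real (ln x) = 0" by (simp only: mult_minus_left left_minus)
    finally have e: "exp (- ?b * of_real (ln x)) * exp (?b * of_real (ln x)) = 1" by simp
    have "exp (- ?b * of_real (ln x)) * (c * exp (?b * of_real (ln x)) / ?b * L (ln x)) =
        (exp (- ?b * of_real (ln x)) * exp (?b * of_real (ln x))) * (c / ?b * L (ln x))" by simp
    then have "?h (ln x) = exp (- ?b * of_real (ln x)) * ?D x"
      unfolding p T_def e right_diff_distrib using x by simp
    then have "norm (?h (ln x)) = exp (- ln x) * norm (?D x)" by (simp add: norm_mult)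
    also have "\<dots> = norm (?D x / of_real x)" using x by (simp add: exp_minus norm_divide field_simps)
    finally show ?thesis by simp
  qed
  show ?thesis
  proof
    assume "?D \<in> o(\<lambda>x. of_real x)"
    then have "((\<lambda>x. ?D x / of_real x) \<longlongrightarrow> 0) at_top" by (rule smalloD_tendsto)
    then have "((\<lambda>u. norm (?D (exp u) / of_real (exp u))) \<longlongrightarrow> 0) at_top"
      by (intro tendsto_norm_zero) (rule filterlim_compose[OF _ exp_at_top])
    moreover have "\<forall>\<^sub>F u in at_top. norm (?D (exp u) / of_real (exp u)) = norm (?h u)"
      using eventually_ge_at_top[of 0]
    proof eventually_elim
      case (elim u)
      then show ?case using eq[of "exp u"] by simp
    qed
    ultimately have "((\<lambda>u. norm (?h u)) \<longlongrightarrow> 0) at_top" by (rule Lim_transform_eventually)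
    then show "(?h \<longlongrightarrow> 0) at_top" by (rule tendsto_norm_zero_cancel)
  next
    assume "(?h \<longlongrightarrow> 0) at_top"
    then have "((\<lambda>x. norm (?h (ln x))) \<longlongrightarrow> 0) at_top"
      by (intro tendsto_norm_zero) (rule filterlim_compose[OF _ ln_at_top])
    moreover have "\<forall>\<^sub>F x in at_top. norm (?h (ln x)) = norm (?D x / of_real x)"
      using eventually_ge_at_top[of 1] by eventually_elim (rule eq[symmetric])
    ultimately have "((\<lambda>x. norm (?D x / of_real x)) \<longlongrightarrow> 0) at_top" by (rule Lim_transform_eventually)
    then have "((\<lambda>x. ?D x / of_real x) \<longlongrightarrow> 0) at_top" by (rule tendsto_norm_zero_cancel)
    then show "?D \<in> o(\<lambda>x. of_real x)"
      by (rule smalloI_tendsto) (use eventually_gt_at_top[of 0] in eventually_elim, simp)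
  qed
qed

end

theorem theorem2p3:
  fixes N P :: "real \<Rightarrow> real" and a c \<alpha> :: real
    and g g1 g2 :: "real \<Rightarrow> complex" and dG :: "real set \<Rightarrow> complex"
    and L :: "real \<Rightarrow> complex"
  assumes system: "beurling_system N P"
    and density: "a > 0" "N \<sim>[at_top] (\<lambda>x. a * x)"
    and arith: "arithmetic N dG"
    and mult: "same_measure dG (conv_exp (weighted g (interval_measure P)))"
    and g: "\<And>x. x \<ge> 1 \<Longrightarrow> g x = g1 x + g2 x"
    and g1_meas: "set_borel_measurable borel {1..} g1"
    and g2_meas: "set_borel_measurable borel {1..} g2"
    and g1_bound: "\<And>x. x \<ge> 1 \<Longrightarrow> norm (g1 x) \<le> 1"
    and g1_cheb: "(\<lambda>x. LINT u:{1..x}|interval_measure P. norm (g1 u) * ln u) \<in> O(\<lambda>x. x)"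
    and g2_int: "set_integrable (interval_measure P) {1..} (\<lambda>x. norm (g2 x) / x)"
    and L_slow: "slowly_varying L"
    and L_norm: "\<And>u. u > 0 \<Longrightarrow> norm (L u) = 1"
  shows "(\<lambda>x. summatory dG x
            - of_real c * of_real x powr (1 + \<i> * of_real \<alpha>) / (1 + \<i> * of_real \<alpha>) * L (ln x))
           \<in> o(\<lambda>x. of_real x)
     \<longleftrightarrow>
     (\<forall>t0 t1 :: real. \<forall>\<epsilon>>0. \<forall>\<^sub>F \<sigma> in at_right 1. \<forall>t \<in> {t0..t1}.
        norm (mellin_stieltjes dG (Complex \<sigma> t)
              - of_real c / (Complex \<sigma> t - 1 - \<i> * of_real \<alpha>) * L (1 / (\<sigma> - 1)))
          \<le> \<epsilon> / (\<sigma> - 1))"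
proof -
  let ?M = "interval_measure P"
  \<comment> \<open>Extension by 0 gives weights that are Borel and bounded as required on the whole
    line, and changes no integral over a subset of \<open>{1..}\<close>.\<close>
  define k1 where "k1 x = indicator {1..} x *\<^sub>R g1 x" for x :: real
  define k2 where "k2 x = indicator {1..} x *\<^sub>R g2 x" for x :: real
  have km[measurable]: "k1 \<in> borel_measurable borel" "k2 \<in> borel_measurable borel"
    using g1_meas g2_meas unfolding set_borel_measurable_def k1_def k2_def by auto
  have k1_le: "norm (k1 x) \<le> 1" for x using g1_bound[of x] by (simp add: k1_def indicator_def)
  have P: "mono P" "\<And>x. continuous (at_right x) P" "\<And>x. x < 1 \<Longrightarrow> P x = 0" "P 1 = 0"
    and N: "mono N" "\<And>x. continuous (at_right x) N" "\<And>x. x < 1 \<Longrightarrow> N x = 0"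
    and NP: "same_measure (\<lambda>A. of_real (measure (interval_measure N) A)) (conv_exp (\<lambda>A. of_real (measure ?M A)))"
    using system unfolding beurling_system_def by auto
  interpret one: mark_base ?M "\<lambda>_. 1" by (rule mark_base_interval_measure[OF P]) auto
  have cheb: "(\<lambda>x. LINT u:{1..x}|?M. norm (k1 u) * ln u) \<in> O(\<lambda>x. x)"
  proof -
    have "(LINT u:{1..x}|?M. norm (k1 u) * ln u) = (LINT u:{1..x}|?M. norm (g1 u) * ln u)" for x
      unfolding set_lebesgue_integral_def
      by (rule Bochner_Integration.integral_cong) (auto simp: k1_def indicator_def)
    then show ?thesis using g1_cheb by simp
  qed
  obtain Cc where Cc: "Cc \<ge> 0"
    "\<And>x. x \<ge> 1 \<Longrightarrow> (\<integral>\<^sup>+u. indicator {..x} u * ennreal (norm (k1 u) * ln u) \<partial>?M) \<le> ennreal (Cc * x)"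
    using one.nn_integral_chebyshev[OF km(1) k1_le cheb] by blast
  have k2_sum: "(\<integral>\<^sup>+x. ennreal (norm (k2 x) / x) \<partial>?M) < \<infinity>"
  proof -
    have "(\<integral>\<^sup>+x. ennreal (norm (k2 x) / x) \<partial>?M) = (\<integral>\<^sup>+x. ennreal (norm (indicator {1..} x *\<^sub>R (norm (g2 x) / x))) \<partial>?M)"
      by (intro nn_integral_cong) (auto simp: k2_def indicator_def)
    also have "\<dots> < \<infinity>" using g2_int unfolding set_integrable_def integrable_iff_bounded by blast
    finally show ?thesis .
  qed
  interpret B: beurling_weight ?M N a k1 k2 Cc
  proof
    show "abs_exp ?M (\<lambda>_. 1) (indicator {..x}) = ennreal (N x)" for x
    proof (rule abs_exp_one_atMost)
      show "0 \<le> N x" using monoD[OF N(1), of "min x 0" x] N(3)[of "min x 0"] by simp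
      show "of_real (N x) = conv_exp (\<lambda>A. of_real (measure ?M A)) {1..x}"
      proof -
        have "{1..x} \<in> bounded_borel" by (rule bounded_borelI[of _ x]) auto
        then have "of_real (measure (interval_measure N) {1..x}) = conv_exp (\<lambda>A. of_real (measure ?M A)) {1..x}"
          using NP unfolding same_measure_def by blast
        then show ?thesis by (simp add: measure_interval_measure_Icc_1[OF N])
      qed
    qed (use N in \<open>auto intro: one.mark_base_axioms\<close>)
  qed (use N density km k1_le Cc k2_sum in auto)
  \<comment> \<open>From here on dG is read on marked points; on bounded sets within
    \<open>{1..}\<close> the weights \<open>g\<close> and \<open>k1 + k2\<close> coincide.\<close>
  have dG: "dG A = (\<integral>p. indicator A (fst p) * snd p \<partial>mark_exp ?M B.g)" if A: "A \<in> bounded_borel" for A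
  proof -
    have "weighted g ?M S = weighted B.g ?M S" if S: "S \<in> bounded_borel" for S
      unfolding weighted_def set_lebesgue_integral_def
      by (rule Bochner_Integration.integral_cong[OF refl])
         (use S g in \<open>auto simp: bounded_borel_def k1_def k2_def indicator_def\<close>)
    then show ?thesis using mult A by (simp add: same_measure_def B.G.conv_exp_eq)
  qed
  have summatory: "summatory dG x = B.G.summ x" for x
    unfolding summatory_def by (subst dG) (auto intro: bounded_borelI B.G.integral_Icc_eq_summ)
  have transform: "mellin_stieltjes dG s = B.F s" if "Re s > 1" for s
    unfolding mellin_stieltjes_def B.F_def
  proof (rule B.G.integral_wrt_eq[OF dG])
    show "of_real x powr (- s) = mellin_kernel s x" if "x \<ge> 1" for x
      using that by (simp add: mellin_kernel_def powr_def Ln_of_real)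
  qed (use that in \<open>auto intro: B.integrable_F\<close>)
  have "\<And>l. l > 0 \<Longrightarrow> ((\<lambda>u. L (l * u) / L u) \<longlongrightarrow> 1) at_top"
    using L_slow by (simp add: slowly_varying_def)
  note iff = B.transform_tendsto_iff[OF L_norm this, of \<alpha> "of_real c / (1 + \<i> * of_real \<alpha>)"]
  \<comment> \<open>The transforms are identified for \<open>\<sigma> > 1\<close>, which the filter
    at 1 from the right guarantees.\<close>
  have ev: "(\<forall>\<^sub>F \<sigma> in at_right 1. \<forall>t \<in> {t0..t1}. norm (mellin_stieltjes dG (Complex \<sigma> t)
        - of_real c / (Complex \<sigma> t - 1 - \<i> * of_real \<alpha>) * L (1 / (\<sigma> - 1))) \<le> \<epsilon> / (\<sigma> - 1)) \<longleftrightarrow>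
      (\<forall>\<^sub>F \<sigma> in at_right 1. \<forall>t \<in> {t0..t1}. norm (B.F (Complex \<sigma> t)
        - of_real c / (Complex \<sigma> t - 1 - \<i> * of_real \<alpha>) * L (1 / (\<sigma> - 1))) \<le> \<epsilon> / (\<sigma> - 1))" for t0 t1 \<epsilon>
    by (rule eventually_cong[OF eventually_at_right_less[of 1]]) (simp add: transform)
  show ?thesis
    unfolding summatory ev B.summ_smallo_iff by (rule trans[OF iff B.transform_uniform_iff[OF L_norm]])
qed

end
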